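(* Let $f:E\to E$ be a nonuniformly expanding map with basis $Y$, reference measure $m$, return time $R$ and associated $f$-invariant probability $\mu$ (see context). Assume that there exist $p>2$, a slowly varying function $s$ at infinity with $s(x)\to 0$ as $x\to\infty$, and a sequence $(u_n)_{n\ge 1}$ of positive reals tending to $0$, such that for all $n\ge 1$ $$e^{-nu_n}\le m(R>n)\le n^{-p}s(n).$$ Then for any Hölder continuous observable $\varphi:E\to\mathbb R$ with $\int\varphi\,d\mu=0$, the series $$\sigma^2(\varphi)=\mathrm{Var}(\varphi)+2\sum_{k\ge1}\mathrm{Cov}(\varphi,\varphi\circ f^k)$$ converges absolutely (variance and covariances with respect to $\mu$), and $$W_n(\varphi)\to\sigma(\varphi)W\quad\text{in distribution in }\mathcal H^0_{1/2-1/p}[0,1],$$ where $W$ is a standard Brownian motion and $W_n(\varphi)$ is regarded as a random process on $(E,\mu)$.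
   Context: **Nonuniformly expanding map.** $(E,d)$ is a complete bounded separable metric space with its Borel $\sigma$-algebra, and $f:E\to E$ is measurable, with an inducing scheme: a closed subset $Y\subset E$ (the basis) equipped with a (Borel) measure $m$; a countable (infinite) measurable partition $\Gamma$ of $Y$ with $m(a)>0$ for all $a\in\Gamma$; an $m$-integrable return time $R:Y\to\mathbb N^*=\{1,2,\dots\}$ with $\gcd\{R(y):y\in Y\}=1$, constant on each $a\in\Gamma$ with value $R(a)$, such that $f^{R(a)}(y)\in Y$ for all $y\in a$. Let $F_Y:Y\to Y$, $F_Y(y)=f^{R(y)}(y)$. There exist $\lambda>1$, $K>0$ such that for all $a\in\Gamma$ and $x,y\in a$: - $F_Y$ restricts to a (measure-theoretic) bijection from $a$ to $Y$; - $d(F_Y(x),F_Y(y))\ge\lambda d(x,y)$; - $d(f^k(x),f^k(y))\le K d(F_Y(x),F_Y(y))$ for $0\le k\le R(a)$; - $|\log|\zeta_a(x)|-\log|\zeta_a(y)||\le K d(F_Y(x),F_Y(y))$, where $\zeta_a=dm/(dm\circ F_Y)$ is the inverse Jacobian of $F_Y:a\to Y$; - $m(Y_\omega)=m(\overline{Y_\omega})$ for every finite word $\omega=a_0a_1\cdots a_n$ in $\Gamma$, where $Y_\omega=\bigcap_{k=0}^nF_Y^{-k}(a_k)$. For such maps there is a unique $F_Y$-invariant probability $\nu_Y$ on $Y$ absolutely continuous with respect to $m$ (with $c^{-1}\le d\nu_Y/dm\le c$ for some $c>0$). The $f$-invariant probability is $\mu=\big(\int_YR\,d\nu_Y\big)^{-1}\sum_{n\ge0}(f^n)_*\big(\nu_Y|_{\{R>n\}}\big)$.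 **Slowly varying.** A measurable $s:(0,\infty)\to(0,\infty)$ is slowly varying at infinity if $s(\lambda x)/s(x)\to1$ as $x\to\infty$ for every $\lambda>0$. **Birkhoff process.** $S_n(\varphi)=\sum_{k=0}^{n-1}\varphi\circ f^k$ ($S_0=0$), and for $n\ge1$, $t\in[0,1]$, $$W_n(\varphi)(t)=n^{-1/2}\big(S_{\lfloor nt\rfloor}(\varphi)+(nt-\lfloor nt\rfloor)\varphi\circ f^{\lfloor nt\rfloor}\big).$$ **Hölder space.** For $\eta\in(0,1)$ and $x:[0,1]\to\mathbb R$, $w_\eta(x,\delta)=\sup_{0<|s-t|<\delta}|x(s)-x(t)|/|s-t|^\eta$ and $w_\eta(x)=\sup_{s\ne t}|x(s)-x(t)|/|s-t|^\eta$. $\mathcal H_\eta[0,1]=\{x:w_\eta(x)<\infty\}$, and $\mathcal H^0_\eta[0,1]=\{x\in\mathcal H_\eta[0,1]:\lim_{\delta\to0}w_\eta(x,\delta)=0\}$ with norm $\|x\|_\eta=w_\eta(x,1)+|x(0)|$ is a separable Banach space. *)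

theory Defs
  imports "HOL-Probability.Probability"
begin

section \<open>Nonuniformly expanding maps\<close>

definition induced_map :: "('a \<Rightarrow> 'a) \<Rightarrow> ('a \<Rightarrow> nat) \<Rightarrow> 'a \<Rightarrow> 'a" where
  "induced_map f R y = (f ^^ R y) y"

text \<open>A bijection from \<open>A\<close> to \<open>B\<close> in the measure-theoretic sense: up to \<open>M\<close>-null sets,
  \<open>g\<close> is a bijection that is measurable in both directions.\<close>

definition bij_betw_mod_null :: "'a measure \<Rightarrow> ('a \<Rightarrow> 'a) \<Rightarrow> 'a set \<Rightarrow> 'a set \<Rightarrow> bool" where
  "bij_betw_mod_null M g A B \<longleftrightarrow>
     (\<exists>N\<in>null_sets M. \<exists>N'\<in>null_sets M.
        bij_betw g (A - N) (B - N') \<and>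
        g \<in> restrict_space M (A - N) \<rightarrow>\<^sub>M restrict_space M (B - N') \<and>
        the_inv_into (A - N) g \<in> restrict_space M (B - N') \<rightarrow>\<^sub>M restrict_space M (A - N))"

text \<open>The measure \<open>M \<circ> g\<close> on \<open>A\<close>, i.e. \<open>B \<mapsto> M (g(B))\<close>.  \<open>measure_of\<close> would return the null
  measure if this set function were not countably additive; below it is only used for \<open>g\<close>
  injective on \<open>A\<close> (a consequence of expansion), where it is a measure.\<close>

definition pullback_measure :: "'a measure \<Rightarrow> 'a set \<Rightarrow> ('a \<Rightarrow> 'a) \<Rightarrow> 'a measure" where
  "pullback_measure M A g =
     measure_of A (sets (restrict_space M A)) (\<lambda>B. emeasure M (g ` B))"

text \<open>\<open>\<zeta>\<close> is a version of the density \<open>dM / d(M \<circ> g)\<close> on \<open>A\<close>.  Positivity is what makes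
  \<open>log \<zeta>\<close> meaningful at every point of \<open>A\<close>.\<close>

definition inverse_jacobian :: "'a measure \<Rightarrow> 'a set \<Rightarrow> ('a \<Rightarrow> 'a) \<Rightarrow> ('a \<Rightarrow> real) \<Rightarrow> bool" where
  "inverse_jacobian M A g \<zeta> \<longleftrightarrow>
     \<zeta> \<in> borel_measurable (restrict_space M A) \<and> (\<forall>x\<in>A. 0 < \<zeta> x) \<and>
     restrict_space M A = density (pullback_measure M A g) (\<lambda>x. ennreal (\<zeta> x))"

definition cylinder :: "'a set \<Rightarrow> ('a \<Rightarrow> 'a) \<Rightarrow> 'a set list \<Rightarrow> 'a set" where
  "cylinder Y F \<omega> = {y\<in>Y. \<forall>k<length \<omega>. (F ^^ k) y \<in> \<omega> ! k}"

text \<open>The ambient space \<open>E\<close> is the whole type \<open>'a\<close>; separability and completeness are part of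
  the class \<open>polish_space\<close>.\<close>

locale nonuniformly_expanding =
  fixes f :: "'a::polish_space \<Rightarrow> 'a"
    and Y :: "'a set"
    and m :: "'a measure"
    and \<Gamma> :: "'a set set"
    and R :: "'a \<Rightarrow> nat"
  assumes bounded_space: "bounded (UNIV :: 'a set)"
    and measurable_map: "f \<in> borel \<rightarrow>\<^sub>M borel"
    and closed_basis: "closed Y"
    and sets_m: "sets m = sets (restrict_space borel Y)"
    and partition: "countable \<Gamma>" "infinite \<Gamma>" "\<Gamma> \<subseteq> sets m" "disjoint \<Gamma>" "\<Union>\<Gamma> = Y"
    and partition_pos: "\<And>a. a \<in> \<Gamma> \<Longrightarrow> 0 < emeasure m a"
    and return_time_pos: "\<And>y. y \<in> Y \<Longrightarrow> 1 \<le> R y"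
    and return_time_const: "\<And>a x y. a \<in> \<Gamma> \<Longrightarrow> x \<in> a \<Longrightarrow> y \<in> a \<Longrightarrow> R x = R y"
    and return_time_integrable: "integrable m (\<lambda>y. real (R y))"
    and return_time_gcd: "Gcd (R ` Y) = 1"
    and returns: "\<And>y. y \<in> Y \<Longrightarrow> (f ^^ R y) y \<in> Y"
    and expansion_distortion:
      "\<exists>c>1. \<exists>K>0. \<forall>a\<in>\<Gamma>.
         bij_betw_mod_null m (induced_map f R) a Y \<and>
         (\<forall>x\<in>a. \<forall>y\<in>a.
            dist (induced_map f R x) (induced_map f R y) \<ge> c * dist x y \<and>
            (\<forall>k\<le>R x. dist ((f ^^ k) x) ((f ^^ k) y)
                        \<le> K * dist (induced_map f R x) (induced_map f R y))) \<and>
         (\<exists>\<zeta>. inverse_jacobian m a (induced_map f R) \<zeta> \<and>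
            (\<forall>x\<in>a. \<forall>y\<in>a. \<bar>ln (\<zeta> x) - ln (\<zeta> y)\<bar>
                        \<le> K * dist (induced_map f R x) (induced_map f R y)))"
    and cylinder_closure:
      "\<And>\<omega>. \<omega> \<noteq> [] \<Longrightarrow> set \<omega> \<subseteq> \<Gamma> \<Longrightarrow>
         emeasure m (cylinder Y (induced_map f R) \<omega>)
           = emeasure m (closure (cylinder Y (induced_map f R) \<omega>))"

definition ac_invariant_prob :: "'a measure \<Rightarrow> ('a \<Rightarrow> 'a) \<Rightarrow> 'a measure \<Rightarrow> bool" where
  "ac_invariant_prob m F \<nu> \<longleftrightarrow>
     prob_space \<nu> \<and> sets \<nu> = sets m \<and> absolutely_continuous m \<nu> \<and> distr \<nu> \<nu> F = \<nu>"

definition tower_measure ::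
    "('a::topological_space \<Rightarrow> 'a) \<Rightarrow> ('a \<Rightarrow> nat) \<Rightarrow> 'a measure \<Rightarrow> 'a measure" where
  "tower_measure f R \<nu> =
     measure_of UNIV (sets borel)
       (\<lambda>A. (\<Sum>n. emeasure (distr (restrict_space \<nu> {y\<in>space \<nu>. n < R y}) borel (f ^^ n)) A)
              / (\<integral>\<^sup>+ y. of_nat (R y) \<partial>\<nu>))"

section \<open>Observables and Birkhoff sums\<close>

definition slowly_varying :: "(real \<Rightarrow> real) \<Rightarrow> bool" where
  "slowly_varying s \<longleftrightarrow>
     s \<in> borel_measurable (restrict_space borel {0<..}) \<and> (\<forall>x>0. 0 < s x) \<and>
     (\<forall>c>0. ((\<lambda>x. s (c * x) / s x) \<longlongrightarrow> 1) at_top)"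

definition hoelder_continuous :: "('a::metric_space \<Rightarrow> real) \<Rightarrow> bool" where
  "hoelder_continuous \<phi> \<longleftrightarrow>
     (\<exists>\<alpha> C. 0 < \<alpha> \<and> \<alpha> \<le> 1 \<and> (\<forall>x y. \<bar>\<phi> x - \<phi> y\<bar> \<le> C * dist x y powr \<alpha>))"

definition covariance :: "'a measure \<Rightarrow> ('a \<Rightarrow> real) \<Rightarrow> ('a \<Rightarrow> real) \<Rightarrow> real" where
  "covariance M X Z =
     (\<integral>x. (X x - (\<integral>u. X u \<partial>M)) * (Z x - (\<integral>u. Z u \<partial>M)) \<partial>M)"

definition asymptotic_variance :: "'a measure \<Rightarrow> ('a \<Rightarrow> 'a) \<Rightarrow> ('a \<Rightarrow> real) \<Rightarrow> real" where
  "asymptotic_variance \<mu> f \<phi> =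
     prob_space.variance \<mu> \<phi> + 2 * (\<Sum>k. covariance \<mu> \<phi> (\<phi> \<circ> f ^^ Suc k))"

definition birkhoff_sum :: "('a \<Rightarrow> 'a) \<Rightarrow> ('a \<Rightarrow> real) \<Rightarrow> nat \<Rightarrow> 'a \<Rightarrow> real" where
  "birkhoff_sum f \<phi> n x = (\<Sum>k<n. \<phi> ((f ^^ k) x))"

text \<open>Functions on \<open>[0,1]\<close> are represented by functions on the reals that are \<open>undefined\<close>
  outside \<open>[0,1]\<close>.  The index \<open>n = 0\<close> gives the zero path and plays no role.\<close>

definition birkhoff_process ::
    "('a \<Rightarrow> 'a) \<Rightarrow> ('a \<Rightarrow> real) \<Rightarrow> nat \<Rightarrow> 'a \<Rightarrow> (real \<Rightarrow> real)" where
  "birkhoff_process f \<phi> n x =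
     (\<lambda>t\<in>{0..1}. (birkhoff_sum f \<phi> (nat \<lfloor>real n * t\<rfloor>) x
         + (real n * t - \<lfloor>real n * t\<rfloor>) * \<phi> ((f ^^ nat \<lfloor>real n * t\<rfloor>) x)) / sqrt (real n))"

section \<open>Hoelder spaces\<close>

definition hoelder_modulus :: "real \<Rightarrow> (real \<Rightarrow> real) \<Rightarrow> real \<Rightarrow> ennreal" where
  "hoelder_modulus \<eta> x \<delta> =
     (SUP (s, t)\<in>{(s, t). s \<in> {0..1} \<and> t \<in> {0..1} \<and> 0 < \<bar>s - t\<bar> \<and> \<bar>s - t\<bar> < \<delta>}.
        ennreal (\<bar>x s - x t\<bar> / \<bar>s - t\<bar> powr \<eta>))"

definition hoelder_seminorm :: "real \<Rightarrow> (real \<Rightarrow> real) \<Rightarrow> ennreal" where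
  "hoelder_seminorm \<eta> x =
     (SUP (s, t)\<in>{(s, t). s \<in> {0..1} \<and> t \<in> {0..1} \<and> s \<noteq> t}.
        ennreal (\<bar>x s - x t\<bar> / \<bar>s - t\<bar> powr \<eta>))"

definition hoelder_space :: "real \<Rightarrow> (real \<Rightarrow> real) set" where
  "hoelder_space \<eta> = {x \<in> extensional {0..1}. hoelder_seminorm \<eta> x < \<infinity>}"

definition hoelder_space0 :: "real \<Rightarrow> (real \<Rightarrow> real) set" where
  "hoelder_space0 \<eta> =
     {x \<in> hoelder_space \<eta>. ((\<lambda>\<delta>. hoelder_modulus \<eta> x \<delta>) \<longlongrightarrow> 0) (at_right 0)}"

definition hoelder_norm :: "real \<Rightarrow> (real \<Rightarrow> real) \<Rightarrow> real" where
  "hoelder_norm \<eta> x = enn2real (hoelder_modulus \<eta> x 1) + \<bar>x 0\<bar>"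

definition hoelder_dist :: "real \<Rightarrow> (real \<Rightarrow> real) \<Rightarrow> (real \<Rightarrow> real) \<Rightarrow> real" where
  "hoelder_dist \<eta> x y = hoelder_norm \<eta> (\<lambda>t. x t - y t)"

definition hoelder_topology0 :: "real \<Rightarrow> (real \<Rightarrow> real) topology" where
  "hoelder_topology0 \<eta> = Metric_space.mtopology (hoelder_space0 \<eta>) (hoelder_dist \<eta>)"

lemma hoelder_modulus_le_seminorm: "hoelder_modulus \<eta> x \<delta> \<le> hoelder_seminorm \<eta> x"
  unfolding hoelder_modulus_def hoelder_seminorm_def by (intro SUP_subset_mono) auto

lemma hoelder_modulus_finite: "x \<in> hoelder_space0 \<eta> \<Longrightarrow> hoelder_modulus \<eta> x \<delta> < \<infinity>"
  using hoelder_modulus_le_seminorm[of \<eta> x \<delta>]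
  by (auto simp: hoelder_space0_def hoelder_space_def)

lemma hoelder_modulus_triangle:
  "hoelder_modulus \<eta> (\<lambda>t. x t - z t) \<delta>
     \<le> hoelder_modulus \<eta> (\<lambda>t. x t - y t) \<delta> + hoelder_modulus \<eta> (\<lambda>t. y t - z t) \<delta>"
  unfolding hoelder_modulus_def
proof (intro SUP_least, clarify)
  let ?D = "{(s, t). s \<in> {0..1::real} \<and> t \<in> {0..1} \<and> 0 < \<bar>s - t\<bar> \<and> \<bar>s - t\<bar> < \<delta>}"
  let ?q = "\<lambda>x (s, t). ennreal (\<bar>x s - x t\<bar> / \<bar>s - t\<bar> powr \<eta>) :: ennreal"
  fix s t :: real
  assume st: "s \<in> {0..1}" "t \<in> {0..1}" "0 < \<bar>s - t\<bar>" "\<bar>s - t\<bar> < \<delta>"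
  have "\<bar>(x s - z s) - (x t - z t)\<bar> / \<bar>s - t\<bar> powr \<eta>
      \<le> \<bar>(x s - y s) - (x t - y t)\<bar> / \<bar>s - t\<bar> powr \<eta> + \<bar>(y s - z s) - (y t - z t)\<bar> / \<bar>s - t\<bar> powr \<eta>"
    unfolding add_divide_distrib[symmetric] by (intro divide_right_mono) auto
  then have "?q (\<lambda>t. x t - z t) (s, t) \<le> ?q (\<lambda>t. x t - y t) (s, t) + ?q (\<lambda>t. y t - z t) (s, t)"
    by (simp add: ennreal_plus[symmetric] ennreal_leI del: ennreal_plus)
  also have "\<dots> \<le> (SUP p\<in>?D. ?q (\<lambda>t. x t - y t) p) + (SUP p\<in>?D. ?q (\<lambda>t. y t - z t) p)"
    using st by (intro add_mono SUP_upper) auto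
  finally show "ennreal (\<bar>(x s - z s) - (x t - z t)\<bar> / \<bar>s - t\<bar> powr \<eta>)
    \<le> (SUP p\<in>?D. ?q (\<lambda>t. x t - y t) p) + (SUP p\<in>?D. ?q (\<lambda>t. y t - z t) p)"
    by simp
qed

lemma hoelder_modulus_commute:
  "hoelder_modulus \<eta> (\<lambda>t. x t - y t) \<delta> = hoelder_modulus \<eta> (\<lambda>t. y t - x t) \<delta>"
proof -
  have "\<bar>(x s - y s) - (x t - y t)\<bar> = \<bar>(y s - x s) - (y t - x t)\<bar>" for s t :: real
    by linarith
  then show ?thesis unfolding hoelder_modulus_def by simp
qed

lemma hoelder_modulus_diff_finite:
  assumes "x \<in> hoelder_space0 \<eta>" "y \<in> hoelder_space0 \<eta>"
  shows "hoelder_modulus \<eta> (\<lambda>t. x t - y t) \<delta> < \<infinity>"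
proof -
  have "hoelder_modulus \<eta> (\<lambda>t. x t - y t) \<delta> \<le> hoelder_modulus \<eta> x \<delta> + hoelder_modulus \<eta> y \<delta>"
    using hoelder_modulus_triangle[of \<eta> x y \<delta> "\<lambda>_. 0"] hoelder_modulus_commute[of \<eta> "\<lambda>_. 0" y \<delta>]
    by simp
  then show ?thesis
    using hoelder_modulus_finite[OF assms(1), of \<delta>] hoelder_modulus_finite[OF assms(2), of \<delta>]
    by (metis ennreal_add_less_top infinity_ennreal_def le_less_trans)
qed

lemma hoelder_dist_zero_imp_eq:
  assumes "x \<in> hoelder_space0 \<eta>" "y \<in> hoelder_space0 \<eta>" "hoelder_dist \<eta> x y = 0"
  shows "x = y"
proof -
  let ?u = "\<lambda>t. x t - y t"
  have nn: "enn2real (hoelder_modulus \<eta> ?u 1) \<ge> 0" by simp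
  have "enn2real (hoelder_modulus \<eta> ?u 1) = 0" and u0: "?u 0 = 0"
    using assms(3) nn unfolding hoelder_dist_def hoelder_norm_def by linarith+
  then have z: "hoelder_modulus \<eta> ?u 1 = 0"
    using hoelder_modulus_diff_finite[OF assms(1,2), of 1] by (auto simp: enn2real_eq_0_iff)
  have eq: "?u s = ?u t" if "s \<in> {0..1}" "t \<in> {0..1}" "0 < \<bar>s - t\<bar>" "\<bar>s - t\<bar> < 1" for s t
  proof -
    have "ennreal (\<bar>?u s - ?u t\<bar> / \<bar>s - t\<bar> powr \<eta>) \<le> hoelder_modulus \<eta> ?u 1"
      unfolding hoelder_modulus_def
      by (rule SUP_upper2[of "(s, t)"]) (use that in auto)
    then show ?thesis using z that by (simp add: ennreal_eq_0_iff divide_le_0_iff)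
  qed
  have "?u t = 0" if t: "t \<in> {0..1}" for t
  proof (cases "t = 1")
    case True
    then show ?thesis using eq[of 1 "1/2"] eq[of "1/2" 0] u0 by simp
  next
    case False
    then show ?thesis using eq[of t 0] t u0 by (cases "t = 0") auto
  qed
  moreover have "x \<in> extensional {0..1}" "y \<in> extensional {0..1}"
    using assms(1,2) by (auto simp: hoelder_space0_def hoelder_space_def)
  ultimately show ?thesis by (intro extensionalityI[of x "{0..1}" y]) auto
qed

text \<open>The defining equations of \<open>Metric_space.mtopology\<close> are only available for metric spaces.\<close>

lemma Metric_space_hoelder: "Metric_space (hoelder_space0 \<eta>) (hoelder_dist \<eta>)"
proof
  fix x y z :: "real \<Rightarrow> real"
  show "0 \<le> hoelder_dist \<eta> x y"
    by (simp add: hoelder_dist_def hoelder_norm_def)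
  show "hoelder_dist \<eta> x y = hoelder_dist \<eta> y x"
    unfolding hoelder_dist_def hoelder_norm_def hoelder_modulus_commute[of \<eta> x y] by simp
  assume x: "x \<in> hoelder_space0 \<eta>" and y: "y \<in> hoelder_space0 \<eta>"
  have "hoelder_modulus \<eta> (\<lambda>t. x t - x t) 1 \<le> 0"
    unfolding hoelder_modulus_def by (rule SUP_least) auto
  then have "hoelder_modulus \<eta> (\<lambda>t. x t - x t) 1 = 0" by simp
  then show "hoelder_dist \<eta> x y = 0 \<longleftrightarrow> x = y"
    using hoelder_dist_zero_imp_eq[OF x y] by (auto simp: hoelder_dist_def hoelder_norm_def)
  assume z: "z \<in> hoelder_space0 \<eta>"
  have "enn2real (hoelder_modulus \<eta> (\<lambda>t. x t - z t) 1)
      \<le> enn2real (hoelder_modulus \<eta> (\<lambda>t. x t - y t) 1 + hoelder_modulus \<eta> (\<lambda>t. y t - z t) 1)"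
    using hoelder_modulus_diff_finite[OF x y, of 1] hoelder_modulus_diff_finite[OF y z, of 1]
    by (intro enn2real_mono hoelder_modulus_triangle) auto
  also have "\<dots> = enn2real (hoelder_modulus \<eta> (\<lambda>t. x t - y t) 1)
      + enn2real (hoelder_modulus \<eta> (\<lambda>t. y t - z t) 1)"
    using hoelder_modulus_diff_finite[OF x y, of 1] hoelder_modulus_diff_finite[OF y z, of 1]
    by (intro enn2real_plus) auto
  finally show "hoelder_dist \<eta> x z \<le> hoelder_dist \<eta> x y + hoelder_dist \<eta> y z"
    by (simp add: hoelder_dist_def hoelder_norm_def)
qed

section \<open>Convergence in distribution and Brownian motion\<close>

definition borel_of_topology :: "'b topology \<Rightarrow> 'b measure" where
  "borel_of_topology T = sigma (topspace T) {U. openin T U}"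

text \<open>Convergence in distribution of random elements of a topological space; measurability of
  the random elements with respect to the Borel sets is part of the notion.\<close>

definition converges_in_distribution ::
    "'b topology \<Rightarrow> 'a measure \<Rightarrow> (nat \<Rightarrow> 'a \<Rightarrow> 'b) \<Rightarrow> 'w measure \<Rightarrow> ('w \<Rightarrow> 'b) \<Rightarrow> bool" where
  "converges_in_distribution T M X M' X' \<longleftrightarrow>
     (\<forall>n. X n \<in> M \<rightarrow>\<^sub>M borel_of_topology T) \<and> X' \<in> M' \<rightarrow>\<^sub>M borel_of_topology T \<and>
     (\<forall>h. continuous_map T euclideanreal h \<and> bounded (h ` topspace T) \<longrightarrow>
        (\<lambda>n. \<integral>\<omega>. h (X n \<omega>) \<partial>M) \<longlonglongrightarrow> (\<integral>\<omega>. h (X' \<omega>) \<partial>M'))"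

text \<open>Standard Brownian motion indexed by \<open>[0,1]\<close>.  To be a random element of
  \<open>hoelder_space0 \<eta>\<close> (with \<open>\<eta> < 1/2\<close>) it must be taken in a version all of whose paths lie
  in that space; every Brownian motion has such a modification.\<close>

definition brownian_motion :: "'w measure \<Rightarrow> (real \<Rightarrow> 'w \<Rightarrow> real) \<Rightarrow> bool" where
  "brownian_motion M W \<longleftrightarrow>
     prob_space M \<and>
     (\<forall>t\<in>{0..1}. W t \<in> borel_measurable M) \<and>
     (AE \<omega> in M. W 0 \<omega> = 0) \<and>
     (\<forall>s t. 0 \<le> s \<and> s < t \<and> t \<le> 1 \<longrightarrow>
        distributed M lborel (\<lambda>\<omega>. W t \<omega> - W s \<omega>) (normal_density 0 (sqrt (t - s)))) \<and>
     (\<forall>n (\<tau> :: nat \<Rightarrow> real). (\<forall>i\<le>n. \<tau> i \<in> {0..1}) \<and> (\<forall>i<n. \<tau> i \<le> \<tau> (Suc i)) \<longrightarrow>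
        prob_space.indep_vars M (\<lambda>_. borel) (\<lambda>i \<omega>. W (\<tau> (Suc i)) \<omega> - W (\<tau> i) \<omega>) {..<n}) \<and>
     (\<forall>\<omega>\<in>space M. continuous_on {0..1} (\<lambda>t. W t \<omega>))"

end

theory Submission imports Defs
begin

text \<open>
Why the theorem holds. Decay of correlations faster than \<open>n powr (- p / 2)\<close>, uniform over all bounded
observables in the second place, is enough for everything else, and the tower provides it.

Loss of memory. A positive functional on bounded Borel functions is called regular if it behaves like
integration against a density whose logarithm is Hoelder continuous. A return to the basis contracts the
regularity constant (\<open>regular_push\<close>), and a small multiple of the reference measure can be split off from
a regular functional at the price of a slightly worse constant (\<open>regular_subtract\<close>). So at every return a
fixed fraction of the mass regenerates, that is, starts afresh from the reference measure. The waiting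
times for regeneration inherit the tail of the return times (\<open>unregen_tail\<close>), and a renewal theorem with
rate (\<open>renewal_convergence\<close>) shows that all regular functionals become proportional at the rate
\<open>n powr (- kap)\<close> for every \<open>kap < p - 1\<close> (\<open>equidistribution\<close>). Cutting the tower along the time until the next
return turns this into decorrelation with respect to the invariant probability (\<open>decorrelation\<close>).

Tightness. Since \<open>p > 2\<close>, some \<open>kap\<close> satisfies \<open>p / 2 < kap < p - 1\<close>. Decorrelation with exponent \<open>kap\<close> bounds the
moments of Birkhoff sums of every order \<open>r < 2 * kap\<close> by the Gaussian growth \<open>n powr (r / 2)\<close> (\<open>moment_bound\<close>),
and dyadic chaining converts these moments into tightness in the Hoelder norm of every exponent below
\<open>1 / 2 - 1 / (2 * kap)\<close> (\<open>increments_tight\<close>). The exponent \<open>1 / 2 - 1 / p\<close> lies strictly below that bound.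

Finite-dimensional limits. The characteristic function of a weighted Birkhoff sum is unwound one summand
at a time: dropping the first summand multiplies it by one minus a variance term, up to an error that
remains small when summed over all steps (\<open>increment_estimate\<close>, \<open>clt_characteristic\<close>).

Assembly. Convergence in distribution is tested on bounded Lipschitz functionals. On paths replaced by
their polygons through finitely many grid points these are Lipschitz functions of finitely many
increments; tightness makes the replacement uniformly harmless (\<open>functional_clt\<close>).\<close>

notation (input) LIMSEQ ("((_)/ ----> (_))" [60, 60] 60)
notation (input) tendsto (infixr "--->" 55)
notation (input) measurable (infixr "->M" 60)
abbreviation (input) ev :: "(nat => bool) => bool" (binder "EV " 10) where "ev P == eventually P sequentially"

section \<open>Renewal sequences\<close>

abbreviation decay :: "real => nat => real" where "decay kap n \<equiv> real (Suc n) powr (- kap)"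

text \<open>The exponentials are orthogonal on the \<open>K\<close>-th roots of unity; for polynomials this replaces integration over the circle.\<close>

lemma dft_parseval:
 fixes b :: "nat => complex"
 assumes "K > 0"
 shows "(SUM j<K. (cmod (SUM n<K. b n * cis (real n * (2 * pi * real j / real K))))^2)
     = real K * (SUM n<K. (cmod (b n))^2)"
proof -
 let ?e = "%n j. cis (real n * (2 * pi * real j / real K))"
 have orth: "(SUM j<K. ?e n j * cnj (?e m j)) = (if n = m then of_nat K else 0)" 
  if nm: "n < K" "m < K" for n m
 proof (cases "n = m")
  case True
  then show ?thesis by (simp add: cis_mult cis_cnj)
 next
  case False
  define w where "w = cis (2 * pi * (real n - real m) / real K)"
  have pw: "?e n j * cnj (?e m j) = w ^ j" for j
   unfolding w_def Complex.DeMoivre using assms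
   by (simp add: cis_cnj cis_mult field_simps)
  have "w ~= 1"
  proof
   assume "w = 1"
   then have "cos (2 * pi * (real n - real m) / real K) = 1" 
    by (auto simp: w_def complex_eq_iff)
   then obtain x :: int where x: "2 * pi * (real n - real m) / real K = of_int x * 2 * pi"
    using cos_one_2pi_int by auto
   have "2 * pi * (real n - real m) = 2 * pi * (real_of_int x * real K)" 
    using x assms by (simp add: field_simps)
   then have "real n - real m = real_of_int x * real K" by simp
   then have eq: "int n - int m = x * int K"
    by (metis (mono_tags, opaque_lifting) of_int_diff of_int_eq_iff of_int_mult of_int_of_nat_eq)
   have "x = 0"
   proof (rule ccontr)
    assume "x ~= 0"
    then have "abs x >= 1" by linarith
    then have "abs (x * int K) >= int K" 
     by (simp add: abs_mult mult_le_cancel_right1)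
    then show False using eq nm by linarith
   qed
   then show False using eq False by simp
  qed
  moreover have "w ^ K = 1"
  proof -
   have "w ^ K = cis (2 * pi * real_of_int (int n - int m))"
    unfolding w_def Complex.DeMoivre using assms by simp
   also have "... = 1" using cis_multiple_2pi[of "real_of_int (int n - int m)"] by simp
   finally show ?thesis .
  qed
  ultimately have "(SUM j<K. w ^ j) = 0" by (simp add: geometric_sum)
  then show ?thesis using False pw by simp
 qed
 have "complex_of_real (SUM j<K. (cmod (SUM n<K. b n * ?e n j))^2)
   = (SUM j<K. SUM n<K. SUM m<K. b n * cnj (b m) * (?e n j * cnj (?e m j)))"
  unfolding of_real_sum complex_norm_square cnj_sum sum_product
  by (intro sum.cong refl) (simp add: mult_ac del: cis_cnj)
 also have "... = (SUM n<K. SUM m<K. b n * cnj (b m) * (SUM j<K. ?e n j * cnj (?e m j)))"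
  by (subst sum.swap, rule sum.cong[OF refl], subst sum.swap) (simp add: sum_distrib_left)
 also have "... = (SUM n<K. SUM m<K. b n * cnj (b m) * (if n = m then of_nat K else 0))"
  by (intro sum.cong refl) (subst orth, auto)
 also have "... = (SUM n<K. b n * cnj (b n) * of_nat K)"
  by (simp add: if_distrib[of "%x. _ * x"] cong: if_cong)
 also have "... = complex_of_real (real K * (SUM n<K. (cmod (b n))^2))"
  unfolding of_real_mult of_real_sum complex_norm_square by (simp add: sum_distrib_left mult_ac)
 finally show ?thesis unfolding of_real_eq_iff .
qed

text \<open>Parseval for the truncations at \<open>K\<close>, whose error is the tail of the series, followed by \<open>K\<close> to infinity.\<close>

lemma bessel_bound:
 fixes b :: "nat => complex"
 assumes sm: "summable (%n. cmod (b n))" and C: "!!t. cmod (\<Sum>n. b n * cis (real n * t)) <= C"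
 shows "(SUM n<N. (cmod (b n))^2) <= C^2"
proof -
 define eps where "eps K = (\<Sum>n. cmod (b (n + K)))" for K
 have eps0: "eps ----> 0" unfolding eps_def by (rule suminf_exist_split2[OF sm])
 have part: "(SUM n<N. (cmod (b n))^2) <= (C + eps K)^2" if K: "K >= N" "K > 0" for K
 proof -
  have bnd: "cmod (SUM n<K. b n * cis (real n * t)) <= C + eps K" for t
  proof -
   have s: "summable (%n. b n * cis (real n * t))"
    by (rule summable_norm_cancel) (simp add: norm_mult sm)
   have s2: "summable (%n. cmod (b (n + K) * cis (real (n + K) * t)))"
    using summable_ignore_initial_segment[OF sm, of K] by (simp add: norm_mult)
   have "(SUM n<K. b n * cis (real n * t)) = (\<Sum>n. b n * cis (real n * t)) - (\<Sum>n. b (n + K) * cis (real (n + K) * t))"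
    using suminf_split_initial_segment[OF s, of K] by simp
   also have "cmod ... <= C + (\<Sum>n. cmod (b (n + K) * cis (real (n + K) * t)))"
    by (intro norm_triangle_le_diff add_mono C summable_norm s2)
   finally show ?thesis by (simp add: norm_mult eps_def)
  qed
  have "real K * (SUM n<N. (cmod (b n))^2) <= real K * (SUM n<K. (cmod (b n))^2)"
   using K by (intro mult_left_mono sum_mono2) auto
  also have "... = (SUM j<K. (cmod (SUM n<K. b n * cis (real n * (2 * pi * real j / real K))))^2)"
   using dft_parseval[OF K(2)] by simp
  also have "... <= (SUM j<K. (C + eps K)^2)"
   by (intro sum_mono power_mono bnd) auto
  finally show ?thesis using K by simp
 qed
 have "(%K. (C + eps K)^2) ----> (C + 0)^2" by (intro tendsto_intros eps0)
 moreover have "\<forall>\<^sub>F K in sequentially. (SUM n<N. (cmod (b n))^2) <= (C + eps K)^2"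
  using eventually_ge_at_top[of "Suc N"] by eventually_elim (rule part, auto)
 ultimately show ?thesis by (intro tendsto_lowerbound[of _ _ sequentially]) auto
qed

text \<open>A case of Wiener's lemma with an elementary proof. With \<open>H = 1 / G\<close> on the disc, \<open>H' = - G' / G^2\<close> is bounded,
because \<open>G\<close> is bounded away from zero on the closed disc and \<open>G'\<close> is bounded by the first moment. Bessel's inequality
then makes \<open>n * h n\<close> square summable, and \<open>2 * a * b <= a^2 + b^2\<close> with \<open>b = 1 / n\<close> makes \<open>h\<close> summable.\<close>

lemma power_series_reciprocal_summable:
 fixes g h :: "nat => real"
 assumes inv: "Abs_fps g * Abs_fps h = 1" and hb: "!!n. abs (h n) <= B" and g0: "!!n. g n >= 0"
  and sg: "summable (%n. real (Suc n) * g n)"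
  and nz: "!!z. cmod z <= 1 ==> (\<Sum>n. of_real (g n) * z ^ n) ~= (0::complex)"
 shows "summable (%n. abs (h n))"
proof -
 define G where "G z = (\<Sum>n. of_real (g n) * z ^ n :: complex)" for z
 define H where "H z = (\<Sum>n. of_real (h n) * z ^ n :: complex)" for z
 have sg1: "summable g"
 proof (rule summable_comparison_test[OF _ sg], intro exI allI impI)
  fix n
  have "1 * g n <= real (Suc n) * g n" using g0 by (intro mult_right_mono) auto
  then show "norm (g n) <= real (Suc n) * g n" using g0[of n] by simp
 qed
 have nG: "norm (of_real (g n) * z ^ n :: complex) <= g n" if "cmod z <= 1" for z n
  using that g0[of n] by (simp add: norm_mult norm_power mult_left_le power_le_one)
 have Gs: "summable (%n. norm (of_real (g n) * z ^ n :: complex))" if "cmod z <= 1" for z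
  by (rule summable_comparison_test[OF _ sg1]) (use nG[OF that] in auto)
 have Hs: "summable (%n. norm (of_real (h n) * z ^ n :: complex))" if z: "cmod z < 1" for z
 proof (rule summable_comparison_test)
  show "summable (%n. B * cmod z ^ n)" using z by (intro summable_mult summable_geometric) auto
  show "EX N. ALL n>=N. norm (norm (of_real (h n) * z ^ n :: complex)) <= B * cmod z ^ n"
   by (auto simp: norm_mult norm_power intro!: mult_right_mono hb)
 qed
 have GH: "G z * H z = 1" if z: "cmod z < 1" for z
 proof -
  have "G z * H z = (\<Sum>k. SUM i<=k. (of_real (g i) * z ^ i) * (of_real (h (k - i)) * z ^ (k - i)))"
   unfolding G_def H_def using z by (intro Cauchy_product Gs Hs) auto
  also have "... = (\<Sum>k. of_real (fps_nth (Abs_fps g * Abs_fps h) k) * z ^ k)"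
  proof (rule suminf_cong)
   fix k
   have pt: "(of_real (g i) * z ^ i) * (of_real (h (k - i)) * z ^ (k - i)) = of_real (g i * h (k - i)) * z ^ k"
    if "i <= k" for i
   proof -
    have "z ^ k = z ^ i * z ^ (k - i)" using that by (simp flip: power_add)
    then show ?thesis by simp
   qed
   have "(SUM i<=k. (of_real (g i) * z ^ i) * (of_real (h (k - i)) * z ^ (k - i)))
     = (SUM i<=k. of_real (g i * h (k - i)) * z ^ k)"
    by (intro sum.cong refl pt) simp
   then show "(SUM i<=k. (of_real (g i) * z ^ i) * (of_real (h (k - i)) * z ^ (k - i)))
     = of_real (fps_nth (Abs_fps g * Abs_fps h) k) * z ^ k"
    by (simp add: fps_mult_nth atLeast0AtMost sum_distrib_right)
  qed
  also have "... = (\<Sum>k. if k = 0 then 1 else 0)"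
   unfolding inv by (intro suminf_cong) auto
  also have "... = 1" by (subst suminf_finite[of "{0}"]) auto
  finally show ?thesis .
 qed
 have contG: "continuous_on (cball 0 1) G"
  unfolding G_def
  by (rule uniform_limit_theorem[OF _ Weierstrass_m_test[OF nG sg1]])
   (auto intro!: always_eventually continuous_intros)
 obtain dlt where dlt: "dlt > 0" "!!z. cmod z <= 1 ==> cmod (G z) >= dlt"
 proof -
  have "EX x:cball 0 1. ALL y:cball 0 1. cmod (G x) <= cmod (G y)"
   by (intro continuous_attains_inf compact_cball continuous_intros contG) auto
  then obtain x where "cmod x <= 1" "ALL y:cball 0 1. cmod (G x) <= cmod (G y)" by auto
  then show ?thesis using nz[of x] that[of "cmod (G x)"] by (auto simp: G_def)
 qed
 define S where "S = (\<Sum>n. real (Suc n) * g n)"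
 have sS: "(\<Sum>n. real (Suc n) * g (Suc n)) <= S" and sS': "summable (%n. real (Suc n) * g (Suc n))"
 proof -
  have 1: "summable (%n. real (Suc (Suc n)) * g (Suc n))" using sg by (subst summable_Suc_iff)
  show 2: "summable (%n. real (Suc n) * g (Suc n))"
  proof (rule summable_comparison_test[OF _ 1], intro exI allI impI)
   fix n
   have "real (Suc n) * g (Suc n) <= real (Suc (Suc n)) * g (Suc n)"
    using g0 by (intro mult_right_mono) auto
   then show "norm (real (Suc n) * g (Suc n)) <= real (Suc (Suc n)) * g (Suc n)"
    using g0[of "Suc n"] by simp
  qed
  have "(\<Sum>n. real (Suc n) * g (Suc n)) <= (\<Sum>n. real (Suc (Suc n)) * g (Suc n))"
   by (intro suminf_le 1 2 mult_right_mono g0) auto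
  also have "... <= S" unfolding S_def using suminf_split_head[OF sg] g0[of 0] by simp
  finally show "(\<Sum>n. real (Suc n) * g (Suc n)) <= S" .
 qed
 define C where "C = S / dlt^2"
 have dbound: "cmod (\<Sum>n. diffs (%n. of_real (h n)) n * z ^ n) <= C" if z: "cmod z < 1" for z
 proof -
  define rho where "rho = complex_of_real ((1 + cmod z) / 2)"
  have rho: "cmod z < cmod rho" "cmod rho < 1" using z by (auto simp: rho_def norm_divide simp del: of_real_add of_real_divide)
  have dG: "(G has_field_derivative (\<Sum>n. diffs (%n. of_real (g n)) n * z ^ n)) (at z)"
   unfolding G_def by (rule termdiffs_strong[OF summable_norm_cancel[OF Gs[of rho]]]) (use rho in auto)
  have dH: "(H has_field_derivative (\<Sum>n. diffs (%n. of_real (h n)) n * z ^ n)) (at z)"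
   unfolding H_def by (rule termdiffs_strong[OF summable_norm_cancel[OF Hs[of rho]]]) (use rho in auto)
  let ?dG = "(\<Sum>n. diffs (%n. of_real (g n)) n * z ^ n) :: complex"
  let ?dH = "(\<Sum>n. diffs (%n. of_real (h n)) n * z ^ n) :: complex"
  have "((%z. G z * H z) has_field_derivative (?dG * H z + ?dH * G z)) (at z)"
   by (rule DERIV_mult[OF dG dH])
  moreover have "((%z. G z * H z) has_field_derivative 0) (at z)"
  proof (rule DERIV_cong_ev[THEN iffD1, OF refl _ refl, of "%_. 1"])
   have "\<forall>\<^sub>F x in nhds z. x : ball 0 1" using z by (intro eventually_nhds_in_open) auto
   then show "\<forall>\<^sub>F x in nhds z. 1 = G x * H x" by eventually_elim (auto simp: GH)
   show "((%_. 1) has_field_derivative 0) (at z)" by simp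
  qed
  ultimately have eq: "?dG * H z + ?dH * G z = 0" by (rule DERIV_unique)
  have Gz: "G z ~= 0" using GH[OF z] by auto
  then have Hz: "H z = 1 / G z" using GH[OF z] by (simp add: eq_divide_eq mult.commute)
  have "?dH = - ?dG / (G z)^2" using eq Gz unfolding Hz
   by (simp add: field_simps power2_eq_square add_eq_0_iff)
  then have "cmod ?dH = cmod ?dG / (cmod (G z))^2" by (simp add: norm_divide norm_power)
  also have "... <= S / dlt^2"
  proof (intro frac_le)
   have n: "norm (diffs (%n. of_real (g n)) n * z ^ n :: complex) <= real (Suc n) * g (Suc n)" for n
   proof -
    have "norm (diffs (%n. of_real (g n)) n * z ^ n :: complex) = (real (Suc n) * g (Suc n)) * cmod z ^ n"
     using g0[of "Suc n"] by (simp add: diffs_def norm_mult norm_power del: of_nat_Suc)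
    also have "... <= (real (Suc n) * g (Suc n)) * 1" using z g0[of "Suc n"]
     by (intro mult_left_mono power_le_one) auto
    finally show ?thesis by simp
   qed
   have "cmod ?dG <= (\<Sum>n. norm (diffs (%n. of_real (g n)) n * z ^ n :: complex))"
    by (intro summable_norm summable_comparison_test[OF _ sS']) (use n in auto)
   also have "... <= (\<Sum>n. real (Suc n) * g (Suc n))"
    by (intro suminf_le n sS' summable_comparison_test[OF _ sS']) (use n in auto)
   finally show "cmod ?dG <= S" using sS by simp
   show "dlt^2 <= (cmod (G z))^2" using dlt z by (intro power_mono) auto
   show "0 <= S" unfolding S_def using g0 by (intro suminf_nonneg sg mult_nonneg_nonneg) auto
  qed (use dlt in auto)
  finally show ?thesis by (simp add: C_def)
 qed
 have bess: "(SUM n<N. (real (Suc n) * h (Suc n))^2) <= C^2" for N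
 proof -
  have *: "(SUM n<N. (real (Suc n) * h (Suc n) * rho ^ n)^2) <= C^2" if rho: "0 < rho" "rho < 1" for rho :: real
  proof -
   let ?b = "%n. diffs (%n. of_real (h n)) n * of_real (rho ^ n) :: complex"
   have s: "summable (%n. cmod (?b n))"
   proof -
    have "summable (%n. abs (h n) * x ^ n)" if "norm x < 1" for x
    proof (rule summable_norm_cancel)
     show "summable (%n. norm (abs (h n) * x ^ n))"
      using Hs[of "of_real x"] that by (simp add: norm_mult norm_power abs_mult power_abs)
    qed
    then have "summable (%n. diffs (%n. abs (h n)) n * rho ^ n)"
     using rho by (intro termdiff_converges[of rho 1]) auto
    then show ?thesis using rho by (simp add: diffs_def norm_mult norm_power abs_mult del: of_nat_Suc)
   qed
   have "(SUM n<N. (cmod (?b n))^2) <= C^2"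
   proof (rule bessel_bound[OF s])
    fix t
    have "cmod (\<Sum>n. diffs (%n. of_real (h n)) n * (of_real rho * cis t) ^ n) <= C"
     using rho by (intro dbound) (simp add: norm_mult)
    then show "cmod (\<Sum>n. ?b n * cis (real n * t)) <= C"
     by (simp add: power_mult_distrib Complex.DeMoivre mult_ac)
   qed
   then show ?thesis using rho by (simp add: diffs_def norm_mult norm_power power_mult_distrib del: of_nat_Suc)
  qed
  have "((%rho. (SUM n<N. (real (Suc n) * h (Suc n) * rho ^ n)^2)) ---> (SUM n<N. (real (Suc n) * h (Suc n) * 1 ^ n)^2)) (at_left 1)"
   by (intro tendsto_intros)
  moreover have "\<forall>\<^sub>F rho in at_left (1::real). (SUM n<N. (real (Suc n) * h (Suc n) * rho ^ n)^2) <= C^2"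
   using eventually_at_left_real[of 0 "1::real"] by (auto elim!: eventually_mono intro!: * simp del: of_nat_Suc)
  ultimately have "(SUM n<N. (real (Suc n) * h (Suc n) * 1 ^ n)^2) <= C^2"
   by (intro tendsto_upperbound[of _ _ "at_left (1::real)"]) auto
  then show ?thesis by simp
 qed
 have "summable (%n. (real (Suc n) * h (Suc n))^2)"
  by (rule summableI_nonneg_bounded[OF _ bess]) auto
 moreover have "summable (%n. 1 / (real (Suc n))^2)"
  using inverse_power_summable[of 2, where 'a = real] by (subst summable_Suc_iff) (simp add: field_simps)
 ultimately have s: "summable (%n. (real (Suc n) * h (Suc n))^2 + 1 / (real (Suc n))^2)"
  by (rule summable_add)
 have "summable (%n. abs (h (Suc n)))"
 proof (rule summable_comparison_test[OF _ s], intro exI allI impI)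
  fix n
  have "2 * (abs (real (Suc n) * h (Suc n)) * (1 / real (Suc n))) <= abs (real (Suc n) * h (Suc n))^2 + (1 / real (Suc n))^2"
   using sum_squares_bound[of "abs (real (Suc n) * h (Suc n))" "1 / real (Suc n)"] by (simp add: mult.assoc)
  moreover have "abs (real (Suc n) * h (Suc n)) * (1 / real (Suc n)) = abs (h (Suc n))"
   by (simp add: abs_mult del: of_nat_Suc)
  ultimately have "2 * abs (h (Suc n)) <= abs (real (Suc n) * h (Suc n))^2 + (1 / real (Suc n))^2" by argo
  also have "... = (real (Suc n) * h (Suc n))^2 + 1 / (real (Suc n))^2" by (simp only: power2_abs power_one_over)
  finally show "norm (abs (h (Suc n))) <= (real (Suc n) * h (Suc n))^2 + 1 / (real (Suc n))^2"
   unfolding real_norm_def abs_idempotent by linarith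
 qed
 then show ?thesis by (subst (asm) summable_Suc_iff)
qed


lemma nonneg_summable_atMost:
 fixes a :: "nat => real"
 assumes "!!n. a n >= 0" "!!Q. (SUM n<=Q. a n) <= B"
 shows "summable a" "suminf a <= B"
proof -
 have b: "(SUM n<Q. a n) <= B" for Q
  by (rule order.trans[OF sum_mono2 assms(2)[of Q]]) (use assms(1) in auto)
 show s: "summable a" by (rule summableI_nonneg_bounded[OF assms(1) b])
 show "suminf a <= B" by (rule suminf_le_const[OF s b])
qed

lemma sum_triangle_le:
 fixes F :: "nat => nat => real"
 assumes "!!i j. F i j >= 0"
 shows "(SUM n<=Q. SUM i<=n. F i (n - i)) <= (SUM i<=Q. SUM j<=Q. F i j)"
proof -
 have "(SUM n<=Q. SUM i<=n. F i (n - i)) = (\<Sum>(i, j)\<in>{(i, j). i + j <= Q}. F i j)"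
  by (simp add: sum.triangle_reindex_eq)
 also have "... <= (\<Sum>(i, j)\<in>{..Q} \<times> {..Q}. F i j)"
  using assms by (intro sum_mono2) auto
 finally show ?thesis by (simp add: sum.cartesian_product)
qed

lemma weighted_convolution_bound:
 fixes a b :: "nat => real"
 assumes "gam >= 0"
 shows "(SUM n<=Q. real (Suc n) powr gam * abs (fps_nth (Abs_fps a * Abs_fps b) n))
  <= (SUM i<=Q. real (Suc i) powr gam * abs (a i)) * (SUM j<=Q. real (Suc j) powr gam * abs (b j))"
proof -
 let ?w = "%n. real (Suc n) powr gam"
 have "?w n * abs (fps_nth (Abs_fps a * Abs_fps b) n) <= (SUM i<=n. (?w i * abs (a i)) * (?w (n - i) * abs (b (n - i))))" for n
 proof -
  have "?w n * abs (fps_nth (Abs_fps a * Abs_fps b) n) <= ?w n * (SUM i<=n. abs (a i * b (n - i)))"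
   by (intro mult_left_mono) (auto simp: fps_mult_nth atLeast0AtMost)
  also have "... <= (SUM i<=n. (?w i * abs (a i)) * (?w (n - i) * abs (b (n - i))))"
   unfolding sum_distrib_left
  proof (intro sum_mono)
   fix i assume i: "i : {..n}"
   have "real (Suc n) <= real (Suc i) * real (Suc (n - i))"
   proof -
    obtain j where "n = i + j" using i le_Suc_ex by auto
    then show ?thesis by (simp add: algebra_simps)
   qed
   then have "?w n <= (real (Suc i) * real (Suc (n - i))) powr gam"
    by (intro powr_mono2 assms) auto
   then have "?w n <= ?w i * ?w (n - i)" by (simp add: powr_mult)
   then have "?w n * abs (a i * b (n - i)) <= (?w i * ?w (n - i)) * abs (a i * b (n - i))"
    by (intro mult_right_mono) auto
   then show "?w n * abs (a i * b (n - i)) <= (?w i * abs (a i)) * (?w (n - i) * abs (b (n - i)))"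
    by (simp add: abs_mult mult_ac)
  qed
  finally show ?thesis .
 qed
 then have "(SUM n<=Q. ?w n * abs (fps_nth (Abs_fps a * Abs_fps b) n))
   <= (SUM n<=Q. SUM i<=n. (?w i * abs (a i)) * (?w (n - i) * abs (b (n - i))))"
  by (intro sum_mono)
 also have "... <= (SUM i<=Q. SUM j<=Q. (?w i * abs (a i)) * (?w j * abs (b j)))"
  by (rule sum_triangle_le) auto
 finally show ?thesis by (simp add: sum_product)
qed

lemma weight_subadditive:
 assumes "gam >= 0" "i <= n"
 shows "real (Suc n) powr gam <= 2 powr gam * (real (Suc i) powr gam + real (Suc (n - i)) powr gam)"
proof -
 have "real (Suc n) <= 2 * max (real (Suc i)) (real (Suc (n - i)))" using assms by (simp add: max_def of_nat_diff)
 then have "real (Suc n) powr gam <= (2 * max (real (Suc i)) (real (Suc (n - i)))) powr gam"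
  using assms by (intro powr_mono2) auto
 also have "... = 2 powr gam * max (real (Suc i)) (real (Suc (n - i))) powr gam"
  by (simp add: powr_mult)
 also have "... <= 2 powr gam * (real (Suc i) powr gam + real (Suc (n - i)) powr gam)"
  by (intro mult_left_mono) (auto simp: max_def)
 finally show ?thesis .
qed

text \<open>Bootstrap from the unweighted case. Splitting \<open>h\<close> into a finite part \<open>hN\<close> and a small tail \<open>hT\<close>, the relation
\<open>g * h = 1\<close> gives \<open>h = hN + e * h\<close> with \<open>e = g * hT\<close>, which is small without weight and, being also
\<open>1 - g * hN\<close>, finite with weight. The weight is subadditive up to a factor, so the weighted norm of \<open>h\<close> is at most
a constant plus half of itself.\<close>

lemma reciprocal_weighted_summable:
 fixes g h :: "nat => real"
 assumes inv: "Abs_fps g * Abs_fps h = 1" and gam: "gam >= 0"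
  and sg: "summable (%n. real (Suc n) powr gam * abs (g n))" and sh: "summable (%n. abs (h n))"
 shows "summable (%n. real (Suc n) powr gam * abs (h n))"
proof -
 let ?w = "%n. real (Suc n) powr gam"
 have w1: "?w n >= 1" for n using gam by (intro ge_one_powr_ge_zero) auto
 have sg1: "summable (%n. abs (g n))"
  using w1 by (intro summable_comparison_test[OF _ sg]) (auto intro!: exI[of _ 0] simp: mult_le_cancel_right1 simp del: of_nat_Suc)
 define n1 where "n1 = (\<Sum>n. abs (g n))"
 have n1: "n1 >= 0" unfolding n1_def by (intro suminf_nonneg sg1) auto
 define eps where "eps = 1 / (2 powr gam * 2 * (n1 + 1))"
 have eps: "eps > 0" using n1 by (simp add: eps_def)
 have "(%K. \<Sum>n. abs (h (n + K))) ----> 0" by (rule suminf_exist_split2[OF sh])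
 then have "\<forall>\<^sub>F K in sequentially. (\<Sum>n. abs (h (n + K))) < eps" by (rule order_tendstoD(2)) (rule eps)
 then obtain N where N: "(\<Sum>n. abs (h (n + N))) < eps" by (auto simp: eventually_sequentially)
 define hN where "hN n = (if n < N then h n else 0)" for n
 define hT where "hT n = (if n < N then 0 else h n)" for n
 have hsplit: "Abs_fps h = Abs_fps hN + Abs_fps hT" by (auto simp: fps_eq_iff hN_def hT_def)
 define e where "e n = fps_nth (Abs_fps g * Abs_fps hT) n" for n
 have eE: "Abs_fps e = Abs_fps g * Abs_fps hT" by (simp add: e_def fps_eq_iff)
 have eE': "Abs_fps e = 1 - Abs_fps g * Abs_fps hN"
  using inv unfolding eE hsplit by (simp add: algebra_simps)
 have hE: "Abs_fps h = Abs_fps hN + Abs_fps e * Abs_fps h"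
  unfolding eE using inv hsplit by (metis mult.commute mult.left_commute mult.right_neutral)
 have hTsum: "(SUM j<=Q. abs (hT j)) <= eps" for Q
 proof -
  have s: "summable (%n. abs (hT n))" by (rule summable_comparison_test[OF _ sh]) (auto simp: hT_def)
  have "(SUM j<=Q. abs (hT j)) <= (\<Sum>n. abs (hT n))" by (intro sum_le_suminf s) auto
  also have "... = (\<Sum>n. abs (hT (n + N))) + (SUM i<N. abs (hT i))" by (rule suminf_split_initial_segment[OF s])
  also have "... = (\<Sum>n. abs (h (n + N)))" by (simp add: hT_def)
  finally show ?thesis using N by simp
 qed
 have e1: "(SUM i<=Q. abs (e i)) <= 1 / (2 * 2 powr gam)" for Q
 proof -
  have "(SUM i<=Q. abs (e i)) <= (SUM i<=Q. abs (g i)) * (SUM j<=Q. abs (hT j))"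
   using weighted_convolution_bound[where gam = 0 and Q = Q and a = g and b = hT] by (simp add: e_def)
  also have "... <= n1 * eps"
   unfolding n1_def by (intro mult_mono hTsum sum_le_suminf sg1 suminf_nonneg sum_nonneg) auto
  also have "... <= 1 / (2 * 2 powr gam)" using n1 by (simp add: eps_def divide_simps)
  finally show ?thesis .
 qed
 define gw where "gw = (\<Sum>n. ?w n * abs (g n))"
 define hw where "hw = (SUM n<N. ?w n * abs (h n))"
 have hNw: "(SUM n<=Q. ?w n * abs (hN n)) <= hw" for Q
 proof -
  have "(SUM n<=Q. ?w n * abs (hN n)) = (SUM n:{..Q} \<inter> {..<N}. ?w n * abs (h n))"
   by (rule sum.mono_neutral_cong_right) (auto simp: hN_def)
  also have "... <= hw" unfolding hw_def by (intro sum_mono2) auto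
  finally show ?thesis .
 qed
 have ew: "(SUM i<=Q. ?w i * abs (e i)) <= 1 + gw * hw" for Q
 proof -
  have "(SUM i<=Q. ?w i * abs (e i)) <= (SUM i<=Q. (if i = 0 then 1 else 0) + ?w i * abs (fps_nth (Abs_fps g * Abs_fps hN) i))"
  proof (intro sum_mono)
   fix i
   have "e i = (if i = 0 then 1 else 0) - fps_nth (Abs_fps g * Abs_fps hN) i"
    using arg_cong[OF eE', of "%x. fps_nth x i"] by simp
   then have "?w i * abs (e i) <= ?w i * (abs (if i = 0 then 1 else 0) + abs (fps_nth (Abs_fps g * Abs_fps hN) i))"
    by (intro mult_left_mono) auto
   then show "?w i * abs (e i) <= (if i = 0 then 1 else 0) + ?w i * abs (fps_nth (Abs_fps g * Abs_fps hN) i)"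
    by (auto simp: algebra_simps split: if_splits)
  qed
  also have "... <= 1 + (SUM i<=Q. ?w i * abs (fps_nth (Abs_fps g * Abs_fps hN) i))"
   by (simp add: sum.distrib)
  also have "... <= 1 + (SUM i<=Q. ?w i * abs (g i)) * (SUM j<=Q. ?w j * abs (hN j))"
   by (intro add_mono weighted_convolution_bound gam) auto
  also have "... <= 1 + gw * hw" unfolding gw_def
   by (intro add_mono mult_mono hNw sum_le_suminf sg suminf_nonneg sum_nonneg order.refl) auto
  finally show ?thesis .
 qed
 define hs where "hs = (\<Sum>n. abs (h n))"
 have "(SUM n<=Q. ?w n * abs (h n)) <= 2 * (hw + 2 powr gam * ((1 + gw * hw) * hs))" for Q
 proof -
  let ?S = "SUM n<=Q. ?w n * abs (h n)"
  have pt: "?w n * abs (h n) <= ?w n * abs (hN n) + (SUM i<=n. 2 powr gam * ((?w i + ?w (n - i)) * (abs (e i) * abs (h (n - i)))))" for n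
  proof -
   have "h n = hN n + (SUM i<=n. e i * h (n - i))"
    using arg_cong[OF hE, of "%x. fps_nth x n"] by (simp add: fps_mult_nth atLeast0AtMost)
   then have "abs (h n) <= abs (hN n) + (SUM i<=n. abs (e i) * abs (h (n - i)))"
    by (auto simp: abs_mult[symmetric] intro: order.trans[OF abs_triangle_ineq] sum_abs)
   then have "?w n * abs (h n) <= ?w n * (abs (hN n) + (SUM i<=n. abs (e i) * abs (h (n - i))))"
    by (intro mult_left_mono) auto
   also have "... = ?w n * abs (hN n) + (SUM i<=n. ?w n * (abs (e i) * abs (h (n - i))))"
    by (simp add: distrib_left sum_distrib_left)
   also have "... <= ?w n * abs (hN n) + (SUM i<=n. 2 powr gam * (?w i + ?w (n - i)) * (abs (e i) * abs (h (n - i))))"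
    by (intro add_mono sum_mono mult_right_mono weight_subadditive gam) auto
   finally show ?thesis by (simp add: mult.assoc)
  qed
  have "?S <= (SUM n<=Q. ?w n * abs (hN n)) + (SUM n<=Q. SUM i<=n. 2 powr gam * ((?w i + ?w (n - i)) * (abs (e i) * abs (h (n - i)))))"
   unfolding sum.distrib[symmetric] by (intro sum_mono pt)
  also have "... <= hw + (SUM i<=Q. SUM j<=Q. 2 powr gam * ((?w i + ?w j) * (abs (e i) * abs (h j))))"
   by (intro add_mono hNw sum_triangle_le) auto
  also have "(SUM i<=Q. SUM j<=Q. 2 powr gam * ((?w i + ?w j) * (abs (e i) * abs (h j))))
    = 2 powr gam * ((SUM i<=Q. ?w i * abs (e i)) * (SUM j<=Q. abs (h j))) + 2 powr gam * ((SUM i<=Q. abs (e i)) * ?S)"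
  proof -
   have "(SUM i<=Q. SUM j<=Q. 2 powr gam * ((?w i + ?w j) * (abs (e i) * abs (h j))))
     = (SUM i<=Q. SUM j<=Q. 2 powr gam * ((?w i * abs (e i)) * abs (h j))) + (SUM i<=Q. SUM j<=Q. 2 powr gam * (abs (e i) * (?w j * abs (h j))))"
    unfolding sum.distrib[symmetric] by (intro sum.cong refl) (simp add: algebra_simps)
   then show ?thesis by (simp only: sum_product) (simp only: sum_distrib_left)
  qed
  also have "(SUM i<=Q. ?w i * abs (e i)) * (SUM j<=Q. abs (h j)) <= (1 + gw * hw) * hs"
   unfolding hs_def
   by (intro mult_mono ew sum_le_suminf sh sum_nonneg) (auto intro!: sum_nonneg order.trans[OF sum_nonneg ew])
  also have "2 powr gam * ((SUM i<=Q. abs (e i)) * ?S) <= 2 powr gam * (1 / (2 * 2 powr gam) * ?S)"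
   by (intro mult_left_mono mult_right_mono e1 sum_nonneg) auto
  finally have "?S <= hw + (2 powr gam * ((1 + gw * hw) * hs) + ?S / 2)" by (simp del: of_nat_Suc)
  then show ?thesis by (simp del: of_nat_Suc)
 qed
 then show ?thesis
  by (intro nonneg_summable_atMost(1)) simp_all
qed


text \<open>The generating function of the tails is \<open>(1 - F z) / (1 - z)\<close>. A zero would force \<open>F z = 1\<close> with \<open>F 1 = 1\<close>, hence
\<open>z ^ k = 1\<close> for all \<open>k\<close> with \<open>f k > 0\<close>; aperiodicity leaves only \<open>z = 1\<close>, where the value is a positive sum.\<close>

lemma renewal_generating_nonzero:
 fixes f g :: "nat => real"
 assumes f0: "f 0 = 0" and fn: "!!n. f n >= 0" and g: "!!n. g n = 1 - (SUM k<=n. f k)" and gn: "!!n. g n >= 0"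
  and sg: "summable g" and gcd: "Gcd {k. f k > 0} = 1" and z: "cmod z <= 1"
 shows "(\<Sum>n. of_real (g n) * z ^ n) ~= (0::complex)"
proof
 assume Gz: "(\<Sum>n. of_real (g n) * z ^ n) = (0::complex)"
 have "g ----> 0" by (rule summable_LIMSEQ_zero[OF sg])
 then have "(%n. 1 - g n) ----> 1 - 0" by (intro tendsto_intros)
 then have fsums: "f sums 1" unfolding sums_def_le by (simp add: g)
 have sf: "summable f" using fsums by (simp add: sums_iff)
 have nf: "norm (of_real (f n) * z ^ n :: complex) <= f n" for n
  using z fn[of n] by (simp add: norm_mult norm_power mult_left_le power_le_one)
 have ng: "norm (of_real (g n) * z ^ n :: complex) <= g n" for n
  using z gn[of n] by (simp add: norm_mult norm_power mult_left_le power_le_one)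
 have sfz: "summable (%n. of_real (f n) * z ^ n :: complex)"
  by (rule summable_comparison_test[OF _ sf]) (use nf in auto)
 have sgz: "summable (%n. of_real (g n) * z ^ n :: complex)"
  by (rule summable_comparison_test[OF _ sg]) (use ng in auto)
 have gS: "g (Suc n) = g n - f (Suc n)" for n by (simp add: g)
 have G1: "(\<Sum>n. of_real (g (Suc n)) * z ^ Suc n :: complex) = - 1"
  using suminf_split_head[OF sgz] Gz by (simp add: g f0)
 have "(\<Sum>n. of_real (g (Suc n)) * z ^ Suc n :: complex)
   = (\<Sum>n. z * (of_real (g n) * z ^ n) - of_real (f (Suc n)) * z ^ Suc n)"
  by (intro suminf_cong) (simp add: gS algebra_simps)
 also have "... = (\<Sum>n. z * (of_real (g n) * z ^ n)) - (\<Sum>n. of_real (f (Suc n)) * z ^ Suc n)"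
  using sfz by (intro suminf_diff[symmetric] summable_mult sgz) (subst summable_Suc_iff)
 also have "(\<Sum>n. z * (of_real (g n) * z ^ n)) = 0" using suminf_mult[OF sgz, of z] Gz by simp
 also have "(\<Sum>n. of_real (f (Suc n)) * z ^ Suc n) = (\<Sum>n. of_real (f n) * z ^ n)"
  using suminf_split_head[OF sfz] f0 by simp
 finally have Fz: "(\<Sum>n. of_real (f n) * z ^ n :: complex) = 1" using G1 by simp
 have "(%n. of_real (f n) * z ^ n) sums (1::complex)" using sfz Fz by (simp add: sums_iff)
 then have "(%n. Re (of_real (f n) * z ^ n)) sums Re 1" by (rule sums_Re)
 then have "(%n. f n - f n * Re (z ^ n)) sums (1 - 1)"
  using fsums by (intro sums_diff) auto
 then have s0: "(%n. f n * (1 - Re (z ^ n))) sums 0" by (simp add: algebra_simps)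
 have Rle: "Re (z ^ n) <= 1" for n
  using complex_Re_le_cmod[of "z ^ n"] z power_le_one[of "cmod z" n] by (simp add: norm_power)
 have zk1: "z ^ k = 1" if k: "f k > 0" for k
 proof -
  have "f k * (1 - Re (z ^ k)) = 0"
   using s0 suminf_eq_zero_iff[of "%n. f n * (1 - Re (z ^ n))"] fn Rle by (auto simp: sums_iff)
  then have re: "Re (z ^ k) = 1" using k by simp
  have "cmod (z ^ k) <= 1" using z by (simp add: norm_power power_le_one)
  then have "(Re (z ^ k))^2 + (Im (z ^ k))^2 <= 1"
   by (metis cmod_power2 norm_ge_zero one_power2 power_mono)
  then show ?thesis using re by (simp add: complex_eq_iff)
 qed
 have "EX k>0. f k > 0"
 proof (rule ccontr)
  assume "~ (EX k>0. f k > 0)"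
  then have "f k = 0" for k using fn[of k] f0 by (metis le_less not_gr_zero)
  then have "f = (%_. 0)" by auto
  then show False using sums_unique2[OF fsums, of 0] by simp
 qed
 then have ex: "EX k>0. z ^ k = 1" using zk1 by auto
 define d where "d = (LEAST k. k > 0 & z ^ k = 1)"
 have d: "d > 0" "z ^ d = 1" using LeastI_ex[OF ex] unfolding d_def by auto
 have "d dvd k" if k: "f k > 0" for k
 proof -
  have "z ^ k = (z ^ d) ^ (k div d) * z ^ (k mod d)"
   unfolding power_mult[symmetric] power_add[symmetric] by simp
  then have "z ^ (k mod d) = 1" using zk1[OF k] d by simp
  moreover have "k mod d < d" using d by simp
  ultimately have "k mod d = 0" using not_less_Least[of "k mod d" "%k. k > 0 & z ^ k = 1"] unfolding d_def by auto
  then show ?thesis by auto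
 qed
 then have "d dvd Gcd {k. f k > 0}" by (intro Gcd_greatest) auto
 then have "z = 1" using gcd d by simp
 then have "(\<Sum>n. of_real (g n) :: complex) = 0" using Gz by simp
 then have "(\<Sum>n. g n) = 0" using suminf_of_real[OF sg] by (metis of_real_eq_0_iff)
 then have "g 0 = 0" using suminf_eq_zero_iff[OF sg gn] by auto
 then show False by (simp add: g f0)
qed

text \<open>The solution of the renewal equation is the partial sum of \<open>h * e\<close>, where \<open>h\<close> is the reciprocal of the tail sequence
\<open>g\<close>: indeed \<open>1 - F z = (1 - z) * G z\<close>. Weighted summability of \<open>h\<close> and \<open>e\<close> passes to the convolution, whose remainders
decay like the reciprocal weight. The constant is uniform in \<open>I\<close> and \<open>e\<close>.\<close>

lemma renewal_convergence:
 fixes f g :: "nat => real"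
 assumes f0: "f 0 = 0" and fn: "!!n. f n >= 0" and g: "!!n. g n = 1 - (SUM k<=n. f k)" and gn: "!!n. g n >= 0"
  and gam: "gam >= 1" and sg: "summable (%n. real (Suc n) powr gam * g n)" and gcd: "Gcd {k. f k > 0} = 1"
 obtains C where "C >= 0"
  "!!I e :: nat => real. (!!n. I n = (SUM k<=n. f k * I (n - k)) + e n) ==> (!!n. abs (e n) <= g n)
   ==> EX l. ALL n. abs (I n - l) <= C * decay gam n"
proof -
 let ?w = "%n. real (Suc n) powr gam"
 let ?F = "Abs_fps f" and ?G = "Abs_fps g"
 have sg': "summable (%n. real (Suc n) * g n)"
 proof (rule summable_comparison_test[OF _ sg], intro exI allI impI)
  fix n
  have "real (Suc n) powr 1 <= real (Suc n) powr gam" using gam by (intro powr_mono) auto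
  then have "real (Suc n) * g n <= real (Suc n) powr gam * g n" using gn by (intro mult_right_mono) auto
  then show "norm (real (Suc n) * g n) <= real (Suc n) powr gam * g n" using gn[of n] by simp
 qed
 have sg1: "summable g"
 proof (rule summable_comparison_test[OF _ sg'], intro exI allI impI)
  fix n
  have "1 * g n <= real (Suc n) * g n" using gn by (intro mult_right_mono) auto
  then show "norm (g n) <= real (Suc n) * g n" using gn[of n] by simp
 qed
 have F1G: "1 - ?F = (1 - fps_X) * ?G"
 proof (rule fps_ext)
  fix n show "fps_nth (1 - ?F) n = fps_nth ((1 - fps_X) * ?G) n"
   by (cases n) (simp_all add: algebra_simps g f0)
 qed
 have G0: "fps_nth ?G 0 ~= 0" by (simp add: g f0)
 define H where "H = inverse ?G"
 define h where "h = fps_nth H"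
 have Hh: "Abs_fps h = H" by (simp add: h_def fps_nth_inverse)
 have GH: "?G * H = 1" unfolding H_def using inverse_mult_eq_1'[OF G0] by simp
 define U where "U = inverse (1 - ?F)"
 have UF: "(1 - ?F) * U = 1" unfolding U_def by (rule inverse_mult_eq_1') (simp add: f0)
 have "H = (1 - fps_X) * U"
 proof -
  have "H = H * ((1 - fps_X) * ?G * U)" using UF unfolding F1G by simp
  also have "... = (?G * H) * ((1 - fps_X) * U)" by (simp add: mult_ac)
  finally show ?thesis using GH by simp
 qed
 then have hU: "h n = fps_nth U n - (if n = 0 then 0 else fps_nth U (n - 1))" for n
  unfolding h_def by (simp add: left_diff_distrib)
 have U01: "0 <= fps_nth U n & fps_nth U n <= 1" for n
 proof (induction n rule: less_induct)
  case (less n)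
  have "U = 1 + ?F * U" using UF by (simp add: algebra_simps)
  then have "fps_nth U n = fps_nth (1 + ?F * U) n" by simp
  then have eq: "fps_nth U n = (if n = 0 then 1 else 0) + (SUM k<=n. f k * fps_nth U (n - k))"
   by (simp add: fps_mult_nth atLeast0AtMost)
  show ?case
  proof (cases "n = 0")
   case True
   then show ?thesis using eq f0 by simp
  next
   case False
   have t: "0 <= f k * fps_nth U (n - k) & f k * fps_nth U (n - k) <= f k" if "k <= n" for k
   proof (cases "k = 0")
    case False
    then show ?thesis using less.IH[of "n - k"] that fn[of k] by (auto intro!: mult_left_le)
   qed (simp add: f0)
   have "(SUM k<=n. f k * fps_nth U (n - k)) <= (SUM k<=n. f k)" using t by (intro sum_mono) auto
   also have "... <= 1" using gn[of n] g[of n] by simp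
   finally show ?thesis using eq False t by (auto intro!: sum_nonneg)
  qed
 qed
 have hb: "abs (h n) <= 1" for n using hU[of n] U01[of n] U01[of "n - 1"] by (auto split: if_splits)
 have inv: "?G * Abs_fps h = 1" using GH Hh by simp
 have sh: "summable (%n. abs (h n))"
  by (rule power_series_reciprocal_summable[OF inv hb gn sg'])
   (rule renewal_generating_nonzero[OF f0 fn g gn sg1 gcd])
 have shw: "summable (%n. ?w n * abs (h n))"
  using sg gn gam by (intro reciprocal_weighted_summable[OF inv _ _ sh]) (simp_all add: abs_of_nonneg)
 define hw where "hw = (\<Sum>n. ?w n * abs (h n))"
 define gw where "gw = (\<Sum>n. ?w n * g n)"
 have nn: "0 <= hw" "0 <= gw" unfolding hw_def gw_def by (intro suminf_nonneg shw sg mult_nonneg_nonneg gn; simp)+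
 show thesis
 proof (rule that[of "hw * gw"])
  show "hw * gw >= 0" using nn by simp
  fix I e :: "nat => real"
  assume I: "!!n. I n = (SUM k<=n. f k * I (n - k)) + e n" and e: "!!n. abs (e n) <= g n"
  define d where "d = fps_nth (Abs_fps h * Abs_fps e)"
  have "Abs_fps I = ?F * Abs_fps I + Abs_fps e"
   by (rule fps_ext) (simp add: fps_mult_nth atLeast0AtMost I[symmetric])
  then have "(1 - fps_X) * ?G * Abs_fps I = Abs_fps e" unfolding F1G[symmetric] by (simp add: algebra_simps)
  then have "(?G * H) * ((1 - fps_X) * Abs_fps I) = H * Abs_fps e" by (metis mult.assoc mult.commute)
  then have D: "(1 - fps_X) * Abs_fps I = Abs_fps h * Abs_fps e" by (simp add: GH Hh)
  have dn: "d n = I n - (if n = 0 then 0 else I (n - 1))" for n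
   unfolding d_def D[symmetric] by (simp add: left_diff_distrib)
  have Id: "I n = (SUM k<=n. d k)" for n by (induction n) (auto simp: dn)
  have wd: "(SUM n<=Q. ?w n * abs (d n)) <= hw * gw" for Q
  proof -
   have "(SUM n<=Q. ?w n * abs (d n)) <= (SUM i<=Q. ?w i * abs (h i)) * (SUM j<=Q. ?w j * abs (e j))"
    unfolding d_def using gam by (intro weighted_convolution_bound) simp
   also have "... <= hw * gw"
   proof (intro mult_mono)
    show "(SUM i<=Q. ?w i * abs (h i)) <= hw" unfolding hw_def by (intro sum_le_suminf shw) auto
    have "(SUM j<=Q. ?w j * abs (e j)) <= (SUM j<=Q. ?w j * g j)" by (intro sum_mono mult_left_mono e) auto
    also have "... <= gw" unfolding gw_def by (intro sum_le_suminf sg) (auto simp: gn)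
    finally show "(SUM j<=Q. ?w j * abs (e j)) <= gw" .
   qed (use nn in "auto intro!: sum_nonneg")
   finally show ?thesis .
  qed
  have swd: "summable (%n. ?w n * abs (d n))"
   by (rule nonneg_summable_atMost(1)[OF _ wd]) simp
  have wdtot: "(\<Sum>n. ?w n * abs (d n)) <= hw * gw"
   by (rule nonneg_summable_atMost(2)[OF _ wd]) simp
  have w1: "?w n >= 1" for n using gam by (intro ge_one_powr_ge_zero) auto
  have sd: "summable (%n. abs (d n))"
   using w1 by (intro summable_comparison_test[OF _ swd]) (auto intro!: exI[of _ 0] simp: mult_le_cancel_right1 simp del: of_nat_Suc)
  have sd': "summable d" using sd by (rule summable_rabs_cancel)
  show "EX l. ALL n. abs (I n - l) <= hw * gw * decay gam n"
  proof (intro exI[of _ "suminf d"] allI)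
   fix n
   have "suminf d = (\<Sum>k. d (k + Suc n)) + I n"
    using suminf_split_initial_segment[OF sd', of "Suc n"] by (simp add: Id lessThan_Suc_atMost)
   then have "abs (I n - suminf d) = abs (\<Sum>k. d (k + Suc n))" by simp
   also have "... <= (\<Sum>k. abs (d (k + Suc n)))" by (intro summable_rabs summable_ignore_initial_segment sd)
   also have "... <= (\<Sum>k. decay gam n * (?w (k + Suc n) * abs (d (k + Suc n))))"
   proof (intro suminf_le summable_mult summable_ignore_initial_segment[of "%n. ?w n * abs (d n)"] summable_ignore_initial_segment[of "%n. abs (d n)"] sd swd)
    fix k
    have "real (Suc n) powr gam <= ?w (k + Suc n)" using gam by (intro powr_mono2) auto
    then have "1 <= decay gam n * ?w (k + Suc n)" by (simp add: powr_minus field_simps del: of_nat_Suc)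
    then have "1 * abs (d (k + Suc n)) <= (decay gam n * ?w (k + Suc n)) * abs (d (k + Suc n))"
     by (intro mult_right_mono) auto
    then show "abs (d (k + Suc n)) <= decay gam n * (?w (k + Suc n) * abs (d (k + Suc n)))"
     by (simp only: mult.assoc mult_1)
   qed
   also have "... = decay gam n * (\<Sum>k. ?w (k + Suc n) * abs (d (k + Suc n)))"
    by (rule suminf_mult[OF summable_ignore_initial_segment[OF swd, of "Suc n"]])
   also have "(\<Sum>k. ?w (k + Suc n) * abs (d (k + Suc n))) <= hw * gw"
   proof -
    have "(\<Sum>k. ?w (k + Suc n) * abs (d (k + Suc n))) <= (\<Sum>n. ?w n * abs (d n))"
     using suminf_split_initial_segment[OF swd, of "Suc n"] by (simp add: sum_nonneg del: of_nat_Suc)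
    then show ?thesis using wdtot by simp
   qed
   finally show "abs (I n - suminf d) <= hw * gw * decay gam n"
    by (simp add: mult_ac mult_left_mono)
  qed
 qed
qed

section \<open>Regular functionals\<close>

definition bdd_borel :: "('a::topological_space => real) => bool" where
 "bdd_borel u \<longleftrightarrow> u : borel_measurable borel & (EX B. ALL x. abs (u x) <= B)"

named_theorems bb

lemma bdd_borel_const [bb]: "bdd_borel (%_. c)"
 by (auto simp: bdd_borel_def)

lemma bdd_borel_add [bb]: "bdd_borel u ==> bdd_borel v ==> bdd_borel (%x. u x + v x)"
proof -
 assume "bdd_borel u" "bdd_borel v"
 then obtain A B where "!!x. abs (u x) <= A" "!!x. abs (v x) <= B" and m: "u : borel_measurable borel" "v : borel_measurable borel"
  by (auto simp: bdd_borel_def)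
 then have "!!x. abs (u x + v x) <= A + B" by (meson abs_triangle_ineq add_mono order.trans)
 then show ?thesis using m unfolding bdd_borel_def by auto
qed

lemma bdd_borel_mult [bb]: "bdd_borel u ==> bdd_borel v ==> bdd_borel (%x. u x * v x)"
proof -
 assume "bdd_borel u" "bdd_borel v"
 then obtain A B where "!!x. abs (u x) <= A" "!!x. abs (v x) <= B" and m: "u : borel_measurable borel" "v : borel_measurable borel"
  by (auto simp: bdd_borel_def)
 then have "!!x. abs (u x * v x) <= abs A * abs B" unfolding abs_mult by (intro mult_mono) (auto intro: order.trans[OF _ abs_ge_self])
 then show ?thesis using m unfolding bdd_borel_def by auto
qed

lemma bdd_borel_cmult [bb]: "bdd_borel u ==> bdd_borel (%x. c * u x)"
 by (intro bb)

lemma bdd_borel_diff [bb]: "bdd_borel u ==> bdd_borel v ==> bdd_borel (%x. u x - v x)"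
 using bdd_borel_add[of u "%x. (- 1) * v x"] bdd_borel_cmult[of v "- 1"] by simp

lemma bdd_borel_abs [bb]: "bdd_borel u ==> bdd_borel (%x. abs (u x))"
 unfolding bdd_borel_def by auto

lemma bdd_borel_indicator [bb]: "A : sets borel ==> bdd_borel (indicator A)"
 unfolding bdd_borel_def by (auto intro!: exI[of _ 1] simp: indicator_def)

lemma bdd_borel_sum [bb]: "(!!i. i : I ==> bdd_borel (u i)) ==> bdd_borel (%x. SUM i:I. u i x)"
 by (induction I rule: infinite_finite_induct) (auto intro: bb)

lemma bdd_borel_comp:
 "bdd_borel u ==> g : borel ->M borel ==> bdd_borel (%x. u (g x))"
 unfolding bdd_borel_def by auto

lemma bdd_borel_integrable:
 assumes "bdd_borel u" "finite_measure M" "sets M = sets borel"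
 shows "integrable M u"
proof -
 obtain B where "!!x. abs (u x) <= B" "u : borel_measurable borel" using assms(1) by (auto simp: bdd_borel_def)
 moreover from this have "u : borel_measurable M" using measurable_cong_sets[OF assms(3) refl] by blast
 ultimately show ?thesis by (intro finite_measure.integrable_const_bound[OF assms(2), of _ B]) auto
qed

definition linear_functional :: "(('a::topological_space => real) => real) => bool" where
 "linear_functional Lam \<longleftrightarrow>
  (ALL u v. bdd_borel u --> bdd_borel v --> Lam (%x. u x + v x) = Lam u + Lam v) &
  (ALL c u. bdd_borel u --> Lam (%x. c * u x) = c * Lam u)"

lemma lin_add: "linear_functional Lam ==> bdd_borel u ==> bdd_borel v ==> Lam (%x. u x + v x) = Lam u + Lam v"
 by (simp add: linear_functional_def)

lemma lin_cmult: "linear_functional Lam ==> bdd_borel u ==> Lam (%x. c * u x) = c * Lam u"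
 by (simp add: linear_functional_def)

lemma lin_zero: "linear_functional Lam ==> Lam (%x. 0) = 0"
 using lin_cmult[of Lam "%_. 0" 0] by (simp add: bb)

lemma lin_diff: "linear_functional Lam ==> bdd_borel u ==> bdd_borel v ==> Lam (%x. u x - v x) = Lam u - Lam v"
 using lin_add[of Lam u "%x. (- 1) * v x"] lin_cmult[of Lam v "- 1"] bdd_borel_cmult[of v "- 1"] by simp

lemma lin_sum:
 "linear_functional Lam ==> (!!i. i : I ==> bdd_borel (u i)) ==> Lam (%x. SUM i:I. u i x) = (SUM i:I. Lam (u i))"
proof (induction I rule: infinite_finite_induct)
 case (insert i I)
 have "Lam (%x. u i x + (SUM i:I. u i x)) = Lam (u i) + Lam (%x. SUM i:I. u i x)"
  using insert by (intro lin_add bb) auto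
 then show ?case using insert by simp
qed (simp_all add: lin_zero)

definition positive_functional :: "(('a::topological_space => real) => real) => bool" where
 "positive_functional Lam \<longleftrightarrow> linear_functional Lam & (ALL u. bdd_borel u --> (ALL x. 0 <= u x) --> 0 <= Lam u)"

lemma pos_nonneg: "positive_functional Lam ==> bdd_borel u ==> (!!x. 0 <= u x) ==> 0 <= Lam u"
 by (simp add: positive_functional_def)

lemma pos_lin: "positive_functional Lam ==> linear_functional Lam"
 by (simp add: positive_functional_def)

lemma pos_mono: "positive_functional Lam ==> bdd_borel u ==> bdd_borel v ==> (!!x. u x <= v x) ==> Lam u <= Lam v"
 using pos_nonneg[OF _ bdd_borel_diff, of Lam v u] lin_diff[OF pos_lin, of Lam v u] by simp

lemma pos_abs_le:
 assumes "positive_functional Lam" "bdd_borel u" "bdd_borel v" "!!x. abs (u x) <= v x"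
 shows "abs (Lam u) <= Lam v"
proof -
 have "Lam u <= Lam v" by (rule pos_mono[OF assms(1-3)]) (meson abs_le_D1 assms(4))
 moreover have "Lam (%x. (- 1) * u x) <= Lam v"
  by (rule pos_mono[OF assms(1) bdd_borel_cmult[OF assms(2)] assms(3)]) (use assms(4) abs_le_D2 in force)
 ultimately show ?thesis using lin_cmult[OF pos_lin[OF assms(1)] assms(2), of "- 1"] by linarith
qed

lemma positive_transform:
 assumes pos: "positive_functional Lam" and w: "bdd_borel w" "!!x. 0 <= w x" and g: "g : borel ->M borel"
 shows "positive_functional (%u. Lam (%x. w x * u (g x)))"
 unfolding positive_functional_def linear_functional_def
proof (intro conjI allI impI)
 note gb = bdd_borel_comp[OF _ g] and lin = pos_lin[OF pos]
 fix u v :: "'b => real" and c :: real assume u: "bdd_borel u"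
 show "Lam (%x. w x * (u (g x) + v (g x))) = Lam (%x. w x * u (g x)) + Lam (%x. w x * v (g x))" if "bdd_borel v"
  unfolding distrib_left by (intro lin_add[OF lin] bb w gb u that)
 have "Lam (%x. c * (w x * u (g x))) = c * Lam (%x. w x * u (g x))" by (intro lin_cmult[OF lin] bb w gb u)
 then show "Lam (%x. w x * (c * u (g x))) = c * Lam (%x. w x * u (g x))" by (simp add: mult_ac)
 show "0 <= Lam (%x. w x * u (g x))" if "ALL x. 0 <= u x"
  by (rule pos_nonneg[OF pos]) (intro bb w gb u, use that w in simp)
qed

lemma positive_integral:
 assumes "finite_measure M" "sets M = sets borel"
 shows "positive_functional (%u. \<integral>x. u x \<partial>M)"
 unfolding positive_functional_def linear_functional_def using bdd_borel_integrable[OF _ assms] by auto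

text \<open>Weighting by a function that varies by at most the factor \<open>A\<close> between the supports costs only that factor: \<open>w\<close> lies
between its infimum over the support of \<open>v\<close> and \<open>A\<close> times this infimum.\<close>

lemma weight_compare:
 assumes pos: "positive_functional Lam" "positive_functional E" and w: "bdd_borel w" "!!x. 0 <= w x"
  and uv: "bdd_borel u" "bdd_borel v" "!!x. 0 <= u x" "!!x. 0 <= v x" and AB: "0 < A" "0 <= B"
  and wA: "!!x y. u x ~= 0 ==> v y ~= 0 ==> w x <= A * w y"
  and B: "Lam u * E v <= B * E u * Lam v"
 shows "Lam (%x. w x * u x) * E v <= A * B * E u * Lam (%x. w x * v x)"
proof -
 note lin = pos_lin[OF pos(1)]
 have nn: "0 <= E u" "0 <= E v" "0 <= Lam (%x. w x * v x)"
  using pos_nonneg[OF pos(2)] uv pos_nonneg[OF pos(1) bdd_borel_mult[OF w(1) uv(2)]] w by auto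
 show ?thesis
 proof (cases "(EX x. u x ~= 0) & (EX y. v y ~= 0)")
  case False
  then have "u = (%_. 0) | v = (%_. 0)" by auto
  then have z: "Lam (%x. w x * u x) * E v = 0" using lin_zero[OF lin] lin_zero[OF pos_lin[OF pos(2)]] by auto
  show ?thesis unfolding z using nn AB by simp
 next
  case True
  then obtain x0 y0 where xy0: "u x0 ~= 0" "v y0 ~= 0" by auto
  define iv where "iv = (INF y\<in>{y. v y ~= 0}. w y)"
  have ivle: "iv <= w y" if "v y ~= 0" for y
   unfolding iv_def by (rule cINF_lower) (use that w in "auto intro: bdd_belowI2[of _ 0]")
  have wxle: "w x <= A * iv" if x: "u x ~= 0" for x
  proof -
   have "w x / A <= w y" if "v y ~= 0" for y using wA[OF x that] AB by (simp add: divide_simps mult.commute)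
   then have "w x / A <= iv" unfolding iv_def using xy0 by (intro cINF_greatest) auto
   then show ?thesis using AB by (simp add: divide_simps mult.commute)
  qed
  have iv0: "0 <= iv" unfolding iv_def using xy0 w by (intro cINF_greatest) auto
  have 1: "Lam (%x. w x * u x) <= A * iv * Lam u"
   unfolding lin_cmult[OF lin uv(1), symmetric]
   using wxle uv(3) by (intro pos_mono[OF pos(1)] bb uv w) (metis mult_right_mono mult_zero_right order.refl)
  have 2: "iv * Lam v <= Lam (%x. w x * v x)"
   unfolding lin_cmult[OF lin uv(2), symmetric]
   using ivle uv(4) by (intro pos_mono[OF pos(1)] bb uv w) (metis mult_right_mono mult_zero_right order.refl)
  have "Lam (%x. w x * u x) * E v <= (A * iv * Lam u) * E v" using 1 nn by (intro mult_right_mono)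
  also have "... = A * iv * (Lam u * E v)" by simp
  also have "... <= A * iv * (B * E u * Lam v)" using B iv0 AB by (intro mult_left_mono) auto
  also have "... = A * B * E u * (iv * Lam v)" by simp
  also have "... <= A * B * E u * Lam (%x. w x * v x)" using 2 nn AB by (intro mult_left_mono) auto
  finally show ?thesis .
 qed
qed

text \<open>Removing \<open>q\<close> on both sides of an inequality with constant \<open>exp s\<close> worsens the constant only by the factor
\<open>1 / (1 - eps)\<close> in the exponent.\<close>

lemma exp_subtract_bound:
 fixes s q eps :: real
 assumes "0 <= s" "0 <= q" "q <= eps" "eps < 1"
 shows "exp s - q <= exp (s / (1 - eps)) * (1 - q)"
proof -
 have q1: "q < 1" using assms by simp
 have "s / (1 - q) <= s / (1 - eps)" using assms by (intro divide_left_mono) auto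
 then have "exp (s / (1 - q)) * (1 - q) <= exp (s / (1 - eps)) * (1 - q)" using q1 by (intro mult_right_mono) auto
 moreover have "exp s - q <= exp (s / (1 - q)) * (1 - q)"
 proof -
  have "s / (1 - q) = s + s * q / (1 - q)" using q1 by (simp add: field_simps)
  then have "exp (s / (1 - q)) = exp s * exp (s * q / (1 - q))" by (simp add: exp_add)
  also have "... >= exp s * (1 + s * q / (1 - q))" by (intro mult_left_mono exp_ge_add_one_self) auto
  finally have "exp (s / (1 - q)) * (1 - q) >= exp s * (1 + s * q / (1 - q)) * (1 - q)"
   using q1 by (intro mult_right_mono) auto
  also have "exp s * (1 + s * q / (1 - q)) * (1 - q) = exp s * (1 - q + s * q)"
   using q1 by (simp add: field_simps)
  finally have 1: "exp (s / (1 - q)) * (1 - q) >= exp s * (1 - q + s * q)" .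
  have "1 - s <= exp (- s)" using exp_ge_add_one_self[of "- s"] by simp
  then have "exp s * (1 - s) <= exp s * exp (- s)" by (intro mult_left_mono) auto
  then have "exp s * (1 - s) <= 1" by (simp add: exp_minus)
  then have "q * (exp s * (1 - s)) <= q * 1" using assms by (intro mult_left_mono) auto
  then show ?thesis using 1 by (simp add: algebra_simps)
 qed
 ultimately show ?thesis by linarith
qed

text \<open>The induced map seen from the whole space: the reference measure \<open>P\<close> is carried by the basis and \<open>R\<close> vanishes outside.
Distortion is stated for integrals of functions, which avoids Jacobians: \<open>u\<close> and \<open>v\<close> stand for test functions
supported in sets at distance at most \<open>t\<close> after the return.\<close>

locale full_branch_map =
 fixes P :: "'a::polish_space measure" and f :: "'a => 'a" and \<Gamma> :: "'a set set" and R :: "'a => nat"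
  and al th K D :: real
 assumes prob_P: "prob_space P" and sets_P: "sets P = sets borel"
  and f_borel [measurable]: "f : borel ->M borel"
  and part: "countable \<Gamma>" "\<Gamma> \<subseteq> sets borel" "disjoint \<Gamma>" "AE x in P. x : \<Union>\<Gamma>"
  and part_pos: "!!a. a : \<Gamma> ==> measure P a > 0"
  and R_const: "!!a x y. a : \<Gamma> ==> x : a ==> y : a ==> R x = R y"
  and R_pos: "!!x. x : \<Union>\<Gamma> ==> R x >= 1" and R_zero: "!!x. x \<notin> \<Union>\<Gamma> ==> R x = 0"
  and diam: "!!x y :: 'a. dist x y powr al <= D" and al: "0 < al"
  and th: "0 < th" "th < 1" and K: "K > 0"
  and contr: "!!a x y. a : \<Gamma> ==> x : a ==> y : a ==>
   dist x y powr al <= th * dist ((f ^^ R x) x) ((f ^^ R y) y) powr al"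
  and distort: "!!a u v t. a : \<Gamma> ==> bdd_borel u ==> bdd_borel v ==> (!!x. 0 <= u x) ==> (!!x. 0 <= v x)
   ==> t >= 0 ==> (!!x y. u x ~= 0 ==> v y ~= 0 ==> dist x y powr al <= t)
   ==> (LINT x|P. indicator a x * u ((f ^^ R x) x)) * (LINT x|P. v x)
      <= exp (K * t) * (LINT x|P. u x) * (LINT x|P. indicator a x * v ((f ^^ R x) x))"
begin

definition F where "F x = (f ^^ R x) x"
definition E :: "('a => real) => real" where "E u = (LINT x|P. u x)"

text \<open>If \<open>Lam\<close> has density \<open>h\<close> with respect to \<open>P\<close>, this essentially says that \<open>h x <= exp (k * dist x y powr al) * h y\<close>. Stated with test
functions it makes sense for functionals without a density and is closed under limits.\<close>

definition regular :: "real => (('a => real) => real) => bool" where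
 "regular k Lam \<longleftrightarrow> positive_functional Lam &
  (ALL u v t. bdd_borel u --> bdd_borel v --> (ALL x. 0 <= u x) --> (ALL x. 0 <= v x) --> t >= 0 -->
    (ALL x y. u x ~= 0 --> v y ~= 0 --> dist x y powr al <= t) -->
    Lam u * E v <= exp (k * t) * E u * Lam v)"

lemma regular_pos: "regular k Lam ==> positive_functional Lam" by (simp add: regular_def)
lemma regular_lin: "regular k Lam ==> linear_functional Lam" by (simp add: regular_def pos_lin)

lemma regularD:
 "regular k Lam ==> bdd_borel u ==> bdd_borel v ==> (!!x. 0 <= u x) ==> (!!x. 0 <= v x) ==> t >= 0 ==>
  (!!x y. u x ~= 0 ==> v y ~= 0 ==> dist x y powr al <= t) ==> Lam u * E v <= exp (k * t) * E u * Lam v"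
 by (simp add: regular_def)

lemma D_nonneg: "0 <= D" using diam[of undefined undefined] by (meson order.trans powr_ge_zero)

lemma R_eq_union: "~ Q 0 ==> {x. Q (R x)} = \<Union>{a : \<Gamma>. a \<subseteq> {x. Q (R x)}}"
proof safe
 fix x assume Q: "~ Q 0" "Q (R x)"
 then have "x : \<Union>\<Gamma>" using R_zero[of x] by (cases "x : \<Union>\<Gamma>") auto
 then obtain a where a: "a : \<Gamma>" "x : a" by auto
 have "a \<subseteq> {x. Q (R x)}"
 proof
  fix y assume "y : a"
  then have "R y = R x" by (rule R_const[OF a(1) _ a(2)])
  then show "y : {x. Q (R x)}" using Q by simp
 qed
 then show "x : \<Union>{a : \<Gamma>. a \<subseteq> {x. Q (R x)}}" using a by blast
qed blast

lemma union_borel: "\<Gamma>' \<subseteq> \<Gamma> ==> \<Union>\<Gamma>' : sets borel"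
 using part by (intro sets.countable_Union) (auto intro: countable_subset)

lemma R_borel [measurable]: "R : borel ->M count_space UNIV"
proof (rule measurableI)
 have 1: "{x. R x = r} : sets borel" for r
 proof (cases "r = 0")
  case True
  then have "x : {x. R x = r} \<longleftrightarrow> x : - \<Union>\<Gamma>" for x
   by (metis Compl_iff mem_Collect_eq not_one_le_zero R_pos R_zero)
  then have "{x. R x = r} = - \<Union>\<Gamma>" by blast
  then show ?thesis using union_borel[of \<Gamma>] by (simp add: sets.compl_sets)
 next
  case False
  then show ?thesis by (subst R_eq_union[of "%i. i = r"]) (simp, rule union_borel, blast)
 qed
 fix A :: "nat set"
 have "R -` A \<inter> space borel = (\<Union>r\<in>A. {x. R x = r})" by auto
 also have "... : sets borel" using 1 by (intro sets.countable_UN') auto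
 finally show "R -` A \<inter> space borel : sets borel" .
qed simp

lemma funpow_borel [measurable]: "f ^^ n : borel ->M borel"
 by (induction n) (auto simp: comp_def)

lemma F_borel [measurable]: "F : borel ->M borel"
 unfolding F_def by (rule measurable_compose_countable[OF funpow_borel R_borel])

lemma R_sets [measurable]: "{x. Q (R x)} : sets borel"
proof -
 have "{x : space borel. Q (R x)} : sets borel" by measurable
 then show ?thesis by simp
qed

lemma E_pos: "positive_functional E"
 unfolding E_def[abs_def] by (rule positive_integral[OF prob_space.finite_measure[OF prob_P] sets_P])

lemma E_lin: "linear_functional E" by (rule pos_lin[OF E_pos])
lemma E_one: "E (%_. 1) = 1"
proof -
 interpret prob_space P by (rule prob_P)
 show ?thesis by (simp add: E_def prob_space)
qed
lemma E_indicator: "A : sets borel ==> E (indicator A) = measure P A"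
 using sets_P sets_eq_imp_space_eq[OF sets_P] by (simp add: E_def)

lemma regular_E: "regular 0 E" unfolding regular_def using E_pos by simp

lemma regular_upper:
 assumes "regular k Lam" "bdd_borel u" "!!x. 0 <= u x"
 shows "Lam u <= exp (k * D) * Lam (%_. 1) * E u"
 using regularD[OF assms(1) assms(2) bdd_borel_const assms(3), of 1 D] diam D_nonneg
 by (simp add: E_one mult_ac)

lemma regular_lower:
 assumes "regular k Lam" "bdd_borel u" "!!x. 0 <= u x"
 shows "Lam (%_. 1) * E u <= exp (k * D) * Lam u"
 using regularD[OF assms(1) bdd_borel_const assms(2) _ assms(3), of 1 D] diam D_nonneg
 by (simp add: E_one mult_ac)

lemma regular_mono:
 assumes "regular k Lam" "k <= k'" shows "regular k' Lam"
 unfolding regular_def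
proof (intro conjI allI impI)
 show pos: "positive_functional Lam" by (rule regular_pos[OF assms(1)])
 fix u v :: "'a => real" and t :: real
 assume *: "bdd_borel u" "bdd_borel v" "ALL x. 0 <= u x" "ALL x. 0 <= v x" "t >= 0"
  "ALL x y. u x ~= 0 --> v y ~= 0 --> dist x y powr al <= t"
 have "Lam u * E v <= exp (k * t) * (E u * Lam v)" using regularD[OF assms(1), of u v t] * by (simp add: mult.assoc)
 also have "... <= exp (k' * t) * (E u * Lam v)"
 proof (rule mult_right_mono)
  show "exp (k * t) <= exp (k' * t)" using * assms(2) by (auto simp: mult_right_mono)
  show "0 <= E u * Lam v" using pos_nonneg[OF pos, of v] pos_nonneg[OF E_pos, of u] * by simp
 qed
 finally show "Lam u * E v <= exp (k' * t) * E u * Lam v" by (simp add: mult.assoc)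
qed


text \<open>The choice of \<open>c\<close> makes \<open>c * E v\<close> at most the fraction \<open>eps\<close> of \<open>Lam v\<close>, so the scalar estimate \<open>exp_subtract_bound\<close> applies.\<close>

lemma regular_subtract:
 assumes reg: "regular k Lam" and k: "k >= 0" and eps: "0 <= eps" "eps < 1"
 shows "regular (k / (1 - eps)) (%u. Lam u - eps * exp (- k * D) * Lam (%_. 1) * E u)"
proof -
 define c where "c = eps * exp (- k * D) * Lam (%_. 1)"
 have pos: "positive_functional Lam" by (rule regular_pos[OF reg])
 have L1: "Lam (%_. 1) >= 0" by (rule pos_nonneg[OF pos]) (auto intro: bb)
 have c0: "c >= 0" using L1 eps by (simp add: c_def)
 have cE: "c * E u <= eps * Lam u" if "bdd_borel u" "!!x. 0 <= u x" for u
 proof -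
  have "eps * exp (- k * D) * (Lam (%_. 1) * E u) <= eps * exp (- k * D) * (exp (k * D) * Lam u)"
   using eps by (intro mult_left_mono regular_lower[OF reg] that) auto
  also have "... = eps * Lam u" by (simp add: exp_minus field_simps)
  finally show ?thesis by (simp add: c_def mult.assoc)
 qed
 have lin: "linear_functional (%u. Lam u - c * E u)"
  unfolding linear_functional_def using lin_add[OF pos_lin[OF pos]] lin_cmult[OF pos_lin[OF pos]] lin_add[OF E_lin] lin_cmult[OF E_lin]
  by (auto simp: algebra_simps)
 have Lamnn: "Lam u >= 0" if "bdd_borel u" "!!x. 0 <= u x" for u using pos_nonneg[OF pos] that by auto
 have posc: "Lam u - c * E u >= 0" if "bdd_borel u" "!!x. 0 <= u x" for u
 proof -
  have "eps * Lam u <= 1 * Lam u" using eps Lamnn[OF that] by (intro mult_right_mono) auto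
  then show ?thesis using cE[OF that] by simp
 qed
 show ?thesis unfolding c_def[symmetric] regular_def
 proof (intro conjI allI impI)
  show "positive_functional (%u. Lam u - c * E u)" unfolding positive_functional_def using lin posc by auto
  fix u v :: "'a => real" and t :: real
  assume *: "bdd_borel u" "bdd_borel v" "ALL x. 0 <= u x" "ALL x. 0 <= v x" "t >= 0"
   "ALL x y. u x ~= 0 --> v y ~= 0 --> dist x y powr al <= t"
  have Eu: "E u >= 0" "E v >= 0" using pos_nonneg[OF E_pos] * by auto
  have Lv: "Lam v >= 0" using Lamnn * by auto
  have main: "exp (k * t) * Lam v - c * E v <= exp (k / (1 - eps) * t) * (Lam v - c * E v)"
  proof (cases "Lam v = 0")
   case True
   then have "c * E v = 0" using cE[of v] * c0 Eu by (metis antisym mult_nonneg_nonneg mult_zero_right)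
   then show ?thesis using True by auto
  next
   case False
   then have Lv': "Lam v > 0" using Lv by simp
   define q where "q = c * E v / Lam v"
   have q: "0 <= q" "q <= eps" "c * E v = q * Lam v"
    using Lv' c0 Eu cE[of v] * by (auto simp: q_def divide_simps)
   have "exp (k * t) - q <= exp (k * t / (1 - eps)) * (1 - q)"
    using q eps k * by (intro exp_subtract_bound) auto
   then have "(exp (k * t) - q) * Lam v <= exp (k * t / (1 - eps)) * (1 - q) * Lam v"
    using Lv' by (intro mult_right_mono) auto
   then show ?thesis unfolding q by (simp add: algebra_simps)
  qed
  have "(Lam u - c * E u) * E v <= E u * (exp (k * t) * Lam v - c * E v)"
   using regularD[OF reg, of u v t] * by (simp add: algebra_simps)
  also have "... <= E u * (exp (k / (1 - eps) * t) * (Lam v - c * E v))"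
   using main Eu by (intro mult_left_mono) auto
  finally show "(Lam u - c * E u) * E v <= exp (k / (1 - eps) * t) * E u * (Lam v - c * E v)"
   by (simp add: mult_ac)
 qed
qed

text \<open>On one branch, the regularity of \<open>Lam\<close> compares the pulled back functions and the distortion of the branch compares
their \<open>E\<close>-integrals with those of the original ones; the two inequalities multiply. The degenerate cases are those in
which an \<open>E\<close>-integral that has to be cancelled vanishes.\<close>

lemma branch_push:
 assumes pos: "positive_functional Lam" and a: "a : \<Gamma>" and k: "k >= 0"
  and loc: "!!u v t. bdd_borel u ==> bdd_borel v ==> (!!x. 0 <= u x) ==> (!!x. 0 <= v x) ==> t >= 0 ==>
   (!!x. u x ~= 0 ==> x : a) ==> (!!x. v x ~= 0 ==> x : a) ==>
   (!!x y. u x ~= 0 ==> v y ~= 0 ==> dist (F x) (F y) powr al <= t) ==> Lam u * E v <= exp (k * t) * E u * Lam v"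
  and uv: "bdd_borel u" "bdd_borel v" "!!x. 0 <= u x" "!!x. 0 <= v x" "t >= 0"
   "!!x y. u x ~= 0 ==> v y ~= 0 ==> dist x y powr al <= t"
 shows "Lam (%x. indicator a x * u (F x)) * E v <= exp ((k + K) * t) * E u * Lam (%x. indicator a x * v (F x))"
proof -
 let ?u = "%x. indicator a x * u (F x)" and ?v = "%x. indicator a x * v (F x)"
 have ab: "a : sets borel" using a part by auto
 have bu: "bdd_borel ?u" "bdd_borel ?v" by (intro bb bdd_borel_comp[OF uv(1) F_borel] bdd_borel_comp[OF uv(2) F_borel] ab)+
 have nn: "!!x. 0 <= ?u x" "!!x. 0 <= ?v x" using uv by auto
 have E0: "0 <= E ?u" "0 <= E ?v" "0 <= E u" "0 <= E v" "0 <= Lam ?u" "0 <= Lam ?v"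
  using pos_nonneg[OF E_pos bu(1) nn(1)] pos_nonneg[OF E_pos bu(2) nn(2)] pos_nonneg[OF pos bu(1) nn(1)]
   pos_nonneg[OF pos bu(2) nn(2)] pos_nonneg[OF E_pos uv(1,3)] pos_nonneg[OF E_pos uv(2,4)] by auto
 have s1: "Lam ?u * E ?v <= exp (k * t) * E ?u * Lam ?v"
  by (rule loc[OF bu nn]) (use uv in "auto simp: indicator_def split: if_splits")
 have s2: "E ?u * E v <= exp (K * t) * E u * E ?v"
  using distort[OF a uv] by (simp add: E_def F_def)
 have Pa: "E (indicator a) > 0" using part_pos[OF a] E_indicator[OF ab] by simp
 have R0: "0 <= exp ((k + K) * t) * E u * Lam ?v" using E0 by simp
 consider "E ?u = 0" | "E ?v = 0" | "E ?u > 0" "E ?v > 0" using E0 by linarith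
 then show ?thesis
 proof cases
  case 1
  have "Lam ?u * E (indicator a) <= exp (k * D) * E ?u * Lam (indicator a)"
   by (rule loc[OF bu(1) bdd_borel_indicator[OF ab] nn(1)]) (use diam D_nonneg in "auto simp: indicator_def split: if_splits")
  then have "Lam ?u * E (indicator a) <= 0" using 1 by simp
  then have "Lam ?u = 0" using Pa E0 by (simp add: mult_le_0_iff)
  then show ?thesis using R0 by simp
 next
  case 2
  have "E (indicator a) * E v <= exp (K * D) * E (%_. 1) * E ?v"
   using distort[OF a bdd_borel_const uv(2) _ uv(4), of 1 D] diam D_nonneg
   by (simp add: E_def F_def)
  then have "E v = 0" using 2 Pa E0 by (simp add: mult_le_0_iff)
  then show ?thesis using R0 by simp
 next
  case 3
  have "(Lam ?u * E ?v) * (E ?u * E v) <= (exp (k * t) * E ?u * Lam ?v) * (exp (K * t) * E u * E ?v)"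
   by (rule mult_mono[OF s1 s2]) (use E0 in auto)
  have "(E ?u * E ?v) * (Lam ?u * E v) <= (E ?u * E ?v) * (exp ((k + K) * t) * E u * Lam ?v)"
  proof -
   have "exp ((k + K) * t) = exp (k * t) * exp (K * t)" by (simp add: exp_add[symmetric] algebra_simps)
   then show ?thesis using \<open>(Lam ?u * E ?v) * (E ?u * E v) <= _\<close> by (simp add: mult_ac)
  qed
  then show ?thesis using 3 by (simp add: mult_le_cancel_left_pos)
 qed
qed

text \<open>One return contracts distances by \<open>th\<close>, so the constant \<open>k\<close> becomes \<open>k * th\<close>; the weight adds \<open>L\<close> and the distortion
adds \<open>K\<close>. Countably many branches are handled by finite unions and the domination of \<open>Lam\<close> by \<open>E\<close>, which stands in for
countable additivity.\<close>

lemma regular_push: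
 assumes reg: "regular k Lam" and k: "k >= 0" and G: "\<Gamma>' \<subseteq> \<Gamma>" and L: "L >= 0"
  and w: "bdd_borel w" "!!x. 0 <= w x"
  and wL: "!!a x y. a : \<Gamma>' ==> x : a ==> y : a ==> w x <= exp (L * dist (F x) (F y) powr al) * w y"
 shows "regular (k * th + L + K) (%u. Lam (%x. indicator (\<Union>\<Gamma>') x * (w x * u (F x))))"
proof -
 have pos: "positive_functional Lam" and lin: "linear_functional Lam"
  using reg by (auto intro: regular_pos pos_lin)
 define Lamw where "Lamw u = Lam (%x. w x * u x)" for u
 have posw: "positive_functional Lamw"
  using positive_transform[OF pos w, of "%x. x"] by (simp add: Lamw_def[abs_def])
 have branch: "Lamw (%x. indicator a x * u (F x)) * E v <= exp ((k * th + L + K) * t) * E u * Lamw (%x. indicator a x * v (F x))"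
  if a: "a : \<Gamma>'" and uv: "bdd_borel u" "bdd_borel v" "!!x. 0 <= u x" "!!x. 0 <= v x" "t >= 0"
   "!!x y. u x ~= 0 ==> v y ~= 0 ==> dist x y powr al <= t" for a u v t
 proof (rule branch_push[OF posw _ _ _ uv])
  show "a : \<Gamma>" using a G by auto
  show "0 <= k * th + L" using k L th by simp
  fix u v :: "'a => real" and t :: real
  assume uv: "bdd_borel u" "bdd_borel v" "!!x. 0 <= u x" "!!x. 0 <= v x" "t >= 0"
   and ua: "!!x. u x ~= 0 ==> x : a" and va: "!!x. v x ~= 0 ==> x : a"
   and d: "!!x y. u x ~= 0 ==> v y ~= 0 ==> dist (F x) (F y) powr al <= t"
  have "Lamw u * E v <= exp (L * t) * exp (k * (th * t)) * E u * Lamw v"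
   unfolding Lamw_def
  proof (rule weight_compare[OF pos E_pos w uv(1-4)])
   fix x y assume xy: "u x ~= 0" "v y ~= 0"
   have "w x <= exp (L * dist (F x) (F y) powr al) * w y" by (rule wL[OF a ua[OF xy(1)] va[OF xy(2)]])
   also have "... <= exp (L * t) * w y" using d[OF xy] L w by (intro mult_right_mono) (auto simp: mult_left_mono)
   finally show "w x <= exp (L * t) * w y" .
  next
   show "Lam u * E v <= exp (k * (th * t)) * E u * Lam v"
   proof (rule regularD[OF reg uv(1-4)])
    show "0 <= th * t" using th uv by simp
    fix x y assume xy: "u x ~= 0" "v y ~= 0"
    have "dist x y powr al <= th * dist (F x) (F y) powr al"
     unfolding F_def by (rule contr[of a]) (use a G ua va xy in auto)
    also have "... <= th * t" using d[OF xy] th by (intro mult_left_mono) auto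
    finally show "dist x y powr al <= th * t" .
   qed
  qed auto
  also have "exp (L * t) * exp (k * (th * t)) = exp ((k * th + L) * t)" by (simp add: exp_add[symmetric] algebra_simps)
  finally show "Lamw u * E v <= exp ((k * th + L) * t) * E u * Lamw v" .
 qed
 define Phi where "Phi u = Lam (%x. indicator (\<Union>\<Gamma>') x * (w x * u (F x)))" for u
 have SB: "\<Union>\<Gamma>' : sets borel" by (rule union_borel[OF G])
 define A where "A N = {a : \<Gamma>'. to_nat_on \<Gamma> a < N}" for N
 define S where "S N = \<Union>(A N)" for N
 have SNB: "S N : sets borel" for N unfolding S_def A_def using G by (intro union_borel) auto
 have fin: "finite (A N)" for N
 proof (rule finite_imageD)
  show "finite (to_nat_on \<Gamma> ` (A N))" by (rule finite_subset[of _ "{..<N}"]) (auto simp: A_def)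
  show "inj_on (to_nat_on \<Gamma>) (A N)"
   by (rule inj_on_subset[OF inj_on_to_nat_on[OF part(1)]]) (use G in "auto simp: A_def")
 qed
 have lim: "(%N. SUM a:A N. Lamw (%x. indicator a x * u (F x))) ----> Phi u"
  if u: "bdd_borel u" for u
 proof -
  interpret prob_space P by (rule prob_P)
  obtain B where B: "!!x. abs (w x * u (F x)) <= B"
   using bdd_borel_mult[OF w(1) bdd_borel_comp[OF u F_borel]] by (auto simp: bdd_borel_def)
  have B0: "B >= 0" using B[of undefined] by linarith
  have eq: "(SUM a:A N. Lamw (%x. indicator a x * u (F x))) = Lam (%x. indicator (S N) x * (w x * u (F x)))" for N
  proof -
   have "(SUM a:A N. Lamw (%x. indicator a x * u (F x)))
     = Lam (%x. SUM a:A N. w x * (indicator a x * u (F x)))"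
    unfolding Lamw_def using G part unfolding A_def by (intro lin_sum[symmetric] lin bb w bdd_borel_comp[OF u F_borel]) auto
   also have "(%x. SUM a:A N. w x * (indicator a x * u (F x))) = (%x. indicator (S N) x * (w x * u (F x)))"
   proof
    fix x
    have "(SUM a:A N. indicator a x) = (indicator (S N) x :: real)"
     unfolding S_def using fin[of N] part(3) G
     by (subst indicator_UN_disjoint[of _ "%a. a", simplified]) (auto simp: A_def disjoint_family_on_def disjoint_def subset_iff)
    then show "(SUM a:A N. w x * (indicator a x * u (F x))) = indicator (S N) x * (w x * u (F x))"
     by (simp add: mult.left_commute[of "w x"] sum_distrib_right[symmetric])
   qed
   finally show ?thesis .
  qed
  have inc: "incseq S" by (auto simp: S_def A_def incseq_def)
  have US: "(\<Union>N. S N) = \<Union>\<Gamma>'" by (auto simp: S_def A_def)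
  let ?e = "%N. B * (exp (k * D) * Lam (%_. 1) * (measure P (\<Union>\<Gamma>') - measure P (S N)))"
  have "(%N. measure P (S N)) ----> measure P (\<Union>N. S N)"
   using SNB sets_P inc by (intro finite_Lim_measure_incseq) auto
  then have "(%N. B * (exp (k * D) * Lam (%_. 1) * (measure P (\<Union>\<Gamma>') - measure P (S N)))) ----> B * (exp (k * D) * Lam (%_. 1) * (measure P (\<Union>\<Gamma>') - measure P (\<Union>\<Gamma>')))"
   unfolding US by (intro tendsto_intros)
  then have lim0: "?e ----> 0" by simp
  have "(%N. Lam (%x. indicator (S N) x * (w x * u (F x))) - Phi u) ----> 0"
  proof (rule Lim_null_comparison[OF always_eventually])
   show "?e ----> 0" by (rule lim0)
   show "ALL N. norm (Lam (%x. indicator (S N) x * (w x * u (F x))) - Phi u) <= ?e N"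
   proof
    fix N
    have sub: "S N \<subseteq> \<Union>\<Gamma>'" by (auto simp: S_def A_def)
    have "Lam (%x. indicator (S N) x * (w x * u (F x))) - Phi u
      = Lam (%x. indicator (S N) x * (w x * u (F x)) - indicator (\<Union>\<Gamma>') x * (w x * u (F x)))"
     unfolding Phi_def by (intro lin_diff[symmetric] lin bb SNB SB w bdd_borel_comp[OF u F_borel])
    also have "abs ... <= Lam (%x. B * indicator (\<Union>\<Gamma>' - S N) x)"
    proof (intro pos_abs_le[OF pos] bb SNB SB w bdd_borel_comp[OF u F_borel])
     show "\<Union>\<Gamma>' - S N : sets borel" using SNB SB by auto
     fix x show "abs (indicator (S N) x * (w x * u (F x)) - indicator (\<Union>\<Gamma>') x * (w x * u (F x))) <= B * indicator (\<Union>\<Gamma>' - S N) x"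
      using B[of x] B0 sub by (auto simp: indicator_def)
    qed
    also have "... = B * Lam (indicator (\<Union>\<Gamma>' - S N))" using SNB SB by (intro lin_cmult lin bb) auto
    also have "... <= B * (exp (k * D) * Lam (%_. 1) * E (indicator (\<Union>\<Gamma>' - S N)))"
     using SNB SB B0 by (intro mult_left_mono regular_upper[OF reg] bb) auto
    also have "E (indicator (\<Union>\<Gamma>' - S N)) = measure P (\<Union>\<Gamma>') - measure P (S N)"
     using SNB SB sub sets_P by (subst E_indicator) (auto intro!: finite_measure_Diff)
    finally show "norm (Lam (%x. indicator (S N) x * (w x * u (F x))) - Phi u) <= ?e N"
     by simp
   qed
  qed
  then show ?thesis unfolding eq by (simp add: LIM_zero_iff)
 qed
 have "regular (k * th + L + K) Phi"
  unfolding regular_def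
 proof (intro conjI allI impI)
  show "positive_functional Phi"
   using positive_transform[OF pos bdd_borel_mult[OF bdd_borel_indicator[OF SB] w(1)] _ F_borel] w(2)
   by (simp add: Phi_def[abs_def] mult.assoc)
  fix u v :: "'a => real" and t :: real
  assume uv: "bdd_borel u" "bdd_borel v" "ALL x. 0 <= u x" "ALL x. 0 <= v x" "t >= 0"
   "ALL x y. u x ~= 0 --> v y ~= 0 --> dist x y powr al <= t"
  show "Phi u * E v <= exp ((k * th + L + K) * t) * E u * Phi v"
  proof (rule tendsto_le[OF sequentially_bot])
   show "(%N. (SUM a:A N. Lamw (%x. indicator a x * u (F x))) * E v) ----> Phi u * E v"
    by (intro tendsto_intros lim uv)
   show "(%N. exp ((k * th + L + K) * t) * E u * (SUM a:A N. Lamw (%x. indicator a x * v (F x)))) ----> exp ((k * th + L + K) * t) * E u * Phi v"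
    by (intro tendsto_intros lim uv)
   show "\<forall>\<^sub>F N in sequentially. (SUM a:A N. Lamw (%x. indicator a x * u (F x))) * E v
     <= exp ((k * th + L + K) * t) * E u * (SUM a:A N. Lamw (%x. indicator a x * v (F x)))"
    unfolding sum_distrib_left sum_distrib_right
    by (intro always_eventually allI sum_mono branch) (use uv in "auto simp: A_def")
  qed
 qed
 then show ?thesis unfolding Phi_def .
qed

end

section \<open>Regeneration\<close>

text \<open>Summation by the first return: \<open>r\<close> is its delay and \<open>k - Suc r\<close> the time that remains.\<close>

lemma sum_reorder_delay:
 fixes a :: "nat => nat => real"
 shows "(SUM k<=n. SUM r<k. a r (k - Suc r)) = (SUM r<n. SUM j<=n - Suc r. a r j)"
proof (induction n)
 case (Suc n)
 have "(SUM r<n. SUM j<=n - r. a r j) = (SUM r<n. (SUM j<=n - Suc r. a r j) + a r (n - r))"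
 proof (intro sum.cong refl)
  fix r assume "r : {..<n}"
  then have "n - r = Suc (n - Suc r)" by auto
  then show "(SUM j<=n - r. a r j) = (SUM j<=n - Suc r. a r j) + a r (n - r)" by simp
 qed
 then show ?case using Suc by (simp add: sum.distrib)
qed simp

text \<open>A first wait longer than the fraction \<open>dlt\<close> of \<open>n\<close> is paid by the tail of \<open>q\<close>, otherwise the remaining time is at least
the fraction \<open>1 - dlt\<close> of it and \<open>tau\<close> pays. Keeping \<open>dlt\<close> free lets the factor \<open>(1 - dlt) powr (- p)\<close> be as close to one as
needed.\<close>

lemma convolution_tail_bound:
 fixes q tau :: "nat => real"
 assumes q: "!!r. 0 <= q r" and S: "(SUM r<n. q r) <= S"
  and tail: "!!rho. (SUM r:{rho..<n}. q r) <= T * decay p rho"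
  and tau: "!!j. 0 <= tau j" "!!j. tau j <= 1" "!!j. tau j <= A * decay p j"
  and dlt: "0 < dlt" "dlt < 1" and p: "p > 0" and AT: "0 <= A" "0 <= T"
 shows "(SUM r<n. q r * tau (n - Suc r)) <= (S * A * (1 - dlt) powr (- p) + T * dlt powr (- p)) * decay p n"
proof -
 define rho where "rho = nat \<lfloor>dlt * real (Suc n)\<rfloor>"
 have rho1: "real rho <= dlt * real (Suc n)" unfolding rho_def using dlt by (intro of_nat_floor) auto
 have rho2: "dlt * real (Suc n) <= real (Suc rho)" unfolding rho_def using dlt by linarith
 have "(SUM r<n. q r * tau (n - Suc r)) <= (SUM r<n. q r * (A * ((1 - dlt) powr (- p) * decay p n)) + (if rho <= r then q r else 0))"
 proof (intro sum_mono)
  fix r assume r: "r : {..<n}"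
  show "q r * tau (n - Suc r) <= q r * (A * ((1 - dlt) powr (- p) * decay p n)) + (if rho <= r then q r else 0)"
  proof (cases "rho <= r")
   case True
   have "q r * tau (n - Suc r) <= q r * 1" by (intro mult_left_mono tau q)
   moreover have "0 <= q r * (A * ((1 - dlt) powr (- p) * decay p n))" using q AT by simp
   ultimately show ?thesis using True by simp
  next
   case False
   have "real (Suc r) <= dlt * real (Suc n)" using False rho1 by linarith
   then have "(1 - dlt) * real (Suc n) <= real (Suc (n - Suc r))" using r by (simp add: of_nat_diff algebra_simps)
   then have "decay p (n - Suc r) <= ((1 - dlt) * real (Suc n)) powr (- p)"
    using dlt p by (intro powr_mono2') auto
   then have "tau (n - Suc r) <= A * ((1 - dlt) powr (- p) * decay p n)"
    using tau(3)[of "n - Suc r"] dlt AT by (subst (asm) powr_mult) (auto intro: order.trans mult_left_mono)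
   then have "q r * tau (n - Suc r) <= q r * (A * ((1 - dlt) powr (- p) * decay p n))"
    by (intro mult_left_mono q)
   then show ?thesis using False by simp
  qed
 qed
 also have "... = (SUM r<n. q r) * (A * ((1 - dlt) powr (- p) * decay p n)) + (SUM r:{rho..<n}. q r)"
 proof -
  have "(SUM r<n. if rho <= r then q r else 0) = (SUM r:{..<n} \<inter> {r. rho <= r}. q r)" by (simp add: sum.inter_restrict)
  also have "{..<n} \<inter> {r. rho <= r} = {rho..<n}" by auto
  finally show ?thesis by (simp add: sum.distrib sum_distrib_right)
 qed
 also have "... <= S * (A * ((1 - dlt) powr (- p) * decay p n)) + T * decay p rho"
  using S AT by (intro add_mono mult_right_mono tail) auto
 also have "T * decay p rho <= T * (dlt powr (- p) * decay p n)"
 proof (intro mult_left_mono AT)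
  have "decay p rho <= (dlt * real (Suc n)) powr (- p)"
   using rho2 dlt p by (intro powr_mono2') auto
  then show "decay p rho <= dlt powr (- p) * decay p n" using dlt by (simp add: powr_mult)
 qed
 finally show ?thesis by (simp add: algebra_simps)
qed

context full_branch_map
begin

text \<open>\<open>K0\<close> is the regularity constant that survives one step of subtracting \<open>cc\<close> times the mass in the form of \<open>E\<close>, which turns
\<open>K0\<close> into \<open>K0 / (1 - eps)\<close>, followed by a return: see \<open>K0_contract\<close>.\<close>

definition eps where "eps = (1 - th) / 2"
definition K0 where "K0 = (1 + th) * K / (1 - th)"
definition cc where "cc = eps * exp (- K0 * D)"

definition res :: "(('a => real) => real) => ('a => real) => real" where
 "res Lam u = Lam u - cc * Lam (%_. 1) * E u"

definition branch :: "nat => (('a => real) => real) => ('a => real) => real" where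
 "branch r Lam u = Lam (%x. indicator {x. R x = r} x * u (F x))"

definition step :: "nat => (('a => real) => real) => ('a => real) => real" where
 "step r Lam = branch r (res Lam)"

text \<open>\<open>regen k Lam\<close> is the mass that regenerates for the first time at time \<open>k\<close>, and \<open>unregen n Lam\<close> the mass that has not
regenerated up to time \<open>n\<close>, when \<open>Lam\<close> is the initial distribution. Time counts iterations of \<open>f\<close>, not returns.\<close>

fun regen :: "nat => (('a => real) => real) => real" where
 "regen k Lam = (if k = 0 then cc * Lam (%_. 1) else 0) + (SUM r<k. regen (k - Suc r) (step (Suc r) Lam))"

fun unregen :: "nat => (('a => real) => real) => real" where
 "unregen n Lam = res Lam (indicator {x. n < R x}) + (SUM r<n. unregen (n - Suc r) (step (Suc r) Lam))"

declare regen.simps [simp del] unregen.simps [simp del]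

lemma eps: "0 < eps" "eps < 1" using th by (auto simp: eps_def)
lemma K0_pos: "K0 > 0" using th K by (auto simp: K0_def)
lemma K_le_K0: "K <= K0"
proof -
 have "(1 - th) * K <= (1 + th) * K" using th K by (intro mult_right_mono) auto
 then show ?thesis using th by (simp add: K0_def pos_le_divide_eq mult.commute)
qed
lemma cc: "0 < cc" "cc < 1"
proof -
 show "0 < cc" using eps by (simp add: cc_def)
 have "exp (- K0 * D) <= 1" using K0_pos D_nonneg by simp
 then have "cc <= eps * 1" unfolding cc_def using eps by (intro mult_left_mono) auto
 then show "cc < 1" using eps by simp
qed

lemma K0_contract: "K0 / (1 - eps) * th + K = K0"
proof -
 have 1: "1 - eps = (1 + th) / 2" by (simp add: eps_def field_simps)
 have t: "1 + th > 0" "1 - th > 0" using th by auto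
 have eq: "K0 / (1 - eps) = 2 * K / (1 - th)" unfolding 1 K0_def using t by simp
 show ?thesis unfolding eq unfolding K0_def using t by (simp add: field_simps)
qed

lemma K0_weight: "K0 * th + K * th + K = K0"
 unfolding K0_def using th by (simp add: field_simps)

lemma regular_res: "regular K0 Lam ==> regular (K0 / (1 - eps)) (res Lam)"
 using regular_subtract[of K0 Lam eps] K0_pos eps unfolding res_def cc_def by simp

lemma regular_branch:
 assumes "regular k Lam" "k >= 0" "r >= 1"
 shows "regular (k * th + K) (branch r Lam)"
proof -
 have "regular (k * th + 0 + K) (%u. Lam (%x. indicator (\<Union>{a : \<Gamma>. a \<subseteq> {x. R x = r}}) x * (1 * u (F x))))"
  using assms by (intro regular_push bb) auto
 then show ?thesis using assms(3) R_eq_union[of "%i. i = r", symmetric] by (simp add: branch_def[abs_def])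
qed

lemma regular_step:
 assumes "regular K0 Lam" "r >= 1"
 shows "regular K0 (step r Lam)"
 using regular_branch[OF regular_res[OF assms(1)] _ assms(2)] K0_pos eps K0_contract by (simp add: step_def)

lemma res_one: "regular K0 Lam ==> res Lam (%_. 1) = (1 - cc) * Lam (%_. 1)"
 by (simp add: res_def E_one algebra_simps)

lemma regular_split:
 assumes reg: "regular k Lam" and u: "bdd_borel u"
 shows "Lam u = (SUM r<n. Lam (%x. indicator {x. R x = Suc r} x * u x)) + Lam (%x. indicator {x. n < R x} x * u x)"
proof -
 have pos: "positive_functional Lam" and lin: "linear_functional Lam"
  using reg by (auto intro: regular_pos pos_lin)
 interpret prob_space P by (rule prob_P)
 have "measure P {x. R x = 0} = 0"
 proof -
  have "AE x in P. ~ R x = 0" using part(4)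
  proof (rule eventually_mono)
   fix x assume "x : \<Union>\<Gamma>"
   from R_pos[OF this] show "~ R x = 0" by linarith
  qed
  then have "AE x in P. x \<notin> {x. R x = 0}" by simp
  then have "{x. R x = 0} : null_sets P" using sets_P by (subst AE_iff_null_sets) auto
  then show ?thesis by (simp add: measure_eq_0_null_sets)
 qed
 then have E0: "E (indicator {x. R x = 0}) = 0" by (subst E_indicator) auto
 obtain B where B: "!!x. abs (u x) <= B" using u by (auto simp: bdd_borel_def)
 have B0: "B >= 0" using B[of undefined] by linarith
 have "abs (Lam (%x. indicator {x. R x = 0} x * u x)) <= Lam (%x. B * indicator {x. R x = 0} x)"
 proof (rule pos_abs_le[OF pos])
  show "abs (indicator {x. R x = 0} x * u x) <= B * indicator {x. R x = 0} x" for x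
   using B B0 by (auto simp: indicator_def)
 qed (intro bb u R_sets)+
 also have "... = B * Lam (indicator {x. R x = 0})" by (intro lin_cmult[OF lin] bb) auto
 also have "... <= B * (exp (k * D) * Lam (%_. 1) * E (indicator {x. R x = 0}))"
  using B0 by (intro mult_left_mono regular_upper[OF reg] bb) auto
 finally have z: "Lam (%x. indicator {x. R x = 0} x * u x) = 0" by (simp add: E0)
 have "u x = ((SUM r<n. indicator {x. R x = Suc r} x * u x) + indicator {x. n < R x} x * u x) + indicator {x. R x = 0} x * u x" for x
 proof -
  have "(SUM r<n. indicator {x. R x = Suc r} x) = (if 1 <= R x & R x <= n then 1 else 0 :: real)"
  proof (cases "1 <= R x & R x <= n")
   case True
   have "(SUM r<n. indicator {x. R x = Suc r} x) = (SUM r<n. if r = R x - 1 then 1 else 0 :: real)"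
    using True by (intro sum.cong) (auto simp: indicator_def)
   then show ?thesis using True by (auto simp: sum.delta)
  next
   case False
   then show ?thesis by (auto intro!: sum.neutral simp: indicator_def)
  qed
  then have "((SUM r<n. indicator {x. R x = Suc r} x) + indicator {x. n < R x} x + indicator {x. R x = 0} x) = (1 :: real)"
   by (auto simp: indicator_def)
  then have "((SUM r<n. indicator {x. R x = Suc r} x) + indicator {x. n < R x} x + indicator {x. R x = 0} x) * u x = 1 * u x" by simp
  then show ?thesis by (simp add: distrib_right sum_distrib_right)
 qed
 then have "Lam u = Lam (%x. ((SUM r<n. indicator {x. R x = Suc r} x * u x) + indicator {x. n < R x} x * u x) + indicator {x. R x = 0} x * u x)"
  by metis
 also have "... = Lam (%x. (SUM r<n. indicator {x. R x = Suc r} x * u x) + indicator {x. n < R x} x * u x) + Lam (%x. indicator {x. R x = 0} x * u x)"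
  by (intro lin_add[OF lin] bb u) auto
 also have "Lam (%x. (SUM r<n. indicator {x. R x = Suc r} x * u x) + indicator {x. n < R x} x * u x)
  = Lam (%x. SUM r<n. indicator {x. R x = Suc r} x * u x) + Lam (%x. indicator {x. n < R x} x * u x)"
  by (intro lin_add[OF lin] bb u) auto
 also have "Lam (%x. SUM r<n. indicator {x. R x = Suc r} x * u x) = (SUM r<n. Lam (%x. indicator {x. R x = Suc r} x * u x))"
  by (intro lin_sum[OF lin] bb u) auto
 finally show ?thesis using z by simp
qed

lemma branch_iterate:
 assumes "r < n"
 shows "branch (Suc r) Lam (%x. psi ((f ^^ (n - Suc r)) x)) = Lam (%x. indicator {x. R x = Suc r} x * psi ((f ^^ n) x))"
proof -
 have "(f ^^ (n - Suc r)) (F x) = (f ^^ n) x" if Rx: "R x = Suc r" for x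
 proof -
  have "(f ^^ (n - Suc r + Suc r)) x = (f ^^ (n - Suc r)) (F x)"
   unfolding F_def Rx funpow_add comp_def ..
  then show ?thesis using assms by simp
 qed
 then have "(%x. indicator {x. R x = Suc r} x * psi ((f ^^ (n - Suc r)) (F x))) = (%x. indicator {x. R x = Suc r} x * psi ((f ^^ n) x))"
  by (auto simp: indicator_def fun_eq_iff)
 then show ?thesis unfolding branch_def by simp
qed

lemma regen_nonneg: "regular K0 Lam ==> 0 <= regen k Lam"
proof (induction k arbitrary: Lam rule: less_induct)
 case (less k)
 have "0 <= Lam (%_. 1)" by (rule pos_nonneg[OF regular_pos[OF less.prems]]) (auto intro: bb)
 moreover have "0 <= regen (k - Suc r) (step (Suc r) Lam)" if "r < k" for r
  using that by (intro less.IH regular_step less.prems) auto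
 ultimately show ?case using cc by (subst regen.simps) (auto intro!: sum_nonneg add_nonneg_nonneg)
qed

lemma unregen_nonneg: "regular K0 Lam ==> 0 <= unregen k Lam"
proof (induction k arbitrary: Lam rule: less_induct)
 case (less k)
 have "0 <= res Lam (indicator {x. k < R x})"
  by (rule pos_nonneg[OF regular_pos[OF regular_res[OF less.prems]]]) (auto intro: bb)
 moreover have "0 <= unregen (k - Suc r) (step (Suc r) Lam)" if "r < k" for r
  using that by (intro less.IH regular_step less.prems) auto
 ultimately show ?case by (subst unregen.simps) (auto intro!: sum_nonneg add_nonneg_nonneg)
qed

lemma branch_one: "branch r Lam (%_. 1) = Lam (indicator {x. R x = r})"
 by (simp add: branch_def)

lemma regen_unregen_mass: "regular K0 Lam ==> (SUM k<=n. regen k Lam) + unregen n Lam = Lam (%_. 1)"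
proof (induction n arbitrary: Lam rule: less_induct)
 case (less n)
 have "(SUM k<=n. regen k Lam) = cc * Lam (%_. 1) + (SUM k<=n. SUM r<k. regen (k - Suc r) (step (Suc r) Lam))"
  by (subst regen.simps) (simp add: sum.distrib)
 also have "(SUM k<=n. SUM r<k. regen (k - Suc r) (step (Suc r) Lam)) = (SUM r<n. SUM j<=n - Suc r. regen j (step (Suc r) Lam))"
  by (rule sum_reorder_delay)
 finally have "(SUM k<=n. regen k Lam) + unregen n Lam = cc * Lam (%_. 1) + res Lam (indicator {x. n < R x})
   + (SUM r<n. (SUM j<=n - Suc r. regen j (step (Suc r) Lam)) + unregen (n - Suc r) (step (Suc r) Lam))"
  by (subst unregen.simps) (simp add: sum.distrib)
 also have "(SUM r<n. (SUM j<=n - Suc r. regen j (step (Suc r) Lam)) + unregen (n - Suc r) (step (Suc r) Lam)) = (SUM r<n. step (Suc r) Lam (%_. 1))"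
  by (intro sum.cong refl less.IH regular_step less.prems) auto
 also have "... = (SUM r<n. res Lam (indicator {x. R x = Suc r}))" by (simp add: step_def branch_one)
 also have "cc * Lam (%_. 1) + res Lam (indicator {x. n < R x}) + (SUM r<n. res Lam (indicator {x. R x = Suc r})) = cc * Lam (%_. 1) + res Lam (%_. 1)"
  using regular_split[OF regular_res[OF less.prems] bdd_borel_const, of 1 n] by simp
 finally show ?case using res_one[OF less.prems] by (simp add: algebra_simps)
qed

lemma unregen_le_mass: "regular K0 Lam ==> unregen n Lam <= Lam (%_. 1)"
 using regen_unregen_mass[of Lam n] sum_nonneg[of "{..n}" "%k. regen k Lam"] regen_nonneg[of Lam] by simp

text \<open>Conditioned on regeneration at time \<open>k\<close>, the rest of the orbit starts from \<open>P\<close>; the error is the mass without regeneration.\<close>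

lemma regeneration_expansion:
 assumes psi: "bdd_borel psi" "!!x. abs (psi x) <= 1"
 shows "regular K0 Lam ==> abs (Lam (%x. psi ((f ^^ n) x)) - (SUM k<=n. regen k Lam * E (%x. psi ((f ^^ (n - k)) x)))) <= unregen n Lam"
proof (induction n arbitrary: Lam rule: less_induct)
 case (less n)
 define I where "I n = E (%x. psi ((f ^^ n) x))" for n
 have b: "bdd_borel (%x. psi ((f ^^ n) x))" for n by (rule bdd_borel_comp[OF psi(1) funpow_borel])
 have regr: "regular (K0 / (1 - eps)) (res Lam)" by (rule regular_res[OF less.prems])
 have posr: "positive_functional (res Lam)" by (rule regular_pos[OF regr])
 have "(SUM k<=n. regen k Lam * I (n - k)) = cc * Lam (%_. 1) * I n + (SUM k<=n. SUM r<k. regen (k - Suc r) (step (Suc r) Lam) * I (n - k))"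
  by (subst regen.simps) (simp add: distrib_right sum.distrib sum_distrib_right if_distrib[of "%x. x * _"] cong: if_cong)
 also have "(SUM k<=n. SUM r<k. regen (k - Suc r) (step (Suc r) Lam) * I (n - k))
   = (SUM k<=n. SUM r<k. regen (k - Suc r) (step (Suc r) Lam) * I (n - Suc r - (k - Suc r)))"
  by (intro sum.cong refl) auto
 also have "... = (SUM r<n. SUM j<=n - Suc r. regen j (step (Suc r) Lam) * I (n - Suc r - j))"
  by (rule sum_reorder_delay)
 finally have 1: "(SUM k<=n. regen k Lam * I (n - k)) = cc * Lam (%_. 1) * I n + (SUM r<n. SUM j<=n - Suc r. regen j (step (Suc r) Lam) * I (n - Suc r - j))" .
 have 2: "Lam (%x. psi ((f ^^ n) x)) = cc * Lam (%_. 1) * I n + res Lam (%x. psi ((f ^^ n) x))"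
  by (simp add: res_def I_def)
 have 3: "res Lam (%x. psi ((f ^^ n) x)) = (SUM r<n. step (Suc r) Lam (%x. psi ((f ^^ (n - Suc r)) x))) + res Lam (%x. indicator {x. n < R x} x * psi ((f ^^ n) x))"
  using regular_split[OF regr b[of n], of n] by (simp add: step_def branch_iterate)
 have "abs (Lam (%x. psi ((f ^^ n) x)) - (SUM k<=n. regen k Lam * I (n - k)))
  = abs (res Lam (%x. indicator {x. n < R x} x * psi ((f ^^ n) x)) + (SUM r<n. step (Suc r) Lam (%x. psi ((f ^^ (n - Suc r)) x)) - (SUM j<=n - Suc r. regen j (step (Suc r) Lam) * I (n - Suc r - j))))"
  unfolding 1 2 3 by (simp add: sum_subtractf)
 also have "... <= res Lam (indicator {x. n < R x}) + (SUM r<n. unregen (n - Suc r) (step (Suc r) Lam))"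
 proof (intro order.trans[OF abs_triangle_ineq] add_mono order.trans[OF sum_abs] sum_mono)
  show "abs (res Lam (%x. indicator {x. n < R x} x * psi ((f ^^ n) x))) <= res Lam (indicator {x. n < R x})"
  proof (rule pos_abs_le[OF posr])
   show "abs (indicator {x. n < R x} x * psi ((f ^^ n) x)) <= indicator {x. n < R x} x" for x
    using psi by (auto simp: indicator_def)
  qed (intro bb b R_sets)+
  fix r assume "r : {..<n}"
  then show "abs (step (Suc r) Lam (%x. psi ((f ^^ (n - Suc r)) x)) - (SUM j<=n - Suc r. regen j (step (Suc r) Lam) * I (n - Suc r - j))) <= unregen (n - Suc r) (step (Suc r) Lam)"
   unfolding I_def by (intro less.IH regular_step less.prems) auto
 qed
 also have "... = unregen n Lam" by (rule unregen.simps[symmetric])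
 finally show ?case unfolding I_def .
qed

end

lemma abs_sum3_le: "abs x <= a ==> abs y <= b ==> abs z <= c ==> abs (x + y - z) <= a + b + (c :: real)"
 by linarith

lemma half_powr: "(1 - 1 / 2 :: real) powr (- s) = 2 powr s" "(1 / 2 :: real) powr (- s) = 2 powr s"
 by (simp_all add: powr_divide powr_minus field_simps)

lemma sum_tail_le:
 fixes q t :: "nat => real"
 assumes "!!n. (SUM r<n. q r) + t n = c" and "!!n. 0 <= t n"
 shows "(SUM r:{rho..<n}. q r) <= t rho"
proof (cases "rho <= n")
 case True
 have "(SUM r<n. q r) = (SUM r<rho. q r) + (SUM r:{rho..<n}. q r)"
  using True by (metis atLeast0LessThan sum.atLeastLessThan_concat zero_le)
 then show ?thesis using assms(1)[of n] assms(1)[of rho] assms(2)[of n] by linarith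
qed (use assms(2) in simp)

locale mixing_full_branch_map = full_branch_map +
 fixes p A0 :: real
 assumes p: "p > 2"
  and return_tail: "!!n. measure P {x. n < R x} <= A0 * decay p n"
  and aperiodic: "Gcd {r. 0 < measure P {x. R x = r}} = 1"
begin

lemma A0_nonneg: "0 <= A0"
 using order.trans[OF measure_nonneg return_tail[of 0]] by simp

text \<open>Induction on \<open>n\<close> along the first return. A return keeps at most the fraction \<open>1 - cc\<close> of the mass without regeneration,
and \<open>dlt\<close> is chosen so small that the loss \<open>(1 - dlt) powr (- p)\<close> in the convolution estimate does not consume this gain.\<close>

lemma unregen_tail:
 obtains A where "A >= 0" "!!Lam n. regular K0 Lam ==> unregen n Lam <= A * Lam (%_. 1) * decay p n"
proof -
 define dlt where "dlt = 1 - ((1 - cc) / (1 - cc / 2)) powr (1 / p)"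
 have x: "0 < (1 - cc) / (1 - cc / 2)" "(1 - cc) / (1 - cc / 2) < 1" using cc by (auto simp: field_simps)
 have dlt: "0 < dlt" "dlt < 1"
  using x p powr_less_mono2[of "1 / p" "(1 - cc) / (1 - cc / 2)" 1] unfolding dlt_def by auto
 have dltp: "(1 - cc) * (1 - dlt) powr (- p) = 1 - cc / 2"
 proof -
  have "(1 - dlt) powr p = (1 - cc) / (1 - cc / 2)"
   unfolding dlt_def using x p cc by (simp add: powr_powr)
  then have "(1 - dlt) powr (- p) = (1 - cc / 2) / (1 - cc)" by (simp only: powr_minus inverse_divide)
  then show ?thesis using cc by simp
 qed
 define C1 where "C1 = exp (K0 / (1 - eps) * D)"
 have C1: "C1 > 0" by (simp add: C1_def)
 \<comment> \<open>the fixed point of the recursion for the constant that the induction step produces\<close>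
 define A where "A = 2 * C1 * A0 * (1 + dlt powr (- p)) / cc"
 have A: "A >= 0" using C1 A0_nonneg cc by (simp add: A_def)
 have res_tail: "res Lam (indicator {x. n < R x}) <= C1 * Lam (%_. 1) * A0 * decay p n"
  if reg: "regular K0 Lam" for Lam n
 proof -
  have L1: "0 <= Lam (%_. 1)" by (rule pos_nonneg[OF regular_pos[OF reg]]) (auto intro: bb)
  have "res Lam (indicator {x. n < R x}) <= C1 * res Lam (%_. 1) * E (indicator {x. n < R x})"
   unfolding C1_def by (rule regular_upper[OF regular_res[OF reg]]) (auto intro: bb R_sets)
  also have "... <= C1 * Lam (%_. 1) * (A0 * decay p n)"
  proof (intro mult_mono mult_left_mono)
   show "res Lam (%_. 1) <= Lam (%_. 1)" unfolding res_one[OF reg] using L1 cc by (simp add: mult_left_le_one_le)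
   show "E (indicator {x. n < R x}) <= A0 * decay p n"
    by (subst E_indicator, rule R_sets, rule return_tail)
   show "0 <= E (indicator {x. n < R x})" by (subst E_indicator) (auto intro: R_sets)
  qed (use C1 L1 cc res_one[OF reg] in auto)
  finally show ?thesis by (simp add: mult_ac)
 qed
 have main: "regular K0 Lam ==> unregen n Lam <= A * Lam (%_. 1) * decay p n" for Lam n
 proof (induction n arbitrary: Lam rule: less_induct)
  case (less n)
  note reg = less.prems
  let ?L = "Lam (%_. 1)"
  have L1: "0 <= ?L" by (rule pos_nonneg[OF regular_pos[OF reg]]) (auto intro: bb)
  have posr: "positive_functional (res Lam)" by (rule regular_pos[OF regular_res[OF reg]])
  define q where "q r = res Lam (indicator {x. R x = Suc r})" for r
  have q0: "0 <= q r" for r unfolding q_def by (rule pos_nonneg[OF posr]) (auto intro: bb R_sets)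
  have mass: "(SUM r<n. q r) + res Lam (indicator {x. n < R x}) = res Lam (%_. 1)" for n
   using regular_split[OF regular_res[OF reg] bdd_borel_const, of 1 n] by (simp add: q_def)
  have t0: "0 <= res Lam (indicator {x. n < R x})" for n by (rule pos_nonneg[OF posr]) (auto intro: bb R_sets)
  have S: "(SUM r<n. q r) <= (1 - cc) * ?L" using mass[of n] t0[of n] res_one[OF reg] by linarith
  have T: "(SUM r:{rho..<n}. q r) <= C1 * ?L * A0 * decay p rho" for rho
   by (rule order.trans[OF sum_tail_le[OF mass t0] res_tail[OF reg]])
  define tau where "tau j = min 1 (A * decay p j)" for j
  have "unregen n Lam = res Lam (indicator {x. n < R x}) + (SUM r<n. unregen (n - Suc r) (step (Suc r) Lam))"
   by (rule unregen.simps)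
  also have "(SUM r<n. unregen (n - Suc r) (step (Suc r) Lam)) <= (SUM r<n. q r * tau (n - Suc r))"
  proof (intro sum_mono)
   fix r assume r: "r : {..<n}"
   have regs: "regular K0 (step (Suc r) Lam)" by (rule regular_step[OF reg]) simp
   have s1: "step (Suc r) Lam (%_. 1) = q r" by (simp add: step_def branch_one q_def)
   have "unregen (n - Suc r) (step (Suc r) Lam) <= q r * 1" using unregen_le_mass[OF regs] s1 by simp
   moreover have "unregen (n - Suc r) (step (Suc r) Lam) <= q r * (A * decay p (n - Suc r))"
    using less.IH[OF _ regs, of "n - Suc r"] r s1 by (simp add: mult_ac)
   ultimately show "unregen (n - Suc r) (step (Suc r) Lam) <= q r * tau (n - Suc r)"
    unfolding tau_def using q0[of r] by (simp add: min_def)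
  qed
  also have "(SUM r<n. q r * tau (n - Suc r)) <= ((1 - cc) * ?L * A * (1 - dlt) powr (- p) + C1 * ?L * A0 * dlt powr (- p)) * decay p n"
   by (rule convolution_tail_bound[OF q0 S T _ _ _ dlt]) (use A A0_nonneg C1 L1 p in "auto simp: tau_def")
  also have "(1 - cc) * ?L * A * (1 - dlt) powr (- p) = ?L * A * (1 - cc / 2)"
   using dltp by (simp add: mult_ac)
  also have "res Lam (indicator {x. n < R x}) <= C1 * ?L * A0 * decay p n" by (rule res_tail[OF reg])
  finally have "unregen n Lam <= (C1 * A0 + (A * (1 - cc / 2) + C1 * A0 * dlt powr (- p))) * (?L * decay p n)"
   by (simp add: algebra_simps)
  also have "C1 * A0 + (A * (1 - cc / 2) + C1 * A0 * dlt powr (- p)) = A"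
   unfolding A_def using cc by (simp add: field_simps)
  finally show ?case by (simp add: mult_ac)
 qed
 show thesis by (rule that[OF A main])
qed

lemma summable_suc_powr: "s > 1 ==> summable (%n. decay s n)"
proof -
 assume "s > 1"
 then have "summable (%n. real n powr (- s))" by (simp add: summable_real_powr_iff)
 then show ?thesis by (subst summable_Suc_iff)
qed

text \<open>Starting from \<open>P\<close>, the integrals \<open>I n\<close> satisfy a renewal equation with waiting times \<open>fr\<close> and an error bounded by their
tails \<open>g\<close>, hence converge to some \<open>l\<close>. Any other regular functional reaches \<open>P\<close> after a regeneration time with the same
tail, so it sees the same limit at the same rate. The bound is uniform in \<open>psi\<close>, only \<open>l\<close> depends on it.\<close>

lemma equidistribution:
 assumes kap: "1 <= kap" "kap < p - 1"
 obtains C where "C >= 1"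
  "!!psi. bdd_borel psi ==> (!!x. abs (psi x) <= 1) ==>
   EX l. abs l <= C & (ALL Lam n. regular K0 Lam -->
    abs (Lam (%x. psi ((f ^^ n) x)) - l * Lam (%_. 1)) <= C * Lam (%_. 1) * decay kap n)"
proof -
 obtain A where An: "A >= 0" and A: "!!Lam n. regular K0 Lam ==> unregen n Lam <= A * Lam (%_. 1) * decay p n"
  using unregen_tail by blast
 define base where "base r = branch r E" for r
 have regb: "regular K0 (base r)" if "r >= 1" for r
  using regular_mono[OF regular_branch[OF regular_E _ that]] K_le_K0 by (simp add: base_def)
 have base1: "base r (%_. 1) = measure P {x. R x = r}" for r
  unfolding base_def branch_one by (rule E_indicator) simp
 define fr where "fr k = (SUM r<k. regen (k - Suc r) (base (Suc r)))" for k
 define g where "g n = measure P {x. n < R x} + (SUM r<n. unregen (n - Suc r) (base (Suc r)))" for n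
 have fr0: "fr 0 = 0" by (simp add: fr_def)
 have frn: "0 <= fr k" for k unfolding fr_def by (intro sum_nonneg regen_nonneg regb) auto
 have gn: "0 <= g n" for n unfolding g_def by (intro add_nonneg_nonneg sum_nonneg unregen_nonneg regb) auto
 have mass1: "(SUM r<n. measure P {x. R x = Suc r}) + measure P {x. n < R x} = 1" for n
 proof -
  have "(SUM r<n. E (indicator {x. R x = Suc r})) + E (indicator {x. n < R x}) = 1"
   using regular_split[OF regular_E bdd_borel_const, of 1 n] E_one by simp
  then show ?thesis by (simp add: E_indicator)
 qed
 have g: "g n = 1 - (SUM k<=n. fr k)" for n
 proof -
  have "(SUM k<=n. fr k) = (SUM r<n. SUM j<=n - Suc r. regen j (base (Suc r)))"
   unfolding fr_def by (rule sum_reorder_delay)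
  then have "(SUM k<=n. fr k) + g n = measure P {x. n < R x} + (SUM r<n. (SUM j<=n - Suc r. regen j (base (Suc r))) + unregen (n - Suc r) (base (Suc r)))"
   by (simp add: g_def sum.distrib)
  also have "(SUM r<n. (SUM j<=n - Suc r. regen j (base (Suc r))) + unregen (n - Suc r) (base (Suc r))) = (SUM r<n. measure P {x. R x = Suc r})"
   by (intro sum.cong refl) (subst regen_unregen_mass, auto intro: regb base1)
  finally show ?thesis using mass1[of n] by simp
 qed
 define A' where "A' = A0 + (A * 2 powr p + A0 * 2 powr p)"
 have gtail: "g n <= A' * decay p n" for n
 proof -
  define q where "q r = measure P {x. R x = Suc r}" for r
  define tau where "tau j = min 1 (A * decay p j)" for j
  have "(SUM r<n. unregen (n - Suc r) (base (Suc r))) <= (SUM r<n. q r * tau (n - Suc r))"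
  proof (intro sum_mono)
   fix r assume r: "r : {..<n}"
   have regs: "regular K0 (base (Suc r))" by (rule regb) simp
   have s1: "base (Suc r) (%_. 1) = q r" by (simp add: base1 q_def)
   show "unregen (n - Suc r) (base (Suc r)) <= q r * tau (n - Suc r)"
    using unregen_le_mass[OF regs, of "n - Suc r"] A[OF regs, of "n - Suc r"] s1
    by (auto simp: tau_def min_def mult_ac)
  qed
  also have "... <= (1 * A * (1 - 1 / 2) powr (- p) + A0 * (1 / 2) powr (- p)) * decay p n"
  proof (rule convolution_tail_bound)
   interpret prob_space P by (rule prob_P)
   show "(SUM r<n. q r) <= 1" unfolding q_def using mass1[of n] measure_nonneg[of P "{x. n < R x}"] by linarith
   fix rho
   show "(SUM r:{rho..<n}. q r) <= A0 * decay p rho"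
    unfolding q_def by (rule order.trans[OF sum_tail_le[OF mass1 measure_nonneg] return_tail])
  qed (use An A0_nonneg p in "auto simp: tau_def q_def")
  finally show ?thesis unfolding half_powr g_def A'_def using return_tail[of n] by (simp add: algebra_simps)
 qed
 have gsum: "summable (%n. real (Suc n) powr kap * g n)"
 proof (rule summable_comparison_test)
  show "summable (%n. A' * decay (p - kap) n)" using kap by (intro summable_mult summable_suc_powr) simp
  show "EX N. ALL n>=N. norm (real (Suc n) powr kap * g n) <= A' * decay (p - kap) n"
  proof (intro exI allI impI)
   fix n
   have "real (Suc n) powr kap * g n <= real (Suc n) powr kap * (A' * decay p n)"
    by (intro mult_left_mono gtail) auto
   also have "... = A' * decay (p - kap) n" by (simp add: powr_add[symmetric] del: of_nat_Suc)
   finally show "norm (real (Suc n) powr kap * g n) <= A' * decay (p - kap) n"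
    using gn[of n] by simp
  qed
 qed
 have gcd: "Gcd {k. fr k > 0} = 1"
 proof -
  have sub: "{r. 0 < measure P {x. R x = r}} - {0} \<subseteq> {k. fr k > 0}"
  proof
   fix r assume "r : {r. 0 < measure P {x. R x = r}} - {0}"
   then have r: "0 < measure P {x. R x = r}" "r >= 1" by auto
   have "regen (r - Suc (r - 1)) (base (Suc (r - 1))) = cc * measure P {x. R x = r}"
    using r by (subst regen.simps) (simp add: base1)
   then have "0 < regen (r - Suc (r - 1)) (base (Suc (r - 1)))" using r cc by simp
   also have "... <= fr r" unfolding fr_def
    by (rule member_le_sum) (use r in "auto intro!: regen_nonneg regb")
   finally show "r : {k. fr k > 0}" by simp
  qed
  have "Gcd {k. fr k > 0} dvd Gcd {r. 0 < measure P {x. R x = r}}"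
  proof (rule Gcd_greatest)
   fix r assume r: "r : {r. 0 < measure P {x. R x = r}}"
   show "Gcd {k. fr k > 0} dvd r"
    by (cases "r = 0") (use r sub in "auto intro!: Gcd_dvd")
  qed
  then show ?thesis using aperiodic by simp
 qed
 obtain C where Cn: "C >= 0" and C:
  "!!I e :: nat => real. (!!n. I n = (SUM k<=n. fr k * I (n - k)) + e n) ==> (!!n. abs (e n) <= g n)
   ==> EX l. ALL n. abs (I n - l) <= C * decay kap n"
  using renewal_convergence[OF fr0 frn g gn kap(1) gsum gcd] by blast
 define C2 where "C2 = (2 powr kap + (1 + A) * 2 powr kap * 2 powr kap)"
 define C' where "C' = A + C * C2 + (1 + C) * A + (1 + C)"
 have C2: "C2 >= 0" using An by (simp add: C2_def)
 show thesis
 proof (rule that[of C'])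
  show "C' >= 1" unfolding C'_def using An Cn C2 by simp
  fix psi :: "'a => real" assume psi: "bdd_borel psi" "!!x. abs (psi x) <= 1"
  define I where "I n = E (%x. psi ((f ^^ n) x))" for n
  have b: "bdd_borel (%x. psi ((f ^^ n) x))" for n by (rule bdd_borel_comp[OF psi(1) funpow_borel])
  have "abs (I n - (SUM k<=n. fr k * I (n - k))) <= g n" for n
  proof -
   have "(SUM k<=n. fr k * I (n - k)) = (SUM k<=n. SUM r<k. regen (k - Suc r) (base (Suc r)) * I (n - Suc r - (k - Suc r)))"
    unfolding fr_def sum_distrib_right by (intro sum.cong refl) auto
   also have "... = (SUM r<n. SUM j<=n - Suc r. regen j (base (Suc r)) * I (n - Suc r - j))" by (rule sum_reorder_delay)
   finally have 1: "(SUM k<=n. fr k * I (n - k)) = (SUM r<n. SUM j<=n - Suc r. regen j (base (Suc r)) * I (n - Suc r - j))" .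
   have 2: "I n = (SUM r<n. base (Suc r) (%x. psi ((f ^^ (n - Suc r)) x))) + E (%x. indicator {x. n < R x} x * psi ((f ^^ n) x))"
    unfolding I_def using regular_split[OF regular_E b[of n], of n] by (simp add: base_def branch_iterate)
   have "abs (I n - (SUM k<=n. fr k * I (n - k))) = abs (E (%x. indicator {x. n < R x} x * psi ((f ^^ n) x)) +
     (SUM r<n. base (Suc r) (%x. psi ((f ^^ (n - Suc r)) x)) - (SUM j<=n - Suc r. regen j (base (Suc r)) * I (n - Suc r - j))))"
    unfolding 1 2 by (simp add: sum_subtractf)
   also have "... <= E (indicator {x. n < R x}) + (SUM r<n. unregen (n - Suc r) (base (Suc r)))"
   proof (intro order.trans[OF abs_triangle_ineq] add_mono order.trans[OF sum_abs] sum_mono)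
    show "abs (E (%x. indicator {x. n < R x} x * psi ((f ^^ n) x))) <= E (indicator {x. n < R x})"
    proof (rule pos_abs_le[OF E_pos])
     show "abs (indicator {x. n < R x} x * psi ((f ^^ n) x)) <= indicator {x. n < R x} x" for x
      using psi by (auto simp: indicator_def)
    qed (intro bb b R_sets)+
    fix r
    show "abs (base (Suc r) (%x. psi ((f ^^ (n - Suc r)) x)) - (SUM j<=n - Suc r. regen j (base (Suc r)) * I (n - Suc r - j))) <= unregen (n - Suc r) (base (Suc r))"
     unfolding I_def by (rule regeneration_expansion[OF psi regb]) simp
   qed
   finally show ?thesis unfolding g_def by (simp add: E_indicator)
  qed
  then have "EX l. ALL n. abs (I n - l) <= C * decay kap n"
   by (intro C[of I "%n. I n - (SUM k<=n. fr k * I (n - k))"]) auto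
  then obtain l where l: "!!n. abs (I n - l) <= C * decay kap n" by auto
  have l1: "abs l <= 1 + C"
  proof -
   have "abs (I 0) <= E (%_. 1)" unfolding I_def by (rule pos_abs_le[OF E_pos b bdd_borel_const]) (simp add: psi)
   then show ?thesis using l[of 0] E_one by simp
  qed
  have main: "abs (Lam (%x. psi ((f ^^ n) x)) - l * Lam (%_. 1)) <= C' * Lam (%_. 1) * decay kap n"
   if reg: "regular K0 Lam" for Lam n
  proof -
   let ?L = "Lam (%_. 1)"
   let ?w = "decay kap n"
   have L1: "0 <= ?L" by (rule pos_nonneg[OF regular_pos[OF reg]]) (auto intro: bb)
   have ppk: "decay p j <= decay kap j" for j using kap by (intro powr_mono) auto
   have un: "unregen n Lam <= A * ?L * ?w"
    using A[OF reg, of n] mult_left_mono[OF ppk[of n], of "A * ?L"] An L1 by simp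
   have conv: "(SUM k<Suc n. regen k Lam * decay kap (Suc n - Suc k)) <= C2 * ?L * ?w"
   proof -
    have "(SUM k<Suc n. regen k Lam * decay kap (Suc n - Suc k))
     <= (?L * 1 * (1 - 1 / 2) powr (- kap) + ((1 + A) * 2 powr kap * ?L) * (1 / 2) powr (- kap)) * decay kap (Suc n)"
    proof (rule convolution_tail_bound)
     show "0 <= regen k Lam" for k by (rule regen_nonneg[OF reg])
     show "(SUM r<Suc n. regen r Lam) <= ?L"
      using regen_unregen_mass[OF reg, of n] unregen_nonneg[OF reg, of n] by (simp add: lessThan_Suc_atMost)
     fix rho
     show "(SUM r:{rho..<Suc n}. regen r Lam) <= (1 + A) * 2 powr kap * ?L * decay kap rho"
     proof -
      define t where "t m = (case m of 0 => ?L | Suc k => unregen k Lam)" for m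
      have "(SUM r<m. regen r Lam) + t m = ?L" for m
       using regen_unregen_mass[OF reg] by (cases m) (simp_all add: t_def lessThan_Suc_atMost del: sum.lessThan_Suc)
      moreover have "0 <= t m" for m using L1 unregen_nonneg[OF reg] by (cases m) (simp_all add: t_def)
      ultimately have "(SUM r:{rho..<Suc n}. regen r Lam) <= t rho" by (rule sum_tail_le)
      also have "t rho <= ((1 + A) * ?L) * (real (Suc rho) / 2) powr (- kap)"
      proof (cases rho)
       case 0
       have "1 <= 2 powr kap" using kap by (intro ge_one_powr_ge_zero) auto
       then have "?L * 1 <= ((1 + A) * ?L) * 2 powr kap" using An L1 by (intro mult_mono) (auto simp: mult_le_cancel_right1)
       then show ?thesis using 0 by (simp add: t_def half_powr)
      next
       case (Suc k)
       have "unregen k Lam <= A * ?L * decay p k" by (rule A[OF reg])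
       also have "... <= ((1 + A) * ?L) * (real (Suc rho) / 2) powr (- kap)"
       proof (rule mult_mono)
        have "decay kap k <= (real (Suc rho) / 2) powr (- kap)" using Suc kap by (intro powr_mono2') auto
        with ppk[of k] show "decay p k <= (real (Suc rho) / 2) powr (- kap)" by linarith
       qed (use An L1 in "auto intro: mult_right_mono")
       finally show ?thesis by (simp add: t_def Suc)
      qed
      also have "... = (1 + A) * 2 powr kap * ?L * decay kap rho" by (simp add: powr_divide powr_minus field_simps)
      finally show ?thesis .
     qed
    next
     fix j
     have "decay kap j <= real (Suc j) powr 0" using kap by (intro powr_mono) auto
     then show "decay kap j <= 1" by simp
     show "0 <= (1 + A) * 2 powr kap * ?L" using An L1 by simp
    qed (use kap in simp_all)
    also have "(?L * 1 * (1 - 1 / 2) powr (- kap) + ((1 + A) * 2 powr kap * ?L) * (1 / 2) powr (- kap)) = (?L * 1 * 2 powr kap + ((1 + A) * 2 powr kap * ?L) * 2 powr kap)" unfolding half_powr ..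
    also have "... = C2 * ?L" by (simp add: C2_def algebra_simps)
    also have "C2 * ?L * decay kap (Suc n) <= C2 * ?L * ?w"
     using C2 L1 kap by (intro mult_left_mono powr_mono2') auto
    finally show ?thesis .
   qed
   have dec: "Lam (%x. psi ((f ^^ n) x)) - l * ?L
    = (Lam (%x. psi ((f ^^ n) x)) - (SUM k<=n. regen k Lam * I (n - k))) + (SUM k<=n. regen k Lam * (I (n - k) - l)) - l * unregen n Lam"
   proof -
    have "(SUM k<=n. regen k Lam * (I (n - k) - l)) = (SUM k<=n. regen k Lam * I (n - k)) - (SUM k<=n. regen k Lam) * l"
     by (simp add: right_diff_distrib sum_subtractf sum_distrib_right)
    then show ?thesis unfolding regen_unregen_mass[OF reg, of n, symmetric] by (simp add: algebra_simps)
   qed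
   have "abs (Lam (%x. psi ((f ^^ n) x)) - l * ?L) <= unregen n Lam + (SUM k<=n. regen k Lam * (C * decay kap (n - k))) + (1 + C) * unregen n Lam"
    unfolding dec
   proof (rule abs_sum3_le)
    show "abs (Lam (%x. psi ((f ^^ n) x)) - (SUM k<=n. regen k Lam * I (n - k))) <= unregen n Lam"
     unfolding I_def by (rule regeneration_expansion[OF psi reg])
    show "abs (SUM k<=n. regen k Lam * (I (n - k) - l)) <= (SUM k<=n. regen k Lam * (C * decay kap (n - k)))"
     by (rule order.trans[OF sum_abs], intro sum_mono)
      (auto simp: abs_mult regen_nonneg[OF reg] simp del: of_nat_Suc intro!: mult_left_mono l)
    show "abs (l * unregen n Lam) <= (1 + C) * unregen n Lam"
     unfolding abs_mult using unregen_nonneg[OF reg, of n] l1 by (auto intro: mult_right_mono)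
   qed
   also have "(SUM k<=n. regen k Lam * (C * decay kap (n - k))) = C * (SUM k<Suc n. regen k Lam * decay kap (Suc n - Suc k))"
    by (simp add: sum_distrib_left lessThan_Suc_atMost mult_ac del: sum.lessThan_Suc)
   also have "unregen n Lam + C * (SUM k<Suc n. regen k Lam * decay kap (Suc n - Suc k)) + (1 + C) * unregen n Lam
    <= A * ?L * ?w + C * (C2 * ?L * ?w) + (1 + C) * (A * ?L * ?w)"
    using un conv Cn by (intro add_mono mult_left_mono) auto
   also have "... <= C' * ?L * ?w"
   proof -
    have "0 <= (1 + C) * (?L * ?w)" using Cn L1 by simp
    then show ?thesis unfolding C'_def by (simp add: algebra_simps)
   qed
   finally show ?thesis .
  qed
  have "abs l <= C'" unfolding C'_def using l1 An Cn C2 by (smt (verit) mult_nonneg_nonneg)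
  then show "EX l. abs l <= C' & (ALL Lam n. regular K0 Lam -->
    abs (Lam (%x. psi ((f ^^ n) x)) - l * Lam (%_. 1)) <= C' * Lam (%_. 1) * decay kap n)"
   using main by blast
 qed
qed

end

section \<open>Lipschitz functions are dense in \<open>L\<^sup>1\<close>\<close>

definition lipschitz_bounded :: "('a::metric_space => real) => bool" where
 "lipschitz_bounded g \<longleftrightarrow> (EX L B. ALL x y. abs (g x - g y) <= L * dist x y & abs (g x) <= B)"

lemma lipschitz_bounded_continuous:
 assumes "lipschitz_bounded g" shows "continuous_on UNIV g"
proof -
 obtain L where L: "!!x y. abs (g x - g y) <= L * dist x y" using assms by (auto simp: lipschitz_bounded_def)
 have "abs (g x - g y) <= abs L * dist x y" for x y
  by (rule order.trans[OF L]) (intro mult_right_mono, auto)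
 then have "(abs L)-lipschitz_on UNIV g" by (intro lipschitz_onI) (auto simp: dist_real_def)
 then show ?thesis by (rule lipschitz_on_continuous_on)
qed

lemma lipschitz_bounded_const: "lipschitz_bounded (%_. c)"
 unfolding lipschitz_bounded_def by (intro exI[of _ 0] exI[of _ "abs c"]) simp

lemma lipschitz_bounded_lincomb:
 assumes "lipschitz_bounded g" "lipschitz_bounded h" shows "lipschitz_bounded (%x. c * g x + h x)"
proof -
 obtain L1 B1 L2 B2 where 1: "!!x y. abs (g x - g y) <= L1 * dist x y" "!!x. abs (g x) <= B1"
  and 2: "!!x y. abs (h x - h y) <= L2 * dist x y" "!!x. abs (h x) <= B2"
  using assms unfolding lipschitz_bounded_def by metis
 have "abs ((c * g x + h x) - (c * g y + h y)) <= (abs c * L1 + L2) * dist x y" for x y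
 proof -
  have "(c * g x + h x) - (c * g y + h y) = c * (g x - g y) + (h x - h y)" by (simp add: algebra_simps)
  also have "abs ... <= abs c * (L1 * dist x y) + L2 * dist x y"
   by (rule order.trans[OF abs_triangle_ineq add_mono[OF _ 2(1)]]) (simp add: abs_mult mult_left_mono 1)
  finally show ?thesis by (simp add: algebra_simps)
 qed
 moreover have "abs (c * g x + h x) <= abs c * B1 + B2" for x
  by (rule order.trans[OF abs_triangle_ineq add_mono[OF _ 2(2)]]) (simp add: abs_mult mult_left_mono 1)
 ultimately show ?thesis unfolding lipschitz_bounded_def by blast
qed

lemma lipschitz_bounded_max0:
 assumes "lipschitz_bounded g" shows "lipschitz_bounded (%x. max 0 (g x))"
proof -
 obtain L B where 1: "!!x y. abs (g x - g y) <= L * dist x y" "!!x. abs (g x) <= B" 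
  using assms unfolding lipschitz_bounded_def by metis
 have "abs (max 0 (g x) - max 0 (g y)) <= L * dist x y & abs (max 0 (g x)) <= B" for x y
  using 1(1)[of x y] 1(2)[of x] by linarith
 then show ?thesis unfolding lipschitz_bounded_def by blast
qed

locale borel_finite_measure = finite_measure M for M :: "'a::polish_space measure" +
 assumes sets_borel: "sets M = sets borel"
begin

lemma measurable_M: "u : borel_measurable borel ==> u : borel_measurable M"
 using measurable_cong_sets[OF sets_borel refl] by blast

lemma integrable_bounded:
 assumes "u : borel_measurable borel" "!!x. abs (u x) <= B"
 shows "integrable M (u :: 'a => real)"
 using assms by (intro integrable_const_bound[of _ B] measurable_M) auto

lemma lipschitz_integrable: "lipschitz_bounded g ==> integrable M g"
 using lipschitz_bounded_continuous[of g]
 by (auto simp: lipschitz_bounded_def intro!: integrable_bounded borel_measurable_continuous_onI)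

definition approximable :: "('a => real) => bool" where
 "approximable u \<longleftrightarrow> integrable M u & (ALL eps>0. EX g. lipschitz_bounded g & (LINT x|M. abs (u x - g x)) < eps)"

lemma approximableD:
 assumes "approximable u" "eps > 0"
 obtains g where "lipschitz_bounded g" "integrable M g" "(LINT x|M. abs (u x - g x)) < eps"
 using assms lipschitz_integrable unfolding approximable_def by metis

lemma approximable_lipschitz: "lipschitz_bounded g ==> approximable g"
 unfolding approximable_def by (auto intro!: lipschitz_integrable exI[of _ g])

lemma approximable_close:
 assumes u: "integrable M u" and *: "!!eps. eps > 0 ==> EX v. approximable v & (LINT x|M. abs (u x - v x)) < eps"
 shows "approximable u"
 unfolding approximable_def
proof (intro conjI allI impI u)
 fix eps :: real assume "eps > 0"
 then obtain v where v: "approximable v" "(LINT x|M. abs (u x - v x)) < eps / 2" using *[of "eps / 2"] by auto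
 have vi: "integrable M v" using v by (simp add: approximable_def)
 obtain g where g: "lipschitz_bounded g" "integrable M g" "(LINT x|M. abs (v x - g x)) < eps / 2"
  using approximableD[OF v(1), of "eps / 2"] \<open>eps > 0\<close> by auto
 have "(LINT x|M. abs (u x - g x)) <= (LINT x|M. abs (u x - v x) + abs (v x - g x))"
  using u vi g by (intro integral_mono) auto
 also have "... = (LINT x|M. abs (u x - v x)) + (LINT x|M. abs (v x - g x))"
  using u vi g by (intro Bochner_Integration.integral_add) auto
 finally show "EX g. lipschitz_bounded g & (LINT x|M. abs (u x - g x)) < eps" using v g by (intro exI[of _ g]) auto
qed

lemma approximable_lincomb:
 assumes "approximable u" "approximable v" shows "approximable (%x. c * u x + v x)"
 unfolding approximable_def
proof (intro conjI allI impI)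
 have ui: "integrable M u" and vi: "integrable M v" using assms by (auto simp: approximable_def)
 then show "integrable M (%x. c * u x + v x)" by auto
 fix eps :: real assume e: "eps > 0"
 have c: "abs c + 1 > 0" by simp
 obtain g where g: "lipschitz_bounded g" "integrable M g" "(LINT x|M. abs (u x - g x)) < eps / 2 / (abs c + 1)"
  using approximableD[OF assms(1), of "eps / 2 / (abs c + 1)"] e c by auto
 obtain h where h: "lipschitz_bounded h" "integrable M h" "(LINT x|M. abs (v x - h x)) < eps / 2"
  using approximableD[OF assms(2), of "eps / 2"] e by auto
 have "(LINT x|M. abs ((c * u x + v x) - (c * g x + h x))) <= (LINT x|M. (abs c + 1) * abs (u x - g x) + abs (v x - h x))"
 proof (intro integral_mono)
  fix x
  have "(c * u x + v x) - (c * g x + h x) = c * (u x - g x) + (v x - h x)" by (simp add: algebra_simps)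
  also have "abs ... <= (abs c + 1) * abs (u x - g x) + abs (v x - h x)"
   by (rule order.trans[OF abs_triangle_ineq add_right_mono]) (simp add: abs_mult mult_right_mono)
  finally show "abs ((c * u x + v x) - (c * g x + h x)) <= (abs c + 1) * abs (u x - g x) + abs (v x - h x)" .
 qed (use ui vi g h in auto)
 also have "... = (abs c + 1) * (LINT x|M. abs (u x - g x)) + (LINT x|M. abs (v x - h x))"
  using ui vi g h by (subst Bochner_Integration.integral_add) auto
 also have "... < eps" using g(3) h(3) c by (simp add: field_simps)
 finally show "EX g. lipschitz_bounded g & (LINT x|M. abs (c * u x + v x - g x)) < eps"
  using g h by (intro exI[of _ "%x. c * g x + h x"]) (auto intro: lipschitz_bounded_lincomb)
qed

lemma approximable_lim:
 assumes v: "!!n. approximable (v n)" and u: "integrable M u" and lim: "!!x. (%n. v n x) ----> u x"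
  and w: "integrable M w" "!!n x. abs (v n x) <= w x"
 shows "approximable u"
proof (rule approximable_close[OF u])
 fix eps :: real assume e: "eps > 0"
 have vi: "integrable M (v n)" for n using v by (simp add: approximable_def)
 have "(%n. (LINT x|M. abs (u x - v n x))) ----> (LINT x|M. 0)"
 proof (rule integral_dominated_convergence[where w = "%x. abs (u x) + w x"])
  have "(%n. abs (u x - v n x)) ----> abs (u x - u x)" for x by (intro tendsto_intros lim)
  then show "AE x in M. (%n. abs (u x - v n x)) ----> 0" by simp
  have "norm (abs (u x - v n x)) <= abs (u x) + w x" for n x using w(2)[of n x] by simp
  then show "AE x in M. norm (abs (u x - v n x)) <= abs (u x) + w x" for n by (intro AE_I2)
 qed (use u vi w(1) in auto)
 then have "\<forall>\<^sub>F n in sequentially. (LINT x|M. abs (u x - v n x)) < eps" using e by (intro order_tendstoD(2)) auto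
 then show "EX v. approximable v & (LINT x|M. abs (u x - v x)) < eps" using v by (auto simp: eventually_sequentially)
qed

text \<open>The ramps \<open>max 0 (1 - n * infdist x S)\<close> are Lipschitz and decrease to the indicator.\<close>

lemma approximable_closed:
 assumes "closed S" shows "approximable (indicator S)"
proof (cases "S = {}")
 case True
 then have "(indicator S :: 'a => real) = (%_. 0)" by auto
 then show ?thesis by (simp only:) (intro approximable_lipschitz lipschitz_bounded_const)
next
 case False
 define v where "v n x = max 0 (1 + (- real n) * infdist x S)" for n x
 have vi: "max 0 (1 + (- real n) * infdist x S) <= 1" for n x
  using mult_nonneg_nonneg[of "real n" "infdist x S"] by (simp add: infdist_nonneg)
 have lip: "lipschitz_bounded (v n)" for n
  unfolding lipschitz_bounded_def
 proof (rule exI[of _ "real n"], rule exI[of _ 1], intro allI conjI)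
  fix x y
  have "abs (infdist x S - infdist y S) <= dist x y" by (rule infdist_triangle_abs)
  then have "abs (real n * infdist x S - real n * infdist y S) <= real n * dist x y"
   by (simp add: abs_mult[symmetric] right_diff_distrib[symmetric] abs_mult mult_left_mono)
  then show "abs (v n x - v n y) <= real n * dist x y" unfolding v_def by (auto simp: max_def abs_le_iff)
  show "abs (v n x) <= 1" unfolding v_def using vi[of n x] by simp
 qed
 show ?thesis
 proof (rule approximable_lim[of v])
  show "approximable (v n)" for n by (rule approximable_lipschitz[OF lip])
  show "integrable M (indicator S :: 'a => real)" using assms by (intro integrable_bounded[of _ 1]) (auto simp: indicator_def)
  show "integrable M (%_. 1 :: real)" by simp
  show "abs (v n x) <= 1" for n x unfolding v_def using vi[of n x] by simp
  fix x
  show "(%n. v n x) ----> indicator S x"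
  proof (cases "x : S")
   case True
   then show ?thesis by (simp add: v_def)
  next
   case x: False
   then have pos: "infdist x S > 0" using assms False
    by (metis infdist_pos_not_in_closed)
   obtain N where N: "real N > 1 / infdist x S" using reals_Archimedean2 by blast
   have "v n x = 0" if "n >= N" for n
   proof -
    have "real n > 1 / infdist x S" using N that by linarith
    then have "real n * infdist x S > 1" using pos by (simp add: field_simps)
    then show ?thesis by (simp add: v_def)
   qed
   then have "\<forall>\<^sub>F n in sequentially. v n x = indicator S x" using x by (auto simp: eventually_sequentially)
   then show ?thesis by (rule tendsto_eventually)
  qed
 qed
qed

lemma approximable_borel:
 assumes A: "A : sets borel" shows "approximable (indicator A)"
proof (rule approximable_close)
 have ind: "integrable M (indicator C :: 'a => real)" if "C : sets borel" for C
  using that by (intro integrable_bounded[of _ 1]) (auto simp: indicator_def)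
 show "integrable M (indicator A :: 'a => real)" by (rule ind[OF A])
 fix eps :: real assume e: "eps > 0"
 obtain C where C: "C \<subseteq> A" "compact C" and m: "emeasure M A < emeasure M C + ennreal eps"
  using inner_regular[OF sets_borel _ A] e
  by (metis (no_types, lifting) SUP_approx_ennreal emeasure_finite empty_iff compact_empty empty_subsetI ennreal_less_zero_iff mem_Collect_eq infinity_ennreal_def)
 have Cs: "C : sets borel" using C(2) by (intro borel_closed compact_imp_closed)
 have "(LINT x|M. abs (indicator A x - indicator C x :: real)) = (LINT x|M. indicator A x - indicator C x)"
  using C(1) by (intro Bochner_Integration.integral_cong refl) (auto simp: indicator_def)
 also have "... = measure M A - measure M C" using ind[OF A] ind[OF Cs] A Cs by (simp add: sets_borel)
 also have "... < eps"
  using m e by (simp add: emeasure_eq_measure ennreal_plus[symmetric] ennreal_less_iff del: ennreal_plus)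
 finally show "EX v. approximable v & (LINT x|M. abs (indicator A x - v x)) < eps"
  using approximable_closed[OF compact_imp_closed[OF C(2)]] by blast
qed

theorem approximable_integrable: "integrable M u ==> approximable u"
proof (induction rule: integrable_induct)
 case (base A c)
 have "approximable (%x. c * indicator A x + 0)"
  using base by (intro approximable_lincomb approximable_borel approximable_lipschitz lipschitz_bounded_const) (simp add: sets_borel)
 then show ?case by (simp add: mult.commute)
next
 case (add g h)
 then show ?case using approximable_lincomb[of g h 1] by simp
next
 case (lim u s)
 have sp: "space M = UNIV" using sets_eq_imp_space_eq[OF sets_borel] by simp
 show ?case by (rule approximable_lim[of s u "%x. 2 * abs (u x)"]) (use lim sp in auto)
qed

end

section \<open>Loss of memory for the tower measure\<close>

context full_branch_map
begin

text \<open>Constants add, as logarithms of densities do.\<close>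

lemma regular_weight:
 assumes reg: "regular k Lam" and L: "L >= 0"
  and w: "bdd_borel w" "!!x. 0 <= w x"
  and wL: "!!x y. w x <= exp (L * dist x y powr al) * w y"
 shows "regular (k + L) (%u. Lam (%x. w x * u x))"
proof -
 note pos = regular_pos[OF reg]
 have "Lam (%x. w x * u x) * E v <= exp ((k + L) * t) * E u * Lam (%x. w x * v x)"
  if uv: "bdd_borel u" "bdd_borel v" "!!x. 0 <= u x" "!!x. 0 <= v x" "t >= 0"
   and d: "!!x y. u x ~= 0 ==> v y ~= 0 ==> dist x y powr al <= t" for u v t
 proof -
  have "Lam (%x. w x * u x) * E v <= exp (L * t) * exp (k * t) * E u * Lam (%x. w x * v x)"
  proof (rule weight_compare[OF pos E_pos w uv(1-4)])
   fix x y assume xy: "u x ~= 0" "v y ~= 0"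
   have "w x <= exp (L * dist x y powr al) * w y" by (rule wL)
   also have "... <= exp (L * t) * w y" using d[OF xy] L w by (intro mult_right_mono) (auto simp: mult_left_mono)
   finally show "w x <= exp (L * t) * w y" .
  qed (auto intro: regularD[OF reg uv d])
  also have "exp (L * t) * exp (k * t) = exp ((k + L) * t)" by (simp add: exp_add[symmetric] algebra_simps)
  finally show ?thesis .
 qed
 then show ?thesis using positive_transform[OF pos w, of "%x. x"] unfolding regular_def by simp
qed

definition push :: "(('a => real) => real) => ('a => real) => real" where
 "push Lam u = Lam (%x. indicator (\<Union>\<Gamma>) x * u (F x))"

lemma regular_push_all: "regular k Lam ==> k >= 0 ==> regular (k * th + K) (push Lam)"
 using regular_push[of k Lam \<Gamma> 0 "%_. 1"] by (simp add: push_def[abs_def] bdd_borel_const)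

lemma regular_push_iterate:
 assumes reg: "regular k Lam" and k: "k >= 0" shows "EX n. regular K0 ((push ^^ n) Lam)"
proof -
 define c where "c = K / (1 - th)"
 have c0: "c >= 0" using K th by (simp add: c_def)
 have cfix: "c * th + K = c" unfolding c_def using th by (simp add: field_simps)
 have it: "regular (th ^ n * k + c) ((push ^^ n) Lam)" for n
 proof (induction n)
  case 0
  show ?case using regular_mono[OF reg, of "k + c"] c0 by simp
 next
  case (Suc n)
  have "(th ^ n * k + c) * th + K = th ^ Suc n * k + c" using cfix by (simp add: algebra_simps)
  then show ?case using regular_push_all[OF Suc] k c0 th by simp
 qed
 have "c < K0" unfolding c_def K0_def using K th by (simp add: divide_strict_right_mono)
 then have gap: "K0 - c > 0" by simp
 have "(%n. th ^ n * k) ----> 0 * k" using th by (intro tendsto_mult LIMSEQ_realpow_zero tendsto_const) auto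
 then have "\<forall>\<^sub>F n in sequentially. th ^ n * k < K0 - c" using order_tendstoD(2)[of _ 0 sequentially "K0 - c"] gap by simp
 then obtain n where "th ^ n * k < K0 - c" by (auto simp: eventually_sequentially)
 then show ?thesis using regular_mono[OF it[of n], of K0] by (intro exI[of _ n]) simp
qed

lemma regular_limit:
 assumes reg: "!!i. regular k (Lam i)" and pos: "positive_functional N"
  and lim: "!!u. bdd_borel u ==> (%i::nat. Lam i u) ----> N u"
 shows "regular k N"
 unfolding regular_def
proof (intro conjI allI impI pos)
 fix u v :: "'a => real" and t :: real
 assume uv: "bdd_borel u" "bdd_borel v" "ALL x. 0 <= u x" "ALL x. 0 <= v x" "t >= 0"
  "ALL x y. u x ~= 0 --> v y ~= 0 --> dist x y powr al <= t"
 have "(%i. Lam i u * E v) ----> N u * E v" "(%i. exp (k * t) * E u * Lam i v) ----> exp (k * t) * E u * N v"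
  using uv by (intro tendsto_intros lim; simp)+
 then show "N u * E v <= exp (k * t) * E u * N v"
  by (rule LIMSEQ_le) (use regularD[OF reg uv(1,2)] uv in blast)
qed

text \<open>The density of \<open>nu\<close> is only integrable, so regularity has to come from invariance. It is approximated in \<open>L1\<close> by a positive
Lipschitz function, which has a regular functional with some constant; iterating the push-forward improves the constant to
\<open>K0\<close>, does not increase the distance, and fixes \<open>nu\<close>. Regularity survives the limit.\<close>

lemma invariant_regular:
 assumes nu: "prob_space nu" "sets nu = sets borel" "absolutely_continuous P nu" "distr nu borel F = nu"
  and lip: "!!x y :: 'a. dist x y <= D1 * dist x y powr al" and D1: "D1 >= 0"
 shows "regular K0 (%u. \<integral>x. u x \<partial>nu)"
proof -
 interpret PP: prob_space P by (rule prob_P)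
 interpret PB: borel_finite_measure P by standard (rule sets_P)
 interpret nu: prob_space nu by (rule nu)
 define N where "N u = (LINT x|nu. u x)" for u :: "'a => real"
 have Nint: "integrable nu u" if "bdd_borel u" for u :: "'a => real"
  using bdd_borel_integrable[OF that _ nu(2)] nu.finite_measure_axioms by auto
 have Npos: "positive_functional N"
  unfolding N_def[abs_def] by (rule positive_integral[OF nu.finite_measure_axioms nu(2)])
 obtain h where h: "h : borel_measurable P" "AE x in P. RN_deriv P nu x = ennreal (h x)" "!!x. 0 <= h x"
  using PP.real_RN_deriv[of nu] nu sets_P nu.finite_measure_axioms by metis
 have hb: "h : borel_measurable borel" using h(1) measurable_cong_sets[OF sets_P refl] by blast
 have dens: "nu = density P (%x. ennreal (h x))"
 proof -
  have "density P (RN_deriv P nu) = nu" using nu sets_P by (intro PP.density_RN_deriv) auto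
  moreover have "density P (RN_deriv P nu) = density P (%x. ennreal (h x))" using h by (intro density_cong) auto
  ultimately show ?thesis by simp
 qed
 have hint: "integrable P h"
 proof -
  have "(nn_integral P (%x. ennreal (h x))) = emeasure nu (space nu)"
   unfolding dens using h(1) by (simp add: emeasure_density cong: nn_integral_cong)
  also have "... = 1" by (rule nu.emeasure_space_1)
  finally show ?thesis using h by (intro integrableI_nonneg) auto
 qed
 have Nh: "N u = (LINT x|P. h x * u x)" if u: "bdd_borel u" for u
 proof -
  have um: "u : borel_measurable P" using u PB.measurable_M by (auto simp: bdd_borel_def)
  show ?thesis unfolding N_def dens using um h by (subst integral_real_density) auto
 qed
 have pushN: "N (%x. indicator (\<Union>\<Gamma>) x * u (F x)) = N u" if u: "bdd_borel u" for u
 proof -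
  have um: "u : borel_measurable borel" using u by (auto simp: bdd_borel_def)
  have "AE x in nu. x : \<Union>\<Gamma>" by (rule absolutely_continuous_AE[OF _ nu(3) part(4)]) (simp add: nu sets_P)
  then have "AE x in nu. indicator (\<Union>\<Gamma>) x * u (F x) = u (F x)" by (rule eventually_mono) (simp only: indicator_simps mult_1)
  moreover have Fm: "F : nu ->M borel" using F_borel measurable_cong_sets[OF nu(2) refl] by blast
  moreover have "(%x. indicator (\<Union>\<Gamma>) x * u (F x)) : borel_measurable nu"
   using bdd_borel_mult[OF bdd_borel_indicator[OF union_borel[of \<Gamma>]] bdd_borel_comp[OF u F_borel]]
    measurable_cong_sets[OF nu(2) refl] by (auto simp: bdd_borel_def)
  ultimately have "N (%x. indicator (\<Union>\<Gamma>) x * u (F x)) = (LINT x|nu. u (F x))"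
   unfolding N_def using um by (intro integral_cong_AE) auto
  also have "... = (\<integral>x. u x \<partial>(distr nu borel F))" using Fm um by (simp add: integral_distr)
  finally show ?thesis unfolding nu(4) N_def .
 qed
 have approx: "EX Lam. regular K0 Lam & (ALL u B. bdd_borel u --> (ALL x. abs (u x) <= B) --> abs (N u - Lam u) <= 2 * eta * B)"
  if eta: "eta > 0" for eta
 proof -
  obtain g0 where g0: "lipschitz_bounded g0" "integrable P g0" "(LINT x|P. abs (h x - g0 x)) < eta"
   using PB.approximableD[OF PB.approximable_integrable[OF hint] eta] by blast
  define g where "g x = max 0 (g0 x)" for x
  have glb: "lipschitz_bounded g" unfolding g_def by (rule lipschitz_bounded_max0[OF g0(1)])
  then obtain L B where L: "!!x y. abs (g x - g y) <= L * dist x y" and B: "!!x. abs (g x) <= B"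
   unfolding lipschitz_bounded_def by metis
  have gb: "g : borel_measurable borel" using lipschitz_bounded_continuous[OF glb] by (rule borel_measurable_continuous_onI)
  have gi: "integrable P g" by (rule PB.lipschitz_integrable[OF glb])
  define w where "w x = g x + eta" for x
  have wbb: "bdd_borel w" unfolding w_def using gb B by (intro bb) (auto simp: bdd_borel_def)
  have weta: "w x >= eta" for x unfolding w_def g_def by simp
  have wi: "integrable P w" unfolding w_def using gi by auto
  have close: "(LINT x|P. abs (h x - w x)) <= 2 * eta"
  proof -
   have "(LINT x|P. abs (h x - w x)) <= (LINT x|P. abs (h x - g0 x) + eta)"
   proof (intro integral_mono)
    fix x show "abs (h x - w x) <= abs (h x - g0 x) + eta" using h(3)[of x] eta unfolding w_def g_def by linarith
   qed (use hint wi g0 in auto)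
   also have "... = (LINT x|P. abs (h x - g0 x)) + eta" using hint g0 by (subst Bochner_Integration.integral_add) (auto simp: PP.prob_space)
   finally show ?thesis using g0(3) by simp
  qed
  define L' where "L' = abs L * D1 / eta"
  have L'0: "L' >= 0" unfolding L'_def using D1 eta by auto
  have wL: "w x <= exp (L' * dist x y powr al) * w y" for x y
  proof -
   have "w x - w y <= L * dist x y" using L[of x y] unfolding w_def by simp
   also have "... <= abs L * (D1 * dist x y powr al)" by (intro mult_mono lip) auto
   also have "... = eta * (L' * dist x y powr al)" unfolding L'_def using eta by simp
   also have "... <= w y * (L' * dist x y powr al)" using weta L'0 by (intro mult_right_mono) auto
   finally have "w x <= (1 + L' * dist x y powr al) * w y" by (simp add: algebra_simps)
   also have "... <= exp (L' * dist x y powr al) * w y"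
    using weta[of y] eta by (intro mult_right_mono exp_ge_add_one_self) auto
   finally show ?thesis .
  qed
  define xi where "xi u = E (%x. w x * u x)" for u
  have "regular (0 + L') xi" unfolding xi_def
   by (rule regular_weight[OF regular_E L'0 wbb _ wL]) (use weta eta in "auto intro: order.trans less_imp_le")
  then obtain n where n: "regular K0 ((push ^^ n) xi)" using regular_push_iterate[of "0 + L'" xi] L'0 by auto
  have "abs (N u - (push ^^ j) xi u) <= 2 * eta * B" if "bdd_borel u" "!!x. abs (u x) <= B" for u B j
   using that
  proof (induction j arbitrary: u)
   case 0
   have um: "u : borel_measurable P" using 0(1) PB.measurable_M by (auto simp: bdd_borel_def)
   have B0: "B >= 0" using 0(2)[of undefined] by linarith
   have i1: "integrable P (%x. h x * u x)" 
   proof (rule Bochner_Integration.integrable_bound[of _ "%x. B * h x"])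
    show "AE x in P. norm (h x * u x) <= norm (B * h x)"
    proof (rule AE_I2)
     fix x show "norm (h x * u x) <= norm (B * h x)"
      using mult_left_mono[OF 0(2)[of x], of "h x"] h(3)[of x] B0 by (simp add: abs_mult mult.commute)
    qed
   qed (use hint um h(1) in auto)
   have i2: "integrable P (%x. w x * u x)" 
    using bdd_borel_integrable[OF bdd_borel_mult[OF wbb 0(1)] PP.finite_measure_axioms sets_P] .
   have "N u - xi u = (LINT x|P. h x * u x - w x * u x)" unfolding Nh[OF 0(1)] xi_def E_def using i1 i2 by simp
   also have "abs ... <= (LINT x|P. abs (h x * u x - w x * u x))" by (rule integral_abs_bound)
   also have "... <= (LINT x|P. abs (h x - w x) * B)"
   proof (intro integral_mono)
    fix x 
    have "abs (h x * u x - w x * u x) = abs (h x - w x) * abs (u x)" by (simp add: abs_mult left_diff_distrib flip: abs_mult)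
    also have "... <= abs (h x - w x) * B" by (intro mult_left_mono 0(2)) auto
    finally show "abs (h x * u x - w x * u x) <= abs (h x - w x) * B" .
   qed (use i1 i2 hint wi in auto)
   also have "... = (LINT x|P. abs (h x - w x)) * B" by simp
   also have "... <= 2 * eta * B" using close B0 by (intro mult_right_mono) auto
   finally show ?case by simp
  next
   case (Suc j)
   let ?u = "%x. indicator (\<Union>\<Gamma>) x * u (F x)"
   have B0: "B >= 0" using Suc.prems(2)[of undefined] by linarith
   have ub: "bdd_borel ?u" by (intro bb union_borel bdd_borel_comp[OF Suc.prems(1) F_borel]) auto
   have "abs (N ?u - (push ^^ j) xi ?u) <= 2 * eta * B"
    by (rule Suc.IH[OF ub]) (use Suc.prems(2) B0 in "auto simp: indicator_def")
   moreover have "(push ^^ Suc j) xi u = (push ^^ j) xi ?u" by (simp add: push_def[of "(push ^^ j) xi" u])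
   ultimately show ?case unfolding pushN[OF Suc.prems(1)] by simp
  qed
  then show ?thesis using n by blast
 qed
 have "EX Lam. ALL i. regular K0 (Lam i) & (ALL u B. bdd_borel u --> (ALL x. abs (u x) <= B) --> abs (N u - Lam i u) <= 2 * (1 / real (Suc i)) * B)"
  by (intro choice allI approx) simp
 then obtain Lam where Lam: "!!i. regular K0 (Lam i)"
   "!!i u B. bdd_borel u ==> (!!x. abs (u x) <= B) ==> abs (N u - Lam i u) <= 2 * (1 / real (Suc i)) * B" by metis
 have "regular K0 N"
 proof (rule regular_limit[OF Lam(1) Npos])
  fix u :: "'a => real" assume u: "bdd_borel u"
  then obtain B where B: "!!x. abs (u x) <= B" by (auto simp: bdd_borel_def)
  have "(%i. Lam i u - N u) ----> 0"
  proof (rule Lim_null_comparison)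
   show "\<forall>\<^sub>F i in sequentially. norm (Lam i u - N u) <= 2 * (1 / real (Suc i)) * B"
    using Lam(2)[OF u B] by (simp add: abs_minus_commute)
   have "(%i. 2 * (1 / real (Suc i)) * B) ----> 2 * 0 * B" by (intro tendsto_intros LIMSEQ_Suc[OF lim_1_over_n])
   then show "(%i. 2 * (1 / real (Suc i)) * B) ----> 0" by simp
  qed
  then show "(%i. Lam i u) ----> N u" by (simp add: LIM_zero_iff)
 qed
 then show ?thesis unfolding N_def .
qed

end

locale tower = mixing_full_branch_map +
 fixes nu :: "'a measure" and K2 D1 :: real
 assumes nu_prob: "prob_space nu" and nu_sets: "sets nu = sets borel"
  and nu_ac: "absolutely_continuous P nu" and nu_inv: "distr nu borel F = nu"
  and lip_hoelder: "!!x y :: 'a. dist x y <= D1 * dist x y powr al" and D1: "D1 >= 0"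
  and K2: "K2 >= 0"
  and orbit: "!!a x y k. a : \<Gamma> ==> x : a ==> y : a ==> k <= R x ==>
   dist ((f ^^ k) x) ((f ^^ k) y) powr al <= K2 * dist (F x) (F y) powr al"
begin

definition N :: "('a => real) => real" where "N u = (LINT x|nu. u x)"

lemma N_regular: "regular K0 N"
 using invariant_regular[OF nu_prob nu_sets nu_ac nu_inv lip_hoelder D1] unfolding N_def[abs_def] .

lemma N_lin: "linear_functional N" by (rule regular_lin[OF N_regular])
lemma N_pos: "positive_functional N" by (rule regular_pos[OF N_regular])

lemma N_one: "N (%_. 1) = 1"
proof -
 interpret prob_space nu by (rule nu_prob)
 show ?thesis by (simp add: N_def prob_space)
qed

lemma nu_measurable: "u : borel ->M M ==> u : nu ->M M"
 using measurable_cong_sets[OF nu_sets refl] by blast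

lemma nu_space: "space nu = UNIV" using sets_eq_imp_space_eq[OF nu_sets] by simp

lemma nu_integrable: "bdd_borel u ==> integrable nu u"
 using bdd_borel_integrable[OF _ prob_space.finite_measure[OF nu_prob] nu_sets] by blast

definition C3 where "C3 = exp (K0 * D) * A0"

lemma C3_nonneg: "0 <= C3" using A0_nonneg by (simp add: C3_def)

lemma N_tail: "N (indicator {x. n < R x}) <= C3 * decay p n"
proof -
 have "N (indicator {x. n < R x}) <= exp (K0 * D) * N (%_. 1) * E (indicator {x. n < R x})"
  by (rule regular_upper[OF N_regular]) (auto intro: bb R_sets)
 also have "E (indicator {x. n < R x}) = measure P {x. n < R x}" by (rule E_indicator[OF R_sets])
 also have "exp (K0 * D) * N (%_. 1) * measure P {x. n < R x} <= exp (K0 * D) * 1 * (A0 * decay p n)"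
  unfolding N_one by (intro mult_left_mono return_tail) auto
 finally show ?thesis by (simp add: C3_def mult_ac)
qed

lemma nu_return_integrable: "integrable nu (%x. real (R x))"
proof -
 interpret nu: prob_space nu by (rule nu_prob)
 have Rm: "R : nu ->M count_space UNIV" by (rule nu_measurable[OF R_borel])
 have "(nn_integral nu (%x. of_nat (R x))) = (\<Sum>n. emeasure nu {x:space nu. n < R x})"
  by (rule nn_integral_nat_function[OF Rm])
 also have "... <= (\<Sum>n. ennreal (C3 * decay p n))"
 proof (rule suminf_le)
  fix n
  have "measure nu {x. n < R x} = N (indicator {x. n < R x})"
   unfolding N_def using nu_sets nu_space by simp
  then show "emeasure nu {x:space nu. n < R x} <= ennreal (C3 * decay p n)"
   using N_tail[of n] by (simp add: nu_space nu.emeasure_eq_measure ennreal_leI)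
 qed auto
 also have "... = ennreal (\<Sum>n. C3 * decay p n)"
  using C3_nonneg p by (intro suminf_ennreal2 summable_mult summable_suc_powr) auto
 also have "... < \<infinity>" by simp
 finally have "(nn_integral nu (%x. of_nat (R x))) < \<infinity>" .
 then show ?thesis using Rm by (intro integrableI_nonneg) (auto simp: ennreal_of_nat_eq_real_of_nat)
qed

text \<open>One of the two times is at least half of the total.\<close>

lemma power_product_bound:
 fixes n i :: nat assumes "0 <= kap" "kap <= p"
 shows "decay kap (n - Suc i) * decay p i
  <= 2 powr kap * decay kap n * decay (p - kap) i"
proof -
 have half: "(real (Suc n) / 2) powr (- kap) = 2 powr kap * decay kap n"
  by (simp add: powr_divide powr_minus field_simps)
 show ?thesis
 proof (cases "real (Suc n) / 2 <= real (Suc i)")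
  case True
  have "decay p i = decay kap i * decay (p - kap) i"
   by (simp add: powr_add[symmetric] del: of_nat_Suc)
  also have "... <= (real (Suc n) / 2) powr (- kap) * decay (p - kap) i"
   using True assms by (intro mult_right_mono powr_mono2') auto
  finally have 1: "decay p i <= (real (Suc n) / 2) powr (- kap) * decay (p - kap) i" .
  have "decay kap (n - Suc i) <= real (Suc (n - Suc i)) powr 0" using assms by (intro powr_mono) auto
  then have "decay kap (n - Suc i) <= 1" by simp
  then have "decay kap (n - Suc i) * decay p i <= 1 * decay p i"
   by (intro mult_right_mono) auto
  also have "1 * decay p i <= (real (Suc n) / 2) powr (- kap) * decay (p - kap) i"
   using 1 by simp
  finally show ?thesis unfolding half .
 next
  case False
  then have i: "real (Suc i) < real (Suc n) / 2" by simp
  then have "real (Suc i) <= real n" by simp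
  then have "Suc i <= n" by (simp only: of_nat_le_iff)
  then have "real (Suc n) / 2 <= real (Suc (n - Suc i))" using i by (simp add: of_nat_diff field_simps)
  then have "decay kap (n - Suc i) <= (real (Suc n) / 2) powr (- kap)"
   using assms by (intro powr_mono2') auto
  moreover have "decay p i <= decay (p - kap) i" using assms by (intro powr_mono) auto
  ultimately show ?thesis unfolding half[symmetric] by (intro mult_mono) auto
 qed
qed

text \<open>Up to normalisation, the integral over the tower with basis \<open>nu\<close> and heights \<open>R\<close>.\<close>

definition T :: "('a => real) => real" where
 "T v = (LINT y|nu. (SUM k<R y. v ((f ^^ k) y)))"

lemma tower_sum_measurable:
 fixes v :: "'a => real"
 assumes "v : borel_measurable borel"
 shows "(%y. SUM k<R y. v ((f ^^ k) y)) : borel_measurable borel"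
proof -
 have "(%y. v ((f ^^ k) y)) : borel_measurable borel" for k
  by (rule measurable_compose[OF funpow_borel assms])
 note m = this
 have "(%y. SUM k<i. v ((f ^^ k) y)) : borel_measurable borel" for i
  by (rule borel_measurable_sum) (rule m)
 then show ?thesis by (rule measurable_compose_countable[OF _ R_borel])
qed

lemma tower_sum_bound:
 fixes v :: "'a => real"
 assumes "!!x. abs (v x) <= B" shows "abs (SUM k<R y. v ((f ^^ k) y)) <= B * real (R y)"
proof -
 have "abs (SUM k<R y. v ((f ^^ k) y)) <= (SUM k<R y. B)" by (intro order.trans[OF sum_abs] sum_mono assms)
 then show ?thesis by (simp add: mult.commute)
qed

lemma tower_sum_integrable:
 assumes "bdd_borel v"
 shows "integrable nu (%y. SUM k<R y. v ((f ^^ k) y))"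
proof -
 obtain B where B: "!!x. abs (v x) <= B" using assms by (auto simp: bdd_borel_def)
 have B0: "B >= 0" using B[of undefined] by linarith
 show ?thesis
 proof (rule Bochner_Integration.integrable_bound[of _ "%y. B * real (R y)"])
  show "integrable nu (%y. B * real (R y))" using nu_return_integrable by auto
  show "(%y. SUM k<R y. v ((f ^^ k) y)) : borel_measurable nu"
   using assms by (intro nu_measurable tower_sum_measurable) (auto simp: bdd_borel_def)
  show "AE y in nu. norm (SUM k<R y. v ((f ^^ k) y)) <= norm (B * real (R y))"
   using tower_sum_bound[of v B] B B0 by (auto intro!: AE_I2)
 qed
qed

lemma T_lin: "bdd_borel u ==> bdd_borel v ==> T (%x. u x + v x) = T u + T v"
 "bdd_borel u ==> T (%x. c * u x) = c * T u"
 using tower_sum_integrable[of u] tower_sum_integrable[of v]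
 by (simp_all add: T_def sum.distrib sum_distrib_left[symmetric])

text \<open>The tower is cut by the time \<open>Suc i\<close> until the next return. The weight \<open>g\<close> read at that level and pushed to the basis
gives a regular functional whose mass is controlled by the tail of the return time, and \<open>n - Suc i\<close> iterations are left
for equidistribution; levels with \<open>Suc i > n\<close> are bounded trivially. Summing over \<open>i\<close> convolves the tail with the rate.\<close>

lemma component_bound:
 assumes kap: "1 <= kap" "kap < p - 1"
  and eq: "!!Lam n. regular K0 Lam ==>
    abs (Lam (%x. psi ((f ^^ n) x)) - l * Lam (%_. 1)) <= C * Lam (%_. 1) * decay kap n"
  and C: "C >= 1" "abs l <= C" and psi: "bdd_borel psi" "!!x. abs (psi x) <= 1"
  and g: "bdd_borel g" "!!x. 0 <= g x" "!!x. g x <= G"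
  and gL: "!!a x y k. a : \<Gamma> ==> x : a ==> y : a ==> k <= R x ==>
   g ((f ^^ k) x) <= exp (K * th * dist (F x) (F y) powr al) * g ((f ^^ k) y)"
 shows "abs (T (%x. g x * (psi ((f ^^ n) x) - l)))
  <= (1 + C) * G * C3 * 2 powr kap * (\<Sum>i. decay (p - kap) i) * decay kap n"
proof -
 have gb: "bdd_borel (%x. u ((f ^^ (R x - Suc i)) x))" if "bdd_borel u" for i and u :: "'a => real"
  using bdd_borel_comp[OF that measurable_compose_countable[OF funpow_borel R_borel], of "%r. r - Suc i"] .
 have G0: "G >= 0" using g(2,3)[of undefined] by linarith
 let ?e = "%j. decay kap j"
 define v where "v x = g x * (psi ((f ^^ n) x) - l)" for x
 have vb: "bdd_borel v" unfolding v_def by (intro bb bdd_borel_comp[OF psi(1) funpow_borel] g)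
 have vB: "abs (v x) <= (1 + C) * G" for x
  unfolding v_def abs_mult mult.commute[of "1 + C"] using g(2,3)[of x] psi(2)[of "(f ^^ n) x"] C(2) G0 by (intro mult_mono) auto
 define c where "c i = N (%x. indicator {x. i < R x} x * v ((f ^^ (R x - Suc i)) x))" for i
 have comp: "abs (c i) <= (1 + C) * G * N (indicator {x. i < R x}) * ?e (n - Suc i)" for i
 proof (cases "Suc i <= n")
  case True
  define Psi where "Psi u = N (%x. indicator {x. i < R x} x * (g ((f ^^ (R x - Suc i)) x) * u (F x)))" for u
  have "regular (K0 * th + K * th + K) (%u. N (%x. indicator (\<Union>{a : \<Gamma>. a \<subseteq> {x. i < R x}}) x * (g ((f ^^ (R x - Suc i)) x) * u (F x))))"
  proof (rule regular_push[OF N_regular])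
   fix a x y assume a: "a : {a : \<Gamma>. a \<subseteq> {x. i < R x}}" and xy: "x : a" "y : a"
   then have "R y = R x" using R_const by auto
   then show "g ((f ^^ (R x - Suc i)) x) <= exp (K * th * dist (F x) (F y) powr al) * g ((f ^^ (R y - Suc i)) y)"
    using a xy gL[of a x y "R x - Suc i"] by simp
  qed (use K0_pos K th g gb in auto)
  then have reg: "regular K0 Psi" using R_eq_union[of "%r. i < r", symmetric] by (simp add: K0_weight Psi_def[abs_def])
  have "Psi (%_. 1) <= N (%x. G * indicator {x. i < R x} x)" unfolding Psi_def
  proof (rule pos_mono[OF N_pos])
   show "indicator {x. i < R x} x * (g ((f ^^ (R x - Suc i)) x) * 1) <= G * indicator {x. i < R x} x" for x
    using g(3) by (auto simp: indicator_def)
  qed (intro bb gb g R_sets)+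
  also have "... = G * N (indicator {x. i < R x})" by (intro lin_cmult[OF N_lin] bb R_sets)
  finally have Psi1: "Psi (%_. 1) <= G * N (indicator {x. i < R x})" .
  have Psi0: "0 <= Psi (%_. 1)" by (rule pos_nonneg[OF regular_pos[OF reg]]) (auto intro: bb)
  have "(f ^^ n) ((f ^^ (R x - Suc i)) x) = (f ^^ (n - Suc i)) (F x)" if "i < R x" for x
  proof -
   have "n + (R x - Suc i) = n - Suc i + R x" using True that by simp
   then show ?thesis unfolding F_def by (metis comp_apply funpow_add)
  qed
  then have "c i = N (%x. indicator {x. i < R x} x * (g ((f ^^ (R x - Suc i)) x) * psi ((f ^^ (n - Suc i)) (F x)))
    - l * (indicator {x. i < R x} x * (g ((f ^^ (R x - Suc i)) x) * 1)))"
   unfolding c_def v_def by (intro arg_cong[of _ _ N] ext) (simp add: indicator_def algebra_simps)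
  also have "... = Psi (%x. psi ((f ^^ (n - Suc i)) x)) - l * Psi (%_. 1)"
   unfolding Psi_def
   by (subst lin_diff[OF N_lin], (intro bb bdd_borel_comp[OF psi(1)] measurable_compose[OF F_borel funpow_borel] gb g R_sets)+,
     subst lin_cmult[OF N_lin], (intro bb gb g R_sets)+) simp
  also have "abs ... <= C * Psi (%_. 1) * ?e (n - Suc i)" by (rule eq[OF reg])
  also have "... <= (1 + C) * (G * N (indicator {x. i < R x})) * ?e (n - Suc i)"
   using Psi0 Psi1 C by (intro mult_right_mono mult_mono) auto
  finally show ?thesis by (simp add: mult.assoc)
 next
  case False
  have "abs (c i) <= N (%x. ((1 + C) * G) * indicator {x. i < R x} x)"
   unfolding c_def
  proof (rule pos_abs_le[OF N_pos])
   show "abs (indicator {x. i < R x} x * v ((f ^^ (R x - Suc i)) x)) <= ((1 + C) * G) * indicator {x. i < R x} x" for x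
    using vB by (auto simp: indicator_def)
  qed (intro bb gb vb R_sets)+
  also have "... = (1 + C) * G * N (indicator {x. i < R x})" by (intro lin_cmult[OF N_lin] bb R_sets)
  finally show ?thesis using False by simp
 qed
 define Z where "Z = (\<Sum>i. decay (p - kap) i)"
 have sZ: "summable (%i. decay (p - kap) i)" using kap by (intro summable_suc_powr) auto
 define B where "B = (1 + C) * G * C3 * 2 powr kap * Z * ?e n"
 have part: "abs (SUM i<rho. c i) <= B" for rho
 proof -
  have "abs (SUM i<rho. c i) <= (SUM i<rho. (1 + C) * G * C3 * (2 powr kap * ?e n * decay (p - kap) i))"
  proof (rule order.trans[OF sum_abs sum_mono])
   fix i
   have "abs (c i) <= (1 + C) * G * (C3 * decay p i) * ?e (n - Suc i)"
    using C G0 by (intro order.trans[OF comp] mult_right_mono mult_left_mono N_tail) auto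
   also have "... = (1 + C) * G * C3 * (?e (n - Suc i) * decay p i)" by (simp only: mult_ac)
   also have "... <= (1 + C) * G * C3 * (2 powr kap * ?e n * decay (p - kap) i)"
    using C G0 C3_nonneg kap by (intro mult_left_mono power_product_bound) auto
   finally show "abs (c i) <= (1 + C) * G * C3 * (2 powr kap * ?e n * decay (p - kap) i)" .
  qed
  also have "... = (1 + C) * G * C3 * (2 powr kap * ?e n) * (SUM i<rho. decay (p - kap) i)"
   by (simp only: sum_distrib_left mult.assoc)
  also have "... <= (1 + C) * G * C3 * (2 powr kap * ?e n) * Z"
   unfolding Z_def using C G0 C3_nonneg by (intro mult_left_mono sum_le_suminf sZ) auto
  finally show ?thesis unfolding B_def by (simp add: mult_ac)
 qed
 define s where "s rho y = (SUM i<rho. indicator {x. i < R x} y * v ((f ^^ (R y - Suc i)) y))" for rho y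
 have cs: "(SUM i<rho. c i) = (LINT y|nu. s rho y)" for rho
  unfolding c_def s_def N_def[symmetric] by (rule lin_sum[OF N_lin, symmetric]) (intro bb gb vb R_sets)
 have "(%rho. \<integral>y. s rho y \<partial>nu) ----> (LINT y|nu. (SUM k<R y. v ((f ^^ k) y)))"
 proof (rule integral_dominated_convergence[where w = "%y. (1 + C) * G * real (R y)"])
  show "(%y. SUM k<R y. v ((f ^^ k) y)) : borel_measurable nu" using tower_sum_integrable[OF vb] by auto
  show "integrable nu (%y. (1 + C) * G * real (R y))" using nu_return_integrable by auto
  show "s rho : borel_measurable nu" for rho unfolding s_def[abs_def]
   by (intro borel_measurable_sum borel_measurable_integrable nu_integrable bb gb vb R_sets)
  have s_eq: "s rho y = (SUM i<min rho (R y). v ((f ^^ (R y - Suc i)) y))" for rho y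
   unfolding s_def by (rule sum.mono_neutral_cong_right) (auto simp: indicator_def)
  show "AE y in nu. (%rho. s rho y) ----> (SUM k<R y. v ((f ^^ k) y))"
  proof (rule AE_I2, rule tendsto_eventually)
   fix y show "\<forall>\<^sub>F rho in sequentially. s rho y = (SUM k<R y. v ((f ^^ k) y))"
    using eventually_ge_at_top[of "R y"]
    by eventually_elim (simp add: s_eq min_absorb2 sum.nat_diff_reindex[of "%k. v ((f ^^ k) y)"])
  qed
  show "AE y in nu. norm (s rho y) <= (1 + C) * G * real (R y)" for rho
  proof (rule AE_I2)
   fix y
   have "norm (s rho y) <= (SUM i<min rho (R y). (1 + C) * G)"
    unfolding s_eq real_norm_def by (intro order.trans[OF sum_abs] sum_mono vB)
   also have "... = (1 + C) * G * real (min rho (R y))" by simp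
   also have "... <= (1 + C) * G * real (R y)" using C G0 by (intro mult_left_mono) auto
   finally show "norm (s rho y) <= (1 + C) * G * real (R y)" .
  qed
 qed
 from tendsto_rabs[OF this] have "(%rho. abs (SUM i<rho. c i)) ----> abs (T v)" unfolding cs T_def .
 then have "abs (T v) <= B" by (rule LIMSEQ_le_const2) (use part in auto)
 then show ?thesis unfolding B_def Z_def v_def .
qed

text \<open>Equidistribution needs positive weights with controlled logarithms, so a constant is added to \<open>phi\<close> and treated
separately. The unknown limit \<open>l\<close> cancels because \<open>phi\<close> has mean zero.\<close>

theorem decorrelation:
 assumes kap: "1 <= kap" "kap < p - 1"
  and phi: "bdd_borel phi" "!!x y. abs (phi x - phi y) <= H * dist x y powr al" and mean: "T phi = 0"
 obtains C where "!!psi n. bdd_borel psi ==> (!!x. abs (psi x) <= 1) ==>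
  abs (T (%x. phi x * psi ((f ^^ n) x))) <= C * decay kap n"
proof -
 obtain C where C: "C >= 1" and eq:
  "!!psi. bdd_borel psi ==> (!!x. abs (psi x) <= 1) ==>
   EX l. abs l <= C & (ALL Lam n. regular K0 Lam -->
    abs (Lam (%x. psi ((f ^^ n) x)) - l * Lam (%_. 1)) <= C * Lam (%_. 1) * decay kap n)"
  using equidistribution[OF kap] by blast
 obtain B where B: "!!x. abs (phi x) <= B" using phi by (auto simp: bdd_borel_def)
 have B0: "B >= 0" using B[of undefined] by linarith
 have Kth: "K * th > 0" using K th by simp
 define m0 where "m0 = abs H * K2 / (K * th) + 1"
 have "0 <= abs H * K2 / (K * th)" using K2 Kth by (intro divide_nonneg_pos mult_nonneg_nonneg) auto
 then have m0: "m0 > 0" "abs H * K2 <= m0 * (K * th)"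
 proof -
  assume "0 <= abs H * K2 / (K * th)"
  then show "m0 > 0" unfolding m0_def by linarith
  have "abs H * K2 / (K * th) * (K * th) = abs H * K2" using Kth by (metis less_irrefl nonzero_eq_divide_eq)
  then have "m0 * (K * th) = abs H * K2 + K * th" unfolding m0_def by (simp only: distrib_right mult_1)
  then show "abs H * K2 <= m0 * (K * th)" using Kth by linarith
 qed
 define c where "c = B + m0"
 have c0: "c > 0" using B0 m0 by (simp add: c_def)
 define g where "g x = phi x + c" for x
 have gm: "m0 <= g x" for x using B[of x] by (simp add: g_def c_def)
 have gG: "g x <= B + c" for x using B[of x] by (simp add: g_def)
 have gb: "bdd_borel g" unfolding g_def by (intro bb phi)
 have gL: "g ((f ^^ k) x) <= exp (K * th * dist (F x) (F y) powr al) * g ((f ^^ k) y)"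
  if a: "a : \<Gamma>" "x : a" "y : a" "k <= R x" for a x y k
 proof -
  let ?d = "dist (F x) (F y) powr al"
  have "g ((f ^^ k) x) - g ((f ^^ k) y) <= H * dist ((f ^^ k) x) ((f ^^ k) y) powr al"
   using phi(2)[of "(f ^^ k) x" "(f ^^ k) y"] by (simp add: g_def)
  also have "... <= abs H * (K2 * ?d)" by (intro mult_mono orbit[OF a]) auto
  also have "... = (abs H * K2) * ?d" by simp
  also have "... <= (m0 * (K * th)) * ?d" using m0 by (intro mult_right_mono) auto
  also have "... = m0 * (K * th * ?d)" by simp
  also have "... <= g ((f ^^ k) y) * (K * th * ?d)" using gm Kth by (intro mult_right_mono) auto
  finally have "g ((f ^^ k) x) <= (1 + K * th * ?d) * g ((f ^^ k) y)" by (simp add: algebra_simps)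
  also have "... <= exp (K * th * ?d) * g ((f ^^ k) y)"
   using order.trans[OF less_imp_le[OF m0(1)] gm] by (intro mult_right_mono exp_ge_add_one_self) auto
  finally show ?thesis .
 qed
 define M where "M = (1 + C) * C3 * 2 powr kap * (\<Sum>i. decay (p - kap) i)"
 show thesis
 proof (rule that[of "(B + c) * M + c * M"])
  fix psi :: "'a => real" and n
  assume psi: "bdd_borel psi" "!!x. abs (psi x) <= 1"
  obtain l where l: "abs l <= C" and ev: "!!Lam n. regular K0 Lam ==>
    abs (Lam (%x. psi ((f ^^ n) x)) - l * Lam (%_. 1)) <= C * Lam (%_. 1) * decay kap n"
   using eq[OF psi] by blast
  have b: "bdd_borel (%x. psi ((f ^^ n) x))" by (rule bdd_borel_comp[OF psi(1) funpow_borel])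
  have 1: "abs (T (%x. g x * (psi ((f ^^ n) x) - l))) <= (B + c) * M * decay kap n"
   using component_bound[OF kap ev C l psi gb _ gG gL, where n = n] gm m0 by (simp add: M_def mult_ac less_imp_le order.trans[OF _ gm])
  have 2: "abs (T (%x. c * (psi ((f ^^ n) x) - l))) <= c * M * decay kap n"
  proof -
   have "c <= exp (K * th * dist (F x) (F y) powr al) * c" for x y
   proof -
    have "1 <= exp (K * th * dist (F x) (F y) powr al)" using Kth by (simp only: one_le_exp_iff) simp
    then show ?thesis using c0 by (simp only: mult_le_cancel_right1) simp
   qed
   then have "abs (T (%x. c * (psi ((f ^^ n) x) - l)))
     <= (1 + C) * c * C3 * 2 powr kap * (\<Sum>i. decay (p - kap) i) * decay kap n"
    using c0 by (intro component_bound[OF kap ev C l psi bdd_borel_const]) auto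
   then show ?thesis by (simp add: M_def mult_ac)
  qed
  have "T (%x. phi x * psi ((f ^^ n) x)) = T (%x. (g x * (psi ((f ^^ n) x) - l) + (- 1) * (c * (psi ((f ^^ n) x) - l))) + l * phi x)"
   unfolding g_def by (intro arg_cong[of _ _ T]) (auto simp: algebra_simps)
  also have "... = (T (%x. g x * (psi ((f ^^ n) x) - l)) + (- 1) * T (%x. c * (psi ((f ^^ n) x) - l))) + l * T phi"
   by (subst T_lin(1), (intro bb b gb phi)+, subst T_lin(1), (intro bb b gb phi)+, subst T_lin(2), (intro bb b gb phi)+, subst T_lin(2), (intro bb b gb phi)+) (rule refl)
  finally have "T (%x. phi x * psi ((f ^^ n) x)) = T (%x. g x * (psi ((f ^^ n) x) - l)) - T (%x. c * (psi ((f ^^ n) x) - l))"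
   using mean by simp
  then show "abs (T (%x. phi x * psi ((f ^^ n) x))) <= ((B + c) * M + c * M) * decay kap n"
   unfolding distrib_right[of "(B + c) * M" "c * M"] using 1 2 by linarith
 qed
qed

end

section \<open>The invariant probability of the map\<close>

context tower
begin

definition mean_return :: real where "mean_return = (LINT y|nu. real (R y))"

lemma nu_AE: "AE x in nu. R x >= 1"
proof -
 have "AE x in nu. x : \<Union>\<Gamma>"
  by (rule absolutely_continuous_AE[OF _ nu_ac part(4)]) (simp add: nu_sets sets_P)
 then show ?thesis by eventually_elim (rule R_pos)
qed

lemma mean_return_pos: "mean_return > 0"
proof -
 interpret nu: prob_space nu by (rule nu_prob)
 have "1 = (LINT y|nu. (1 :: real))" by (simp add: nu.prob_space)
 also have "... <= mean_return"
  unfolding mean_return_def by (rule integral_mono_AE) (use nu_AE nu_return_integrable in auto)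
 finally show ?thesis by linarith
qed

lemma nn_mean_return: "(nn_integral nu (%y. of_nat (R y))) = ennreal mean_return"
proof -
 have "(nn_integral nu (%y. of_nat (R y))) = (nn_integral nu (%y. ennreal (real (R y))))" by (simp add: ennreal_of_nat_eq_real_of_nat)
 also have "... = ennreal mean_return" unfolding mean_return_def using nu_return_integrable by (intro nn_integral_eq_integral) auto
 finally show ?thesis .
qed

text \<open>The image under \<open>(f ^^ n) y\<close> of the part \<open>n < R y\<close> of the product of counting measure and \<open>nu\<close>, a genuine measure by construction; up to the
normalisation it is the tower measure.\<close>

definition flow_measure :: "'a measure" where
 "flow_measure = distr (density (count_space UNIV \<Otimes>\<^sub>M nu) (%p. indicator {p. fst p < R (snd p)} p)) borel (%p. (f ^^ fst p) (snd p))"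

lemma nn_integral_flow:
 assumes g: "g : borel_measurable borel"
 shows "(nn_integral flow_measure (%x. g x)) = (nn_integral nu (%y. (SUM k<R y. g ((f ^^ k) y))))"
  and "(nn_integral flow_measure (%x. g x)) = (\<Sum>n. \<integral>\<^sup>+y. indicator {y. n < R y} y * g ((f ^^ n) y) \<partial>nu)"
proof -
 interpret nu: prob_space nu by (rule nu_prob)
 have m1 [measurable]: "(%p. (f ^^ fst p) (snd p)) : count_space UNIV \<Otimes>\<^sub>M nu ->M borel"
  by (rule measurable_pair_measure_countable1) (auto intro: nu_measurable funpow_borel)
 have gm: "(%y. g ((f ^^ n) y)) : borel_measurable nu" for n
  by (rule nu_measurable[OF measurable_compose[OF funpow_borel g]])
 have m2 [measurable]: "(%p. g ((f ^^ fst p) (snd p))) : borel_measurable (count_space UNIV \<Otimes>\<^sub>M nu)"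
  by (rule measurable_pair_measure_countable1) (auto intro: gm)
 have im: "indicator {y. n < R y} : borel_measurable nu" for n
  by (intro borel_measurable_indicator) (use R_sets[of "%r. n < r"] nu_sets in simp)
 have m3 [measurable]: "(%p. indicator {p. fst p < R (snd p)} p :: ennreal) : borel_measurable (count_space UNIV \<Otimes>\<^sub>M nu)"
 proof (rule measurable_pair_measure_countable1)
  fix n :: nat
  have "(%y. indicator {p. fst p < R (snd p)} (n, y)) = (indicator {y. n < R y} :: 'a => ennreal)" by (auto simp: indicator_def)
  then show "(%y. indicator {p. fst p < R (snd p)} (n, y) :: ennreal) : borel_measurable nu" using im by simp
 qed simp
 have "(nn_integral flow_measure (%x. g x)) = (\<integral>\<^sup>+p. indicator {p. fst p < R (snd p)} p * g ((f ^^ fst p) (snd p)) \<partial>(count_space UNIV \<Otimes>\<^sub>M nu))"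
  unfolding flow_measure_def using g by (subst nn_integral_distr) (auto simp: nn_integral_density)
 also have "... = (\<integral>\<^sup>+n. \<integral>\<^sup>+y. indicator {y. n < R y} y * g ((f ^^ n) y) \<partial>nu \<partial>count_space UNIV)"
  by (subst nu.nn_integral_fst[symmetric]) (measurable, simp add: indicator_def)
 also have "... = (\<Sum>n. \<integral>\<^sup>+y. indicator {y. n < R y} y * g ((f ^^ n) y) \<partial>nu)" by (rule nn_integral_count_space_nat)
 finally show 2: "(nn_integral flow_measure (%x. g x)) = (\<Sum>n. \<integral>\<^sup>+y. indicator {y. n < R y} y * g ((f ^^ n) y) \<partial>nu)" .
 also have "... = (nn_integral nu (%y. (\<Sum>n. indicator {y. n < R y} y * g ((f ^^ n) y))))"
  by (rule nn_integral_suminf[symmetric]) (intro borel_measurable_times_ennreal im gm)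
 also have "... = (nn_integral nu (%y. (SUM k<R y. g ((f ^^ k) y))))"
 proof (intro nn_integral_cong)
  fix y
  have "(\<Sum>n. indicator {y. n < R y} y * g ((f ^^ n) y)) = (SUM n:{..<R y}. indicator {y. n < R y} y * g ((f ^^ n) y))"
   by (rule suminf_finite) auto
  then show "(\<Sum>n. indicator {y. n < R y} y * g ((f ^^ n) y)) = (SUM k<R y. g ((f ^^ k) y))" by simp
 qed
 finally show "(nn_integral flow_measure (%x. g x)) = (nn_integral nu (%y. (SUM k<R y. g ((f ^^ k) y))))" .
qed

lemma tower_measure_flow: "tower_measure f R nu = scale_measure (ennreal (1 / mean_return)) flow_measure"
proof -
 have eq: "(\<Sum>n. emeasure (distr (restrict_space nu {y:space nu. n < R y}) borel (f ^^ n)) A) / (nn_integral nu (%y. of_nat (R y)))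
   = emeasure (scale_measure (ennreal (1 / mean_return)) flow_measure) A" if A: "A : sets borel" for A
 proof -
  have Rs: "{y. n < R y} : sets nu" for n using R_sets[of "%r. n < r"] nu_sets by simp
  have "emeasure (distr (restrict_space nu {y:space nu. n < R y}) borel (f ^^ n)) A
    = (nn_integral nu (%y. indicator {y. n < R y} y * indicator A ((f ^^ n) y)))" for n
  proof -
   have fm: "f ^^ n : nu ->M borel" by (rule nu_measurable[OF funpow_borel])
   have pre: "(f ^^ n) -` A \<inter> {y. n < R y} : sets nu" using measurable_sets[OF fm A] Rs[of n] by (simp add: nu_space)
   have "emeasure (distr (restrict_space nu {y:space nu. n < R y}) borel (f ^^ n)) A
     = emeasure (restrict_space nu {y. n < R y}) ((f ^^ n) -` A \<inter> {y. n < R y})"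
    using A fm by (subst emeasure_distr) (auto simp: nu_space space_restrict_space intro: measurable_restrict_space1)
   also have "... = emeasure nu ((f ^^ n) -` A \<inter> {y. n < R y})"
    by (rule emeasure_restrict_space) (use Rs in "auto simp: nu_space")
   also have "... = (nn_integral nu (%y. indicator ((f ^^ n) -` A \<inter> {y. n < R y}) y))" using pre by simp
   also have "... = (nn_integral nu (%y. indicator {y. n < R y} y * indicator A ((f ^^ n) y)))"
    by (intro nn_integral_cong) (auto simp: indicator_def)
   finally show ?thesis .
  qed
  then have "(\<Sum>n. emeasure (distr (restrict_space nu {y:space nu. n < R y}) borel (f ^^ n)) A) = (nn_integral flow_measure (%x. indicator A x))"
   using A by (subst nn_integral_flow(2)) auto
  also have "... = emeasure flow_measure A" using A by (intro nn_integral_indicator) (simp add: flow_measure_def)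
  finally show ?thesis using mean_return_pos
   by (simp add: nn_mean_return divide_ennreal_def inverse_ennreal inverse_eq_divide mult.commute)
 qed
 have "tower_measure f R nu = measure_of UNIV (sets borel) (emeasure (scale_measure (ennreal (1 / mean_return)) flow_measure))"
  unfolding tower_measure_def
 proof (rule measure_of_eq)
  fix A assume "A : sigma_sets (UNIV :: 'a set) (sets borel)"
  then have "A : sets borel" using sets.sigma_sets_eq[of "borel :: 'a measure"] by simp
  then show "(\<Sum>n. emeasure (distr (restrict_space nu {y:space nu. n < R y}) borel (f ^^ n)) A) / (nn_integral nu (%y. of_nat (R y)))
   = emeasure (scale_measure (ennreal (1 / mean_return)) flow_measure) A" by (rule eq)
 qed simp
 also have "... = scale_measure (ennreal (1 / mean_return)) flow_measure"
  using measure_of_of_measure[of "scale_measure (ennreal (1 / mean_return)) flow_measure"] by (simp add: flow_measure_def space_scale_measure)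
 finally show ?thesis .
qed

abbreviation "mu \<equiv> tower_measure f R nu"

lemma mu_sets: "sets mu = sets borel" by (simp add: tower_measure_flow flow_measure_def)

lemma mu_prob: "prob_space mu"
proof (rule prob_spaceI)
 have "emeasure mu (space mu) = ennreal (1 / mean_return) * (nn_integral flow_measure (%x. 1))"
  by (simp add: tower_measure_flow space_scale_measure)
 also have "(nn_integral flow_measure (%x. 1)) = ennreal mean_return" by (subst nn_integral_flow(1)) (simp_all add: nn_mean_return)
 also have "ennreal (1 / mean_return) * ennreal mean_return = 1" using mean_return_pos by (simp add: ennreal_mult[symmetric])
 finally show "emeasure mu (space mu) = 1" .
qed

lemma mu_integral_nonneg:
 assumes u: "bdd_borel u" "!!x. 0 <= u x"
 shows "(LINT x|mu. u x) = T u / mean_return"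
proof -
 have um: "u : borel_measurable borel" using u by (simp add: bdd_borel_def)
 have um': "(%x. ennreal (u x)) : borel_measurable flow_measure"
  using um by (simp add: flow_measure_def)
 have "(LINT x|mu. u x) = enn2real (nn_integral mu (%x. ennreal (u x)))"
  using u um mu_sets by (intro integral_eq_nn_integral) (auto cong: measurable_cong_sets)
 also have "(nn_integral mu (%x. ennreal (u x))) = ennreal (1 / mean_return) * (nn_integral flow_measure (%x. ennreal (u x)))"
  unfolding tower_measure_flow by (rule nn_integral_scale_measure[OF um'])
 also have "(nn_integral flow_measure (%x. ennreal (u x))) = (nn_integral nu (%y. ennreal (SUM k<R y. u ((f ^^ k) y))))"
  using um u by (subst nn_integral_flow(1)) (auto intro!: nn_integral_cong simp: sum_ennreal)
 also have "... = ennreal (T u)" unfolding T_def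
  by (rule nn_integral_eq_integral[OF tower_sum_integrable[OF u(1)]]) (use u in "auto intro!: AE_I2 sum_nonneg")
 also have "ennreal (1 / mean_return) * ennreal (T u) = ennreal (T u / mean_return)"
  using mean_return_pos u unfolding T_def by (subst ennreal_mult[symmetric]) (auto intro!: integral_nonneg_AE AE_I2 sum_nonneg)
 also have "enn2real ... = T u / mean_return"
  using mean_return_pos u unfolding T_def by (intro enn2real_ennreal divide_nonneg_pos integral_nonneg_AE AE_I2 sum_nonneg) auto
 finally show ?thesis .
qed

lemma mu_integrable: "bdd_borel u ==> integrable mu u"
 using bdd_borel_integrable[OF _ prob_space.finite_measure[OF mu_prob] mu_sets] by blast

lemma mu_integral:
 assumes u: "bdd_borel u"
 shows "(LINT x|mu. u x) = T u / mean_return"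
proof -
 interpret mu: prob_space mu by (rule mu_prob)
 obtain B where B: "!!x. abs (u x) <= B" using u by (auto simp: bdd_borel_def)
 have B0: "B >= 0" using order.trans[OF abs_ge_zero B] .
 have bb1: "bdd_borel (%x. u x + B)" by (intro bb u)
 have nn: "0 <= u x + B" for x using B[of x] by linarith
 have "(LINT x|mu. u x + B) = T (%x. u x + B) / mean_return" by (rule mu_integral_nonneg[OF bb1 nn])
 also have "T (%x. u x + B) = T u + T (%_. B)" by (rule T_lin(1)[OF u bdd_borel_const])
 also have "T (%_. B) = B * mean_return" by (simp add: T_def mean_return_def mult.commute)
 also have "(T u + B * mean_return) / mean_return = T u / mean_return + B" using mean_return_pos by (simp add: add_divide_distrib)
 also have "(LINT x|mu. u x + B) = (LINT x|mu. u x) + B" using mu_integrable[OF u] by (simp add: mu.prob_space)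
 finally show ?thesis by simp
qed

text \<open>Applying \<open>f\<close> shifts each column of the tower by one; the boundary terms \<open>u (F y) - u y\<close> integrate to zero.\<close>

lemma T_invariant:
 assumes u: "bdd_borel u"
 shows "T (%x. u (f x)) = T u"
proof -
 have uf: "bdd_borel (%x. u (f x))" by (rule bdd_borel_comp[OF u f_borel])
 have uF: "bdd_borel (%x. u (F x))" by (rule bdd_borel_comp[OF u F_borel])
 have tele: "(SUM k<n. u (f ((f ^^ k) y))) = (SUM k<n. u ((f ^^ k) y)) + (u ((f ^^ n) y) - u y)" for n y
  by (induction n) auto
 have inv: "(LINT y|nu. u (F y)) = (LINT y|nu. u y)"
 proof -
  have "(\<integral>y. u y \<partial>(distr nu borel F)) = (LINT y|nu. u (F y))"
   using u by (intro integral_distr nu_measurable F_borel) (simp add: bdd_borel_def)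
  then show ?thesis by (simp add: nu_inv)
 qed
 have "T (%x. u (f x)) = (LINT y|nu. (SUM k<R y. u ((f ^^ k) y)) + (u (F y) - u y))"
  unfolding T_def tele F_def ..
 also have "... = T u + ((LINT y|nu. u (F y)) - (LINT y|nu. u y))"
  using tower_sum_integrable[OF u] nu_integrable[OF u] nu_integrable[OF uF] by (simp add: T_def)
 finally show ?thesis by (simp add: inv)
qed

lemma mu_invariant: "distr mu borel f = mu"
proof (rule measure_eqI)
 interpret mu: prob_space mu by (rule mu_prob)
 show "sets (distr mu borel f) = sets mu" by (simp add: mu_sets)
 fix A assume "A : sets (distr mu borel f)"
 then have A: "A : sets borel" by simp
 have fm: "f : mu ->M borel" using f_borel measurable_cong_sets[OF mu_sets refl] by blast
 have bA: "bdd_borel (indicator A)" by (rule bdd_borel_indicator[OF A])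
 have sp: "space mu = UNIV" using sets_eq_imp_space_eq[OF mu_sets] by simp
 have pre: "f -` A : sets mu" using measurable_sets[OF fm A] by (simp add: sp)
 have ind: "indicator (f -` A) x = (indicator A (f x) :: real)" for x by (auto simp: indicator_def)
 have "measure mu (f -` A) = (LINT x|mu. indicator (f -` A) x)" using pre by simp
 also have "... = (LINT x|mu. indicator A (f x))" by (simp only: ind)
 also have "... = T (%x. indicator A (f x)) / mean_return" by (rule mu_integral[OF bdd_borel_comp[OF bA f_borel]])
 also have "... = T (indicator A) / mean_return" by (simp only: T_invariant[OF bA])
 also have "... = (LINT x|mu. indicator A x)" by (rule mu_integral[OF bA, symmetric])
 also have "... = measure mu A" using A mu_sets by simp
 finally show "emeasure (distr mu borel f) A = emeasure mu A"
  using A fm by (subst emeasure_distr) (simp_all add: sp mu.emeasure_eq_measure)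
qed

lemma mu_decorrelation:
 assumes kap: "1 <= kap" "kap < p - 1"
  and phi: "bdd_borel phi" "!!x y. abs (phi x - phi y) <= H * dist x y powr al" and mean: "(LINT x|mu. phi x) = 0"
 obtains C where "C > 0" "!!psi n. bdd_borel psi ==> (!!x. abs (psi x) <= 1) ==>
  abs (\<integral>x. phi x * psi ((f ^^ n) x) \<partial>mu) <= C * decay kap n"
proof -
 have "T phi = 0" using mean mean_return_pos unfolding mu_integral[OF phi(1)] by simp
 then obtain C where C: "!!psi n. bdd_borel psi ==> (!!x. abs (psi x) <= 1) ==>
  abs (T (%x. phi x * psi ((f ^^ n) x))) <= C * decay kap n"
  using decorrelation[OF kap phi] by blast
 show thesis
 proof (rule that[of "(abs C + 1) / mean_return"])
  show "(abs C + 1) / mean_return > 0" using mean_return_pos by (intro divide_pos_pos) auto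
  fix psi :: "'a => real" and n assume psi: "bdd_borel psi" "!!x. abs (psi x) <= 1"
  have "bdd_borel (%x. phi x * psi ((f ^^ n) x))" by (intro bdd_borel_mult phi(1) bdd_borel_comp[OF psi(1) funpow_borel])
  then have "abs (\<integral>x. phi x * psi ((f ^^ n) x) \<partial>mu) = abs (T (%x. phi x * psi ((f ^^ n) x))) / mean_return"
   using mean_return_pos by (simp add: mu_integral)
  also have "... <= ((abs C + 1) * decay kap n) / mean_return"
  proof (rule divide_right_mono)
   have "C * decay kap n <= (abs C + 1) * decay kap n" by (intro mult_right_mono) auto
   with C[OF psi, of n] show "abs (T (%x. phi x * psi ((f ^^ n) x))) <= (abs C + 1) * decay kap n" by linarith
  qed (use mean_return_pos in simp)
  finally show "abs (\<integral>x. phi x * psi ((f ^^ n) x) \<partial>mu) <= (abs C + 1) / mean_return * decay kap n" by simp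
 qed
qed

text \<open>Loss of memory without rate for merely bounded observables, by approximation with Lipschitz ones in \<open>L1\<close>.\<close>

lemma mu_exact:
 assumes u: "bdd_borel u" and e: "e > 0"
 shows "EX N. ALL n>=N. ALL psi. bdd_borel psi --> (ALL x. abs (psi x) <= 1) -->
   abs (\<integral>x. (u x - (LINT z|mu. u z)) * psi ((f ^^ n) x) \<partial>mu) <= e"
proof -
 interpret mu: prob_space mu by (rule mu_prob)
 interpret borel_finite_measure mu by standard (rule mu_sets)
 obtain g where g: "lipschitz_bounded g" and close: "(LINT x|mu. abs (u x - g x)) < e / 4"
  using approximableD[OF approximable_integrable[OF mu_integrable[OF u]], of "e / 4"] e by auto
 obtain L Bg where L: "!!x y. abs (g x - g y) <= L * dist x y" and Bg: "!!x. abs (g x) <= Bg" using g unfolding lipschitz_bounded_def by blast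
 have gb: "bdd_borel g" unfolding bdd_borel_def using Bg lipschitz_bounded_continuous[OF g] by (auto intro: borel_measurable_continuous_onI)
 define ug where "ug = (LINT z|mu. g z)"
 define uu where "uu = (LINT z|mu. u z)"
 define h where "h x = g x - ug" for x
 have hb: "bdd_borel h" unfolding h_def by (intro bb gb)
 have h0: "(LINT x|mu. h x) = 0" unfolding h_def using mu_integrable[OF gb] by (simp add: mu.prob_space ug_def)
 have hH: "abs (h x - h y) <= (abs L * D1) * dist x y powr al" for x y
 proof -
  have "abs (h x - h y) <= L * dist x y" using L[of x y] by (simp add: h_def)
  also have "... <= abs L * (D1 * dist x y powr al)" by (intro mult_mono lip_hoelder) auto
  finally show ?thesis by simp
 qed
 obtain C where C: "C > 0" "!!psi n. bdd_borel psi ==> (!!x. abs (psi x) <= 1) ==>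
  abs (\<integral>x. h x * psi ((f ^^ n) x) \<partial>mu) <= C * real (Suc n) powr (- 1)"
  using mu_decorrelation[of 1 h "abs L * D1"] p hb hH h0 by auto
 obtain M where M: "2 * C / e < real M" using reals_Archimedean2 by blast
 have "abs (\<integral>x. (u x - uu) * psi ((f ^^ n) x) \<partial>mu) <= e"
  if n: "n >= M" and psi: "bdd_borel psi" "!!x. abs (psi x) <= 1" for n psi
 proof -
  have psin: "bdd_borel (%x. psi ((f ^^ n) x))" by (rule bdd_borel_comp[OF psi(1) funpow_borel])
  have i1: "integrable mu (%x. abs (u x - g x))" using mu_integrable[OF u] mu_integrable[OF gb] by auto
  have ugu: "abs (ug - uu) <= e / 4"
  proof -
   have "uu - ug = (LINT x|mu. u x - g x)" unfolding ug_def uu_def using mu_integrable[OF u] mu_integrable[OF gb] by simp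
   also have "abs ... <= (LINT x|mu. abs (u x - g x))" by (rule integral_abs_bound)
   finally show ?thesis using close by linarith
  qed
  have b1: "bdd_borel (%x. (u x - uu) * psi ((f ^^ n) x))" "bdd_borel (%x. h x * psi ((f ^^ n) x))" by (intro bb u hb psin)+
  have "(LINT x|mu. (u x - uu) * psi ((f ^^ n) x)) - (LINT x|mu. h x * psi ((f ^^ n) x)) = (LINT x|mu. (u x - uu) * psi ((f ^^ n) x) - h x * psi ((f ^^ n) x))"
   by (rule Bochner_Integration.integral_diff[symmetric, OF mu_integrable[OF b1(1)] mu_integrable[OF b1(2)]])
  also have "abs ... <= (LINT x|mu. abs ((u x - uu) * psi ((f ^^ n) x) - h x * psi ((f ^^ n) x)))" by (rule integral_abs_bound)
  also have "... <= (LINT x|mu. abs (u x - g x) + e / 4)"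
  proof (rule integral_mono')
   show "integrable mu (%x. abs (u x - g x) + e / 4)" using i1 by auto
   fix x
   have "(u x - uu) * psi ((f ^^ n) x) - h x * psi ((f ^^ n) x) = ((u x - g x) + (ug - uu)) * psi ((f ^^ n) x)"
    by (simp add: h_def algebra_simps)
   also have "abs ... <= abs ((u x - g x) + (ug - uu)) * 1" unfolding abs_mult by (intro mult_left_mono psi(2)) auto
   also have "abs ((u x - g x) + (ug - uu)) * 1 <= abs (u x - g x) + e / 4"
    unfolding mult_1_right by (rule order.trans[OF abs_triangle_ineq add_left_mono[OF ugu]])
   finally show "abs ((u x - uu) * psi ((f ^^ n) x) - h x * psi ((f ^^ n) x)) <= abs (u x - g x) + e / 4" .
   show "0 <= abs (u x - g x) + e / 4" using e by simp
  qed
  also have "... = (LINT x|mu. abs (u x - g x)) + e / 4" using i1 by (simp add: mu.prob_space)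
  finally have d: "abs ((LINT x|mu. (u x - uu) * psi ((f ^^ n) x)) - (LINT x|mu. h x * psi ((f ^^ n) x))) <= e / 2" using close by linarith
  have "C * real (Suc n) powr (- 1) <= e / 2"
  proof -
   have "2 * C / e < real (Suc n)" using M n by simp
   then show ?thesis using e by (simp add: powr_minus_divide field_simps)
  qed
  then show ?thesis using C(2)[OF psi, of n] d by linarith
 qed
 then show ?thesis unfolding uu_def[symmetric] by blast
qed

end

section \<open>Moments of Birkhoff sums\<close>

lemma deriv_abs_powr_nonzero:
 fixes x s :: real assumes "x ~= 0"
 shows "((%x. abs x powr s) has_real_derivative s * x * abs x powr (s - 2)) (at x)"
proof (cases "x > 0")
 case True
 have "((%x. x powr s) has_real_derivative s * x powr (s - 1)) (at x)" using True by (rule has_real_derivative_powr)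
 moreover have "x powr (s - 1) = x * x powr (s - 2)" using True powr_mult_base[of x "s - 2"] by simp
 ultimately have "((%x. x powr s) has_real_derivative s * x * abs x powr (s - 2)) (at x)" using True by (simp add: mult.assoc)
 then show ?thesis
  by (rule has_field_derivative_transform_within_open[of _ _ _ "{0<..}"]) (use True in auto)
next
 case False
 then have x: "- x > 0" using assms by simp
 have "((%x. x powr s) has_real_derivative s * (- x) powr (s - 1)) (at (- x))" using x by (rule has_real_derivative_powr)
 then have "((%x. (- x) powr s) has_real_derivative (s * (- x) powr (s - 1)) * - 1) (at x)"
  by (rule DERIV_chain2[where g = uminus]) (auto intro!: derivative_eq_intros)
 moreover have "(- x) powr (s - 1) = (- x) * (- x) powr (s - 2)" using x powr_mult_base[of "- x" "s - 2"] by simp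
 ultimately have "((%x. (- x) powr s) has_real_derivative s * x * abs x powr (s - 2)) (at x)" using x by (simp add: mult.assoc)
 then show ?thesis
  by (rule has_field_derivative_transform_within_open[of _ _ _ "{..<0}"]) (use x in auto)
qed

lemma deriv_signed_powr:
 fixes x q :: real assumes q: "q > 0"
 shows "((%x. x * abs x powr q) has_real_derivative (q + 1) * abs x powr q) (at x)"
proof (cases "x = 0")
 case True
 have "((%h. abs h powr q) ---> (abs (0 :: real)) powr q) (at 0)"
  using q by (intro tendsto_powr' tendsto_intros) auto
 then have lim: "((%h. abs h powr q) ---> 0) (at (0 :: real))" by simp
 have "((%h. (h * abs h powr q) / h) ---> 0) (at (0 :: real))"
  by (rule Lim_transform_eventually[OF lim]) (auto simp: eventually_at_filter)
 then show ?thesis using True by (simp add: DERIV_def)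
next
 case False
 have "((%x. x * abs x powr q) has_real_derivative 1 * abs x powr q + (q * x * abs x powr (q - 2)) * x) (at x)"
  by (intro DERIV_mult deriv_abs_powr_nonzero DERIV_ident False)
 moreover have "x * x * abs x powr (q - 2) = abs x powr q"
 proof -
  have "abs x powr q = abs x powr (2 + (q - 2))" by simp
  also have "... = abs x powr 2 * abs x powr (q - 2)" by (rule powr_add)
  also have "abs x powr 2 = x * x" using False by (simp add: powr_numeral power2_eq_square)
  finally show ?thesis by simp
 qed
 ultimately show ?thesis by (simp add: algebra_simps)
qed

lemma deriv_abs_powr:
 fixes x s :: real assumes s: "s > 1"
 shows "((%x. abs x powr s) has_real_derivative s * x * abs x powr (s - 2)) (at x)"
proof (cases "x = 0")
 case True
 have "((%h. abs h powr (s - 1)) ---> (abs (0 :: real)) powr (s - 1)) (at 0)"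
  using s by (intro tendsto_powr' tendsto_intros) auto
 then have lim: "((%h. abs h powr (s - 1)) ---> 0) (at (0 :: real))" by simp
 have "((%h. abs h powr s / h) ---> 0) (at (0 :: real))"
 proof (rule Lim_null_comparison[OF _ lim])
  have "norm (abs h powr s / h) <= abs h powr (s - 1)" if "h ~= 0" for h :: real
   using powr_mult_base[of "abs h" "s - 1"] that by (simp add: abs_mult field_simps)
  then show "\<forall>\<^sub>F h in at (0::real). norm (abs h powr s / h) <= abs h powr (s - 1)"
   by (auto simp: eventually_at_filter)
 qed
 then show ?thesis using True by (simp add: DERIV_def)
qed (rule deriv_abs_powr_nonzero)

lemma powr_sum_le:
 fixes a b s :: real assumes "0 <= a" "0 <= b" "0 <= s"
 shows "(a + b) powr s <= 2 powr s * (a powr s + b powr s)"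
proof -
 have "(a + b) powr s <= (2 * max a b) powr s" using assms by (intro powr_mono2) auto
 also have "... = 2 powr s * (max a b) powr s" using assms by (simp add: powr_mult)
 also have "... <= 2 powr s * (a powr s + b powr s)" by (intro mult_left_mono) (auto simp: max_def)
 finally show ?thesis .
qed

text \<open>The derivative of the \<open>r\<close>-th power of the absolute value.\<close>

definition dpow :: "real => real => real" where "dpow r x = r * (x * abs x powr (r - 2))"

lemma dpow_diff:
 assumes r: "r > 2"
 shows "abs (dpow r (x + y) - dpow r x) <= r * (r - 1) * 2 powr (r - 2) * abs y * (abs x powr (r - 2) + abs y powr (r - 2))"
proof -
 have d: "(dpow r has_real_derivative r * ((r - 1) * abs z powr (r - 2))) (at z)" for z
  using DERIV_cmult[OF deriv_signed_powr[of "r - 2" z], of r] r by (simp add: dpow_def[abs_def])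
 have b: "norm (r * ((r - 1) * abs z powr (r - 2))) <= r * (r - 1) * (2 powr (r - 2) * (abs x powr (r - 2) + abs y powr (r - 2)))"
  if "z : closed_segment x (x + y)" for z
 proof -
  have "abs z <= abs x + abs y" using that by (auto simp: closed_segment_eq_real_ivl split: if_splits)
  then have "abs z powr (r - 2) <= (abs x + abs y) powr (r - 2)" using r by (intro powr_mono2) auto
  also have "... <= 2 powr (r - 2) * (abs x powr (r - 2) + abs y powr (r - 2))" using r by (intro powr_sum_le) auto
  finally have "r * (r - 1) * abs z powr (r - 2) <= r * (r - 1) * (2 powr (r - 2) * (abs x powr (r - 2) + abs y powr (r - 2)))"
   using r by (intro mult_left_mono) auto
  then show ?thesis using r by (simp add: mult.assoc abs_mult)
 qed
 have "norm (dpow r (x + y) - dpow r x) <= r * (r - 1) * (2 powr (r - 2) * (abs x powr (r - 2) + abs y powr (r - 2))) * norm ((x + y) - x)"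
  by (rule field_differentiable_bound[of "closed_segment x (x + y)"])
   (use d b in "auto intro: has_field_derivative_at_within")
 then show ?thesis by (simp add: mult_ac)
qed

lemma pow_taylor:
 assumes r: "r > 2"
 shows "abs ((abs (x + y)) powr r - abs x powr r - y * dpow r x)
  <= r * (r - 1) * 2 powr (r - 2) * y^2 * (abs x powr (r - 2) + abs y powr (r - 2))"
proof -
 let ?C = "r * (r - 1) * 2 powr (r - 2) * abs y * (abs x powr (r - 2) + abs y powr (r - 2))"
 have d: "((%z. abs z powr r - z * dpow r x) has_real_derivative dpow r z - dpow r x) (at z)" for z
  using DERIV_diff[OF deriv_abs_powr[of r z] DERIV_cmult_right[OF DERIV_ident, of "dpow r x"]] r
  by (simp add: dpow_def mult.assoc)
 have b: "norm (dpow r z - dpow r x) <= ?C" if "z : closed_segment x (x + y)" for z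
 proof -
  have yz: "abs (z - x) <= abs y" using that by (auto simp: closed_segment_eq_real_ivl split: if_splits)
  have "abs (dpow r (x + (z - x)) - dpow r x) <= r * (r - 1) * 2 powr (r - 2) * abs (z - x) * (abs x powr (r - 2) + abs (z - x) powr (r - 2))"
   by (rule dpow_diff[OF r])
  also have "... <= ?C" using yz r by (intro mult_mono mult_left_mono add_mono powr_mono2) auto
  finally show ?thesis by simp
 qed
 have "norm ((abs (x + y) powr r - (x + y) * dpow r x) - (abs x powr r - x * dpow r x)) <= ?C * norm ((x + y) - x)"
  by (rule field_differentiable_bound[of "closed_segment x (x + y)"])
   (use d b in "auto intro: has_field_derivative_at_within")
 also have "?C * norm ((x + y) - x) = r * (r - 1) * 2 powr (r - 2) * (abs y * abs y) * (abs x powr (r - 2) + abs y powr (r - 2))"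
  by (simp add: mult_ac)
 also have "abs y * abs y = y^2" by (simp add: power2_eq_square)
 also have "(abs (x + y) powr r - (x + y) * dpow r x) - (abs x powr r - x * dpow r x) = abs (x + y) powr r - abs x powr r - y * dpow r x"
  by (simp add: algebra_simps)
 finally show ?thesis by simp
qed

locale decorrelated = prob_space mu for mu :: "'a::polish_space measure" +
 fixes f :: "'a => 'a" and phi :: "'a => real" and B A kap :: real
 assumes sets_mu: "sets mu = sets borel" and f_meas [measurable]: "f : borel ->M borel"
  and inv: "distr mu borel f = mu"
  and phi_meas [measurable]: "phi : borel_measurable borel" and phi_bound: "!!x. abs (phi x) <= B" and B: "B > 0"
  and A: "A > 0" and kap: "kap > 1"
  and decor: "!!psi n. bdd_borel psi ==> (!!x. abs (psi x) <= 1) ==>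
   abs (\<integral>x. phi x * psi ((f ^^ n) x) \<partial>mu) <= A * decay kap n"
  and mean: "(LINT x|mu. phi x) = 0"
begin

lemma mu_meas: "u : borel ->M M ==> u : mu ->M M"
 using measurable_cong_sets[OF sets_mu refl] by blast

lemma mu_space: "space mu = UNIV" using sets_eq_imp_space_eq[OF sets_mu] by simp

lemma fpow_meas [measurable]: "f ^^ n : borel ->M borel"
 by (induction n) (auto simp: comp_def)

lemma bb_int: "bdd_borel u ==> integrable mu u"
 by (rule bdd_borel_integrable[OF _ finite_measure_axioms sets_mu])

lemma bb_comp: "bdd_borel u ==> bdd_borel (%x. u ((f ^^ n) x))"
 by (rule bdd_borel_comp[OF _ fpow_meas])

lemma phi_bb: "bdd_borel phi" using phi_bound by (auto simp: bdd_borel_def)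

lemma distr_pow: "distr mu borel (f ^^ n) = mu"
proof (induction n)
 case 0
 show ?case using distr_id2[of borel mu] sets_mu by (simp add: id_def)
next
 case (Suc n)
 have "distr mu borel (f ^^ Suc n) = distr (distr mu borel (f ^^ n)) borel f"
  by (subst distr_distr) (auto simp: comp_def mu_meas)
 then show ?case using Suc inv by (simp add: comp_def)
qed

lemma invariant:
 fixes u :: "'a => 'b::{banach, second_countable_topology}"
 assumes "u : borel_measurable borel"
 shows "(LINT x|mu. u ((f ^^ n) x)) = (LINT x|mu. u x)"
proof -
 have "(LINT x|mu. u x) = (\<integral>x. u x \<partial>(distr mu borel (f ^^ n)))" by (simp add: distr_pow)
 also have "... = (LINT x|mu. u ((f ^^ n) x))" using assms by (intro integral_distr) (auto simp: mu_meas)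
 finally show ?thesis by simp
qed

abbreviation S where "S \<equiv> birkhoff_sum f phi"

lemma S_0: "S 0 x = 0" by (simp add: birkhoff_sum_def)
lemma S_Suc: "S (Suc n) x = phi x + S n (f x)"
 by (simp add: birkhoff_sum_def lessThan_Suc_atMost[symmetric] sum.lessThan_Suc_shift funpow_swap1 del: sum.lessThan_Suc)

lemma S_bb: "bdd_borel (S n)"
 unfolding birkhoff_sum_def by (intro bb bb_comp phi_bb)

lemma S_meas [measurable]: "S n : borel_measurable borel" using S_bb by (simp add: bdd_borel_def)

lemma powr_bb:
 assumes "bdd_borel u" "s >= 0" shows "bdd_borel (%x. abs (u x) powr s)"
proof -
 obtain C where C: "!!x. abs (u x) <= C" and [measurable]: "u : borel_measurable borel" using assms by (auto simp: bdd_borel_def)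
 have "abs ((abs (u x)) powr s) <= C powr s" for x using C[of x] assms by (simp add: powr_mono2)
 then show ?thesis unfolding bdd_borel_def by auto
qed

lemma dpow_bb:
 assumes "bdd_borel u" "r > 2" shows "bdd_borel (%x. dpow r (u x))"
 unfolding dpow_def using assms by (intro bb powr_bb) auto

definition a where "a n = A * decay kap n"

lemma a_pos: "a n > 0" using A by (simp add: a_def)

text \<open>Truncation of \<open>zet\<close> at the level that balances both errors trades integrability of \<open>zet\<close> for part of the rate.\<close>

lemma decorrelation_interpolated:
 assumes th: "th > 1" and z: "bdd_borel zet" and V: "(LINT x|mu. abs (zet x) powr th) <= V" "V > 0"
 shows "abs (\<integral>x. phi x * zet ((f ^^ n) x) \<partial>mu) <= (1 + B) * a n powr (1 - 1 / th) * V powr (1 / th)"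
proof -
 define Lam where "Lam = (V / a n) powr (1 / th)"
 have Lam: "Lam > 0" using V a_pos[of n] by (simp add: Lam_def)
 have [measurable]: "zet : borel_measurable borel" using z by (simp add: bdd_borel_def)
 define psi where "psi x = (if abs (zet x) <= Lam then zet x / Lam else 0)" for x
 define xi where "xi x = (if abs (zet x) <= Lam then 0 else zet x)" for x
 have psi1: "abs (psi x) <= 1" for x using Lam by (auto simp: psi_def)
 have psib: "bdd_borel psi" 
 proof -
  have "psi : borel_measurable borel" unfolding psi_def[abs_def] by measurable
  then show ?thesis unfolding bdd_borel_def using psi1 by blast
 qed
 obtain Cz where Cz: "!!x. abs (zet x) <= Cz" using z by (auto simp: bdd_borel_def)
 have xib: "bdd_borel xi"
  unfolding bdd_borel_def
 proof (intro conjI exI allI)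
  show "xi : borel_measurable borel" unfolding xi_def[abs_def] by measurable
  show "abs (xi x) <= Cz" for x using Cz[of x] by (auto simp: xi_def)
 qed
 have z_eq: "zet x = Lam * psi x + xi x" for x using Lam by (simp add: psi_def xi_def)
 have xile: "abs (xi x) <= Lam powr (1 - th) * abs (zet x) powr th" for x
 proof (cases "abs (zet x) <= Lam")
  case False
  then have z0: "abs (zet x) > Lam" by simp
  have "abs (zet x) = abs (zet x) powr (1 - th) * abs (zet x) powr th" using z0 Lam by (simp add: powr_add[symmetric])
  also have "... <= Lam powr (1 - th) * abs (zet x) powr th" using z0 Lam th by (intro mult_right_mono powr_mono2') auto
  finally show ?thesis using False by (simp add: xi_def)
 qed (simp add: xi_def)
 have "(LINT x|mu. phi x * zet ((f ^^ n) x)) = (LINT x|mu. Lam * (phi x * psi ((f ^^ n) x)) + phi x * xi ((f ^^ n) x))"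
  by (intro Bochner_Integration.integral_cong refl) (simp add: z_eq algebra_simps)
 also have "... = Lam * (LINT x|mu. phi x * psi ((f ^^ n) x)) + (LINT x|mu. phi x * xi ((f ^^ n) x))"
  by (subst Bochner_Integration.integral_add) (auto intro!: bb_int bb phi_bb bb_comp psib xib)
 also have "abs ... <= Lam * a n + B * (Lam powr (1 - th) * V)"
 proof (rule order.trans[OF abs_triangle_ineq add_mono])
  show "abs (Lam * (LINT x|mu. phi x * psi ((f ^^ n) x))) <= Lam * a n"
   unfolding abs_mult a_def using decor[OF psib psi1, of n] Lam by (simp add: mult_left_mono)
  have "abs (\<integral>x. phi x * xi ((f ^^ n) x) \<partial>mu) <= (LINT x|mu. abs (phi x * xi ((f ^^ n) x)))" by (rule integral_abs_bound)
  also have "... <= (LINT x|mu. B * abs (xi ((f ^^ n) x)))"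
   by (intro integral_mono bb_int bb phi_bb bb_comp xib) (simp add: abs_mult mult_right_mono phi_bound)
  also have "... = B * (LINT x|mu. abs (xi x))" using invariant[of "%x. abs (xi x)" n] bdd_borel_abs[OF xib] by (simp add: bdd_borel_def)
  also have "(LINT x|mu. abs (xi x)) <= (LINT x|mu. Lam powr (1 - th) * abs (zet x) powr th)"
   using th by (intro integral_mono bb_int bb powr_bb z xib xile) auto
  also have "... = Lam powr (1 - th) * (LINT x|mu. abs (zet x) powr th)" by simp
  also have "... <= Lam powr (1 - th) * V" using V by (intro mult_left_mono) auto
  finally show "abs (\<integral>x. phi x * xi ((f ^^ n) x) \<partial>mu) <= B * (Lam powr (1 - th) * V)" using B by (simp add: mult_left_mono)
 qed
 also have "Lam * a n = a n powr (1 - 1 / th) * V powr (1 / th)"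
  unfolding Lam_def using V a_pos[of n] by (simp add: powr_divide powr_diff)
 also have "Lam powr (1 - th) * V = a n powr (1 - 1 / th) * V powr (1 / th)"
 proof -
  have e: "1 / th * (1 - th) = 1 / th - 1" using th by (simp add: field_simps)
  have "Lam powr (1 - th) = (V / a n) powr (1 / th - 1)" unfolding Lam_def powr_powr e ..
  also have "... = V powr (1 / th) / V * a n powr (1 - 1 / th)"
   using V a_pos[of n] by (simp add: powr_divide powr_diff)
  finally show ?thesis using V by simp
 qed
 finally show ?thesis by (simp add: algebra_simps)
qed

text \<open>Expanding the \<open>r\<close>-th power, the increment of the moment from \<open>l\<close> to \<open>Suc l\<close> is the covariance of \<open>phi\<close> with
\<open>dpow r (S l (f x))\<close> plus a term of order \<open>r - 2\<close>. The covariance is split along the telescoping differences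
\<open>zet\<close>, each of which depends on the orbit from time \<open>Suc j\<close> on and has integrable power \<open>r / (r - 2)\<close>; the interpolated
decorrelation gives summable terms precisely because \<open>r < 2 * kap\<close>. So the moment grows in each step up
to \<open>n\<close> by at most a constant times the power \<open>1 - 2 / r\<close> of the largest of them, which adds up to \<open>n powr (r / 2)\<close>.\<close>

theorem moment_bound:
 assumes r: "2 < r" "r < 2 * kap"
 obtains C where "!!n. n >= 1 ==> (LINT x|mu. abs (S n x) powr r) <= C * real n powr (r / 2)"
proof -
 define C1 where "C1 = r * (r - 1) * 2 powr (r - 2)"
 have C1: "C1 > 0" using r by (simp add: C1_def)
 define th where "th = r / (r - 2)"
 have th: "th > 1" "1 - 1 / th = 2 / r" "1 / th = 1 - 2 / r" "(r - 2) * th = r"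
  using r by (auto simp: th_def field_simps)
 have sa: "summable (%j. a j powr (2 / r))"
 proof -
  have e: "a j powr (2 / r) = A powr (2 / r) * decay (2 * kap / r) j" for j
   unfolding a_def using A by (simp add: powr_mult powr_powr mult.commute[of kap 2] del: of_nat_Suc)
  have "2 * kap / r > 1" using r by (simp add: field_simps)
  then have "summable (%n. real n powr (- (2 * kap / r)))" by (simp add: summable_real_powr_iff)
  then have "summable (%n. decay (2 * kap / r) n)" by (subst summable_Suc_iff)
  then show ?thesis unfolding e by (rule summable_mult)
 qed
 define \<Sigma> where "\<Sigma> = (\<Sum>j. a j powr (2 / r))"
 define C5 where "C5 = (1 + B) * (2 * C1 * B) * \<Sigma> + 3 * C1 * B^2"
 define m where "m n = (LINT x|mu. abs (S n x) powr r)" for n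
 have m0: "0 <= m n" for n unfolding m_def by (intro integral_nonneg_AE) auto
 have \<Sigma>0: "\<Sigma> >= 0" unfolding \<Sigma>_def by (intro suminf_nonneg sa) simp
 have C5: "C5 > 0" unfolding C5_def using B C1 \<Sigma>0 by (intro add_nonneg_pos) auto
 have main: "m n <= ((C5 + B^2) powr (r / 2)) * real n powr (r / 2)" if n: "n >= 1" for n
 proof -
  define Q where "Q = Max (m ` {..n})"
  have mQ: "m l <= Q" if "l <= n" for l unfolding Q_def using that by (intro Max_ge) auto
  define V where "V = Q + B powr r"
  have Q0: "Q >= 0" using mQ[of 0] m0[of 0] by simp
  have V: "V > 0" unfolding V_def using Q0 B by (intro add_nonneg_pos) auto
  let ?W = "V powr (1 - 2 / r)"
  have re: "r * (1 - 2 / r) = r - 2" using r by (simp add: right_diff_distrib)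
  have BW: "B powr (r - 2) <= ?W"
  proof -
   have "B powr (r - 2) = (B powr r) powr (1 - 2 / r)" unfolding powr_powr re ..
   also have "... <= ?W" using Q0 B r by (intro powr_mono2) (auto simp: V_def)
   finally show ?thesis .
  qed
  have lower: "(LINT x|mu. abs (S l x) powr (r - 2)) <= 2 * ?W" if l: "l <= n" for l
  proof -
   have pt: "abs s powr (r - 2) <= ?W + V powr (- 2 / r) * abs s powr r" for s :: real
   proof (cases "abs s powr r <= V")
    case True
    have "abs s powr (r - 2) = (abs s powr r) powr (1 - 2 / r)" unfolding powr_powr re ..
    also have "... <= ?W" using True r by (intro powr_mono2) auto
    finally show ?thesis by (simp add: add_increasing2)
   next
    case False
    then have s0: "abs s > 0" using V by (cases "s = 0") auto
    have "abs s powr (r - 2) = (abs s powr r) powr (- 2 / r) * abs s powr r"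
     using r s0 by (simp add: powr_powr powr_add[symmetric])
    also have "... <= V powr (- 2 / r) * abs s powr r"
     using False V r by (intro mult_right_mono powr_mono2') auto
    finally show ?thesis by (simp add: add_increasing)
   qed
   have "(LINT x|mu. abs (S l x) powr (r - 2)) <= (LINT x|mu. ?W + V powr (- 2 / r) * abs (S l x) powr r)"
    using r by (intro integral_mono bb_int bb powr_bb S_bb pt) auto
   also have "... = ?W + V powr (- 2 / r) * m l"
    unfolding m_def using r by (subst Bochner_Integration.integral_add) (auto intro!: bb_int bb powr_bb S_bb simp: prob_space)
   also have "V powr (- 2 / r) * m l <= V powr (- 2 / r) * V"
    using mQ[OF l] by (intro mult_left_mono) (auto simp: V_def intro: add_increasing2)
   also have "... = ?W" using V by (simp add: powr_diff powr_minus field_simps)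
   finally show ?thesis by simp
  qed
  have first: "abs (\<integral>x. phi x * dpow r (S l (f x)) \<partial>mu) <= (1 + B) * (2 * C1 * B) * \<Sigma> * ?W" if l: "l < n" for l
  proof -
   define zet where "zet i x = dpow r (S (Suc i) x) - dpow r (S i (f x))" for i x
   have zetb: "bdd_borel (zet i)" for i unfolding zet_def using bb_comp[OF S_bb[of i], of 1] r by (intro bb dpow_bb S_bb) auto
   have zetle: "abs (zet i x) <= C1 * B * (abs (S i (f x)) powr (r - 2) + B powr (r - 2))" for i x
   proof -
    have "abs (zet i x) <= C1 * abs (phi x) * (abs (S i (f x)) powr (r - 2) + abs (phi x) powr (r - 2))"
     unfolding zet_def S_Suc C1_def using dpow_diff[OF r(1), of "S i (f x)" "phi x"] by (simp add: add.commute)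
    also have "... <= C1 * B * (abs (S i (f x)) powr (r - 2) + B powr (r - 2))"
     using C1 B r phi_bound by (intro mult_mono mult_left_mono add_mono powr_mono2) auto
    finally show ?thesis .
   qed
   have zetV: "(LINT x|mu. abs (zet i x) powr th) <= (2 * C1 * B) powr th * V" if i: "i <= n" for i
   proof -
    have pt: "abs (zet i x) powr th <= (2 * C1 * B) powr th * (abs (S i (f x)) powr r + B powr r)" for x
    proof -
     have "abs (zet i x) powr th <= (C1 * B * (abs (S i (f x)) powr (r - 2) + B powr (r - 2))) powr th"
      using zetle th by (intro powr_mono2) auto
     also have "... = (C1 * B) powr th * (abs (S i (f x)) powr (r - 2) + B powr (r - 2)) powr th"
      using C1 B by (simp add: powr_mult)
     also have "... <= (C1 * B) powr th * (2 powr th * ((abs (S i (f x)) powr (r - 2)) powr th + (B powr (r - 2)) powr th))"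
      using th by (intro mult_left_mono powr_sum_le) auto
     also have "... = (2 * C1 * B) powr th * (abs (S i (f x)) powr r + B powr r)"
      unfolding powr_powr th(4) using C1 B by (simp add: powr_mult)
     finally show ?thesis .
    qed
    have Sfb: "bdd_borel (%x. abs (S i (f x)) powr r)" using bb_comp[OF powr_bb[OF S_bb[of i], of r], of 1] r by simp
    have "(LINT x|mu. abs (zet i x) powr th) <= (LINT x|mu. (2 * C1 * B) powr th * (abs (S i (f x)) powr r + B powr r))"
     using th by (intro integral_mono bb_int bb powr_bb zetb Sfb pt) auto
    also have "... = (2 * C1 * B) powr th * ((LINT x|mu. abs (S i (f x)) powr r) + B powr r)"
     using bb_int[OF Sfb] by (simp add: prob_space)
    also have "(LINT x|mu. abs (S i (f x)) powr r) = m i" unfolding m_def using invariant[of "%x. abs (S i x) powr r" 1] by simp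
    also have "(2 * C1 * B) powr th * (m i + B powr r) <= (2 * C1 * B) powr th * V"
     unfolding V_def using mQ[OF i] by (intro mult_left_mono) auto
    finally show ?thesis .
   qed
   have single: "abs (\<integral>x. phi x * zet i ((f ^^ j) x) \<partial>mu) <= (1 + B) * (2 * C1 * B) * ?W * a j powr (2 / r)" if i: "i <= n" for i j
   proof -
    have "abs (\<integral>x. phi x * zet i ((f ^^ j) x) \<partial>mu) <= (1 + B) * a j powr (1 - 1 / th) * ((2 * C1 * B) powr th * V) powr (1 / th)"
     using V C1 B by (intro decorrelation_interpolated th(1) zetb zetV i) auto
    also have "((2 * C1 * B) powr th * V) powr (1 / th) = (2 * C1 * B) * ?W"
     unfolding th(3)[symmetric] using V C1 B th(1) by (simp add: powr_mult powr_powr)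
    also have "(1 + B) * a j powr (1 - 1 / th) * ((2 * C1 * B) * ?W) = (1 + B) * (2 * C1 * B) * ?W * a j powr (2 / r)"
     unfolding th(2) by (simp only: mult_ac)
    finally show ?thesis .
   qed
   have tele: "(LINT x|mu. phi x * dpow r (S l (f x))) = (SUM j<l. \<integral>x. phi x * zet (l - Suc j) ((f ^^ Suc j) x) \<partial>mu)"
   proof -
    have "dpow r (S l (f x)) = (SUM j<l. zet (l - Suc j) ((f ^^ Suc j) x))" for x
    proof -
     have "(SUM j<l. zet (l - Suc j) ((f ^^ Suc j) x)) = (SUM j<l. dpow r (S (l - j) ((f ^^ Suc j) x)) - dpow r (S (l - Suc j) ((f ^^ Suc (Suc j)) x)))"
      unfolding zet_def by (intro sum.cong refl) (auto simp: Suc_diff_Suc)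
     also have "... = dpow r (S l (f x)) - dpow r (S 0 ((f ^^ Suc l) x))"
      using sum_lessThan_telescope'[of "%j. dpow r (S (l - j) ((f ^^ Suc j) x))" l] by simp
     finally show ?thesis by (simp add: S_0 dpow_def)
    qed
    then have "(LINT x|mu. phi x * dpow r (S l (f x))) = (LINT x|mu. (SUM j<l. phi x * zet (l - Suc j) ((f ^^ Suc j) x)))"
     by (simp only: sum_distrib_left)
    also have "... = (SUM j<l. \<integral>x. phi x * zet (l - Suc j) ((f ^^ Suc j) x) \<partial>mu)"
     by (intro Bochner_Integration.integral_sum bb_int bb phi_bb bb_comp zetb)
    finally show ?thesis .
   qed
   have "abs (\<integral>x. phi x * dpow r (S l (f x)) \<partial>mu) <= (SUM j<l. (1 + B) * (2 * C1 * B) * ?W * a (Suc j) powr (2 / r))"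
    unfolding tele using l by (intro order.trans[OF sum_abs] sum_mono single) auto
   also have "... = (1 + B) * (2 * C1 * B) * ?W * (SUM j<l. a (Suc j) powr (2 / r))" by (simp add: sum_distrib_left)
   also have "(1 + B) * (2 * C1 * B) * ?W * (SUM j<l. a (Suc j) powr (2 / r)) <= (1 + B) * (2 * C1 * B) * ?W * \<Sigma>"
   proof (rule mult_left_mono)
    have "(SUM j<l. a (Suc j) powr (2 / r)) <= (SUM j<Suc l. a j powr (2 / r))"
     using sum.lessThan_Suc_shift[of "%j. a j powr (2 / r)" l] by (simp del: sum.lessThan_Suc)
    also have "... <= \<Sigma>" unfolding \<Sigma>_def by (intro sum_le_suminf sa) auto
    finally show "(SUM j<l. a (Suc j) powr (2 / r)) <= \<Sigma>" .
   qed (use B C1 in simp)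
   finally show ?thesis by (simp only: mult_ac)
  qed
  have inc: "m (Suc l) - m l <= C5 * ?W" if l: "l < n" for l
  proof -
   have Sfb: "bdd_borel (%x. S l (f x))" using bb_comp[OF S_bb[of l], of 1] by simp
   have pt: "abs (S (Suc l) x) powr r - abs (S l (f x)) powr r <= phi x * dpow r (S l (f x)) + C1 * B^2 * (abs (S l (f x)) powr (r - 2) + B powr (r - 2))" for x
   proof -
    have "abs (S (Suc l) x) powr r - abs (S l (f x)) powr r - phi x * dpow r (S l (f x)) <= C1 * (phi x)^2 * (abs (S l (f x)) powr (r - 2) + abs (phi x) powr (r - 2))"
     unfolding S_Suc C1_def using pow_taylor[OF r(1), of "S l (f x)" "phi x"] by (simp add: add.commute)
    also have "... <= C1 * B^2 * (abs (S l (f x)) powr (r - 2) + B powr (r - 2))"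
    proof (intro mult_mono mult_left_mono add_mono powr_mono2)
     show "(phi x)^2 <= B^2" using phi_bound[of x] B by (intro abs_le_square_iff[THEN iffD1]) auto
    qed (use C1 r phi_bound in auto)
    finally show ?thesis by simp
   qed
   have "m (Suc l) - m l = (LINT x|mu. abs (S (Suc l) x) powr r - abs (S l (f x)) powr r)"
   proof -
    have "m l = (LINT x|mu. abs (S l (f x)) powr r)" unfolding m_def using invariant[of "%x. abs (S l x) powr r" 1] by simp
    then show ?thesis unfolding m_def using r by (simp add: Bochner_Integration.integral_diff[OF bb_int bb_int] powr_bb S_bb Sfb)
   qed
   also have "... <= (LINT x|mu. phi x * dpow r (S l (f x)) + C1 * B^2 * (abs (S l (f x)) powr (r - 2) + B powr (r - 2)))"
    using r by (intro integral_mono bb_int bb powr_bb dpow_bb S_bb Sfb phi_bb pt) auto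
   also have "... = (LINT x|mu. phi x * dpow r (S l (f x))) + C1 * B^2 * ((LINT x|mu. abs (S l (f x)) powr (r - 2)) + B powr (r - 2))"
   proof -
    have 1: "integrable mu (%x. phi x * dpow r (S l (f x)))" "integrable mu (%x. abs (S l (f x)) powr (r - 2))"
     using r by (intro bb_int bb dpow_bb powr_bb Sfb phi_bb; simp)+
    then show ?thesis by (simp add: prob_space)
   qed
   also have "(LINT x|mu. abs (S l (f x)) powr (r - 2)) = (LINT x|mu. abs (S l x) powr (r - 2))"
    using invariant[of "%x. abs (S l x) powr (r - 2)" 1] by simp
   also have "(LINT x|mu. phi x * dpow r (S l (f x))) + C1 * B^2 * ((LINT x|mu. abs (S l x) powr (r - 2)) + B powr (r - 2))
    <= (1 + B) * (2 * C1 * B) * \<Sigma> * ?W + C1 * B^2 * (2 * ?W + ?W)"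
    using first[OF l] lower[of l] l BW C1 by (intro add_mono mult_left_mono) auto
   also have "... = C5 * ?W" by (simp add: C5_def algebra_simps)
   finally show ?thesis .
  qed
  have lin: "m l <= real n * (C5 * ?W)" if "l <= n" for l
  proof -
   have "m l <= real l * (C5 * ?W)" using that
   proof (induction l)
    case 0
    show ?case using r by (simp add: m_def S_0)
   next
    case (Suc l)
    then show ?case using inc[of l] by (simp add: algebra_simps)
   qed
   also have "... <= real n * (C5 * ?W)" using that C5 by (intro mult_right_mono) auto
   finally show ?thesis .
  qed
  have "Q <= real n * (C5 * ?W)" unfolding Q_def using lin by (intro Max.boundedI) auto
  moreover have "B powr r <= real n * (B^2 * ?W)"
  proof -
   have "B powr r = B^2 * B powr (r - 2)" using B by (simp add: powr_diff powr_numeral)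
   also have "... <= B^2 * ?W" using BW by (intro mult_left_mono) auto
   also have "... = 1 * (B^2 * ?W)" by simp
   also have "... <= real n * (B^2 * ?W)" using n by (intro mult_right_mono) auto
   finally show ?thesis .
  qed
  ultimately have "V <= real n * (C5 + B^2) * ?W" by (simp add: V_def algebra_simps)
  moreover have "V = V powr (2 / r) * ?W" using V by (simp add: powr_add[symmetric])
  ultimately have "V powr (2 / r) * ?W <= real n * (C5 + B^2) * ?W" by simp
  then have "V powr (2 / r) <= real n * (C5 + B^2)" using V by (simp add: mult_le_cancel_right)
  then have "(V powr (2 / r)) powr (r / 2) <= (real n * (C5 + B^2)) powr (r / 2)" using r by (intro powr_mono2) auto
  also have "(V powr (2 / r)) powr (r / 2) = V" using V r by (simp add: powr_powr)
  also have "(real n * (C5 + B^2)) powr (r / 2) = (C5 + B^2) powr (r / 2) * real n powr (r / 2)"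
   using C5 by (simp add: powr_mult mult.commute)
  finally have "V <= (C5 + B^2) powr (r / 2) * real n powr (r / 2)" .
  moreover have "m n <= V" using mQ[of n] by (simp add: V_def add_increasing2)
  ultimately show ?thesis by linarith
 qed
 show thesis by (rule that[OF main[unfolded m_def]])
qed

end

section \<open>The central limit theorem for weighted sums\<close>

lemma iexp_taylor0: "cmod (iexp t - 1) <= abs t"
 using iexp_approx1[of t 0] by simp

lemma iexp_taylor1: "cmod (iexp t - 1 - \<i> * t) <= t^2"
proof -
 have "(SUM k<=1. (\<i> * complex_of_real t) ^ k / fact k) = 1 + \<i> * t" by simp
 then have "cmod (iexp t - 1 - \<i> * t) <= t^2 / 2" 
  using iexp_approx1[of t 1] by (simp add: diff_diff_eq eval_nat_numeral)
 also have "... <= t^2" by simp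
 finally show ?thesis .
qed

lemma iexp_taylor2: "cmod (iexp t - 1 - \<i> * t + t^2 / 2) <= abs t ^ 3"
proof -
 have "(SUM k<=2. (\<i> * complex_of_real t) ^ k / fact k) = 1 + \<i> * t - t^2 / 2"
  by (simp add: eval_nat_numeral power_mult_distrib field_simps)
 then have "cmod (iexp t - (1 + \<i> * t - t^2 / 2)) <= abs t ^ Suc 2 / fact (Suc 2)" 
  using iexp_approx1[of t 2] by simp
 also have "... = abs t ^ 3 / 6" by (simp add: eval_nat_numeral)
 also have "... <= abs t ^ 3"
 proof -
  have "0 <= abs t ^ 3" by simp
  then show ?thesis by linarith
 qed
 finally show ?thesis by (simp add: algebra_simps)
qed

lemma exp_taylor1: "abs (exp x - 1 - x) <= x^2 * exp (abs (x :: real))"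
proof -
 have 0: "0 <= exp x - 1 - x" using exp_ge_add_one_self[of x] by linarith
 have "1 - x <= exp (- x)" using exp_ge_add_one_self[of "- x"] by simp
 then have "(1 - x) * exp x <= exp (- x) * exp x" by (intro mult_right_mono) auto
 then have 1: "exp x - 1 <= x * exp x" by (simp add: exp_minus algebra_simps)
 have "exp x - 1 - x <= x^2 * exp (abs x)"
 proof (cases "x >= 0")
  case True
  have "exp x - 1 - x <= x * (exp x - 1)" using 1 by (simp add: algebra_simps)
  also have "... <= x * (x * exp x)" using 1 True by (intro mult_left_mono) auto
  finally show ?thesis using True by (simp add: power2_eq_square)
 next
  case False
  have "exp x - 1 - x <= (- x) * (1 - exp x)" using 1 by (simp add: algebra_simps)
  also have "... <= (- x) * (- x)"
  proof (rule mult_left_mono)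
   show "1 - exp x <= - x" using exp_ge_add_one_self[of x] by linarith
  qed (use False in simp)
  also have "... <= x^2 * exp (abs x)" by (simp add: power2_eq_square mult_le_cancel_left1)
  finally show ?thesis .
 qed
 then show ?thesis using 0 by simp
qed

context decorrelated
begin

lemma complex_bounded_integrable:
 fixes Z :: "'a => complex"
 assumes "Z : borel_measurable borel" "!!x. cmod (Z x) <= b"
 shows "integrable mu Z"
 using assms by (intro integrable_const_bound[of _ b] mu_meas) auto

lemma complex_product_integrable:
 fixes Z :: "'a => complex"
 assumes u: "bdd_borel u" and Z: "Z : borel_measurable borel" "!!x. cmod (Z x) <= b"
 shows "(%x. of_real (u x) * Z x) : borel_measurable borel" "integrable mu (%x. of_real (u x) * Z x)"
proof -
 obtain Bu where "!!x. abs (u x) <= Bu" "u : borel_measurable borel" using u by (auto simp: bdd_borel_def)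
 note * = this
 show m: "(%x. of_real (u x) * Z x) : borel_measurable borel" using *(2) Z(1) by measurable
 have "cmod (of_real (u x) * Z x) <= Bu * b" for x
  unfolding norm_mult norm_of_real using order.trans[OF abs_ge_zero *(1)] by (intro mult_mono * Z) auto
 then show "integrable mu (%x. of_real (u x) * Z x)" by (rule complex_bounded_integrable[OF m])
qed

lemma integral_cmod_le:
 fixes Z :: "'a => complex"
 assumes "!!x. cmod (Z x) <= b" "Z : borel_measurable borel"
 shows "cmod (LINT x|mu. Z x) <= b"
proof -
 have "cmod (LINT x|mu. Z x) <= (LINT x|mu. cmod (Z x))" by (rule integral_norm_bound)
 also have "... <= (LINT x|mu. b)" 
  using assms by (intro integral_mono integrable_norm complex_bounded_integrable[of Z b]) auto
 finally show ?thesis by (simp add: prob_space)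
qed

lemma complex_covariance_le:
 fixes Z :: "'a => complex" and u :: "'a => real"
 assumes u: "bdd_borel u"
  and dec: "!!psi. bdd_borel psi ==> (!!x. abs (psi x) <= 1) ==> abs (\<integral>x. u x * psi ((f ^^ n) x) \<partial>mu) <= eps"
  and Z: "Z : borel_measurable borel" "!!x. cmod (Z x) <= b" and b: "b >= 0"
 shows "cmod (LINT x|mu. of_real (u x) * Z ((f ^^ n) x)) <= 2 * b * eps"
proof (cases "b = 0")
 case True
 then show ?thesis using Z by simp
next
 case False
 then have b0: "b > 0" using b by simp
 have Zn: "(%x. Z ((f ^^ n) x)) : borel_measurable borel" by (rule measurable_compose[OF fpow_meas Z(1)])
 have int: "integrable mu (%x. of_real (u x) * Z ((f ^^ n) x))" by (rule complex_product_integrable[OF u Zn Z(2)])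
 have real_case: "abs (\<integral>x. u x * zet ((f ^^ n) x) \<partial>mu) <= b * eps"
  if "zet : borel_measurable borel" "!!x. abs (zet x) <= b" for zet :: "'a => real"
 proof -
  have "bdd_borel (%x. (1 / b) * zet x)" using that by (intro bb) (auto simp: bdd_borel_def)
  moreover have "abs ((1 / b) * zet x) <= 1" for x using that(2)[of x] b0 by (simp add: abs_mult)
  ultimately have "abs (\<integral>x. u x * ((1 / b) * zet ((f ^^ n) x)) \<partial>mu) <= eps" by (rule dec)
  also have "(LINT x|mu. u x * ((1 / b) * zet ((f ^^ n) x))) = (1 / b) * (LINT x|mu. u x * zet ((f ^^ n) x))"
   by (subst integral_mult_right_zero[symmetric]) (intro Bochner_Integration.integral_cong refl, simp)
  finally show ?thesis using b0 by (simp add: abs_mult field_simps)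
 qed
 have R: "Re (LINT x|mu. of_real (u x) * Z ((f ^^ n) x)) = (LINT x|mu. u x * Re (Z ((f ^^ n) x)))"
  using int by (subst integral_Re[symmetric]) auto
 have I: "Im (LINT x|mu. of_real (u x) * Z ((f ^^ n) x)) = (LINT x|mu. u x * Im (Z ((f ^^ n) x)))"
  using int by (subst integral_Im[symmetric]) auto
 have "abs (\<integral>x. u x * Re (Z ((f ^^ n) x)) \<partial>mu) <= b * eps" "abs (\<integral>x. u x * Im (Z ((f ^^ n) x)) \<partial>mu) <= b * eps"
  using Z by (intro real_case; auto intro: order.trans[OF abs_Re_le_cmod] order.trans[OF abs_Im_le_cmod])+
 then show ?thesis using cmod_le[of "\<integral>x. of_real (u x) * Z ((f ^^ n) x) \<partial>mu"] unfolding R I by simp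
qed

definition c where "c j = (LINT x|mu. phi x * phi ((f ^^ j) x))"

lemma c_le: "abs (c j) <= B * a j"
proof -
 have "abs (\<integral>x. phi x * ((1 / B) * phi ((f ^^ j) x)) \<partial>mu) <= a j"
  unfolding a_def using phi_bound B by (intro decor bb phi_bb) (auto simp: abs_mult divide_simps)
 also have "(LINT x|mu. phi x * ((1 / B) * phi ((f ^^ j) x))) = (1 / B) * c j"
  unfolding c_def by (subst integral_mult_right_zero[symmetric]) (intro Bochner_Integration.integral_cong refl, simp)
 finally show ?thesis using B by (simp add: abs_mult field_simps)
qed

lemma c_le_B: "abs (c j) <= B^2"
proof -
 have "abs (c j) <= (LINT x|mu. abs (phi x * phi ((f ^^ j) x)))" unfolding c_def by (rule integral_abs_bound)
 also have "... <= (LINT x|mu. B^2)"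
  by (intro integral_mono bb_int bb phi_bb bb_comp) (auto simp: abs_mult power2_eq_square intro!: mult_mono phi_bound less_imp_le[OF B])
 finally show ?thesis by (simp add: prob_space)
qed

lemma a_summable: "summable a"
proof -
 have "summable (%n. real n powr (- kap))" using kap by (simp add: summable_real_powr_iff)
 then have "summable (%n. decay kap n)" by (subst summable_Suc_iff)
 then show ?thesis unfolding a_def[abs_def] by (rule summable_mult)
qed

lemma c_summable: "summable (%j. abs (c j))"
 by (rule summable_comparison_test[OF _ summable_mult[OF a_summable, of B]]) (use c_le in auto)

text \<open>\<open>e k\<close> is the exponential of the sum without its first \<open>k\<close> terms. Expanding the factor of the first term to second order
leaves the covariance of \<open>phi\<close> with \<open>E 1\<close>, which telescopes into the \<open>X j\<close>. For \<open>j > J\<close> decorrelation bounds \<open>X j\<close>; for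
\<open>j <= J\<close> a further expansion yields \<open>phi * (phi \<circ> f ^^ j)\<close>, and after skipping \<open>M\<close> further terms loss of memory replaces it by
its mean \<open>c j\<close>.\<close>

lemma increment_estimate:
 fixes th :: "nat => real" and n J M :: nat and eps tau :: real
 assumes th: "!!i. abs (th i) <= Th" "!!i. i >= n ==> th i = 0" and tau: "tau > 0"
  and ex: "!!j psi. j <= J ==> bdd_borel psi ==> (!!x. abs (psi x) <= 1) ==>
   abs (\<integral>x. (phi x * phi ((f ^^ j) x) - c j) * psi ((f ^^ (j + 1 + M)) x) \<partial>mu) <= eps"
 defines "y \<equiv> %k. \<integral>x. iexp (tau * (SUM i<n - k. th (k + i) * phi ((f ^^ i) x))) \<partial>mu"
  and "V \<equiv> %k. (th k)^2 * c 0 / 2 + (SUM j:{1..J}. th k * th (k + j) * c j)"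
 shows "cmod (y k - (1 - of_real (tau^2 * V k)) * y (Suc k))
  <= tau^2 * (2 * Th^2 * B * (\<Sum>j. a (j + Suc J)) + 2 * Th^2 * real (Suc J) * eps
    + tau * (Th ^ 3 * B ^ 3 * (real J + 2 * real (Suc J) * real (M + J + 1) + 1)))"
proof -
 define s where "s = tau * Th * B"
 have Th0: "Th >= 0" using th(1)[of 0] by linarith
 have s0: "s >= 0" using tau Th0 B by (simp add: s_def)
 define e where "e k x = iexp (tau * (SUM i<n - k. th (k + i) * phi ((f ^^ i) x)))" for k x
 have ye: "y k = (LINT x|mu. e k x)" for k by (simp add: y_def e_def)
 have phim: "(%x. phi ((f ^^ i) x)) : borel_measurable borel" for i by (rule measurable_compose[OF fpow_meas phi_meas])
 have em [measurable]: "e k : borel_measurable borel" for k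
  unfolding e_def[abs_def] using phim by measurable
 have e1: "cmod (e k x) = 1" for k x by (simp add: e_def)
 have eSuc: "e k x = iexp (tau * th k * phi x) * e (Suc k) (f x)" for k x
 proof (cases "k < n")
  case True
  then obtain d where d: "n - k = Suc d" "n - Suc k = d" by (metis Suc_diff_Suc)
  have "(SUM i<Suc d. th (k + i) * phi ((f ^^ i) x)) = th k * phi x + (SUM i<d. th (Suc k + i) * phi ((f ^^ i) (f x)))"
   by (subst sum.lessThan_Suc_shift) (simp add: funpow_swap1)
  then show ?thesis unfolding e_def d by (simp add: distrib_left exp_add mult.assoc)
 next
  case False
  then show ?thesis using th(2) by (simp add: e_def)
 qed
 have e_end: "e k x = 1" if "k >= n" for k x using that by (simp add: e_def)
 have ts: "abs (tau * th k * phi x) <= s" for k x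
  unfolding s_def abs_mult using tau th(1)[of k] phi_bound[of x] Th0 by (intro mult_mono) auto
 have e_shift: "cmod (e k x - e (k + m) ((f ^^ m) x)) <= real m * s" for k m x
 proof (induction m)
  case (Suc m)
  let ?x = "(f ^^ m) x"
  have "cmod (e (k + m) ?x - e (Suc (k + m)) (f ?x)) = cmod ((iexp (tau * th (k + m) * phi ?x) - 1) * e (Suc (k + m)) (f ?x))"
   by (subst eSuc) (simp add: left_diff_distrib)
  also have "... <= s" unfolding norm_mult e1 using iexp_taylor0[of "tau * th (k + m) * phi ?x"] ts[of "k + m" ?x] by simp
  finally have 1: "cmod (e (k + m) ?x - e (Suc (k + m)) (f ?x)) <= s" .
  have "e k x - e (k + Suc m) ((f ^^ Suc m) x) = (e k x - e (k + m) ?x) + (e (k + m) ?x - e (Suc (k + m)) (f ?x))" by simp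
  then show ?case using norm_triangle_mono[OF Suc 1] by (simp add: algebra_simps)
 qed simp
 define E where "E j x = e (k + j) ((f ^^ j) x)" for j x
 have Em [measurable]: "E j : borel_measurable borel" for j
  unfolding E_def[abs_def] by (rule measurable_compose[OF fpow_meas em])
 have E1: "cmod (E j x) = 1" for j x by (simp add: E_def e1)
 have E_next: "E (Suc j) x = e (k + j + 1) (f ((f ^^ j) x))" for j x by (simp add: E_def)
 have E_diff: "E j x - E (Suc j) x = (iexp (tau * th (k + j) * phi ((f ^^ j) x)) - 1) * E (Suc j) x" for j x
  unfolding E_next by (simp add: E_def eSuc[of "k + j"] left_diff_distrib)
 have E_shift: "cmod (E j x - E (j + m) x) <= real m * s" for j m x
  using e_shift[of "k + j" "(f ^^ j) x" m] by (simp add: E_def add.assoc add.commute[of j m] funpow_add)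
 have inv_E: "(LINT x|mu. E j x) = y (k + j)" for j unfolding E_def ye by (rule invariant[OF em])
 have y_shift: "cmod (y (k + i) - y (k + i + m)) <= real m * s" for i m
 proof -
  have "y (k + i) - y (k + i + m) = (LINT x|mu. E i x - E (i + m) x)"
   unfolding add.assoc inv_E[symmetric]
   by (intro Bochner_Integration.integral_diff[symmetric] complex_bounded_integrable[of _ 1] Em) (simp_all add: E1)
  also have "cmod ... <= real m * s" by (intro integral_cmod_le E_shift) measurable
  finally show ?thesis .
 qed
 have Ei: "integrable mu (%x. of_real (phi x) * E j x)" for j
  by (rule complex_product_integrable[OF phi_bb Em, of j 1]) (simp add: E1)
 have p_bb: "bdd_borel (%x. phi x * phi ((f ^^ j) x))" for j by (intro bb phi_bb bb_comp)
 have pEi: "integrable mu (%x. of_real (phi x * phi ((f ^^ j) x)) * E i x)" for i j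
  by (rule complex_product_integrable[OF p_bb Em, of i 1]) (simp add: E1)
 define X where "X j = (LINT x|mu. of_real (phi x) * E j x - of_real (phi x) * E (Suc j) x)" for j
 define G where "G j = (LINT x|mu. of_real (phi x * phi ((f ^^ j) x)) * E (Suc j) x)" for j
 have Xa: "cmod (X j) <= 2 * s * a j" for j
 proof -
  define Z where "Z x = (iexp (tau * th (k + j) * phi x) - 1) * e (k + j + 1) (f x)" for x
  have "X j = (LINT x|mu. of_real (phi x) * Z ((f ^^ j) x))"
   unfolding X_def Z_def right_diff_distrib[symmetric] E_diff by (simp only: E_next)
  also have "cmod ... <= 2 * s * a j"
  proof (rule complex_covariance_le[OF phi_bb _ _ _ s0])
   show "abs (\<integral>x. phi x * psi ((f ^^ j) x) \<partial>mu) <= a j" if "bdd_borel psi" "!!x. abs (psi x) <= 1" for psi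
    unfolding a_def by (rule decor[OF that])
   show "Z : borel_measurable borel" unfolding Z_def by measurable
   show "cmod (Z x) <= s" for x
    unfolding Z_def norm_mult e1 using iexp_taylor0[of "tau * th (k + j) * phi x"] ts[of "k + j" x] by simp
  qed
  finally show ?thesis .
 qed
 have XG: "cmod (X j - \<i> * tau * th (k + j) * G j) <= B * s^2" for j
 proof -
  let ?t = "%x. tau * th (k + j) * phi ((f ^^ j) x)"
  define Z where "Z x = (iexp (?t x) - 1 - \<i> * ?t x) * E (Suc j) x" for x
  have "X j - \<i> * tau * th (k + j) * G j = (LINT x|mu. of_real (phi x) * E j x - of_real (phi x) * E (Suc j) x
    - \<i> * tau * th (k + j) * (of_real (phi x * phi ((f ^^ j) x)) * E (Suc j) x))"
   unfolding X_def G_def using Ei pEi by simp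
  also have "... = (LINT x|mu. of_real (phi x) * Z x)"
   unfolding right_diff_distrib[symmetric] E_diff Z_def by (intro Bochner_Integration.integral_cong refl) (simp add: algebra_simps)
  also have "cmod ... <= B * s^2"
  proof (rule integral_cmod_le)
   show "(%x. of_real (phi x) * Z x) : borel_measurable borel" unfolding Z_def using phim by measurable
   show "cmod (of_real (phi x) * Z x) <= B * s^2" for x
    unfolding Z_def norm_mult norm_of_real E1 mult_1_right
    using order.trans[OF iexp_taylor1[of "?t x"]] power_mono[OF ts[of "k + j" "(f ^^ j) x"], of 2] B
    by (intro mult_mono phi_bound) auto
  qed
  finally show ?thesis .
 qed
 have Gc: "cmod (G j - c j * y (Suc k)) <= 2 * B^2 * real (M + J + 1) * s + 2 * eps" if j: "j <= J" for j
 proof -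
  let ?E = "E (Suc j + M)" and ?p = "%x. phi x * phi ((f ^^ j) x)"
  have pB: "abs (?p x) <= B^2" for x unfolding abs_mult power2_eq_square using phi_bound B by (auto intro: mult_mono)
  have d_bb: "bdd_borel (%x. ?p x - c j)" by (intro bb phi_bb bb_comp)
  have i2: "integrable mu (%x. of_real (?p x - c j) * ?E x)"
   by (rule complex_product_integrable[OF d_bb Em, of _ 1]) (simp add: E1)
  have i1: "integrable mu (%x. of_real (?p x) * E (Suc j) x - of_real (?p x) * ?E x)"
   by (intro Bochner_Integration.integrable_diff pEi)
  have i3: "integrable mu (%x. c j * ?E x)"
   using complex_product_integrable(2)[OF bdd_borel_const Em, of _ 1 "c j"] by (simp add: E1)
  have "G j = (LINT x|mu. (of_real (?p x) * E (Suc j) x - of_real (?p x) * ?E x) + of_real (?p x - c j) * ?E x + c j * ?E x)"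
   unfolding G_def by (intro Bochner_Integration.integral_cong refl) (simp add: algebra_simps)
  also have "... = (LINT x|mu. of_real (?p x) * E (Suc j) x - of_real (?p x) * ?E x) + (LINT x|mu. of_real (?p x - c j) * ?E x)
    + c j * y (k + 1 + (j + M))"
   unfolding Bochner_Integration.integral_add[OF Bochner_Integration.integrable_add[OF i1 i2] i3] Bochner_Integration.integral_add[OF i1 i2]
   using inv_E[of "Suc j + M"] by simp
  finally have Geq: "G j - c j * y (Suc k) = (LINT x|mu. of_real (?p x) * E (Suc j) x - of_real (?p x) * ?E x)
   + (LINT x|mu. of_real (?p x - c j) * ?E x) + c j * (y (k + 1 + (j + M)) - y (k + 1))" by (simp add: algebra_simps)
  have b1: "cmod (LINT x|mu. of_real (?p x) * E (Suc j) x - of_real (?p x) * ?E x) <= B^2 * (real M * s)"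
  proof (rule integral_cmod_le)
   show "(%x. of_real (?p x) * E (Suc j) x - of_real (?p x) * ?E x) : borel_measurable borel" using phim by measurable
   show "cmod (of_real (?p x) * E (Suc j) x - of_real (?p x) * ?E x) <= B^2 * (real M * s)" for x
    unfolding right_diff_distrib[symmetric] norm_mult norm_of_real by (intro mult_mono pB E_shift) auto
  qed
  have b2: "cmod (LINT x|mu. of_real (?p x - c j) * ?E x) <= 2 * 1 * eps"
   unfolding E_def
  proof (rule complex_covariance_le[OF d_bb])
   show "abs (\<integral>x. (?p x - c j) * psi ((f ^^ (Suc j + M)) x) \<partial>mu) <= eps" if "bdd_borel psi" "!!x. abs (psi x) <= 1" for psi
    using ex[OF j that] by simp
  qed (auto simp: e1)
  have b3: "cmod (c j * (y (k + 1 + (j + M)) - y (k + 1))) <= B^2 * (real (j + M) * s)"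
   unfolding norm_mult norm_of_real using y_shift[of 1 "j + M"] by (intro mult_mono c_le_B) (auto simp: norm_minus_commute)
  have "cmod (G j - c j * y (Suc k)) <= B^2 * (real M * s) + 2 * 1 * eps + B^2 * (real (j + M) * s)"
   unfolding Geq by (intro norm_triangle_mono b1 b2 b3)
  also have "... <= 2 * B^2 * real (M + J + 1) * s + 2 * eps"
  proof -
   have "real M + real (j + M) <= 2 * real (M + J + 1)" using j by simp
   then have "(real M + real (j + M)) * (B^2 * s) <= (2 * real (M + J + 1)) * (B^2 * s)" using s0 by (intro mult_right_mono) auto
   then show ?thesis by (simp add: algebra_simps)
  qed
  finally show ?thesis .
 qed
 have tele: "(LINT x|mu. of_real (phi x) * E 1 x) = (SUM j:{1..J + n}. X j)"
 proof -
  have "(SUM j:{1..m}. X j) = (LINT x|mu. of_real (phi x) * E 1 x) - (LINT x|mu. of_real (phi x) * E (Suc m) x)" for m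
   by (induction m) (simp_all add: X_def Ei)
  moreover have "(LINT x|mu. of_real (phi x) * E (Suc (J + n)) x) = complex_of_real (LINT x|mu. phi x)"
   by (simp add: E_def e_end)
  ultimately show ?thesis using mean by simp
 qed
 define rho where "rho = y k - y (Suc k) - \<i> * tau * th k * (SUM j:{1..J + n}. X j) + tau^2 * (th k)^2 / 2 * G 0"
 have rho: "cmod rho <= s ^ 3"
 proof -
  let ?t = "%x. tau * th k * phi x"
  have i: "integrable mu (E j)" for j by (rule complex_bounded_integrable[OF Em, of _ 1]) (simp add: E1)
  have "rho = (LINT x|mu. E 0 x - E 1 x - \<i> * tau * th k * (of_real (phi x) * E 1 x) + tau^2 * (th k)^2 / 2 * (of_real (phi x * phi ((f ^^ 0) x)) * E 1 x))"
   unfolding rho_def tele[symmetric] G_def using i Ei pEi[of 0 1] inv_E[of 0] inv_E[of 1] by simp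
  also have "... = (LINT x|mu. (iexp (?t x) - 1 - \<i> * ?t x + (?t x)^2 / 2) * E 1 x)"
   using E_diff[of 0] by (intro Bochner_Integration.integral_cong refl) (simp add: algebra_simps power2_eq_square)
  also have "cmod ... <= s ^ 3"
  proof (rule integral_cmod_le)
   fix x
   have "abs (?t x) ^ 3 <= s ^ 3" by (intro power_mono ts) auto
   then show "cmod ((iexp (?t x) - 1 - \<i> * ?t x + (?t x)^2 / 2) * E 1 x) <= s ^ 3"
    unfolding norm_mult E1 using iexp_taylor2[of "?t x"] by simp
  qed measurable
  finally show ?thesis .
 qed
 have sumsplit: "(SUM j:{1..J + n}. X j) = (SUM j:{1..J}. X j) + (SUM j:{Suc J..J + n}. X j)"
 proof -
  have "{1..J + n} = {1..J} \<union> {Suc J..J + n}" by auto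
  then show ?thesis by (simp add: sum.union_disjoint)
 qed
 have main_eq: "y k - (1 - of_real (tau^2 * V k)) * y (Suc k)
   = rho + \<i> * tau * th k * (SUM j:{1..J}. X j - \<i> * tau * th (k + j) * G j) + \<i> * tau * th k * (SUM j:{Suc J..J + n}. X j)
    + (- (tau^2 * th k * (SUM j:{1..J}. th (k + j) * (G j - c j * y (Suc k)))) - tau^2 * (th k)^2 / 2 * (G 0 - c 0 * y (Suc k)))"
 proof -
  have 1: "\<i> * tau * th k * (SUM j:{1..J}. X j - \<i> * tau * th (k + j) * G j) = \<i> * tau * th k * (SUM j:{1..J}. X j) + tau^2 * th k * (SUM j:{1..J}. th (k + j) * G j)"
  proof -
   have h: "(SUM j:{1..J}. X j - \<i> * tau * th (k + j) * G j) = (SUM j:{1..J}. X j) - \<i> * tau * (SUM j:{1..J}. th (k + j) * G j)"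
    by (simp add: sum_subtractf sum_distrib_left mult.assoc)
   show ?thesis unfolding h by (simp add: right_diff_distrib power2_eq_square mult_ac)
  qed
  have 2: "(SUM j:{1..J}. th (k + j) * (G j - c j * y (Suc k))) = (SUM j:{1..J}. th (k + j) * G j) - (SUM j:{1..J}. th (k + j) * c j) * y (Suc k)"
   by (simp add: sum_subtractf right_diff_distrib sum_distrib_right mult.assoc)
  have 3: "of_real (V k) = (th k)^2 * c 0 / 2 + th k * complex_of_real (SUM j:{1..J}. th (k + j) * c j)"
   unfolding V_def by (simp add: sum_distrib_left mult.assoc)
  show ?thesis unfolding 1 2 rho_def sumsplit of_real_mult[of "tau^2"] 3
   by (simp add: algebra_simps diff_divide_distrib)
 qed
 have sa: "summable (%j. a (j + Suc J))" using a_summable by (rule summable_ignore_initial_segment)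
 have t1: "cmod (\<i> * tau * th k * (SUM j:{1..J}. X j - \<i> * tau * th (k + j) * G j)) <= tau * Th * (real J * (B * s^2))"
 proof -
  have "cmod (SUM j:{1..J}. X j - \<i> * tau * th (k + j) * G j) <= (SUM j:{1..J}. B * s^2)"
   by (intro order.trans[OF norm_sum] sum_mono XG)
  then have "cmod (\<i> * tau * th k) * cmod (SUM j:{1..J}. X j - \<i> * tau * th (k + j) * G j) <= (tau * Th) * (real J * (B * s^2))"
   using tau th(1)[of k] Th0 by (intro mult_mono) (auto simp: norm_mult)
  then show ?thesis by (simp only: norm_mult)
 qed
 have t2: "cmod (\<i> * tau * th k * (SUM j:{Suc J..J + n}. X j)) <= tau * Th * (2 * s * (\<Sum>j. a (j + Suc J)))"
 proof -
  have "cmod (SUM j:{Suc J..J + n}. X j) <= (SUM j:{Suc J..J + n}. 2 * s * a j)"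
   by (intro order.trans[OF norm_sum] sum_mono Xa)
  also have "... = 2 * s * (SUM j:{Suc J..J + n}. a j)" by (simp add: sum_distrib_left)
  also have "(SUM j:{Suc J..J + n}. a j) = (SUM j<n. a (j + Suc J))"
   by (rule sum.reindex_bij_witness[of _ "%j. j + Suc J" "%j. j - Suc J"]) auto
  also have "2 * s * (SUM j<n. a (j + Suc J)) <= 2 * s * (\<Sum>j. a (j + Suc J))"
   using s0 a_pos by (intro mult_left_mono sum_le_suminf sa) (auto intro: less_imp_le)
  finally have "cmod (\<i> * tau * th k) * cmod (SUM j:{Suc J..J + n}. X j) <= (tau * Th) * (2 * s * (\<Sum>j. a (j + Suc J)))"
   using tau th(1)[of k] Th0 by (intro mult_mono) (auto simp: norm_mult)
  then show ?thesis by (simp only: norm_mult)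
 qed
 let ?g = "2 * B^2 * real (M + J + 1) * s + 2 * eps"
 have t3: "cmod (- (tau^2 * th k * (SUM j:{1..J}. th (k + j) * (G j - c j * y (Suc k)))) - tau^2 * (th k)^2 / 2 * (G 0 - c 0 * y (Suc k)))
   <= tau^2 * Th * (real J * (Th * ?g)) + tau^2 * Th^2 * ?g"
 proof -
  have "cmod (SUM j:{1..J}. th (k + j) * (G j - c j * y (Suc k))) <= (SUM j:{1..J}. Th * ?g)"
  proof (intro order.trans[OF norm_sum] sum_mono)
   fix j assume "j : {1..J}"
   then show "cmod (th (k + j) * (G j - c j * y (Suc k))) <= Th * ?g"
    unfolding norm_mult norm_of_real using Th0 by (intro mult_mono th Gc) auto
  qed
  then have "cmod (tau^2 * th k) * cmod (SUM j:{1..J}. th (k + j) * (G j - c j * y (Suc k))) <= (tau^2 * Th) * (real J * (Th * ?g))"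
   using th(1)[of k] Th0 by (intro mult_mono) (auto simp: norm_mult norm_power mult_left_mono)
  then have 1: "cmod (- (tau^2 * th k * (SUM j:{1..J}. th (k + j) * (G j - c j * y (Suc k))))) <= tau^2 * Th * (real J * (Th * ?g))"
   by (simp only: norm_mult norm_minus_cancel)
  have "(th k)^2 <= Th^2" using power_mono[OF th(1)[of k], of 2] by simp
  then have "cmod (tau^2 * (th k)^2 / 2) <= tau^2 * Th^2"
   by (simp add: norm_mult norm_power norm_divide) (smt (verit) mult_left_mono zero_le_power2 mult_nonneg_nonneg)
  then have 2: "cmod (tau^2 * (th k)^2 / 2 * (G 0 - c 0 * y (Suc k))) <= tau^2 * Th^2 * ?g"
   unfolding norm_mult[of "complex_of_real (tau^2 * (th k)^2 / 2)"] by (rule mult_mono[OF _ Gc]) auto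
  show ?thesis by (rule order.trans[OF norm_triangle_ineq4 add_mono[OF 1 2]])
 qed
 have "cmod (y k - (1 - of_real (tau^2 * V k)) * y (Suc k)) <= s ^ 3 + tau * Th * (real J * (B * s^2)) + tau * Th * (2 * s * (\<Sum>j. a (j + Suc J)))
  + (tau^2 * Th * (real J * (Th * ?g)) + tau^2 * Th^2 * ?g)"
  unfolding main_eq by (intro norm_triangle_mono rho t1 t2 t3)
 also have "... = tau^2 * (2 * Th^2 * B * (\<Sum>j. a (j + Suc J)) + 2 * Th^2 * real (Suc J) * eps
    + tau * (Th ^ 3 * B ^ 3 * (real J + 2 * real (Suc J) * real (M + J + 1) + 1)))"
  unfolding s_def by (simp add: algebra_simps power2_eq_square power3_eq_cube)
 finally show ?thesis .
qed

end

lemma double_limit: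
 fixes y :: "nat => 'm::metric_space"
 assumes "!!e. e > 0 ==> EX J0. ALL J>=J0. \<forall>\<^sub>F n in sequentially. dist (y n) (z J n) < e"
  and z: "!!J. z J ----> l J" and l: "l ----> L"
 shows "y ----> L"
proof (rule tendstoI)
 fix e :: real assume e: "e > 0"
 obtain J0 where J0: "!!J. J >= J0 ==> \<forall>\<^sub>F n in sequentially. dist (y n) (z J n) < e / 3" using assms(1)[of "e / 3"] e by auto
 have "\<forall>\<^sub>F J in sequentially. dist (l J) L < e / 3 & J0 <= J"
  using tendstoD[OF l, of "e / 3"] e by (intro eventually_conj eventually_ge_at_top) simp
 then obtain J where J: "dist (l J) L < e / 3" "J0 <= J" by (auto simp: eventually_sequentially)
 have "\<forall>\<^sub>F n in sequentially. dist (z J n) (l J) < e / 3" using tendstoD[OF z, of "e / 3"] e by simp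
 then show "\<forall>\<^sub>F n in sequentially. dist (y n) L < e"
  using J0[OF J(2)]
 proof eventually_elim
  case (elim n)
  then show ?case using J(1) dist_triangle[of "y n" L "z J n"] dist_triangle[of "z J n" L "l J"] by linarith
 qed
qed

locale decorrelated_exact = decorrelated +
 assumes exact: "!!u eps. bdd_borel u ==> eps > 0 ==> EX N. ALL n>=N. ALL psi. bdd_borel psi --> (ALL x. abs (psi x) <= 1) -->
   abs (\<integral>x. (u x - (LINT z|mu. u z)) * psi ((f ^^ n) x) \<partial>mu) <= eps"
begin

definition half_variance where "half_variance = c 0 / 2 + (\<Sum>j. c (Suc j))"

text \<open>Telescoping of \<open>EE k * yy n k\<close>, where \<open>EE\<close> collects the variance factors of the increment estimate. The cut-off \<open>J\<close> is
fixed first, then the gap \<open>M\<close>, and \<open>n\<close> tends to infinity last. Triangular weights give joint limits of increments.\<close>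

theorem clt_characteristic:
 fixes th :: "nat => nat => real"
 assumes th: "!!n k. abs (th n k) <= Th" "!!n k. k >= n ==> th n k = 0"
  and Q: "!!j. (%n. (SUM k<n. th n k * th n (k + j)) / real n) ----> Q"
 shows "(%n. \<integral>x. iexp ((SUM k<n. th n k * phi ((f ^^ k) x)) / sqrt (real n)) \<partial>mu)
  ----> of_real (exp (- (Q * half_variance)))"
proof -
 define w where "w j = (if j = 0 then c 0 / 2 else c j)" for j
 define Vm where "Vm = (\<Sum>j. abs (c j)) * Th^2"
 have Vm0: "0 <= Vm" unfolding Vm_def by (intro mult_nonneg_nonneg suminf_nonneg c_summable) auto
 have Th0: "Th >= 0" using th(1)[of 0 0] by linarith
 define yy where "yy n k = (LINT x|mu. iexp (1 / sqrt (real n) * (SUM i<n - k. th n (k + i) * phi ((f ^^ i) x))))" for n k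
 define V where "V J n k = (SUM j<=J. w j * (th n k * th n (k + j)))" for J n k
 define Cj where "Cj J M = Th ^ 3 * B ^ 3 * (real J + 2 * real (Suc J) * real (M + J + 1) + 1)" for J M :: nat
 have V_eq: "V J n k = (th n k)^2 * c 0 / 2 + (SUM j:{1..J}. th n k * th n (k + j) * c j)" for J n k
  unfolding V_def atMost_atLeast0 by (simp add: sum.atLeast_Suc_atMost w_def power2_eq_square mult_ac)
 have V_le: "abs (V J n k) <= Vm" for J n k
 proof -
  have "abs (V J n k) <= (SUM j<=J. abs (c j) * Th^2)"
   unfolding V_def
  proof (rule order.trans[OF sum_abs sum_mono])
   fix j
   have "abs (w j) <= abs (c j)" by (simp add: w_def)
   then show "abs (w j * (th n k * th n (k + j))) <= abs (c j) * Th^2"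
    unfolding abs_mult power2_eq_square using Th0 by (intro mult_mono th) auto
  qed
  also have "... <= Vm" unfolding Vm_def sum_distrib_right[symmetric] by (intro mult_right_mono sum_le_suminf c_summable) auto
  finally show ?thesis .
 qed
 have main: "cmod (yy n 0 - of_real (exp (- ((SUM k<n. V J n k) / real n)))) <=
   exp Vm * (2 * Th^2 * B * (\<Sum>j. a (j + Suc J)) + 2 * Th^2 * real (Suc J) * eps + Cj J M / sqrt (real n) + Vm^2 * exp Vm / real n)"
  if n: "n >= 1" and ex: "!!j psi. j <= J ==> bdd_borel psi ==> (!!x. abs (psi x) <= 1) ==>
   abs (\<integral>x. (phi x * phi ((f ^^ j) x) - c j) * psi ((f ^^ (j + 1 + M)) x) \<partial>mu) <= eps" for n J M eps
 proof -
  define tau where "tau = 1 / sqrt (real n)"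
  have tau: "tau > 0" "tau^2 = 1 / real n" using n by (auto simp: tau_def power_divide)
  let ?err = "2 * Th^2 * B * (\<Sum>j. a (j + Suc J)) + 2 * Th^2 * real (Suc J) * eps + tau * Cj J M"
  have inc: "cmod (yy n k - (1 - of_real (tau^2 * V J n k)) * yy n (Suc k)) <= tau^2 * ?err" for k
   unfolding yy_def V_eq Cj_def tau_def[symmetric]
   by (rule increment_estimate[OF th(1) th(2) tau(1) ex])
  have y1: "cmod (yy n k) <= 1" for k
  proof -
   have "(%x. phi ((f ^^ i) x)) : borel_measurable borel" for i by (rule measurable_compose[OF fpow_meas phi_meas])
   then show ?thesis unfolding yy_def by (intro integral_cmod_le) (simp, measurable)
  qed
  define EE where "EE k = exp (- (tau^2 * (SUM i<k. V J n i)))" for k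
  have EE_le: "EE k <= exp Vm" if "k <= n" for k
  proof -
   have "- (tau^2 * (SUM i<k. V J n i)) <= tau^2 * (SUM i<k. Vm)"
   proof -
    have "- (SUM i<k. V J n i) <= (SUM i<k. Vm)" unfolding sum_negf[symmetric] by (intro sum_mono) (use V_le in "auto simp: abs_le_iff")
    then have "tau^2 * - (SUM i<k. V J n i) <= tau^2 * (SUM i<k. Vm)" by (intro mult_left_mono) auto
    then show ?thesis by simp
   qed
   also have "... = (real k / real n) * Vm" by (simp add: tau)
   also have "... <= 1 * Vm" using that n Vm0 by (intro mult_right_mono) auto
   finally show ?thesis by (simp add: EE_def)
  qed
  have step: "cmod (of_real (EE k) * yy n k - of_real (EE (Suc k)) * yy n (Suc k)) <= exp Vm * (tau^2 * ?err + tau^2 * (tau^2 * (Vm^2 * exp Vm)))"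
   if k: "k < n" for k
  proof -
   let ?s = "tau^2 * V J n k"
   have gen: "of_real A * u - of_real (A * q) * w = of_real A * ((u - (1 - of_real t) * w) - of_real (q - 1 - (- t)) * w)"
    for A q t :: real and u w :: complex by (simp add: algebra_simps)
   have ES: "EE (Suc k) = EE k * exp (- ?s)" by (simp add: EE_def distrib_left exp_add[symmetric])
   have "of_real (EE k) * yy n k - of_real (EE (Suc k)) * yy n (Suc k)
    = of_real (EE k) * ((yy n k - (1 - of_real ?s) * yy n (Suc k)) - of_real (exp (- ?s) - 1 - (- ?s)) * yy n (Suc k))"
    unfolding ES by (rule gen)
   also have "cmod ... <= exp Vm * (tau^2 * ?err + tau^2 * (tau^2 * (Vm^2 * exp Vm)))"
    unfolding norm_mult[of "of_real (EE k)"]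
   proof (rule mult_mono)
    show "cmod (of_real (EE k)) <= exp Vm" using EE_le[of k] k by (simp add: EE_def)
    show "cmod ((yy n k - (1 - of_real ?s) * yy n (Suc k)) - of_real (exp (- ?s) - 1 - (- ?s)) * yy n (Suc k)) <= tau^2 * ?err + tau^2 * (tau^2 * (Vm^2 * exp Vm))"
    proof (rule order.trans[OF norm_triangle_ineq4 add_mono[OF inc]])
     have "tau^2 <= 1" using n by (simp add: tau)
     then have s1: "abs (?s) <= 1 * Vm" unfolding abs_mult using V_le by (intro mult_mono) auto
     have s2: "?s^2 <= tau^2 * (tau^2 * Vm^2)"
     proof -
      have "(V J n k)^2 <= Vm^2" using power_mono[OF V_le[of J n k], of 2] by simp
      then have "(tau^2)^2 * (V J n k)^2 <= (tau^2)^2 * Vm^2" by (intro mult_left_mono) auto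
      then show ?thesis by (simp add: power_mult_distrib power2_eq_square[of "tau^2"] mult.assoc)
     qed
     have "abs (exp (- ?s) - 1 - (- ?s)) <= (- ?s)^2 * exp (abs (- ?s))" by (rule exp_taylor1)
     also have "... <= (tau^2 * (tau^2 * Vm^2)) * exp Vm" using s1 s2 by (intro mult_mono) auto
     finally have "abs (exp (- ?s) - 1 - (- ?s)) * cmod (yy n (Suc k)) <= ((tau^2 * (tau^2 * Vm^2)) * exp Vm) * 1"
      using y1[of "Suc k"] by (intro mult_mono) auto
     then show "cmod (of_real (exp (- ?s) - 1 - (- ?s)) * yy n (Suc k)) <= tau^2 * (tau^2 * (Vm^2 * exp Vm))"
      unfolding norm_mult norm_of_real by (simp only: mult.assoc mult_1_right)
    qed
   qed auto
   finally show ?thesis .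
  qed
  have tele: "(SUM k<m. of_real (EE k) * yy n k - of_real (EE (Suc k)) * yy n (Suc k)) = of_real (EE 0) * yy n 0 - of_real (EE m) * yy n m" for m
   by (induction m) auto
  have yn: "yy n n = 1" by (simp add: yy_def prob_space)
  have tot: "yy n 0 - of_real (EE n) = (SUM k<n. of_real (EE k) * yy n k - of_real (EE (Suc k)) * yy n (Suc k))"
   unfolding tele yn by (simp add: EE_def)
  have "cmod (yy n 0 - of_real (EE n)) <= (SUM k<n. exp Vm * (tau^2 * ?err + tau^2 * (tau^2 * (Vm^2 * exp Vm))))"
   unfolding tot by (intro order.trans[OF norm_sum] sum_mono step) auto
  also have "... = exp Vm * ((real n * tau^2) * ?err + (real n * tau^2) * (tau^2 * (Vm^2 * exp Vm)))"
  proof -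
   have "real n * (z * (t * r + t * q)) = z * ((real n * t) * r + (real n * t) * q)" for z t r q :: real
    by (simp add: algebra_simps)
   then show ?thesis by (simp only: sum_constant card_lessThan)
  qed
  also have "real n * tau^2 = 1" using n by (simp add: tau)
  finally have "cmod (yy n 0 - of_real (EE n)) <= exp Vm * (?err + tau^2 * (Vm^2 * exp Vm))" by simp
  moreover have "EE n = exp (- ((SUM k<n. V J n k) / real n))" by (simp add: EE_def tau)
  moreover have "tau * Cj J M = Cj J M / sqrt (real n)" "tau^2 * (Vm^2 * exp Vm) = Vm^2 * exp Vm / real n"
   unfolding tau(2) by (simp_all add: tau_def)
  ultimately show ?thesis by (simp add: add.assoc)
 qed
 have Vlim: "(%n. (SUM k<n. V J n k) / real n) ----> (SUM j<=J. w j * Q)" for J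
 proof -
  have "(SUM k<n. V J n k) / real n = (SUM j<=J. w j * ((SUM k<n. th n k * th n (k + j)) / real n))" for n
   unfolding V_def by (subst sum.swap) (simp add: sum_distrib_left sum_divide_distrib)
  then show ?thesis by (simp only:) (intro tendsto_intros Q)
 qed
 have vlim: "(%J. SUM j<=J. w j * Q) ----> Q * half_variance"
 proof -
  have "w sums (half_variance - w 0 + w 0)" unfolding sums_Suc_iff[symmetric]
   using summable_rabs_cancel[OF c_summable] by (simp add: w_def half_variance_def summable_sums summable_Suc_iff)
  then have "(%j. w j * Q) sums (half_variance * Q)" by (intro sums_mult2) simp
  then show ?thesis by (simp add: sums_def_le mult.commute)
 qed
 have "(%n. yy n 0) ----> of_real (exp (- (Q * half_variance)))"
 proof (rule double_limit)
  show "(%n. of_real (exp (- ((SUM k<n. V J n k) / real n)))) ----> (of_real (exp (- (SUM j<=J. w j * Q))) :: complex)" for J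
   by (intro tendsto_intros Vlim)
  show "(%J. of_real (exp (- (SUM j<=J. w j * Q)))) ----> (of_real (exp (- (Q * half_variance))) :: complex)"
   by (intro tendsto_intros vlim)
  fix e :: real assume e: "e > 0"
  have T0: "(%J. exp Vm * (2 * Th^2 * B * (\<Sum>j. a (j + Suc J)))) ----> exp Vm * (2 * Th^2 * B * 0)"
   by (intro tendsto_intros LIMSEQ_Suc[OF suminf_exist_split2[OF a_summable]])
  then obtain J0 where J0: "!!J. J >= J0 ==> exp Vm * (2 * Th^2 * B * (\<Sum>j. a (j + Suc J))) < e / 3"
   using order_tendstoD(2)[OF T0, of "e / 3"] e by (auto simp: eventually_sequentially)
  show "EX J0. ALL J>=J0. \<forall>\<^sub>F n in sequentially. dist (yy n 0) (of_real (exp (- ((SUM k<n. V J n k) / real n)))) < e"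
  proof (intro exI[of _ J0] allI impI)
   fix J assume J: "J >= J0"
   define d where "d = 2 * Th^2 * real (Suc J) + 1"
   define eps where "eps = e / (3 * exp Vm * d)"
   have d: "d > 0" unfolding d_def by (intro add_nonneg_pos) auto
   have eps: "eps > 0" unfolding eps_def using e d by simp
   have "exp Vm * (2 * Th^2 * real (Suc J) * eps) <= exp Vm * (d * eps)"
    using eps unfolding d_def by (intro mult_left_mono mult_right_mono) auto
   also have "... = e / 3" using d by (simp add: eps_def)
   finally have eps2: "exp Vm * (2 * Th^2 * real (Suc J) * eps) <= e / 3" .
   have "EX N. ALL n>=N. ALL psi. bdd_borel psi --> (ALL x. abs (psi x) <= 1) --> abs (\<integral>x. (phi x * phi ((f ^^ j) x) - c j) * psi ((f ^^ n) x) \<partial>mu) <= eps" for j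
    unfolding c_def by (rule exact[OF _ eps]) (intro bb phi_bb bb_comp)
   then obtain NN where NN: "!!j n psi. n >= NN j ==> bdd_borel psi ==> (!!x. abs (psi x) <= 1) ==> abs (\<integral>x. (phi x * phi ((f ^^ j) x) - c j) * psi ((f ^^ n) x) \<partial>mu) <= eps"
    by metis
   define M where "M = Max (NN ` {..J})"
   have MN: "NN j <= j + 1 + M" if "j <= J" for j
    unfolding M_def using that by (intro trans_le_add2 Max_ge) auto
   have L1: "(%n. exp Vm * (Cj J M / sqrt (real n) + Vm^2 * exp Vm / real n)) ----> exp Vm * (0 + 0)"
    by (intro tendsto_intros tendsto_divide_0[OF tendsto_const] filterlim_at_top_imp_at_infinity
      filterlim_compose[OF sqrt_at_top filterlim_real_sequentially] filterlim_real_sequentially)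
   have "\<forall>\<^sub>F n in sequentially. exp Vm * (Cj J M / sqrt (real n) + Vm^2 * exp Vm / real n) < e / 3"
    using order_tendstoD(2)[OF L1, of "e / 3"] e by simp
   then show "\<forall>\<^sub>F n in sequentially. dist (yy n 0) (of_real (exp (- ((SUM k<n. V J n k) / real n)))) < e"
    using eventually_ge_at_top[of "1::nat"]
   proof eventually_elim
    case (elim n)
    have "cmod (yy n 0 - of_real (exp (- ((SUM k<n. V J n k) / real n))))
     <= exp Vm * (2 * Th^2 * B * (\<Sum>j. a (j + Suc J)) + 2 * Th^2 * real (Suc J) * eps + Cj J M / sqrt (real n) + Vm^2 * exp Vm / real n)"
     by (rule main[OF elim(2)]) (rule NN[OF MN])
    then show ?case using J0[OF J] eps2 elim(1) unfolding distrib_left[of "exp Vm"] dist_norm by linarith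
   qed
  qed
 qed
 then show ?thesis unfolding yy_def by simp
qed

text \<open>Characteristic functions are bounded by one in modulus, and so is their limit.\<close>

lemma half_variance_nonneg: "half_variance >= 0"
proof -
 have "(%n. \<integral>x. iexp ((SUM k<n. (if k < n then 1 else 0) * phi ((f ^^ k) x)) / sqrt (real n)) \<partial>mu)
  ----> of_real (exp (- (1 * half_variance)))"
 proof (rule clt_characteristic[where Th = 1])
  fix j :: nat
  have eq: "(SUM k<n. (if k < n then 1 else 0) * (if k + j < n then 1 else 0)) / real n = real (n - j) / real n" for n
  proof -
   have "(SUM k<n. (if k < n then 1 else 0) * (if k + j < n then 1 else 0)) = (SUM k:{..<n - j}. 1 :: real)"
    by (rule sum.mono_neutral_cong_right) auto
   then show ?thesis by simp
  qed
  have "(%n. 1 - real j / real n) ----> 1 - 0"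
   by (intro tendsto_intros tendsto_divide_0[OF tendsto_const] filterlim_at_top_imp_at_infinity filterlim_real_sequentially)
  moreover have "\<forall>\<^sub>F n in sequentially. 1 - real j / real n = real (n - j) / real n"
   using eventually_gt_at_top[of j] by eventually_elim (simp add: of_nat_diff field_simps)
  ultimately show "(%n. (SUM k<n. (if k < n then 1 else 0) * (if k + j < n then 1 else 0)) / real n) ----> (1::real)"
   unfolding eq by (simp add: Lim_transform_eventually)
 qed auto
 then have "(%n. cmod (LINT x|mu. iexp ((SUM k<n. (if k < n then 1 else 0) * phi ((f ^^ k) x)) / sqrt (real n))))
  ----> cmod (of_real (exp (- (1 * half_variance))))" by (rule tendsto_norm)
 then have "cmod (of_real (exp (- (1 * half_variance)))) <= 1"
 proof (rule LIMSEQ_le_const2)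
  show "EX N. ALL n>=N. cmod (LINT x|mu. iexp ((SUM k<n. (if k < n then 1 else 0) * phi ((f ^^ k) x)) / sqrt (real n))) <= 1"
  proof (intro exI allI impI integral_cmod_le)
   fix n x
   have "(%x. phi ((f ^^ i) x)) : borel_measurable borel" for i by (rule measurable_compose[OF fpow_meas phi_meas])
   then show "(%x. iexp ((SUM k<n. (if k < n then 1 else 0) * phi ((f ^^ k) x)) / sqrt (real n))) : borel_measurable borel"
    by measurable
  qed simp
 qed
 then show ?thesis by simp
qed

end

section \<open>Convergence of random vectors\<close>

definition coord_lipschitz :: "nat => real => real => ((nat => real) => real) => bool" where
 "coord_lipschitz k L b G \<longleftrightarrow> (ALL v. abs (G v) <= b) & (ALL v w. abs (G v - G w) <= L * (SUM j<k. abs (v j - w j)))"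

lemma coord_lipschitz_continuous:
 assumes G: "coord_lipschitz k L b G"
 shows "continuous_on UNIV G"
 unfolding continuous_on_def
proof
 fix v :: "nat => real"
 have c: "((%w::nat => real. w j) ---> v j) (at v)" for j
  using continuous_on_product_coordinates[of j, where 'b = real] by (simp add: continuous_on_def)
 have "((%w. L * (SUM j<k. abs (w j - v j))) ---> L * (SUM j<k. abs (v j - v j))) (at v)"
  by (intro tendsto_intros tendsto_sum tendsto_rabs tendsto_diff c)
 then have "((%w. L * (SUM j<k. abs (w j - v j))) ---> 0) (at v)" by simp
 then have "((%w. G w - G v) ---> 0) (at v)"
  by (rule Lim_null_comparison[rotated]) (use G in "auto simp: coord_lipschitz_def")
 then show "(G ---> G v) (at v within UNIV)" by (simp add: LIM_zero_iff)
qed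

lemma continuous_coordinates_measurable:
 fixes G :: "(nat => real) => real"
 assumes G: "continuous_on UNIV G" and xi: "!!i. xi i : borel_measurable M"
 shows "(%x. G (%i. xi i x)) : borel_measurable M"
proof -
 have "(%x i. xi i x) : borel_measurable M" by (rule measurable_coordinatewise_then_product) (rule xi)
 then show ?thesis by (rule measurable_compose[OF _ borel_measurable_continuous_onI[OF G]])
qed

lemmas coord_lipschitz_measurable = continuous_coordinates_measurable[OF coord_lipschitz_continuous]

inductive coordinate_polynomial :: "nat => ((nat => real) => real) => bool" for d where
 const: "coordinate_polynomial d (%_. c)"
| add: "coordinate_polynomial d q ==> coordinate_polynomial d r ==> coordinate_polynomial d (%s. q s + r s)"
| coord: "coordinate_polynomial d q ==> j < d ==> coordinate_polynomial d (%s. q s * s j)"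

lemma coordinate_polynomial_mult:
 assumes "coordinate_polynomial d q" "coordinate_polynomial d r"
 shows "coordinate_polynomial d (%s. q s * r s)"
 using assms(2)
proof induction
 case (const c)
 show ?case using assms(1)
 proof induction
  case (coord q j)
  then show ?case using coordinate_polynomial.coord[OF coord.IH coord.hyps(2)] by (simp add: mult_ac)
 qed (auto simp: distrib_right intro: coordinate_polynomial.intros)
next
 case (coord r j)
 then show ?case using coordinate_polynomial.coord[OF coord.IH coord.hyps(2)] by (simp add: mult_ac)
qed (auto simp: distrib_left intro: coordinate_polynomial.intros)

lemma coordinate_polynomial_continuous: "coordinate_polynomial d q ==> continuous_on UNIV q"
 by (induction rule: coordinate_polynomial.induct) (auto intro!: continuous_intros)

lemmas coordinate_polynomial_measurable = continuous_coordinates_measurable[OF coordinate_polynomial_continuous]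

definition sine_cube :: "nat => (nat => real) set" where
 "sine_cube d = {s. ALL j. s j : (if j < d then {-1..1} else {0})}"

lemma sine_cube_approximation:
 assumes g: "continuous_on (sine_cube d) g" and e: "e > 0"
 obtains q where "coordinate_polynomial d q" "!!s. s : sine_cube d ==> abs (g s - q s) < e"
proof -
 have eq: "sine_cube d = PiE UNIV (%j. if j < d then {-1..1} else {0})"
  unfolding sine_cube_def PiE_UNIV_domain by (simp add: Pi_def)
 have "compactin (product_topology (%_. euclidean) UNIV) (sine_cube d)"
  unfolding eq compactin_PiE by auto
 then have "compact (sine_cube d)" by (simp add: euclidean_product_topology)
 then interpret function_ring_on "{q. coordinate_polynomial d q}" "sine_cube d"
 proof unfold_locales
  fix x y assume xy: "x : sine_cube d" "y : sine_cube d" "x ~= y"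
  then obtain j where j: "x j ~= y j" by auto
  have "x j : (if j < d then {-1..1} else {0})" "y j : (if j < d then {-1..1} else {0})"
   using xy unfolding sine_cube_def by blast+
  with j have "j < d" by (cases "j < d") auto
  with j show "EX f:{q. coordinate_polynomial d q}. f x ~= f y"
   using coordinate_polynomial.coord[OF coordinate_polynomial.const[of d 1]] by (intro bexI[of _ "%s. 1 * s j"]) auto
 qed (auto intro: coordinate_polynomial.intros coordinate_polynomial_mult continuous_on_subset[OF coordinate_polynomial_continuous])
 show thesis using Stone_Weierstrass_basic[OF g e] that by auto
qed

text \<open>Sines turn polynomials into trigonometric polynomials, whose integrals are combinations of characteristic functions. The
factor \<open>iexp\<close> makes the induction over polynomials work: a coordinate sine shifts the frequency \<open>t\<close>.\<close>

definition sine_moment :: "nat => real => 'a measure => (nat => 'a => real) => ((nat => real) => real) => (nat => real) => complex" where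
 "sine_moment d a Q X q t = (LINT x|Q. of_real (q (%j. if j < d then sin (a * X j x) else 0)) * iexp (SUM j<d. t j * X j x))"

lemma sine_polynomial_convergence:
 fixes xi :: "nat => nat => 'a => real" and zet :: "nat => 'b => real"
 assumes M: "prob_space M" "prob_space M'"
  and meas: "!!n i. xi n i : borel_measurable M" "!!i. zet i : borel_measurable M'"
  and conv: "!!t. (%n. \<integral>x. iexp (SUM j<d. t j * xi n j x) \<partial>M) ----> (LINT x|M'. iexp (SUM j<d. t j * zet j x))"
  and q: "coordinate_polynomial d q"
 shows "(%n. sine_moment d a M (xi n) q t) ----> sine_moment d a M' zet q t"
proof -
 let ?Phi = "sine_moment d a"
 note Phi_def = sine_moment_def
 have bnd: "EX b. ALL X. abs (q (%j. if j < d then sin (X j) else (0::real))) <= b" if "coordinate_polynomial d q" for q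
  using that
 proof induction
  case (add q r)
  then obtain b c where "!!X. abs (q (%j. if j < d then sin (X j) else (0::real))) <= b" "!!X. abs (r (%j. if j < d then sin (X j) else (0::real))) <= c" by blast
  then show ?case by (intro exI[of _ "b + c"] allI) (rule order.trans[OF abs_triangle_ineq add_mono])
 next
  case (coord q j)
  then obtain b where b: "!!X. abs (q (%j. if j < d then sin (X j) else (0::real))) <= b" by blast
  have "abs (q (%j. if j < d then sin (X j) else 0) * sin (X j)) <= b * 1" for X
   unfolding abs_mult by (intro mult_mono b) (use order.trans[OF abs_ge_zero b] in auto)
  then show ?case using coord(2) by auto
 qed auto
 have integ: "integrable Q (%x. of_real (q (%j. if j < d then sin (a * X j x) else 0)) * iexp (SUM j<d. t j * X j x))"
  if q: "coordinate_polynomial d q" and Q: "prob_space Q" and X: "!!i. X i : borel_measurable Q" for Q :: "'c measure" and X q t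
 proof -
  interpret Q: prob_space Q by fact
  note [measurable] = X
  obtain b where "!!X. abs (q (%j. if j < d then sin (X j) else (0::real))) <= b" using bnd[OF q] by blast
  moreover have "(%x. q (%j. if j < d then sin (a * X j x) else 0)) : borel_measurable Q"
   by (rule coordinate_polynomial_measurable[OF q]) measurable
  ultimately show ?thesis by (intro Q.integrable_const_bound[of _ b]) (auto simp: norm_mult)
 qed
 have Phi_add: "?Phi Q X (%s. q s + r s) t = ?Phi Q X q t + ?Phi Q X r t"
  if "coordinate_polynomial d q" "coordinate_polynomial d r" "prob_space Q" "!!i. X i : borel_measurable Q" for Q :: "'c measure" and X q r t
  using integ[OF that(1,3,4)] integ[OF that(2,3,4)] by (simp add: Phi_def distrib_right)
 have Phi_coord: "?Phi Q X (%s. q s * s j) t = (?Phi Q X q (t(j := t j + a)) - ?Phi Q X q (t(j := t j + - a))) / (2 * \<i>)"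
  if "coordinate_polynomial d q" "prob_space Q" "!!i. X i : borel_measurable Q" and j: "j < d" for Q :: "'c measure" and X q t j
 proof -
  have upd: "iexp (SUM i<d. (t(j := t j + b)) i * y i) = iexp (SUM i<d. t i * y i) * iexp (b * y j)" for b and y :: "nat => real"
  proof -
   have "(SUM i<d. (t(j := t j + b)) i * y i) = (SUM i<d. t i * y i + (if i = j then b * y j else 0))"
    by (intro sum.cong) (auto simp: distrib_right)
   then show ?thesis using j by (simp add: sum.distrib exp_add distrib_left)
  qed
  have sn: "complex_of_real (sin y) = (iexp y - iexp (- y)) / (2 * \<i>)" for y
   by (simp add: sin_exp_eq sin_of_real[symmetric] exp_minus)
  have pt: "of_real (w * sin (a * y j)) * iexp (SUM i<d. t i * y i) = (of_real w * iexp (SUM i<d. (t(j := t j + a)) i * y i)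
    - of_real w * iexp (SUM i<d. (t(j := t j + - a)) i * y i)) / (2 * \<i>)" for w and y :: "nat => real"
   unfolding upd of_real_mult sn by (simp add: algebra_simps diff_divide_distrib)
  have "?Phi Q X (%s. q s * s j) t = (LINT x|Q. (of_real (q (%j. if j < d then sin (a * X j x) else 0)) * iexp (SUM i<d. (t(j := t j + a)) i * X i x)
    - of_real (q (%j. if j < d then sin (a * X j x) else 0)) * iexp (SUM i<d. (t(j := t j + - a)) i * X i x)) / (2 * \<i>))"
   unfolding Phi_def by (intro Bochner_Integration.integral_cong refl) (simp only: if_P[OF j], rule pt)
  then show ?thesis
   by (simp only: Phi_def integral_divide_zero Bochner_Integration.integral_diff[OF integ[OF that(1,2,3)] integ[OF that(1,2,3)]])
 qed
 show ?thesis
  using q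
 proof (induction arbitrary: t)
  case (const c)
  show ?case unfolding Phi_def integral_mult_right_zero by (intro tendsto_intros conv)
 next
  case (add q r)
  then show ?case using M meas by (simp add: Phi_add tendsto_add)
 next
  case (coord q j)
  then show ?case using M meas by (simp add: Phi_coord) (intro tendsto_intros coord.IH, auto)
 qed
qed

text \<open>On a box that carries almost all mass the coordinates are \<open>A * arcsin\<close> of their sines, so there \<open>G\<close> is a continuous
function on the compact sine cube and, by Stone and Weierstrass, close to a polynomial in sines.\<close>

theorem lipschitz_convergence:
 fixes xi :: "nat => nat => 'a => real" and zet :: "nat => 'b => real"
 assumes M: "prob_space M" "prob_space M'"
  and meas: "!!n i. xi n i : borel_measurable M" "!!i. zet i : borel_measurable M'"
  and conv: "!!t. (%n. \<integral>x. iexp (SUM j<d. t j * xi n j x) \<partial>M) ----> (LINT x|M'. iexp (SUM j<d. t j * zet j x))"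
  and tight: "!!e. e > 0 ==> EX A. ALL n. measure M {x : space M. EX j<d. A < abs (xi n j x)} <= e"
  and G: "coord_lipschitz d L b G"
 shows "(%n. \<integral>x. G (%i. xi n i x) \<partial>M) ----> (LINT x|M'. G (%i. zet i x))"
proof (rule tendstoI)
 interpret M': prob_space M' by fact
 note [measurable] = meas
 fix eps :: real assume eps: "eps > 0"
 have Gb: "abs (G v) <= b" and GL: "abs (G v - G w) <= L * (SUM j<d. abs (v j - w j))" for v w using G by (auto simp: coord_lipschitz_def)
 have b: "b >= 0" using order.trans[OF abs_ge_zero Gb] .
 define e where "e = eps / (8 * (b + 1))"
 define e' where "e' = min 1 (eps / 8)"
 have e: "e > 0" "2 * (b + 1) * e <= eps / 4" "e' > 0" "e' <= 1" "e' <= eps / 8"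
  using eps b by (auto simp: e_def e'_def field_simps)
 obtain A1 where A1: "!!n. measure M {x : space M. EX j<d. A1 < abs (xi n j x)} <= e" using tight[OF e(1)] by blast
 obtain A2 where A2: "measure M' {x : space M'. EX j<d. A2 < abs (zet j x)} <= e"
 proof -
  have "(%m. \<integral>x. indicator {x : space M'. EX j<d. real m < abs (zet j x)} x \<partial>M') ----> (LINT x|M'. (0 :: real))"
  proof (rule integral_dominated_convergence[where w = "%_. 1"])
   show "AE x in M'. (%m. indicator {x : space M'. EX j<d. real m < abs (zet j x)} x :: real) ----> 0"
   proof (rule AE_I2)
    fix x
    obtain m0 :: nat where m0: "(SUM j<d. abs (zet j x)) <= real m0" using real_arch_simple by blast
    have "indicator {x : space M'. EX j<d. real m < abs (zet j x)} x = (0 :: real)" if "m >= m0" for m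
    proof -
     have "abs (zet j x) <= real m" if "j < d" for j
      using member_le_sum[of j "{..<d}" "%j. abs (zet j x)"] m0 that \<open>m >= m0\<close> by simp
     then show ?thesis unfolding indicator_def by (force simp: not_less[symmetric])
    qed
    then show "(%m. indicator {x : space M'. EX j<d. real m < abs (zet j x)} x :: real) ----> 0"
     by (intro tendsto_eventually eventually_sequentiallyI)
   qed
  qed (auto simp: indicator_def)
  then have "(%m. measure M' {x : space M'. EX j<d. real m < abs (zet j x)}) ----> 0" by simp
  then have "\<forall>\<^sub>F m in sequentially. measure M' {x : space M'. EX j<d. real m < abs (zet j x)} < e" using e(1) by (rule order_tendstoD)
  then show thesis using that by (meson eventually_sequentially less_imp_le order_refl)
 qed
 define A where "A = max 1 (max A1 A2)"
 have A: "A > 0" by (simp add: A_def)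
 define a where "a = 1 / A"
 define sn where "sn v = (%j. if j < d then sin (a * v j) else 0)" for v :: "nat => real"
 define g where "g s = G (%j. A * arcsin (s j))" for s
 have "continuous_on (sine_cube d) (%s j. A * arcsin (s j))"
 proof (rule continuous_on_coordinatewise_then_product)
  fix j
  have c: "continuous_on (sine_cube d) (%s. s j)" by (rule continuous_on_subset[OF continuous_on_product_coordinates]) simp
  have "-1 <= s j & s j <= 1" if "s : sine_cube d" for s
  proof -
   have "s j : (if j < d then {-1..1} else {0})" using that unfolding sine_cube_def by blast
   then show ?thesis by (cases "j < d") auto
  qed
  then show "continuous_on (sine_cube d) (%s. A * arcsin (s j))"
   by (intro continuous_on_mult continuous_on_const continuous_on_arcsin c) auto
 qed
 then have "continuous_on (sine_cube d) g"
  unfolding g_def by (rule continuous_on_compose2[OF coord_lipschitz_continuous[OF G]]) simp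
 then obtain q where q: "coordinate_polynomial d q" and gq: "!!s. s : sine_cube d ==> abs (g s - q s) < e'"
  using sine_cube_approximation e(3) by blast
 have sn: "sn v : sine_cube d" for v by (auto simp: sn_def sine_cube_def)
 have qb: "abs (q (sn v)) <= b + 1" for v using gq[OF sn, of v] Gb[of "%j. A * arcsin (sn v j)"] e(4) unfolding g_def by linarith
 have close: "abs (G v - q (sn v)) <= e' + (2 * b + 1) * of_bool (EX j<d. A < abs (v j))" for v
 proof (cases "EX j<d. A < abs (v j)")
  case True
  then show ?thesis using Gb[of v] qb[of v] e(3) by simp
 next
  case False
  have "A * arcsin (sn v j) = v j" if "j < d" for j
  proof -
   have "abs (v j) <= A" using False that by (meson not_less)
   then have "abs (a * v j) <= 1" using A by (simp add: a_def)
   then have "arcsin (sin (a * v j)) = a * v j" using pi_ge_two by (intro arcsin_sin) auto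
   then show ?thesis using that A by (simp add: sn_def a_def)
  qed
  then have "abs (G v - g (sn v)) <= L * 0" using GL[of v "%j. A * arcsin (sn v j)"] by (simp add: g_def)
  then show ?thesis using gq[OF sn, of v] by (simp only: False of_bool_eq)
 qed
 have near: "abs ((LINT x|Q. G (%i. X i x)) - (LINT x|Q. q (sn (%i. X i x)))) <= e' + eps / 4"
  if Q: "prob_space Q" and X: "!!i. X i : borel_measurable Q" and small: "measure Q {x : space Q. EX j<d. A' < abs (X j x)} <= e" "A' <= A"
  for Q :: "'c measure" and X A'
 proof -
  interpret Q: prob_space Q by fact
  note [measurable] = X
  have Gm: "integrable Q (%x. G (%i. X i x))"
   using coord_lipschitz_measurable[OF G X] Gb by (intro Q.integrable_const_bound[of _ b]) auto
  have "(%x. q (sn (%i. X i x))) : borel_measurable Q"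
   unfolding sn_def by (rule coordinate_polynomial_measurable[OF q]) measurable
  then have qm: "integrable Q (%x. q (sn (%i. X i x)))" using qb by (intro Q.integrable_const_bound[of _ "b + 1"]) auto
  define S where "S = {x : space Q. EX j<d. A < abs (X j x)}"
  have S [measurable]: "S : sets Q" unfolding S_def by measurable
  have iS: "integrable Q (indicator S :: 'c => real)" by (intro integrable_real_indicator S) (simp add: less_top[symmetric])
  have "measure Q S <= measure Q {x : space Q. EX j<d. A' < abs (X j x)}"
   unfolding S_def using small(2) by (intro Q.finite_measure_mono) (auto intro: le_less_trans, measurable)
  then have mS: "measure Q S <= e" using small(1) by simp
  have "abs ((LINT x|Q. G (%i. X i x)) - (LINT x|Q. q (sn (%i. X i x)))) = abs (\<integral>x. G (%i. X i x) - q (sn (%i. X i x)) \<partial>Q)" using Gm qm by simp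
  also have "... <= (LINT x|Q. abs (G (%i. X i x) - q (sn (%i. X i x))))" by (rule integral_abs_bound)
  also have "... <= (LINT x|Q. e' + (2 * b + 1) * indicator S x)"
  proof (rule integral_mono_AE)
   show "AE x in Q. abs (G (%i. X i x) - q (sn (%i. X i x))) <= e' + (2 * b + 1) * indicator S x"
    by (rule AE_I2) (use close in "simp add: S_def indicator_def of_bool_def")
  qed (use Gm qm iS in auto)
  also have "... = e' + (2 * b + 1) * measure Q S" using iS by (simp add: Q.prob_space)
  also have "(2 * b + 1) * measure Q S <= 2 * (b + 1) * e" using mS b by (intro mult_mono) auto
  finally show ?thesis using e(2) by linarith
 qed
 have lim: "(%n. \<integral>x. q (sn (%i. xi n i x)) \<partial>M) ----> (LINT x|M'. q (sn (%i. zet i x)))"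
  using tendsto_Re[OF sine_polynomial_convergence[OF M meas conv q, of a "%_. 0"]] by (simp add: sn_def sine_moment_def)
 have fin: "abs ((LINT x|M'. G (%i. zet i x)) - (LINT x|M'. q (sn (%i. zet i x)))) <= e' + eps / 4"
  by (rule near[OF M(2) meas(2) A2]) (simp add: A_def)
 have "\<forall>\<^sub>F n in sequentially. dist (LINT x|M. q (sn (%i. xi n i x))) (LINT x|M'. q (sn (%i. zet i x))) < eps / 4"
  using lim eps by (intro tendstoD) auto
 then show "\<forall>\<^sub>F n in sequentially. dist (LINT x|M. G (%i. xi n i x)) (LINT x|M'. G (%i. zet i x)) < eps"
 proof eventually_elim
  case (elim n)
  have "abs ((LINT x|M. G (%i. xi n i x)) - (LINT x|M. q (sn (%i. xi n i x)))) <= e' + eps / 4"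
   by (rule near[OF M(1) meas(1) A1]) (simp add: A_def)
  then show ?case using elim fin e(5) eps unfolding dist_real_def by linarith
 qed
qed

section \<open>Hoelder functions and polygonal interpolation\<close>

definition hoelder_bound :: "real => (real => real) => real => bool" where
 "hoelder_bound eta x K \<longleftrightarrow> (ALL s:{0..1}. ALL t:{0..1}. abs (x s - x t) <= K * abs (s - t) powr eta)"

lemma hoelder_bound_wlog:
 assumes "!!s t. 0 <= s ==> s < t ==> t <= 1 ==> abs (x s - x t) <= K * abs (s - t) powr eta"
 shows "hoelder_bound eta x K"
 unfolding hoelder_bound_def
proof (intro ballI)
 fix s t :: real assume st: "s : {0..1}" "t : {0..1}"
 consider "s < t" | "s = t" | "t < s" by linarith
 then show "abs (x s - x t) <= K * abs (s - t) powr eta"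
 proof cases
  case 3
  then show ?thesis using assms[of t s] st by (simp add: abs_minus_commute)
 qed (use assms[of s t] st in auto)
qed

lemma hoelder_boundD: "hoelder_bound eta x K ==> s : {0..1} ==> t : {0..1} ==> abs (x s - x t) <= K * abs (s - t) powr eta"
 by (auto simp: hoelder_bound_def)

lemma hoelder_seminorm_le:
 assumes "hoelder_bound eta x K"
 shows "hoelder_seminorm eta x <= ennreal K"
 unfolding hoelder_seminorm_def
proof (intro SUP_least, clarify)
 fix s t :: real assume "s : {0..1}" "t : {0..1}" "s ~= t"
 then have "abs (x s - x t) / abs (s - t) powr eta <= K"
  using hoelder_boundD[OF assms, of s t] by (simp add: pos_divide_le_eq)
 then show "ennreal (abs (x s - x t) / abs (s - t) powr eta) <= ennreal K" by (rule ennreal_leI)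
qed

lemma hoelder_space0I:
 assumes x: "x : extensional {0..1}" and b: "hoelder_bound eta' x K" and eta: "eta < eta'"
 shows "x : hoelder_space0 eta"
proof -
 have K: "0 <= K" using hoelder_boundD[OF b, of 0 1] by simp
 have le: "abs (x s - x t) / abs (s - t) powr eta <= K * dlt powr (eta' - eta)" if "s : {0..1}" "t : {0..1}" "0 < abs (s - t)" "abs (s - t) <= dlt" for s t dlt
 proof -
  have "abs (x s - x t) <= K * abs (s - t) powr eta'" using that by (intro hoelder_boundD[OF b])
  also have "abs (s - t) powr eta' = abs (s - t) powr (eta' - eta) * abs (s - t) powr eta" by (simp add: powr_add[symmetric])
  finally have "abs (x s - x t) / abs (s - t) powr eta <= K * abs (s - t) powr (eta' - eta)"
   using that by (simp add: pos_divide_le_eq mult.assoc)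
  also have "... <= K * dlt powr (eta' - eta)" using that eta K by (intro mult_left_mono powr_mono2) auto
  finally show ?thesis .
 qed
 have "hoelder_bound eta x K"
  unfolding hoelder_bound_def
 proof (intro ballI)
  fix s t :: real assume st: "s : {0..1}" "t : {0..1}"
  show "abs (x s - x t) <= K * abs (s - t) powr eta"
  proof (cases "s = t")
   case False
   then show ?thesis using le[OF st, of 1] st by (simp add: pos_divide_le_eq abs_le_iff)
  qed simp
 qed
 then have sp: "x : hoelder_space eta"
  using hoelder_seminorm_le[of eta x K] x by (auto simp: hoelder_space_def le_less_trans)
 have m: "hoelder_modulus eta x dlt <= ennreal (K * dlt powr (eta' - eta))" for dlt
  unfolding hoelder_modulus_def by (intro SUP_least) (auto intro!: ennreal_leI le)
 have "((%dlt. K * dlt powr (eta' - eta)) ---> K * 0 powr (eta' - eta)) (at_right 0)"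
  using eta by (intro tendsto_mult tendsto_const tendsto_powr' tendsto_ident_at disjI2 conjI)
   (auto intro: eventually_mono[OF eventually_at_right_less])
 then have "((%dlt. ennreal (K * dlt powr (eta' - eta))) ---> ennreal 0) (at_right 0)"
  by (intro tendsto_ennrealI) simp
 then have lim: "((%dlt. ennreal (K * dlt powr (eta' - eta))) ---> 0) (at_right 0)" by simp
 have "((%dlt. hoelder_modulus eta x dlt) ---> 0) (at_right 0)"
 proof (rule tendsto_sandwich[OF _ _ tendsto_const lim])
  show "\<forall>\<^sub>F dlt in at_right 0. hoelder_modulus eta x dlt <= ennreal (K * dlt powr (eta' - eta))"
   by (intro always_eventually allI m)
 qed simp_all
 then show ?thesis using sp by (simp add: hoelder_space0_def)
qed

lemma hoelder_dist_le:
 assumes "hoelder_bound eta (%t. x t - y t) K"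
 shows "hoelder_dist eta x y <= K + abs (x 0 - y 0)"
proof -
 have K: "0 <= K" using hoelder_boundD[OF assms, of 0 1] by simp
 have "hoelder_modulus eta (%t. x t - y t) 1 <= ennreal K"
  using hoelder_modulus_le_seminorm hoelder_seminorm_le[OF assms] by (rule order.trans)
 then show ?thesis using K by (simp add: hoelder_dist_def hoelder_norm_def enn2real_leI)
qed

lemma hoelder_modulus_bound:
 assumes "hoelder_modulus eta x dlt <= ennreal om" "0 <= om" "s : {0..1}" "t : {0..1}" "abs (s - t) < dlt"
 shows "abs (x s - x t) <= om * abs (s - t) powr eta"
proof (cases "s = t")
 case False
 have "ennreal (abs (x s - x t) / abs (s - t) powr eta) <= hoelder_modulus eta x dlt"
  unfolding hoelder_modulus_def by (rule SUP_upper2[of "(s, t)"]) (use False assms in auto)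
 then have "ennreal (abs (x s - x t) / abs (s - t) powr eta) <= ennreal om" using assms(1) by (rule order.trans)
 then show ?thesis using False assms(2) by (simp add: pos_divide_le_eq)
qed simp

definition polygon :: "nat => (nat => real) => real => real" where
 "polygon N v = (\<lambda>t\<in>{0..1}. v (nat \<lfloor>real N * t\<rfloor>)
  + (real N * t - \<lfloor>real N * t\<rfloor>) * (v (Suc (nat \<lfloor>real N * t\<rfloor>)) - v (nat \<lfloor>real N * t\<rfloor>)))"

lemma polygon_extensional: "polygon N v : extensional {0..1}"
 by (simp add: polygon_def)

lemma polygon_diff: "t : {0..1} ==> polygon N v t - polygon N w t = polygon N (%j. v j - w j) t"
 by (simp add: polygon_def algebra_simps)

lemma polygon_cell:
 assumes N: "N > 0" and j: "j < N" and t: "real j <= real N * t" "real N * t <= real (Suc j)"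
 shows "polygon N v t = v j + (real N * t - real j) * (v (Suc j) - v j)"
proof -
 have t01: "t : {0..1}"
 proof -
  have "0 <= real N * t" using t(1) by linarith
  moreover have "real N * t <= real N * 1" using t(2) j by linarith
  then have "t <= 1" using N by (simp only: mult_le_cancel_left_pos of_nat_0_less_iff)
  ultimately show ?thesis using N by (auto simp: zero_le_mult_iff)
 qed
 show ?thesis
 proof (cases "real N * t = real (Suc j)")
  case True
  have "nat \<lfloor>real N * t\<rfloor> = Suc j" unfolding True by (metis floor_of_nat nat_int)
  then show ?thesis using t01 unfolding polygon_def restrict_apply True by simp
 next
  case False
  then have "\<lfloor>real N * t\<rfloor> = int j" using t by (intro floor_unique) auto
  then show ?thesis using t01 unfolding polygon_def by simp
 qed
qed

lemma polygon_vertex: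
 assumes N: "N > 0" and j: "j <= N"
 shows "polygon N v (real j / real N) = v j"
proof -
 have e: "real N * (real j / real N) = real j" using N by simp
 have "real j / real N : {0..1}" using j N by simp
 then show ?thesis unfolding polygon_def restrict_apply e by simp
qed

text \<open>Two points of \<open>[0,1]\<close> either lie in one cell of the grid or are separated by grid points;
 this reduces every Hoelder estimate to pairs in one cell and pairs of grid points.\<close>

lemma grid_cases:
 assumes N: "N > 0" and st: "0 <= s" "s < t" "t <= (1::real)"
 obtains (cell) j where "j < N" "real j <= real N * s" "real N * t <= real (Suc j)"
 | (far) i j k where "i < N" "real i <= real N * s" "real N * s <= real (Suc i)" "Suc i <= j" "j <= N"
   "real j <= real N * t" "k < N" "k <= j" "j <= Suc k" "real N * t <= real (Suc k)"
proof -
 define i where "i = nat \<lfloor>real N * s\<rfloor>"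
 define j where "j = nat \<lfloor>real N * t\<rfloor>"
 have s0: "0 <= real N * s" using st by simp
 have t0: "0 <= real N * t" using st by simp
 have Nst: "real N * s < real N * t" using st N by simp
 have tN: "real N * t <= real N" using st N by (simp add: mult_left_le)
 have i1: "real i <= real N * s" unfolding i_def using s0 by simp
 have i2: "real N * s < real i + 1" unfolding i_def using s0 by linarith
 have j1: "real j <= real N * t" unfolding j_def using t0 by simp
 have j2: "real N * t < real j + 1" unfolding j_def using t0 by linarith
 have iN: "i < N" using i1 Nst tN by linarith
 have jN: "j <= N" using j1 tN by linarith
 have ij: "i <= j" using i1 Nst j2 by linarith
 show thesis
 proof (cases "i = j")
  case True
  show thesis by (rule cell[OF iN i1]) (use True j2 in simp)
 next
  case False
  define k where "k = (if j = N then N - 1 else j)"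
  show thesis
   by (rule far[of i j k]) (use False ij iN i1 i2 j1 j2 jN N tN in "auto simp: k_def")
 qed
qed

text \<open>Within one cell of the grid a linear function has the Hoelder constant that its increment over the cell dictates.\<close>

lemma powr_slope:
 assumes N: "(N::nat) > 0" and u: "0 <= u" "u <= 1 / real N" and eta: "0 < eta" "eta <= (1::real)"
 shows "real N * u * (1 / real N) powr eta <= u powr eta"
proof (cases "u = 0")
 case False
 have "real N * u * (1 / real N) powr eta = u * (1 / real N) powr (eta - 1)"
  using N by (simp add: powr_diff)
 also have "... <= u * u powr (eta - 1)" using u False eta by (intro mult_left_mono powr_mono2') auto
 also have "... = u powr eta" using False u by (simp add: powr_diff)
 finally show ?thesis .
qed simp

lemma polygon_cell_bound:
 assumes N: "N > 0" and j: "j < N" and eta: "0 < eta" "eta <= 1"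
  and s: "real j <= real N * s" "real N * s <= real (Suc j)" and t: "real j <= real N * t" "real N * t <= real (Suc j)"
  and K: "abs (v (Suc j) - v j) <= K * (1 / real N) powr eta"
 shows "abs (polygon N v s - polygon N v t) <= K * abs (s - t) powr eta"
proof -
 have K0: "0 <= K" using order.trans[OF abs_ge_zero K] N by (simp add: zero_le_mult_iff)
 have st: "abs (s - t) <= 1 / real N"
 proof -
  have "real N * s - real N * t <= 1" "real N * t - real N * s <= 1" using s t by (simp_all add: of_nat_Suc)
  then have "abs (real N * (s - t)) <= 1" unfolding right_diff_distrib by linarith
  then show ?thesis using N by (simp add: abs_mult pos_le_divide_eq mult.commute)
 qed
 have "polygon N v s - polygon N v t = real N * (s - t) * (v (Suc j) - v j)"
  unfolding polygon_cell[OF N j s] polygon_cell[OF N j t] by (simp add: algebra_simps)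
 then have "abs (polygon N v s - polygon N v t) = real N * abs (s - t) * abs (v (Suc j) - v j)" by (simp add: abs_mult)
 also have "... <= real N * abs (s - t) * (K * (1 / real N) powr eta)" using K by (intro mult_left_mono) auto
 also have "... = K * (real N * abs (s - t) * (1 / real N) powr eta)" by simp
 also have "... <= K * abs (s - t) powr eta" by (rule mult_left_mono[OF powr_slope[OF N _ st eta] K0]) simp
 finally show ?thesis .
qed

lemma polygon_hoelder_bound:
 assumes N: "N > 0" and eta: "0 < eta" "eta <= 1"
  and K: "!!i j. i < j ==> j <= N ==> abs (v j - v i) <= K * (real (j - i) / real N) powr eta"
 shows "hoelder_bound eta (polygon N v) (3 * K)"
proof (rule hoelder_bound_wlog)
 fix s t :: real assume st: "0 <= s" "s < t" "t <= 1"
 have K1: "abs (v (Suc j) - v j) <= K * (1 / real N) powr eta" if "j < N" for j using K[of j "Suc j"] that by simp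
 have K0: "0 <= K" using order.trans[OF abs_ge_zero K1[OF N]] N by (simp add: zero_le_mult_iff)
 show "abs (polygon N v s - polygon N v t) <= 3 * K * abs (s - t) powr eta"
  using N st
 proof (cases rule: grid_cases)
  case (cell j)
  have a: "real N * s <= real (Suc j)" "real j <= real N * t" using cell st N by (smt (verit) mult_left_mono of_nat_0_le_iff)+
  have "abs (polygon N v s - polygon N v t) <= K * abs (s - t) powr eta"
   by (rule polygon_cell_bound[OF N cell(1) eta cell(2) a cell(3) K1[OF cell(1)]])
  also have "... <= 3 * K * abs (s - t) powr eta" using K0 by (simp add: mult_right_mono)
  finally show ?thesis .
 next
  case (far i j k)
  define s' where "s' = real (Suc i) / real N"
  define t' where "t' = real j / real N"
  have Ns': "real N * s' = real (Suc i)" and Nt': "real N * t' = real j" using N by (simp_all add: s'_def t'_def)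
  have ss: "s <= s'" "s' <= t'" "t' <= t"
   using far N by (simp_all add: s'_def t'_def pos_le_divide_eq pos_divide_le_eq divide_right_mono mult.commute)
  have pv: "polygon N v s' = v (Suc i)" "polygon N v t' = v j"
   unfolding s'_def t'_def by (rule polygon_vertex[OF N]; use far in linarith)+
  have mono: "K * abs (a - b) powr eta <= K * abs (s - t) powr eta" if "abs (a - b) <= abs (s - t)" for a b
   by (rule mult_left_mono[OF powr_mono2[OF _ _ that] K0]) (use eta in auto)
  have 1: "abs (polygon N v s - polygon N v s') <= K * abs (s - t) powr eta"
   by (rule order.trans[OF polygon_cell_bound[OF N far(1) eta far(2,3) _ _ K1[OF far(1)]] mono])
    (use Ns' ss in auto)
  have 2: "abs (polygon N v t' - polygon N v t) <= K * abs (s - t) powr eta"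
  proof (rule order.trans[OF polygon_cell_bound[OF N far(7) eta _ _ _ _ K1[OF far(7)]] mono])
   show "real k <= real N * t" using far by linarith
   show "real k <= real N * t'" "real N * t' <= real (Suc k)" unfolding Nt' using far by auto
  qed (use far ss in auto)
  have 3: "abs (polygon N v s' - polygon N v t') <= K * abs (s - t) powr eta"
  proof (cases "Suc i = j")
   case False
   have "abs (v j - v (Suc i)) <= K * (real (j - Suc i) / real N) powr eta" using False far by (intro K) auto
   also have "real (j - Suc i) / real N = t' - s'" using far by (simp add: s'_def t'_def of_nat_diff diff_divide_distrib)
   also have "K * (t' - s') powr eta <= K * abs (s - t) powr eta" using mono[of t' s'] ss by simp
   finally show ?thesis unfolding pv by (simp add: abs_minus_commute)
  qed (use K0 pv in auto)
  show ?thesis using 1 2 3 by linarith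
 qed
qed

text \<open>The difference vanishes at the grid points, so only pairs in one cell count, where both terms obey the local bound.\<close>

theorem polygon_approximation:
 assumes N: "N > 0" and eta: "0 < eta" "eta <= 1"
  and x: "!!s t. s : {0..1} ==> t : {0..1} ==> abs (s - t) <= 1 / real N ==> abs (x s - x t) <= om * abs (s - t) powr eta"
 shows "hoelder_bound eta (%t. x t - polygon N (%j. x (real j / real N)) t) (4 * om)"
proof (rule hoelder_bound_wlog)
 fix s t :: real assume st: "0 <= s" "s < t" "t <= 1"
 let ?v = "%j. x (real j / real N)"
 define z where "z t = x t - polygon N ?v t" for t
 have om0: "0 <= om" 
 proof -
  have "1 / real N <= 1" using N by simp
  then show ?thesis using order.trans[OF abs_ge_zero x[of 0 "1 / real N"]] N by (simp add: zero_le_mult_iff)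
 qed
 have cellz: "abs (z a - z b) <= 2 * om * abs (a - b) powr eta"
  if j: "j < N" and a: "real j <= real N * a" "real N * a <= real (Suc j)" and b: "real j <= real N * b" "real N * b <= real (Suc j)" for j a b
 proof -
  have j01: "real j / real N : {0..1}" "real (Suc j) / real N : {0..1}" using j N by auto
  have in01: "c : {0..1}" if "real j <= real N * c" "real N * c <= real (Suc j)" for c
  proof -
   have "0 <= real N * c" "real N * c <= real N * 1" using that j by linarith+
   then have "0 <= c" "c <= 1" using N by (simp_all only: mult_le_cancel_left_pos of_nat_0_less_iff zero_le_mult_iff) (auto)
   then show ?thesis by simp
  qed
  have "abs (real N * (a - b)) <= 1" unfolding right_diff_distrib using a b by (simp add: abs_le_iff)
  then have ab: "abs (a - b) <= 1 / real N" using N by (simp add: abs_mult pos_le_divide_eq mult.commute)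
  have "abs (x a - x b) <= om * abs (a - b) powr eta" using in01 a b ab by (intro x) auto
  moreover have "abs (polygon N ?v a - polygon N ?v b) <= om * abs (a - b) powr eta"
  proof (rule polygon_cell_bound[OF N j eta a b])
   have e: "abs (real (Suc j) / real N - real j / real N) = 1 / real N" by (simp add: diff_divide_distrib[symmetric])
   show "abs (x (real (Suc j) / real N) - x (real j / real N)) <= om * (1 / real N) powr eta"
    using x[OF j01(2,1)] unfolding e by simp
  qed
  ultimately show ?thesis unfolding z_def by linarith
 qed
 have z0: "z (real j / real N) = 0" if "j <= N" for j
  unfolding z_def polygon_vertex[OF N that] by simp
 have "abs (z s - z t) <= 4 * om * abs (s - t) powr eta"
  using N st
 proof (cases rule: grid_cases)
  case (cell j)
  have a: "real N * s <= real (Suc j)" "real j <= real N * t" using cell st N by (smt (verit) mult_left_mono of_nat_0_le_iff)+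
  have "abs (z s - z t) <= 2 * om * abs (s - t) powr eta" by (rule cellz[OF cell(1,2) a cell(3)])
  also have "... <= 4 * om * abs (s - t) powr eta" using om0 by (simp add: mult_right_mono)
  finally show ?thesis .
 next
  case (far i j k)
  define s' where "s' = real (Suc i) / real N"
  define t' where "t' = real j / real N"
  have Ns': "real N * s' = real (Suc i)" and Nt': "real N * t' = real j" using N by (simp_all add: s'_def t'_def)
  have ss: "s <= s'" "s' <= t'" "t' <= t"
   using far N by (simp_all add: s'_def t'_def pos_le_divide_eq pos_divide_le_eq divide_right_mono mult.commute)
  have pv: "z s' = 0" "z t' = 0"
   unfolding s'_def t'_def by (rule z0; use far in linarith)+
  have mono: "2 * om * abs (a - b) powr eta <= 2 * om * abs (s - t) powr eta" if "abs (a - b) <= abs (s - t)" for a b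
   by (rule mult_left_mono[OF powr_mono2[OF _ _ that]]) (use eta om0 in auto)
  have 1: "abs (z s - z s') <= 2 * om * abs (s - t) powr eta"
   by (rule order.trans[OF cellz[OF far(1,2,3)] mono]) (use Ns' ss in auto)
  have 2: "abs (z t' - z t) <= 2 * om * abs (s - t) powr eta"
  proof (rule order.trans[OF cellz[OF far(7)] mono])
   show "real k <= real N * t" using far by linarith
   show "real k <= real N * t'" "real N * t' <= real (Suc k)" unfolding Nt' using far by auto
  qed (use far ss in auto)
  show ?thesis using 1 2 pv by linarith
 qed
 then show "abs ((x s - polygon N ?v s) - (x t - polygon N ?v t)) <= 4 * om * abs (s - t) powr eta" by (simp add: z_def)
qed

section \<open>Convergence in distribution in metric spaces\<close>

context Metric_space
begin

abbreviation "B \<equiv> borel_of_topology mtopology"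

lemma space_B: "space B = M" by (simp add: borel_of_topology_def space_measure_of_conv)

lemma sets_B: "openin mtopology U ==> U : sets B"
 unfolding borel_of_topology_def by (rule in_measure_of) (auto simp: openin_mtopology)

lemma measurable_BI:
 assumes "X : space N \<rightarrow> M" "!!U. openin mtopology U ==> X -` U \<inter> space N : sets N"
 shows "X : N ->M B"
 unfolding borel_of_topology_def
 by (rule measurable_sigma_sets[OF _ _ _ assms(2)]) (use assms(1) in "auto simp: openin_mtopology sets_measure_of_conv")

text \<open>A point of an open set \<open>U\<close> has a ball of some radius \<open>2 * r k\<close> inside \<open>U\<close>; hence the limit lies in \<open>U\<close> iff for some \<open>k\<close> almost
all terms lie in the union \<open>V k\<close> of the balls of half that radius.\<close>

lemma measurable_limit:
 assumes X: "!!n. X n : N ->M B" and Y: "!!x. x : space N ==> Y x : M"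
  and lim: "!!x. x : space N ==> (%n. d (X n x) (Y x)) ----> 0"
 shows "Y : N ->M B"
proof (rule measurable_BI)
 show "Y : space N \<rightarrow> M" using Y by auto
 fix U assume U: "openin mtopology U"
 have XM: "X n x : M" if "x : space N" for n x using measurable_space[OF X that] by (simp add: space_B)
 define r where "r k = 1 / real (Suc k)" for k
 have r: "r k > 0" for k by (simp add: r_def)
 define V where "V k = \<Union>{mball y (r k) |y. y : M & mball y (2 * r k) \<subseteq> U}" for k
 have V: "openin mtopology (V k)" for k unfolding V_def by (intro openin_Union) auto
 have "Y -` U \<inter> space N = {x : space N. EX k. EX n0. ALL n>=n0. X n x : V k}"
 proof (intro set_eqI iffI)
  fix x assume "x : Y -` U \<inter> space N"
  then have x: "x : space N" "Y x : U" by auto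
  obtain e where e: "e > 0" "mball (Y x) e \<subseteq> U" using U x by (auto simp: openin_mtopology)
  obtain k where k: "2 * r k < e"
  proof -
   obtain k where "2 / e < real (Suc k)" using reals_Archimedean2 by (metis less_Suc_eq less_trans of_nat_less_iff)
   then show thesis using e(1) by (intro that[of k]) (simp add: r_def field_simps)
  qed
  have "\<forall>\<^sub>F n in sequentially. d (X n x) (Y x) < r k" using lim[OF x(1)] r by (rule order_tendstoD)
  then obtain n0 where n0: "!!n. n >= n0 ==> d (X n x) (Y x) < r k" by (auto simp: eventually_sequentially)
  have sub: "mball (Y x) (2 * r k) \<subseteq> U" using e(2) k by (meson less_imp_le mball_subset_concentric subset_trans)
  have "X n x : V k" if "n >= n0" for n
   unfolding V_def using sub Y[OF x(1)] XM[OF x(1)] n0[OF that]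
   by (intro UnionI[of "mball (Y x) (r k)"]) (auto simp: commute)
  then show "x : {x : space N. EX k. EX n0. ALL n>=n0. X n x : V k}" using x(1) by blast
 next
  fix x assume "x : {x : space N. EX k. EX n0. ALL n>=n0. X n x : V k}"
  then obtain k n0 where x: "x : space N" "ALL n>=n0. X n x : V k" by auto
  have "\<forall>\<^sub>F n in sequentially. d (X n x) (Y x) < r k" using lim[OF x(1)] r by (rule order_tendstoD)
  then obtain n1 where n1: "!!n. n >= n1 ==> d (X n x) (Y x) < r k" by (auto simp: eventually_sequentially)
  define n where "n = max n0 n1"
  obtain y where y: "y : M" "mball y (2 * r k) \<subseteq> U" "X n x : mball y (r k)"
   using x(2)[rule_format, of n] unfolding V_def n_def by auto
  have "d y (Y x) <= d y (X n x) + d (X n x) (Y x)" using y Y x XM by (intro triangle) auto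
  also have "... < 2 * r k" using y(3) n1[of n] by (simp add: n_def)
  finally have "Y x : mball y (2 * r k)" using y Y x by simp
  then show "x : Y -` U \<inter> space N" using y x(1) by auto
 qed
 also have "... : sets N"
 proof -
  have m: "{x : space N. X n x : V k} : sets N" for n k
  proof -
   have "{x : space N. X n x : V k} = X n -` V k \<inter> space N" by auto
   then show ?thesis using measurable_sets[OF X sets_B[OF V]] by simp
  qed
  have "{x : space N. EX k. EX n0. ALL n>=n0. X n x : V k} = (\<Union>k. \<Union>n0. space N \<inter> (\<Inter>n\<in>{n0..}. {x : space N. X n x : V k}))" by auto
  then show ?thesis using m by (simp only:) (intro sets.countable_UN' sets.Int sets.top sets.countable_INT' , auto)
 qed
 finally show "Y -` U \<inter> space N : sets N" .
qed

lemma measurable_continuous: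
 assumes X: "X : N ->M B" and h: "continuous_map mtopology euclideanreal h"
 shows "(%x. h (X x)) : borel_measurable N"
proof (rule borel_measurableI)
 fix S :: "real set" assume "open S"
 then have o: "openin mtopology {x : M. h x : S}"
  using h by (auto simp: continuous_map_def)
 have "(%x. h (X x)) -` S \<inter> space N = X -` {x : M. h x : S} \<inter> space N"
  using measurable_space[OF X] by (auto simp: space_B)
 also have "... : sets N" by (rule measurable_sets[OF X sets_B[OF o]])
 finally show "(%x. h (X x)) -` S \<inter> space N : sets N" .
qed

lemma continuous_map_lipschitz:
 assumes L: "!!x y. x : M ==> y : M ==> abs (h x - h y) <= L * d x y"
 shows "continuous_map mtopology euclideanreal h"
proof -
 have "continuous_map mtopology Met_TC.mtopology h"
  unfolding metric_continuous_map[OF Met_TC.Metric_space_axioms]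
 proof (intro conjI ballI allI impI)
  fix a and e :: real assume a: "a : M" "e > 0"
  show "EX dlt>0. ALL x. x : M & d a x < dlt --> dist (h a) (h x) < e"
  proof (intro exI conjI allI impI)
   show "0 < e / (abs L + 1)" using a(2) by (simp add: add_nonneg_pos)
   fix x assume x: "x : M & d a x < e / (abs L + 1)"
   have "abs (h a - h x) <= L * d a x" using a x by (intro L) auto
   also have "... <= (abs L + 1) * d a x" by (intro mult_right_mono) auto
   also have "... < e" using x add_nonneg_pos[OF abs_ge_zero[of L] zero_less_one] by (simp add: pos_less_divide_eq mult.commute)
   finally show "dist (h a) (h x) < e" by (simp add: dist_real_def)
  qed
 qed auto
 then show ?thesis by (simp add: mtopology_is_euclidean)
qed

text \<open>The inf-convolutions \<open>g k x = inf (h y + k * d x y)\<close> are \<open>k\<close>-Lipschitz and increase to \<open>h\<close>, which gives the lower bound for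
the limit inferior; the upper bound follows from \<open>- h\<close>.\<close>

theorem converges_in_distributionI:
 assumes N: "prob_space N" "prob_space N'"
  and X: "!!n. X n : N ->M B" and Y: "Y : N' ->M B"
  and lip: "!!h L b. (!!x. x : M ==> abs (h x) <= b) ==> (!!x y. x : M ==> y : M ==> abs (h x - h y) <= L * d x y)
   ==> (%n. \<integral>om. h (X n om) \<partial>N) ----> (LINT om|N'. h (Y om))"
 shows "converges_in_distribution mtopology N X N' Y"
proof -
 interpret N: prob_space N by fact
 interpret N': prob_space N' by fact
 have XM: "X n x : M" if "x : space N" for n x using measurable_space[OF X that] by (simp add: space_B)
 have YM: "Y x : M" if "x : space N'" for x using measurable_space[OF Y that] by (simp add: space_B)
 have lower: "\<forall>\<^sub>F n in sequentially. (LINT om|N'. h (Y om)) - eps < (LINT om|N. h (X n om))"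
  if h: "continuous_map mtopology euclideanreal h" and b: "!!x. x : M ==> abs (h x) <= b" and eps: "eps > 0" for h b eps
 proof -
  obtain x0 where x0: "x0 : M" using YM N'.not_empty by auto
  define g where "g k x = (INF y\<in>M. h y + real k * d x y)" for k x
  have bdd: "bdd_below ((%y. h y + real k * d x y) ` M)" for k x
  proof (rule bdd_belowI2)
   fix y assume "y : M"
   then show "- b <= h y + real k * d x y" using b[of y] by (smt (verit) nonneg mult_nonneg_nonneg of_nat_0_le_iff)
  qed
  have g_le: "g k x <= h y + real k * d x y" if "y : M" for k x y
   unfolding g_def by (rule cINF_lower[OF bdd that])
  have g_le_h: "g k x <= h x" if "x : M" for k x using g_le[OF that, of k x] that by simp
  have g_ge: "- b <= g k x" for k x
   unfolding g_def
  proof (rule cINF_greatest)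
   fix y assume "y : M"
   then show "- b <= h y + real k * d x y" using b[of y] by (smt (verit) nonneg mult_nonneg_nonneg of_nat_0_le_iff)
  qed (use x0 in auto)
  have g_b: "abs (g k x) <= b" if "x : M" for k x using g_ge[of k x] g_le_h[OF that, of k] b[OF that] by linarith
  have g_lip1: "g k x - real k * d x z <= g k z" if "x : M" "z : M" for k x z
  proof -
   have "g k x - real k * d x z <= h y + real k * d z y" if "y : M" for y
   proof -
    have "real k * d x y <= real k * (d x z + d z y)" using that \<open>x : M\<close> \<open>z : M\<close> by (intro mult_left_mono triangle) auto
    then show ?thesis using g_le[OF that, of k x] by (simp add: distrib_left)
   qed
   then show ?thesis unfolding g_def[of k z] using x0 by (intro cINF_greatest) auto
  qed
  have g_lip: "abs (g k x - g k z) <= real k * d x z" if "x : M" "z : M" for k x z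
   using g_lip1[OF that, of k] g_lip1[OF that(2,1), of k] by (simp add: commute)
  have g_lim: "(%k. g k x) ----> h x" if x: "x : M" for x
  proof (rule LIMSEQ_I)
   fix e :: real assume e: "e > 0"
   have "openin mtopology {y : M. h y : {h x - e / 2<..}}"
    using h open_greaterThan[of "h x - e / 2"] unfolding continuous_map_def by (simp only: topspace_mtopology open_openin[symmetric] Pi_iff)
   moreover have "x : {y : M. h y : {h x - e / 2<..}}" using x e by simp
   ultimately obtain dlt where dlt: "dlt > 0" "mball x dlt \<subseteq> {y : M. h y : {h x - e / 2<..}}"
    unfolding openin_mtopology by blast
   obtain k0 where k0: "2 * b / dlt < real k0" using reals_Archimedean2 by blast
   have "norm (g k x - h x) < e" if k: "k >= k0" for k
   proof -
    have "h x - e / 2 <= h y + real k * d x y" if y: "y : M" for y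
    proof (cases "d x y < dlt")
     case True
     then have "h x - e / 2 < h y" using dlt x y by auto
     then show ?thesis using mult_nonneg_nonneg[of "real k" "d x y"] by (simp add: add_increasing2 less_imp_le)
    next
     case False
     have "2 * b < real k0 * dlt" using k0 dlt by (simp add: pos_divide_less_eq)
     also have "... <= real k * d x y" using k False dlt by (intro mult_mono) auto
     finally show ?thesis using b[OF x] b[OF y] e by linarith
    qed
    then have "h x - e / 2 <= g k x" unfolding g_def using x0 by (intro cINF_greatest) auto
    then show ?thesis using g_le_h[OF x, of k] e by simp
   qed
   then show "EX no. ALL n>=no. norm (g n x - h x) < e" by blast
  qed
  have gc: "continuous_map mtopology euclideanreal (g k)" for k by (rule continuous_map_lipschitz[OF g_lip])
  note hX [measurable] = measurable_continuous[OF X h]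
  note hY [measurable] = measurable_continuous[OF Y h]
  note gX [measurable] = measurable_continuous[OF X gc]
  note gY [measurable] = measurable_continuous[OF Y gc]
  have "(%k. \<integral>om. g k (Y om) \<partial>N') ----> (LINT om|N'. h (Y om))"
   by (rule integral_dominated_convergence[where w = "%_. b"]) (use g_lim g_b YM in "auto intro!: AE_I2")
  then have "\<forall>\<^sub>F k in sequentially. (LINT om|N'. h (Y om)) - eps < (LINT om|N'. g k (Y om))"
   by (rule order_tendstoD(1)) (use eps in simp)
  then obtain k where k: "(LINT om|N'. h (Y om)) - eps < (LINT om|N'. g k (Y om))" by (auto simp: eventually_sequentially)
  have "(%n. \<integral>om. g k (X n om) \<partial>N) ----> (LINT om|N'. g k (Y om))" by (rule lip[OF g_b g_lip])
  then have "\<forall>\<^sub>F n in sequentially. (LINT om|N'. h (Y om)) - eps < (LINT om|N. g k (X n om))" using k by (rule order_tendstoD(1))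
  then show ?thesis
  proof eventually_elim
   case (elim n)
   have "(LINT om|N. g k (X n om)) <= (LINT om|N. h (X n om))"
   proof (rule integral_mono_AE)
    show "integrable N (%om. g k (X n om))" using g_b XM by (intro N.integrable_const_bound[of _ b]) auto
    show "integrable N (%om. h (X n om))" using b XM by (intro N.integrable_const_bound[of _ b]) auto
   qed (use g_le_h XM in auto)
   then show ?case using elim by linarith
  qed
 qed
 show ?thesis
  unfolding converges_in_distribution_def
 proof (intro conjI allI impI X Y)
  fix h assume h: "continuous_map mtopology euclideanreal h & bounded (h ` topspace mtopology)"
  then obtain b where b: "!!x. x : M ==> abs (h x) <= b" by (auto simp: bounded_iff)
  have c: "continuous_map mtopology euclideanreal (%x. - h x)" using h by (intro continuous_map_minus) auto
  show "(%n. \<integral>om. h (X n om) \<partial>N) ----> (LINT om|N'. h (Y om))"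
  proof (rule tendstoI)
   fix e :: real assume e: "e > 0"
   have 1: "\<forall>\<^sub>F n in sequentially. (LINT om|N'. h (Y om)) - e < (LINT om|N. h (X n om))" by (rule lower[OF conjunct1[OF h] b e])
   have 2: "\<forall>\<^sub>F n in sequentially. (LINT om|N'. - h (Y om)) - e < (LINT om|N. - h (X n om))" by (rule lower[OF c _ e, of b]) (use b in auto)
   show "\<forall>\<^sub>F n in sequentially. dist (LINT om|N. h (X n om)) (LINT om|N'. h (Y om)) < e"
    using 1 2 by eventually_elim (simp add: dist_real_def abs_less_iff)
  qed
 qed
qed

end

section \<open>Tightness of the increments of Birkhoff sums\<close>

text \<open>Round \<open>i\<close> up and \<open>j\<close> down to even times, at the cost of one step each, and pass to the sequence at even times.\<close>

lemma dyadic_chaining: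
 fixes S D :: "nat => real"
 assumes "!!l k. (k + 1) * 2 ^ l <= n ==> abs (S ((k + 1) * 2 ^ l) - S (k * 2 ^ l)) <= D l" and "!!l. 0 <= D l"
  and "i <= j" "j <= n" "j - i < 2 ^ m"
 shows "abs (S j - S i) <= 2 * (SUM l<m. D l)"
 using assms
proof (induction m arbitrary: S D n i j)
 case 0
 then show ?case by simp
next
 case (Suc m)
 note D = Suc.prems(1)
 have step: "abs (S (Suc k) - S k) <= D 0" if "Suc k <= n" for k using D[of k 0] that by simp
 have D0: "0 <= D 0" by (rule Suc.prems(2))
 define i' where "i' = (i + 1) div 2"
 define j' where "j' = j div 2"
 show ?case
 proof (cases "i' <= j'")
  case True
  have 1: "abs (S (2 * j') - S (2 * i')) <= 2 * (SUM l<m. D (Suc l))"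
  proof (rule Suc.IH[of "n div 2" "%k. S (2 * k)" "%l. D (Suc l)" i' j'])
   fix l k :: nat assume a: "(k + 1) * 2 ^ l <= n div 2"
   have "(k + 1) * 2 ^ Suc l <= n" using a by (simp add: algebra_simps)
   from D[OF this] show "abs (S (2 * ((k + 1) * 2 ^ l)) - S (2 * (k * 2 ^ l))) <= D (Suc l)"
    by (simp add: mult_ac)
  next
   show "0 <= D (Suc l)" for l by (rule Suc.prems(2))
   show "j' <= n div 2" using Suc.prems unfolding j'_def by (intro div_le_mono) auto
   have "2 * j' <= j" "i <= 2 * i'" unfolding i'_def j'_def by linarith+
   then have "2 * (j' - i') < 2 * 2 ^ m" using Suc.prems(5) by simp
   then show "j' - i' < 2 ^ m" by simp
  qed (rule True)
  have 2: "abs (S j - S (2 * j')) <= D 0"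
  proof -
   have "j = 2 * j' | j = Suc (2 * j')" unfolding j'_def by linarith
   then show ?thesis using step[of "2 * j'"] D0 Suc.prems(4) by auto
  qed
  have 3: "abs (S (2 * i') - S i) <= D 0"
  proof -
   have "i = 2 * i' | 2 * i' = Suc i" unfolding i'_def by linarith
   moreover have "2 * i' <= n" using True Suc.prems(4) unfolding j'_def by linarith
   ultimately show ?thesis using step[of i] D0 by auto
  qed
  have "(SUM l<Suc m. D l) = D 0 + (SUM l<m. D (Suc l))" by (rule sum.lessThan_Suc_shift)
  then show ?thesis using 1 2 3 by (simp del: sum.lessThan_Suc)
 next
  case False
  then have "i = j" using Suc.prems(3) unfolding i'_def j'_def by linarith
  then show ?thesis using Suc.prems(2) by (simp add: sum_nonneg del: sum.lessThan_Suc)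
 qed
qed

definition chaining_constant :: "real => real" where
 "chaining_constant eta = 2 * (2 powr eta / (2 powr eta - 1))"

lemma geometric_powr_sum_le:
 assumes "eta > (0::real)"
 shows "(SUM l<Suc m. real (2 ^ l) powr eta) <= real (2 ^ m) powr eta * (2 powr eta / (2 powr eta - 1))"
proof -
 have q: "2 powr eta > 1" using assms by simp
 have e: "real (2 ^ l) powr eta = (2 powr eta) ^ l" for l by (simp add: powr_realpow[symmetric] powr_powr mult.commute)
 have "(SUM l<Suc m. real (2 ^ l) powr eta) = ((2 powr eta) ^ Suc m - 1) / (2 powr eta - 1)"
  unfolding e by (rule geometric_sum) (use q in linarith)
 also have "... <= (2 powr eta) ^ Suc m / (2 powr eta - 1)" using q by (intro divide_right_mono) auto
 also have "... = real (2 ^ m) powr eta * (2 powr eta / (2 powr eta - 1))" unfolding e by simp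
 finally show ?thesis .
qed

lemma dyadic_hoelder:
 fixes S :: "nat => real"
 assumes eta: "eta > 0" and Q: "Q >= 0" and ij: "i < j" "j <= n"
  and D: "!!l k. (k + 1) * 2 ^ l <= n ==> abs (S ((k + 1) * 2 ^ l) - S (k * 2 ^ l)) <= Q * real (2 ^ l) powr eta"
 shows "abs (S j - S i) <= chaining_constant eta * Q * real (j - i) powr eta"
proof -
 obtain m where m: "2 ^ m <= j - i" "j - i < 2 ^ (m + 1)" using ex_power_ivl1[of 2 "j - i"] ij by (metis One_nat_def Suc_leI order_refl zero_less_diff)
 have q: "2 powr eta > 1" using eta by simp
 have "abs (S j - S i) <= 2 * (SUM l<Suc m. Q * real (2 ^ l) powr eta)"
  by (rule dyadic_chaining[where n = n]) (use D Q ij m in auto)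
 also have "... = 2 * Q * (SUM l<Suc m. real (2 ^ l) powr eta)" by (simp only: sum_distrib_left mult.assoc)
 also have "... <= 2 * Q * (real (2 ^ m) powr eta * (2 powr eta / (2 powr eta - 1)))"
  using Q by (intro mult_left_mono geometric_powr_sum_le eta) auto
 also have "... <= 2 * Q * (real (j - i) powr eta * (2 powr eta / (2 powr eta - 1)))"
 proof (intro mult_left_mono mult_right_mono powr_mono2)
  show "real (2 ^ m) <= real (j - i)" using m(1) by (simp only: of_nat_le_iff)
  show "0 <= 2 powr eta / (2 powr eta - 1)" using q by (intro divide_nonneg_pos) linarith+
 qed (use Q eta in auto)
 finally show ?thesis by (simp add: chaining_constant_def mult_ac)
qed

context decorrelated
begin

lemma S_shift: "S (d + q) x - S d x = S q ((f ^^ d) x)"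
proof (induction q)
 case (Suc q)
 have "(f ^^ (d + q)) x = (f ^^ q) ((f ^^ d) x)" by (simp add: add.commute[of d] funpow_add)
 then show ?case using Suc by (simp add: birkhoff_sum_def)
qed (simp add: birkhoff_sum_def)

definition irregular :: "real => real => nat => 'a set" where
 "irregular K eta n = {x. EX i j. i < j & j <= n & K * sqrt (real n) * (real (j - i) / real n) powr eta < abs (S j x - S i x)}"

text \<open>By chaining, a large Hoelder quotient forces a large increment over some dyadic block. Markov's inequality with the
moment of order \<open>r\<close> bounds each block, and the sum over blocks of length \<open>2 ^ l\<close> is geometric since \<open>eta < 1 / 2 - 1 / r\<close>.\<close>

theorem increments_tight:
 assumes r: "2 < r" "r < 2 * kap" and eta: "0 < eta" "eta < 1 / 2 - 1 / r"
 obtains C where "!!n K. n >= 1 ==> K > 0 ==>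
  measure mu (irregular K eta n) <= C * K powr (- r)"
proof -
 obtain C1 where C1: "!!n. n >= 1 ==> (LINT x|mu. abs (S n x) powr r) <= C1 * real n powr (r / 2)"
  using moment_bound[OF r] by blast
 have C1_0: "0 <= C1"
 proof -
  have "0 <= (LINT x|mu. abs (S 1 x) powr r)" by (intro integral_nonneg_AE) auto
  also have "... <= C1 * real 1 powr (r / 2)" by (rule C1) simp
  finally show ?thesis by simp
 qed
 define bet where "bet = r / 2 - 1 - eta * r"
 have bet: "bet > 0"
 proof -
  have "eta * r < (1 / 2 - 1 / r) * r" using eta r by (intro mult_strict_right_mono) auto
  also have "... = r / 2 - 1" using r by (simp add: left_diff_distrib)
  finally show ?thesis by (simp add: bet_def)
 qed
 define c0 where "c0 = chaining_constant eta"
 have c0: "c0 > 0" using eta by (simp add: c0_def chaining_constant_def)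
 show thesis
 proof (rule that[of "C1 * c0 powr r * (2 powr bet / (2 powr bet - 1))"])
  fix n :: nat and K :: real assume n: "n >= 1" and K: "K > 0"
  define Q where "Q = K / c0 * real n powr (1 / 2 - eta)"
  have Q: "Q > 0" using K c0 n by (simp add: Q_def)
  define E where "E l k = {x. Q * real (2 ^ l) powr eta < abs (S ((k + 1) * 2 ^ l) x - S (k * 2 ^ l) x)}" for l k
  have E [measurable]: "E l k : sets mu" for l k
   unfolding E_def sets_mu by measurable
  obtain L where L: "2 ^ L <= n" "n < 2 ^ (L + 1)" using ex_power_ivl1[of 2 n] n by auto
  have sub: "irregular K eta n
    \<subseteq> (\<Union>l\<in>{..<Suc L}. \<Union>k\<in>{..<n div 2 ^ l}. E l k)"
  proof (rule subsetI, rule ccontr)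
   fix x assume x: "x : irregular K eta n"
    and nx: "x \<notin> (\<Union>l\<in>{..<Suc L}. \<Union>k\<in>{..<n div 2 ^ l}. E l k)"
   obtain i j where ij: "i < j" "j <= n" and big: "K * sqrt (real n) * (real (j - i) / real n) powr eta < abs (S j x - S i x)"
    using x by (auto simp: irregular_def)
   have "abs (S j x - S i x) <= chaining_constant eta * Q * real (j - i) powr eta"
   proof (rule dyadic_hoelder[OF eta(1) less_imp_le[OF Q] ij])
    fix l k :: nat assume lk: "(k + 1) * 2 ^ l <= n"
    have "2 ^ l <= (k + 1) * 2 ^ l" by simp
    then have "(2::nat) ^ l < 2 ^ (L + 1)" using lk L(2) by linarith
    then have "l < Suc L" using power_less_imp_less_exp[of "2::nat" l "L + 1"] by simp
    moreover have "k < n div 2 ^ l" using lk div_le_mono[OF lk, of "2 ^ l"] by simp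
    ultimately show "abs (S ((k + 1) * 2 ^ l) x - S (k * 2 ^ l) x) <= Q * real (2 ^ l) powr eta"
     using nx by (force simp: E_def)
   qed
   also have "... = K * (real n powr (1 / 2 - eta) * real (j - i) powr eta)"
    using c0 by (simp add: Q_def c0_def)
   also have "real n powr (1 / 2 - eta) * real (j - i) powr eta = sqrt (real n) * (real (j - i) / real n) powr eta"
    using n by (simp add: powr_diff powr_half_sqrt powr_divide)
   finally show False using big by simp
  qed
  have Em: "measure mu (E l k) <= C1 * (Q powr (- r) * real (2 ^ l) powr (r / 2 - eta * r))" for l k
  proof -
   define b where "b = Q * real (2 ^ l) powr eta"
   have b: "b > 0" using Q by (simp add: b_def)
   have sh: "S ((k + 1) * 2 ^ l) x - S (k * 2 ^ l) x = S (2 ^ l) ((f ^^ (k * 2 ^ l)) x)" for x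
    using S_shift[of "k * 2 ^ l" "2 ^ l" x] by (simp add: add.commute)
   define g where "g x = abs (S (2 ^ l) x) powr r" for x
   have gb: "bdd_borel g" unfolding g_def using r by (intro powr_bb S_bb) auto
   have gb': "bdd_borel (%x. g ((f ^^ (k * 2 ^ l)) x))" by (intro bb_comp gb)
   have "b powr r * measure mu (E l k) = (LINT x|mu. b powr r * indicator (E l k) x)" by simp
   also have "... <= (LINT x|mu. g ((f ^^ (k * 2 ^ l)) x))"
   proof (rule integral_mono)
    show "integrable mu (%x. b powr r * indicator (E l k) x)"
     by (intro integrable_mult_right integrable_real_indicator E) (simp add: less_top[symmetric])
    show "integrable mu (%x. g ((f ^^ (k * 2 ^ l)) x))" by (rule bb_int[OF gb'])
    fix x show "b powr r * indicator (E l k) x <= g ((f ^^ (k * 2 ^ l)) x)"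
    proof (cases "x : E l k")
     case True
     then have "b < abs (S (2 ^ l) ((f ^^ (k * 2 ^ l)) x))" unfolding E_def mem_Collect_eq sh b_def .
     then show ?thesis using b r True by (simp add: g_def powr_mono2)
    qed (simp add: g_def)
   qed
   also have "... = (LINT x|mu. g x)" using gb by (intro invariant) (simp add: bdd_borel_def)
   also have "... <= C1 * real (2 ^ l) powr (r / 2)" unfolding g_def by (rule C1) simp
   finally have "measure mu (E l k) <= C1 * real (2 ^ l) powr (r / 2) / b powr r"
    using b by (simp add: pos_le_divide_eq mult.commute)
   also have "... = C1 * (Q powr (- r) * real (2 ^ l) powr (r / 2 - eta * r))"
   proof -
    have "b powr r = Q powr r * real (2 ^ l) powr (eta * r)" unfolding b_def using Q by (simp only: powr_mult powr_powr)
    then show ?thesis by (simp only: powr_diff powr_minus_divide) (simp only: times_divide_eq_right times_divide_eq_left divide_divide_eq_left mult_1_left)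
   qed
   finally show ?thesis .
  qed
  have Qr: "Q powr (- r) = c0 powr r * K powr (- r) * real n powr (- bet - 1)"
  proof -
   have "Q powr (- r) = (K / c0) powr (- r) * (real n powr (1 / 2 - eta)) powr (- r)"
    unfolding Q_def using K c0 by (intro powr_mult)
   also have "(K / c0) powr (- r) = c0 powr r * K powr (- r)" using K c0 by (simp add: powr_divide powr_minus_divide)
   also have "(real n powr (1 / 2 - eta)) powr (- r) = real n powr (- bet - 1)"
    by (simp add: powr_powr bet_def algebra_simps)
   finally show ?thesis .
  qed
  have "measure mu (irregular K eta n)
   <= measure mu (\<Union>l\<in>{..<Suc L}. \<Union>k\<in>{..<n div 2 ^ l}. E l k)"
   by (intro finite_measure_mono sub sets.finite_UN finite_lessThan E)
  also have "... <= (SUM l<Suc L. measure mu (\<Union>k\<in>{..<n div 2 ^ l}. E l k))"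
   by (intro finite_measure_subadditive_finite image_subsetI sets.finite_UN finite_lessThan E)
  also have "... <= (SUM l<Suc L. C1 * (c0 powr r * K powr (- r)) * real n powr (- bet) * real (2 ^ l) powr bet)"
  proof (rule sum_mono)
   fix l
   have "measure mu (\<Union>k\<in>{..<n div 2 ^ l}. E l k) <= (SUM k<n div 2 ^ l. measure mu (E l k))"
    by (intro finite_measure_subadditive_finite image_subsetI finite_lessThan E)
   also have "... <= (SUM k<n div 2 ^ l. C1 * (Q powr (- r) * real (2 ^ l) powr (r / 2 - eta * r)))" by (intro sum_mono Em)
   also have "... = real (n div 2 ^ l) * (C1 * (Q powr (- r) * real (2 ^ l) powr (r / 2 - eta * r)))" by simp
   also have "... <= (real n / real (2 ^ l)) * (C1 * (Q powr (- r) * real (2 ^ l) powr (r / 2 - eta * r)))"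
    using C1_0 of_nat_div_le_of_nat[of n "2 ^ l"] by (intro mult_right_mono) auto
   also have "... = C1 * (c0 powr r * K powr (- r)) * (real n * real n powr (- bet - 1)) * (real (2 ^ l) powr (r / 2 - eta * r) / real (2 ^ l))"
    unfolding Qr by (simp only: divide_inverse mult_ac)
   also have "real n * real n powr (- bet - 1) = real n powr (- bet)" using n by (simp add: powr_diff)
   also have "real (2 ^ l) powr (r / 2 - eta * r) / real (2 ^ l) = real (2 ^ l) powr bet"
    unfolding bet_def by (simp add: powr_diff)
   finally show "measure mu (\<Union>k\<in>{..<n div 2 ^ l}. E l k) <= C1 * (c0 powr r * K powr (- r)) * real n powr (- bet) * real (2 ^ l) powr bet" .
  qed
  also have "... = C1 * (c0 powr r * K powr (- r)) * real n powr (- bet) * (SUM l<Suc L. real (2 ^ l) powr bet)"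
   by (simp only: sum_distrib_left)
  also have "... <= C1 * (c0 powr r * K powr (- r)) * real n powr (- bet) * (real n powr bet * (2 powr bet / (2 powr bet - 1)))"
  proof (rule mult_left_mono[OF order.trans[OF geometric_powr_sum_le[OF bet]]])
   have "real (2 ^ L) <= real n" using L(1) by (simp only: of_nat_le_iff)
   then show "real (2 ^ L) powr bet * (2 powr bet / (2 powr bet - 1)) <= real n powr bet * (2 powr bet / (2 powr bet - 1))"
    using bet powr_mono[of 0 bet "2::real"] by (intro mult_right_mono powr_mono2 divide_nonneg_nonneg) auto
  qed (use C1_0 in auto)
  also have "... = C1 * c0 powr r * (2 powr bet / (2 powr bet - 1)) * K powr (- r) * (real n powr (- bet) * real n powr bet)"
   by (simp only: mult_ac)
  also have "real n powr (- bet) * real n powr bet = 1" using n by (simp add: powr_add[symmetric])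
  finally show "measure mu (irregular K eta n)
   <= C1 * c0 powr r * (2 powr bet / (2 powr bet - 1)) * K powr (- r)" by simp
 qed
qed

end

interpretation hoelder: Metric_space "hoelder_space0 eta" "hoelder_dist eta" for eta
 by (rule Metric_space_hoelder)

lemma hoelder_mtopology: "hoelder.mtopology eta = hoelder_topology0 eta"
 by (simp add: hoelder_topology0_def)

lemma hoelder_bound_cong:
 assumes "!!t. t : {0..1} ==> x t = y t"
 shows "hoelder_bound eta x K \<longleftrightarrow> hoelder_bound eta y K"
 unfolding hoelder_bound_def using assms by simp

lemma polygon_hoelder_bound_crude:
 assumes eta: "0 < eta" "eta <= 1"
 shows "hoelder_bound eta (polygon N v) (6 * real N * (SUM k<=N. abs (v k)))"
proof (cases "N = 0")
 case True
 have "polygon 0 v t = v 0" if "t : {0..1}" for t using that by (simp add: polygon_def)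
 then show ?thesis unfolding hoelder_bound_def True by simp
next
 case False
 then have N: "N > 0" by simp
 have "hoelder_bound eta (polygon N v) (3 * (2 * real N * (SUM k<=N. abs (v k))))"
 proof (rule polygon_hoelder_bound[OF N eta])
  fix i j :: nat assume ij: "i < j" "j <= N"
  have le: "abs (v k) <= (SUM k<=N. abs (v k))" if "k <= N" for k using that by (intro member_le_sum) auto
  have "abs (v j - v i) <= 2 * (SUM k<=N. abs (v k)) * 1" using le[of i] le[of j] ij by linarith
  also have "1 <= real N * (real (j - i) / real N) powr eta"
  proof -
   have "1 <= real (j - i)" using ij by simp
   also have "... = real N * (real (j - i) / real N) powr 1" using N ij by simp
   also have "... <= real N * (real (j - i) / real N) powr eta"
    using N ij eta by (intro mult_left_mono powr_mono') auto
   finally show ?thesis .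
  qed
  then have "2 * (SUM k<=N. abs (v k)) * 1 <= 2 * (SUM k<=N. abs (v k)) * (real N * (real (j - i) / real N) powr eta)"
   by (intro mult_left_mono) (auto intro: sum_nonneg)
  finally show "abs (v j - v i) <= 2 * real N * (SUM k<=N. abs (v k)) * (real (j - i) / real N) powr eta" by (simp only: mult_ac)
 qed
 then show ?thesis by (simp add: mult_ac)
qed

lemma polygon_space0:
 assumes "0 < eta" "eta < 1"
 shows "polygon N v : hoelder_space0 eta"
 by (rule hoelder_space0I[OF polygon_extensional polygon_hoelder_bound_crude[of 1]]) (use assms in auto)

text \<open>For a fixed grid, the Hoelder distance of polygons is controlled by the vertices, so polygons depend measurably on them.\<close>

lemma polygon_dist:
 assumes eta: "0 < eta" "eta < 1"
 shows "hoelder_dist eta (polygon N v) (polygon N w) <= (6 * real N + 1) * (SUM k<=N. abs (v k - w k))"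
proof -
 have "hoelder_bound eta (%t. polygon N v t - polygon N w t) (6 * real N * (SUM k<=N. abs (v k - w k)))"
  by (subst hoelder_bound_cong[OF polygon_diff]) (use eta in "auto intro: polygon_hoelder_bound_crude")
 then have "hoelder_dist eta (polygon N v) (polygon N w) <= 6 * real N * (SUM k<=N. abs (v k - w k)) + abs (polygon N v 0 - polygon N w 0)"
  by (rule hoelder_dist_le)
 also have "abs (polygon N v 0 - polygon N w 0) = abs (v 0 - w 0)" by (simp add: polygon_def)
 also have "abs (v 0 - w 0) <= (SUM k<=N. abs (v k - w k))" by (intro member_le_sum) auto
 finally show ?thesis by (simp add: distrib_right)
qed

lemma polygon_cong:
 assumes "!!k. k <= N ==> v k = w k"
 shows "polygon N v = polygon N w"
proof -
 have "hoelder_dist (1/2) (polygon N v) (polygon N w) <= 0"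
  using polygon_dist[of "1/2" N v w] assms by simp
 then have "hoelder_dist (1/2) (polygon N v) (polygon N w) = 0"
  using hoelder.nonneg[of "1/2" "polygon N v" "polygon N w"] by linarith
 then show ?thesis by (intro hoelder_dist_zero_imp_eq[of _ "1/2"] polygon_space0) auto
qed

lemma polygon_measurable:
 assumes eta: "0 < eta" "eta < 1" and xi: "!!i. xi i : borel_measurable M"
 shows "(%x. polygon N (%i. xi i x)) : M ->M borel_of_topology (hoelder_topology0 eta)"
proof -
 have "polygon N : borel ->M hoelder.B eta"
 proof (rule hoelder.measurable_BI)
  show "polygon N : space borel \<rightarrow> hoelder_space0 eta" using polygon_space0[OF eta] by auto
  fix U assume U: "openin (hoelder.mtopology eta) U"
  have "open (polygon N -` U)"
  proof (subst open_subopen, intro ballI)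
   fix v assume v: "v : polygon N -` U"
   obtain e where e: "e > 0" "hoelder.mball eta (polygon N v) e \<subseteq> U" using U v by (auto simp: hoelder.openin_mtopology)
   let ?T = "{w. (6 * real N + 1) * (SUM k<=N. abs (v k - w k)) < e}"
   have "continuous_on UNIV (%w::nat => real. w k)" for k by (rule continuous_on_product_coordinates)
   then have "open ?T" by (intro open_Collect_less continuous_intros)
   moreover have "v : ?T" using e by simp
   moreover have "?T \<subseteq> polygon N -` U"
   proof
    fix w assume w: "w : ?T"
    then have "hoelder_dist eta (polygon N v) (polygon N w) < e" using polygon_dist[OF eta, of N v w] by simp
    then have "polygon N w : hoelder.mball eta (polygon N v) e" using polygon_space0[OF eta] by simp
    then show "w : polygon N -` U" using e by auto
   qed
   ultimately show "EX T. open T & v : T & T \<subseteq> polygon N -` U" by blast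
  qed
  then show "polygon N -` U \<inter> space borel : sets borel" by simp
 qed
 moreover have "(%x i. xi i x) : M ->M borel" by (rule measurable_coordinatewise_then_product) (rule xi)
 ultimately show ?thesis unfolding hoelder_mtopology by (rule measurable_compose[rotated])
qed

text \<open>Here the small modulus of paths in the separable Hoelder space is needed: it is the Hoelder constant inside the cells.\<close>

lemma polygon_converges:
 assumes x: "x : hoelder_space0 eta" and eta: "0 < eta" "eta < 1"
 shows "(%N. hoelder_dist eta (polygon N (%j. x (real j / real N))) x) ----> 0"
proof (rule tendstoI)
 fix e :: real assume e: "e > 0"
 have "((%dlt. hoelder_modulus eta x dlt) ---> 0) (at_right 0)" using x by (simp add: hoelder_space0_def)
 then have "\<forall>\<^sub>F dlt in at_right 0. hoelder_modulus eta x dlt < ennreal (e / 8)"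
  by (rule order_tendstoD(2)) (use e in simp)
 then obtain b where b: "b > 0" "!!dlt. 0 < dlt ==> dlt < b ==> hoelder_modulus eta x dlt < ennreal (e / 8)"
  unfolding eventually_at_right_field by auto
 define dlt where "dlt = b / 2"
 have dlt: "dlt > 0" "hoelder_modulus eta x dlt <= ennreal (e / 8)" using b(1) b(2)[of dlt] by (auto simp: dlt_def less_imp_le)
 obtain N0 where N0: "1 / dlt < real N0" using reals_Archimedean2 by blast
 have "dist (hoelder_dist eta (polygon N (%j. x (real j / real N))) x) 0 < e" if N: "N >= N0" for N
 proof -
  have rN: "real N > 1 / dlt" using N0 N by simp
  have Np: "N > 0"
  proof -
   have "0 < 1 / dlt" using dlt by simp
   then have "0 < real N" using rN by linarith
   then show ?thesis by simp
  qed
  have small: "1 / real N < dlt" using rN dlt Np by (simp add: field_simps)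
  have "hoelder_bound eta (%t. x t - polygon N (%j. x (real j / real N)) t) (4 * (e / 8))"
  proof (rule polygon_approximation[OF Np])
   fix s t :: real assume st: "s : {0..1}" "t : {0..1}" "abs (s - t) <= 1 / real N"
   show "abs (x s - x t) <= e / 8 * abs (s - t) powr eta"
    by (rule hoelder_modulus_bound[OF dlt(2) _ st(1,2)]) (use e st(3) small in auto)
  qed (use eta in auto)
  then have "hoelder_dist eta x (polygon N (%j. x (real j / real N))) <= 4 * (e / 8) + abs (x 0 - polygon N (%j. x (real j / real N)) 0)"
   by (rule hoelder_dist_le)
  also have "polygon N (%j. x (real j / real N)) 0 = x 0" by (simp add: polygon_def)
  finally show ?thesis using e hoelder.commute[of eta x] hoelder.nonneg[of eta x "polygon N (%j. x (real j / real N))"] by simp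
 qed
 then show "\<forall>\<^sub>F N in sequentially. dist (hoelder_dist eta (polygon N (%j. x (real j / real N))) x) 0 < e"
  unfolding eventually_sequentially by blast
qed

lemma hoelder_space0_scale:
 assumes x: "(\<lambda>t\<in>{0..1}. x t) : hoelder_space0 eta"
 shows "(\<lambda>t\<in>{0..1}. c * x t) : hoelder_space0 eta"
proof -
 have q: "ennreal (abs (c * x s - c * x t) / abs (s - t) powr eta) = ennreal (abs c) * ennreal (abs (x s - x t) / abs (s - t) powr eta)" for s t
  by (simp add: right_diff_distrib[symmetric] abs_mult ennreal_mult[symmetric])
 have m: "hoelder_modulus eta (\<lambda>t\<in>{0..1}. c * x t) dlt = ennreal (abs c) * hoelder_modulus eta (\<lambda>t\<in>{0..1}. x t) dlt" for dlt
  unfolding hoelder_modulus_def SUP_mult_left_ennreal by (intro SUP_cong refl) (auto simp: q)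
 have sn: "hoelder_seminorm eta (\<lambda>t\<in>{0..1}. c * x t) = ennreal (abs c) * hoelder_seminorm eta (\<lambda>t\<in>{0..1}. x t)"
  unfolding hoelder_seminorm_def SUP_mult_left_ennreal by (intro SUP_cong refl) (auto simp: q)
 have "((%dlt. ennreal (abs c) * hoelder_modulus eta (\<lambda>t\<in>{0..1}. x t) dlt) ---> ennreal (abs c) * 0) (at_right 0)"
  using x by (intro ennreal_tendsto_cmult) (auto simp: hoelder_space0_def)
 then show ?thesis using x by (auto simp: hoelder_space0_def hoelder_space_def m[abs_def] sn ennreal_mult_less_top)
qed

lemma brownian_increment_char:
 assumes W: "brownian_motion M W" and N: "N > 0"
 shows "(LINT om|M. iexp (SUM j<N. t j * (c * (W (real (Suc j) / real N) om - W (real j / real N) om))))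
  = of_real (exp (- (c^2 / 2 * ((SUM j<N. (t j)^2) / real N))))"
proof -
 interpret prob_space M using W by (simp add: brownian_motion_def)
 define D where "D j om = W (real (Suc j) / real N) om - W (real j / real N) om" for j om
 define s where "s = sqrt (1 / real N)"
 have s: "s > 0" "s^2 = 1 / real N" using N by (auto simp: s_def)
 have ind: "indep_vars (%_. borel) D {..<N}"
 proof -
  have "ALL n (tau :: nat => real). (ALL i<=n. tau i : {0..1}) & (ALL i<n. tau i <= tau (Suc i)) -->
    indep_vars (%_. borel) (%i om. W (tau (Suc i)) om - W (tau i) om) {..<n}"
   using W by (simp add: brownian_motion_def)
  from this[THEN spec[of _ N], THEN spec[of _ "%j. real j / real N"]] show ?thesis
   using N unfolding D_def[abs_def] by (auto simp: divide_right_mono)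
 qed
 have Dm: "random_variable borel (D j)" if "j < N" for j using ind that by (auto simp: indep_vars_def)
 have Dn: "distributed M lborel (D j) (normal_density 0 s)" if j: "j < N" for j
 proof -
  have "ALL s t. 0 <= s & s < t & t <= 1 --> distributed M lborel (%om. W t om - W s om) (normal_density 0 (sqrt (t - s)))"
   using W by (simp add: brownian_motion_def)
  from this[THEN spec[of _ "real j / real N"], THEN spec[of _ "real (Suc j) / real N"]]
  have "distributed M lborel (D j) (normal_density 0 (sqrt (real (Suc j) / real N - real j / real N)))"
   using j N unfolding D_def[abs_def] by (auto simp: divide_strict_right_mono)
  also have "sqrt (real (Suc j) / real N - real j / real N) = s" by (simp add: s_def diff_divide_distrib[symmetric])
  finally show ?thesis .
 qed
 have one: "char (distr M borel (%om. t j * (c * D j om))) 1 = of_real (exp (- (c^2 / 2 * ((t j)^2 / real N))))" if j: "j < N" for j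
 proof -
  note [measurable] = Dm[OF j]
  have Z: "distributed M lborel (%om. D j om / s) std_normal_density"
   using Dn[OF j] normal_standard_normal_convert[OF s(1), of "D j" 0] by simp
  have "char (distr M borel (%om. t j * (c * D j om))) 1 = (LINT om|M. iexp (t j * (c * D j om)))"
   unfolding char_def by (subst integral_distr) auto
  also have "... = (LINT om|M. iexp ((t j * c * s) * (D j om / s)))" using s by simp
  also have "... = (\<integral>z. iexp ((t j * c * s) * z) \<partial>(distr M lborel (%om. D j om / s)))"
   by (subst integral_distr) auto
  also have "distr M lborel (%om. D j om / s) = std_normal_distribution" using Z by (simp add: distributed_def)
  also have "(\<integral>z. iexp ((t j * c * s) * z) \<partial>std_normal_distribution) = char std_normal_distribution (t j * c * s)"
   by (simp add: char_def)
  also have "... = of_real (exp (- (c^2 / 2 * ((t j)^2 / real N))))"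
   unfolding char_std_normal_distribution by (simp add: power_mult_distrib s(2) mult.commute)
  finally show ?thesis .
 qed
 have "(LINT om|M. iexp (SUM j<N. t j * (c * D j om))) = char (distr M borel (%om. SUM j<N. t j * (c * D j om))) 1"
  unfolding char_def by (subst integral_distr) (use Dm in "auto intro!: borel_measurable_sum")
 also have "... = (\<Prod>j<N. char (distr M borel (%om. t j * (c * D j om))) 1)"
  by (rule char_distr_sum, rule indep_vars_compose2[OF ind, where Y = "%j x. t j * (c * x)"]) simp
 also have "... = (\<Prod>j<N. of_real (exp (- (c^2 / 2 * ((t j)^2 / real N)))))" by (intro prod.cong refl one) simp
 also have "... = of_real (exp (SUM j<N. - (c^2 / 2 * ((t j)^2 / real N))))" by (simp add: exp_sum)
 also have "(SUM j<N. - (c^2 / 2 * ((t j)^2 / real N))) = - (c^2 / 2 * ((SUM j<N. (t j)^2) / real N))"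
  by (simp only: sum_negf sum_distrib_left sum_divide_distrib)
 finally show ?thesis by (simp add: D_def)
qed

section \<open>The functional central limit theorem\<close>

definition grid_time :: "nat => nat => nat => nat" where
 "grid_time N n q = n * q div N"

lemma grid_time_mono: "q <= q' ==> grid_time N n q <= grid_time N n q'"
 by (simp add: grid_time_def div_le_mono)

lemma grid_time_0: "grid_time N n 0 = 0" by (simp add: grid_time_def)

lemma grid_time_N: "N > 0 ==> grid_time N n N = n" by (simp add: grid_time_def)

lemma grid_time_le: "N > 0 ==> q <= N ==> grid_time N n q <= n"
 using grid_time_mono[of q N N n] by (simp add: grid_time_N)

lemma sum_grid:
 fixes g :: "nat => 'b::comm_monoid_add"
 shows "(SUM k<grid_time N n q. g k) = (SUM i<q. SUM k:{grid_time N n i..<grid_time N n (Suc i)}. g k)"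
proof (induction q)
 case (Suc q)
 have "(SUM k<grid_time N n (Suc q). g k) = (SUM k<grid_time N n q. g k) + (SUM k:{grid_time N n q..<grid_time N n (Suc q)}. g k)"
  unfolding lessThan_atLeast0 by (rule sum.atLeastLessThan_concat[symmetric]) (auto intro: grid_time_mono)
 then show ?case using Suc by simp
qed (simp add: grid_time_0)

lemma grid_time_limit:
 assumes N: "N > 0"
 shows "(%n. real (grid_time N n q) / real n) ----> real q / real N"
proof -
 have b: "abs (real (grid_time N n q) / real n - real q / real N) <= 1 / real n" if n: "n > 0" for n
 proof -
  have "real (n * q) / real N - 1 <= real (grid_time N n q)" "real (grid_time N n q) <= real (n * q) / real N"
   unfolding grid_time_def using floor_divide_of_nat_eq[of "n * q" N, where 'a = real] by linarith+
  then have "abs (real (grid_time N n q) - real (n * q) / real N) <= 1" by linarith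
  then have "abs ((real (grid_time N n q) - real (n * q) / real N) / real n) <= 1 / real n"
   unfolding abs_divide abs_of_nat by (rule divide_right_mono) simp
  also have "(real (grid_time N n q) - real (n * q) / real N) / real n = real (grid_time N n q) / real n - real q / real N"
   using n by (simp add: diff_divide_distrib)
  finally show ?thesis .
 qed
 have "(%n. real (grid_time N n q) / real n - real q / real N) ----> 0"
 proof (rule Lim_null_comparison[OF _ lim_1_over_n])
  show "\<forall>\<^sub>F n in sequentially. norm (real (grid_time N n q) / real n - real q / real N) <= 1 / real n"
   using eventually_gt_at_top[of 0] by eventually_elim (use b in simp)
 qed
 then show ?thesis by (simp add: LIM_zero_iff)
qed

text \<open>The linear combination \<open>t\<close> of increments over the grid cells is one weighted sum of \<open>phi \<circ> f ^^ k\<close>, with weight \<open>t q\<close> on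
the times of the \<open>q\<close>-th cell.\<close>

definition step_weight :: "nat => (nat => real) => nat => nat => real" where
 "step_weight N t n k = (SUM q<N. if grid_time N n q <= k & k < grid_time N n (Suc q) then t q else 0)"

lemma step_weight_cell:
 assumes q: "q < N" "grid_time N n q <= k" "k < grid_time N n (Suc q)"
 shows "step_weight N t n k = t q"
proof -
 have "step_weight N t n k = (SUM q'<N. if q' = q then t q else 0)"
  unfolding step_weight_def
 proof (intro sum.cong refl)
  fix q' 
  have uq: "q' = q" if "grid_time N n q' <= k" "k < grid_time N n (Suc q')"
  proof (rule ccontr)
   assume "q' ~= q"
   then have "Suc q' <= q | Suc q <= q'" by linarith
   then show False using grid_time_mono[of "Suc q'" q N n] grid_time_mono[of "Suc q" q' N n] q that by linarith
  qed
  show "(if grid_time N n q' <= k & k < grid_time N n (Suc q') then t q' else 0) = (if q' = q then t q else 0)"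
  proof (cases "q' = q")
   case False
   then have "~ (grid_time N n q' <= k & k < grid_time N n (Suc q'))" using uq by blast
   then show ?thesis unfolding if_not_P[OF False] by (rule if_not_P)
  qed (use q in simp)
 qed
 then show ?thesis using q(1) by simp
qed

lemma step_weight_bound: "abs (step_weight N t n k) <= (SUM q<N. abs (t q))"
 unfolding step_weight_def by (rule order.trans[OF sum_abs]) (auto intro: sum_mono)

lemma step_weight_zero:
 assumes N: "N > 0" and k: "k >= n"
 shows "step_weight N t n k = 0"
 unfolding step_weight_def
proof (intro sum.neutral ballI)
 fix q assume "q : {..<N}"
 then have "grid_time N n (Suc q) <= n" using N by (intro grid_time_le) auto
 then show "(if grid_time N n q <= k & k < grid_time N n (Suc q) then t q else 0) = 0" using k by simp
qed

lemma step_weight_sum: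
 assumes N: "N > 0"
 shows "(SUM k<n. step_weight N t n k * g k) = (SUM q<N. t q * (SUM k:{grid_time N n q..<grid_time N n (Suc q)}. g k))"
proof -
 have "(SUM k<n. step_weight N t n k * g k) = (SUM q<N. SUM k:{grid_time N n q..<grid_time N n (Suc q)}. step_weight N t n k * g k)"
  using sum_grid[of "%k. step_weight N t n k * g k" N n N] by (simp add: grid_time_N[OF N])
 also have "... = (SUM q<N. SUM k:{grid_time N n q..<grid_time N n (Suc q)}. t q * g k)"
  by (intro sum.cong refl) (simp add: step_weight_cell)
 finally show ?thesis by (simp only: sum_distrib_left)
qed

text \<open>A shift by \<open>j\<close> changes the weight only at the last \<open>j\<close> times of each cell, a vanishing fraction.\<close>

lemma step_weight_correlation:
 assumes N: "N > 0"
 shows "(%n. (SUM k<n. step_weight N t n k * step_weight N t n (k + j)) / real n) ----> (SUM q<N. (t q)^2) / real N"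
proof -
 define Th where "Th = (SUM q<N. abs (t q))"
 define len where "len n q = real (grid_time N n (Suc q) - grid_time N n q)" for n q
 have Th0: "Th >= 0" by (simp add: Th_def sum_nonneg)
 have cell: "abs ((SUM k:{grid_time N n q..<grid_time N n (Suc q)}. step_weight N t n (k + j)) - t q * len n q) <= 2 * Th * real j"
  if q: "q < N" for n q
 proof -
  let ?a = "grid_time N n q" and ?b = "grid_time N n (Suc q)"
  have tq: "abs (t q) <= Th" unfolding Th_def using q by (intro member_le_sum) auto
  have "(SUM k:{?a..<?b}. step_weight N t n (k + j)) - t q * len n q = (SUM k:{?a..<?b}. step_weight N t n (k + j) - t q)"
   by (simp add: sum_subtractf len_def mult.commute)
  also have "abs ... <= (SUM k:{?a..<?b}. abs (step_weight N t n (k + j) - t q))" by (rule sum_abs)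
  also have "... <= (SUM k:{?a..<?b}. if ?b <= k + j then 2 * Th else 0)"
  proof (rule sum_mono)
   fix k assume k: "k : {?a..<?b}"
   show "abs (step_weight N t n (k + j) - t q) <= (if ?b <= k + j then 2 * Th else 0)"
   proof (cases "?b <= k + j")
    case True
    have "abs (step_weight N t n (k + j)) <= Th" unfolding Th_def by (rule step_weight_bound)
    then show ?thesis using True tq by simp
   next
    case False
    then have "step_weight N t n (k + j) = t q" using k q by (intro step_weight_cell) auto
    then show ?thesis using False by simp
   qed
  qed
  also have "... = 2 * Th * real (card {k : {?a..<?b}. ?b <= k + j})"
   by (simp add: sum.If_cases Int_def mult.commute)
  also have "... <= 2 * Th * real j"
  proof -
   have "{k : {?a..<?b}. ?b <= k + j} \<subseteq> {?b - j..<?b}" by auto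
   then have "card {k : {?a..<?b}. ?b <= k + j} <= card {?b - j..<?b}" by (intro card_mono) auto
   also have "... <= j" by simp
   finally show ?thesis using Th0 by (intro mult_left_mono) auto
  qed
  finally show ?thesis .
 qed
 have main: "abs ((SUM k<n. step_weight N t n k * step_weight N t n (k + j)) - (SUM q<N. (t q)^2 * len n q)) <= 2 * Th^2 * real j" for n
 proof -
  have "(SUM k<n. step_weight N t n k * step_weight N t n (k + j)) - (SUM q<N. (t q)^2 * len n q)
    = (SUM q<N. t q * ((SUM k:{grid_time N n q..<grid_time N n (Suc q)}. step_weight N t n (k + j)) - t q * len n q))"
   unfolding step_weight_sum[OF N] by (simp add: sum_subtractf[symmetric] right_diff_distrib power2_eq_square mult.assoc)
  also have "abs ... <= (SUM q<N. abs (t q) * (2 * Th * real j))"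
  proof (rule order.trans[OF sum_abs], rule sum_mono)
   fix q assume "q : {..<N}"
   then show "abs (t q * ((SUM k:{grid_time N n q..<grid_time N n (Suc q)}. step_weight N t n (k + j)) - t q * len n q)) <= abs (t q) * (2 * Th * real j)"
    unfolding abs_mult by (intro mult_left_mono cell) auto
  qed
  also have "... = 2 * Th^2 * real j" unfolding sum_distrib_right[symmetric] Th_def[symmetric] by (simp add: power2_eq_square)
  finally show ?thesis .
 qed
 have len_lim: "(%n. len n q / real n) ----> 1 / real N" for q
 proof -
  have "(%n. real (grid_time N n (Suc q)) / real n - real (grid_time N n q) / real n) ----> real (Suc q) / real N - real q / real N"
   by (intro tendsto_diff grid_time_limit N)
  then show ?thesis
   by (simp add: len_def of_nat_diff grid_time_mono diff_divide_distrib[symmetric])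
 qed
 have "(%n. SUM q<N. (t q)^2 * (len n q / real n)) ----> (SUM q<N. (t q)^2 * (1 / real N))"
  by (intro tendsto_sum tendsto_mult tendsto_const len_lim)
 then have 1: "(%n. (SUM q<N. (t q)^2 * len n q) / real n) ----> (SUM q<N. (t q)^2) / real N"
  by (simp add: sum_divide_distrib)
 have "(%n. (SUM k<n. step_weight N t n k * step_weight N t n (k + j)) / real n - (SUM q<N. (t q)^2 * len n q) / real n) ----> 0"
 proof (rule Lim_null_comparison)
  show "\<forall>\<^sub>F n in sequentially. norm ((SUM k<n. step_weight N t n k * step_weight N t n (k + j)) / real n - (SUM q<N. (t q)^2 * len n q) / real n)
    <= 2 * Th^2 * real j / real n"
  proof (intro always_eventually allI)
   fix n
   show "norm ((SUM k<n. step_weight N t n k * step_weight N t n (k + j)) / real n - (SUM q<N. (t q)^2 * len n q) / real n)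
    <= 2 * Th^2 * real j / real n"
    unfolding diff_divide_distrib[symmetric] real_norm_def abs_divide abs_of_nat by (rule divide_right_mono[OF main]) simp
  qed
  show "(%n. 2 * Th^2 * real j / real n) ----> 0" by (rule lim_const_over_n)
 qed
 from tendsto_add[OF this 1] show ?thesis by simp
qed

context decorrelated
begin

lemma birkhoff_process_polygon:
 "birkhoff_process f phi n x = polygon n (%j. S j x / sqrt (real n))"
proof -
 have "S (Suc j) x / sqrt (real n) - S j x / sqrt (real n) = phi ((f ^^ j) x) / sqrt (real n)" for j
  unfolding diff_divide_distrib[symmetric] by (simp add: birkhoff_sum_def)
 then show ?thesis unfolding birkhoff_process_def polygon_def by (simp add: add_divide_distrib)
qed

lemma birkhoff_process_grid:
 assumes N: "N > 0" and j: "j <= N"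
 shows "abs (birkhoff_process f phi n x (real j / real N) - S (grid_time N n j) x / sqrt (real n)) <= B / sqrt (real n)"
proof -
 have t: "real j / real N : {0..1}" using N j by simp
 have fl: "\<lfloor>real n * (real j / real N)\<rfloor> = int (grid_time N n j)"
  unfolding grid_time_def using floor_divide_of_nat_eq[of "n * j" N, where 'a = real] by simp
 define rho where "rho = real n * (real j / real N) - \<lfloor>real n * (real j / real N)\<rfloor>"
 have rho: "0 <= rho" "rho <= 1" unfolding rho_def by linarith+
 have "birkhoff_process f phi n x (real j / real N) = (S (grid_time N n j) x + rho * phi ((f ^^ grid_time N n j) x)) / sqrt (real n)"
  using t unfolding birkhoff_process_def rho_def restrict_apply fl by simp
 then have "birkhoff_process f phi n x (real j / real N) - S (grid_time N n j) x / sqrt (real n) = rho * phi ((f ^^ grid_time N n j) x) / sqrt (real n)"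
  by (simp add: add_divide_distrib)
 moreover have "abs (rho * phi ((f ^^ grid_time N n j) x)) <= 1 * B" unfolding abs_mult using rho phi_bound B by (intro mult_mono) auto
 ultimately show ?thesis by (simp add: divide_right_mono)
qed

lemma birkhoff_process_measurable:
 assumes "0 < eta" "eta < 1"
 shows "birkhoff_process f phi n : mu ->M borel_of_topology (hoelder_topology0 eta)"
 unfolding birkhoff_process_polygon[abs_def]
 by (rule polygon_measurable[OF assms]) (intro mu_meas borel_measurable_divide borel_measurable_const S_meas)

lemma birkhoff_process_approximation:
 assumes eta: "0 < eta" "eta < eta'" "eta' < 1" and n: "n > 0" and N: "N > 0"
  and x: "!!i j. i < j ==> j <= n ==> abs (S j x - S i x) <= K * sqrt (real n) * (real (j - i) / real n) powr eta'"
 shows "hoelder_dist eta (birkhoff_process f phi n x) (polygon N (%j. birkhoff_process f phi n x (real j / real N)))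
  <= 12 * K * real N powr (eta - eta')"
proof -
 let ?X = "birkhoff_process f phi n x"
 have hb: "hoelder_bound eta' ?X (3 * K)"
  unfolding birkhoff_process_polygon
 proof (rule polygon_hoelder_bound[OF n])
  fix i j assume ij: "i < j" "j <= n"
  have "abs (S j x / sqrt (real n) - S i x / sqrt (real n)) = abs (S j x - S i x) / sqrt (real n)"
   by (simp add: diff_divide_distrib[symmetric])
  also have "... <= K * (real (j - i) / real n) powr eta'"
   using x[OF ij] n by (simp add: pos_divide_le_eq mult_ac)
  finally show "abs (S j x / sqrt (real n) - S i x / sqrt (real n)) <= K * (real (j - i) / real n) powr eta'" .
 qed (use eta in auto)
 have K0: "0 <= 3 * K" using order.trans[OF abs_ge_zero hoelder_boundD[OF hb, of 0 1]] by simp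
 have "hoelder_bound eta (%t. ?X t - polygon N (%j. ?X (real j / real N)) t) (4 * (3 * K * real N powr (eta - eta')))"
 proof (rule polygon_approximation[OF N])
  fix s t :: real assume st: "s : {0..1}" "t : {0..1}" "abs (s - t) <= 1 / real N"
  have "abs (?X s - ?X t) <= 3 * K * abs (s - t) powr eta'" by (rule hoelder_boundD[OF hb st(1,2)])
  also have "abs (s - t) powr eta' = abs (s - t) powr (eta' - eta) * abs (s - t) powr eta" by (simp add: powr_add[symmetric])
  also have "3 * K * (abs (s - t) powr (eta' - eta) * abs (s - t) powr eta) <= 3 * K * (real N powr (eta - eta') * abs (s - t) powr eta)"
  proof (intro mult_left_mono mult_right_mono)
   have "abs (s - t) powr (eta' - eta) <= (1 / real N) powr (eta' - eta)" using st eta by (intro powr_mono2) auto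
   also have "... = real N powr (eta - eta')" using N powr_minus_divide[of "real N" "eta' - eta"] by (simp add: powr_divide)
   finally show "abs (s - t) powr (eta' - eta) <= real N powr (eta - eta')" .
  qed (use K0 in auto)
  finally show "abs (?X s - ?X t) <= 3 * K * real N powr (eta - eta') * abs (s - t) powr eta" by (simp only: mult.assoc)
 qed (use eta in auto)
 then have "hoelder_dist eta ?X (polygon N (%j. ?X (real j / real N))) <= 4 * (3 * K * real N powr (eta - eta')) + abs (?X 0 - polygon N (%j. ?X (real j / real N)) 0)"
  by (rule hoelder_dist_le)
 also have "polygon N (%j. ?X (real j / real N)) 0 = ?X 0" by (simp add: polygon_def)
 finally show ?thesis by simp
qed

lemma irregular_sets: "irregular K eta n : sets mu" unfolding irregular_def sets_mu by measurable

text \<open>An order \<open>r\<close> below \<open>2 * kap\<close> leaves room for an exponent \<open>th\<close> strictly above \<open>eta\<close>; the surplus makes the interpolation error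
of the paths vanish on fine grids.\<close>

lemma irregular_unlikely:
 assumes eta: "0 < eta" "eta < 1 / 2 - 1 / (2 * kap)"
 obtains th where "eta < th" "th < 1" "!!e. e > 0 ==> EX K>0. ALL n>=1. measure mu (irregular K th n) <= e"
proof -
 define r where "r = (max (1 / (1 / 2 - eta)) 2 + 2 * kap) / 2"
 have h1: "1 / 2 - eta > 0" using eta(2) kap by (smt (verit) divide_nonneg_nonneg)
 have "1 / (1 / 2 - eta) < 2 * kap" using eta(2) h1 kap by (simp add: field_simps)
 then have r: "2 < r" "r < 2 * kap" "1 / (1 / 2 - eta) < r" using kap unfolding r_def by auto
 have "1 / r < 1 / 2 - eta" using r h1 by (simp add: field_simps)
 then obtain th where th: "eta < th" "th < 1 / 2 - 1 / r" using dense[of eta "1 / 2 - 1 / r"] by auto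
 obtain C where C: "!!n K. n >= 1 ==> K > 0 ==> measure mu (irregular K th n) <= C * K powr (- r)"
  using increments_tight[OF r(1,2) _ th(2)] eta th by auto
 show thesis
 proof
  show "th < 1" using th(2) r by (smt (verit) divide_nonneg_nonneg field_sum_of_halves)
  fix e :: real assume e: "e > 0"
  have "((%K. C * K powr (- r)) ---> C * 0) at_top"
   using r by (intro tendsto_intros tendsto_neg_powr filterlim_ident) auto
  then have "\<forall>\<^sub>F K in at_top. C * K powr (- r) < e" by (rule order_tendstoD(2)) (use e in simp)
  then have "\<forall>\<^sub>F K in at_top. C * K powr (- r) < e & K > 0"
   using eventually_gt_at_top[of 0] by eventually_elim simp
  then obtain K where "C * K powr (- r) < e" "K > 0" by (auto simp: eventually_at_top_linorder)
  then show "EX K>0. ALL n>=1. measure mu (irregular K th n) <= e" using C by (meson less_imp_le order.trans)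
 qed (rule th)
qed

lemma grid_increments_tight:
 assumes N: "N > 0" and th: "th > 0" and K: "K > 0" "!!n. n >= 1 ==> measure mu (irregular K th n) <= e" "e > 0"
 shows "measure mu {x : space mu. EX j<N. K < abs ((S (grid_time N n (Suc j)) x - S (grid_time N n j) x) / sqrt (real n))} <= e"
proof (cases "n = 0")
 case False
 let ?g = "grid_time N n"
 have "x : irregular K th n" if j: "j < N" and x: "K < abs ((S (?g (Suc j)) x - S (?g j) x) / sqrt (real n))" for x j
 proof -
  have x': "K * sqrt (real n) < abs (S (?g (Suc j)) x - S (?g j) x)" using x False by (simp add: pos_less_divide_eq)
  have "?g j < ?g (Suc j)" using x K(1) grid_time_mono[of j "Suc j" N n] by (cases "?g j = ?g (Suc j)") auto
  moreover have le: "?g (Suc j) <= n" using j by (intro grid_time_le N) simp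
  moreover have "(real (?g (Suc j) - ?g j) / real n) powr th <= 1" using le False th by (intro powr_le1) auto
  then have "K * sqrt (real n) * (real (?g (Suc j) - ?g j) / real n) powr th <= K * sqrt (real n) * 1"
   using K(1) by (intro mult_left_mono) auto
  ultimately show ?thesis using x' unfolding irregular_def by (intro CollectI exI conjI) auto
 qed
 then have "measure mu {x : space mu. EX j<N. K < abs ((S (?g (Suc j)) x - S (?g j) x) / sqrt (real n))} <= measure mu (irregular K th n)"
  by (intro finite_measure_mono irregular_sets) auto
 with K(2)[of n] False show ?thesis by simp
qed (use K in simp)

end

context decorrelated_exact
begin

lemma grid_increments_characteristic:
 assumes W: "brownian_motion M W" and N: "N > 0" and sgm: "sgm^2 = 2 * half_variance"
 shows "(%n. \<integral>x. iexp (SUM j<N. t j * ((S (grid_time N n (Suc j)) x - S (grid_time N n j) x) / sqrt (real n))) \<partial>mu)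
  ----> (LINT om|M. iexp (SUM j<N. t j * (sgm * (W (real (Suc j) / real N) om - W (real j / real N) om))))"
proof -
 have inc: "S (grid_time N n (Suc j)) x - S (grid_time N n j) x = (SUM k:{grid_time N n j..<grid_time N n (Suc j)}. phi ((f ^^ k) x))" for n j x
  unfolding birkhoff_sum_def sum_grid by simp
 have eq: "(SUM j<N. t j * ((S (grid_time N n (Suc j)) x - S (grid_time N n j) x) / sqrt (real n)))
   = (SUM k<n. step_weight N t n k * phi ((f ^^ k) x)) / sqrt (real n)" for n x
  unfolding step_weight_sum[OF N] inc by (simp only: sum_divide_distrib[of _ "{..<N}"] times_divide_eq_right)
 have ex: "(sgm^2 / 2 * ((SUM j<N. (t j)^2) / real N)) = (SUM j<N. (t j)^2) / real N * half_variance" unfolding sgm by simp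
 show ?thesis unfolding brownian_increment_char[OF W N] eq ex
  by (rule clt_characteristic[OF step_weight_bound step_weight_zero[OF N] step_weight_correlation[OF N]])
qed

text \<open>\<open>close\<close> bounds the effect of replacing the process by a polygon, for all large times; \<open>grid\<close> is the finite-dimensional
limit; \<open>lim_grid\<close> removes the grid on the Brownian side. \<open>double_limit\<close> combines them.\<close>

theorem functional_clt:
 assumes eta: "0 < eta" "eta < 1 / 2 - 1 / (2 * kap)"
  and W: "brownian_motion M W" and paths: "!!om. om : space M ==> (\<lambda>t\<in>{0..1}. W t om) : hoelder_space0 eta"
  and sgm: "sgm^2 = 2 * half_variance"
 shows "converges_in_distribution (hoelder_topology0 eta) mu (birkhoff_process f phi) M (%om. \<lambda>t\<in>{0..1}. sgm * W t om)"
proof -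
 interpret M: prob_space M using W by (simp add: brownian_motion_def)
 have Wm [measurable]: "W t : borel_measurable M" if "t : {0..1}" for t using W that by (simp add: brownian_motion_def)
 have W0: "AE om in M. W 0 om = 0" using W by (simp add: brownian_motion_def)
 have eta1: "eta < 1" using eta(2) kap by (smt (verit) divide_nonneg_nonneg field_sum_of_halves)
 obtain th where th: "eta < th" "th < 1" and bad: "!!e. e > 0 ==> EX K>0. ALL n>=1. measure mu (irregular K th n) <= e"
  using irregular_unlikely[OF eta] by metis
 define Y where "Y om = (\<lambda>t\<in>{0..1}. sgm * W t om)" for om
 define X where "X = birkhoff_process f phi"
 define PY where "PY N om = polygon N (%j. if j <= N then Y om (real j / real N) else 0)" for N om
 define PX where "PX N n x = polygon N (%j. S (grid_time N n j) x / sqrt (real n))" for N n x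
 have poly: "polygon N v : hoelder_space0 eta" for N v by (rule polygon_space0[OF eta(1) eta1])
 have YM: "Y om : hoelder_space0 eta" if "om : space M" for om unfolding Y_def by (intro hoelder_space0_scale paths that)
 have XM: "X n x : hoelder_space0 eta" for n x unfolding X_def birkhoff_process_polygon by (rule poly)
 have Xm: "X n : mu ->M hoelder.B eta" for n unfolding X_def hoelder_mtopology by (rule birkhoff_process_measurable[OF eta(1) eta1])
 have PXm: "PX N n : mu ->M hoelder.B eta" for N n
  unfolding PX_def[abs_def] hoelder_mtopology
  by (rule polygon_measurable[OF eta(1) eta1]) (intro mu_meas borel_measurable_divide borel_measurable_const S_meas)
 have PYm: "PY N : M ->M hoelder.B eta" for N
  unfolding PY_def[abs_def] hoelder_mtopology
 proof (rule polygon_measurable[OF eta(1) eta1])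
  fix i
  show "(%om. if i <= N then Y om (real i / real N) else 0) : borel_measurable M"
  proof (cases "i <= N")
   case True
   then have "real i / real N : {0..1}" by (cases "N = 0") auto
   then show ?thesis using True Wm by (simp add: Y_def)
  qed simp
 qed
 have PY_eq: "PY N om = polygon N (%j. Y om (real j / real N))" for N om unfolding PY_def by (rule polygon_cong) simp
 have PY_lim: "(%N. hoelder_dist eta (PY N om) (Y om)) ----> 0" if "om : space M" for om
  unfolding PY_eq by (rule polygon_converges[OF YM[OF that] eta(1) eta1])
 have Ym: "Y : M ->M hoelder.B eta" by (rule hoelder.measurable_limit[OF PYm YM PY_lim])
 have "converges_in_distribution (hoelder.mtopology eta) mu X M Y"
 proof (rule hoelder.converges_in_distributionI[OF prob_space_axioms M.prob_space_axioms Xm Ym])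
  fix h and L0 b :: real
  assume hb: "!!x. x : hoelder_space0 eta ==> abs (h x) <= b"
   and hL: "!!x y. x : hoelder_space0 eta ==> y : hoelder_space0 eta ==> abs (h x - h y) <= L0 * hoelder_dist eta x y"
  define L where "L = abs L0"
  have hL': "abs (h x - h y) <= L * r" if "x : hoelder_space0 eta" "y : hoelder_space0 eta" "hoelder_dist eta x y <= r" for x y r
  proof -
   have "abs (h x - h y) <= L0 * hoelder_dist eta x y" using that by (intro hL)
   also have "... <= L * hoelder_dist eta x y" unfolding L_def by (intro mult_right_mono) auto
   also have "... <= L * r" using that by (intro mult_left_mono) (auto simp: L_def)
   finally show ?thesis .
  qed
  have L: "L >= 0" and b: "0 <= b" using order.trans[OF abs_ge_zero hb[OF XM]] by (auto simp: L_def)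
  have meas_h: "(%x. h (Z x)) : borel_measurable Q" if "Z : Q ->M hoelder.B eta" for Z and Q :: "'z measure"
   by (rule hoelder.measurable_continuous[OF that hoelder.continuous_map_lipschitz[OF hL]])
  have int_mu: "integrable mu (%x. h (Z x))" if "Z : mu ->M hoelder.B eta" for Z
   using meas_h[OF that] hb measurable_space[OF that] by (intro integrable_const_bound[of _ b]) (auto simp: hoelder.space_B)
  define I where "I n = (LINT x|mu. h (X n x))" for n
  define I' where "I' N n = (LINT x|mu. h (PX N n x))" for N n
  define J where "J = (LINT om|M. h (Y om))"
  define J' where "J' N = (LINT om|M. h (PY N om))" for N
  define c where "c N = (6 * real N + 1) * real (Suc N)" for N
  have c: "c N >= 0" for N by (simp add: c_def)
  have dp: "hoelder_dist eta (polygon N v) (polygon N w) <= c N * r" if "!!k. k <= N ==> abs (v k - w k) <= r" for N v w r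
  proof -
   have "(SUM k<=N. abs (v k - w k)) <= real (Suc N) * r" using sum_bounded_above[of "{..N}" "%k. abs (v k - w k)" r] that by simp
   then have "(6 * real N + 1) * (SUM k<=N. abs (v k - w k)) <= c N * r" unfolding c_def mult.assoc by (intro mult_left_mono) auto
   with polygon_dist[OF eta(1) eta1, of N v w] show ?thesis by (rule order.trans)
  qed
  have close: "EX N0>0. ALL N>=N0. \<forall>\<^sub>F n in sequentially. abs (I n - I' N n) <= e" if e: "e > 0" for e
  proof -
   have "e / (4 * (b + 1)) > 0" using e b by simp
   from bad[OF this] obtain K where K: "K > 0" "!!n. n >= 1 ==> measure mu (irregular K th n) <= e / (4 * (b + 1))" by auto
   define u where "u N = L * (12 * K * real N powr (eta - th))" for N :: nat
   define v where "v N n = L * (c N * (B / sqrt (real n)))" for N n :: nat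
   have uv: "u N >= 0" "v N n >= 0" for N n using L K(1) c B by (simp_all add: u_def v_def)
   have "u ----> L * (12 * K * 0)" unfolding u_def[abs_def]
    using th by (intro tendsto_intros tendsto_neg_powr filterlim_real_sequentially) auto
   then have "\<forall>\<^sub>F N in sequentially. u N < e / 4" by (rule order_tendstoD(2)) (use e in simp)
   then obtain N0 where N0: "!!N. N >= N0 ==> u N < e / 4" by (auto simp: eventually_sequentially)
   have "\<forall>\<^sub>F n in sequentially. abs (I n - I' N n) <= e" if N: "N >= max N0 1" for N
   proof -
    have "(%n. B / sqrt (real n)) ----> 0"
     by (intro tendsto_divide_0[OF tendsto_const] filterlim_at_top_imp_at_infinity filterlim_compose[OF sqrt_at_top filterlim_real_sequentially])
    then have "v N ----> L * (c N * 0)" unfolding v_def[abs_def] by (intro tendsto_mult tendsto_const)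
    then have "\<forall>\<^sub>F n in sequentially. v N n < e / 4" by (rule order_tendstoD(2)) (use e in simp)
    then show ?thesis using eventually_ge_at_top[of 1]
    proof eventually_elim
     case (elim n)
     let ?bad = "irregular K th n"
     have bi: "integrable mu (%x. indicator ?bad x :: real)"
      by (intro integrable_real_indicator irregular_sets) (simp add: less_top[symmetric])
     let ?Q = "%x. polygon N (%j. X n x (real j / real N))"
     have "abs (h (X n x) - h (PX N n x)) <= u N + v N n + 2 * b * indicator ?bad x" for x
     proof (cases "x : ?bad")
      case True
      have "abs (h (PX N n x)) <= b" unfolding PX_def by (rule hb[OF poly])
      then show ?thesis using hb[OF XM[of n x]] uv(1)[of N] uv(2)[of N n] unfolding indicator_simps(1)[OF True] by linarith
     next
      case False
      have "abs (h (X n x) - h (?Q x)) <= u N"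
       unfolding u_def
      proof (rule hL'[OF XM poly], unfold X_def, rule birkhoff_process_approximation[OF eta(1) th])
       show "abs (S j x - S i x) <= K * sqrt (real n) * (real (j - i) / real n) powr th" if "i < j" "j <= n" for i j
        using False that unfolding irregular_def mem_Collect_eq not_ex de_Morgan_conj not_less by (metis not_le)
      qed (use elim(2) N in auto)
      moreover have "abs (h (?Q x) - h (PX N n x)) <= v N n" unfolding v_def PX_def
       by (rule hL'[OF poly poly dp], unfold X_def, rule birkhoff_process_grid) (use N in auto)
      ultimately show ?thesis using False by simp
     qed
     then have "(LINT x|mu. abs (h (X n x) - h (PX N n x))) <= (LINT x|mu. u N + v N n + 2 * b * indicator ?bad x)"
      using bi uv b by (intro integral_mono') auto
     also have "... = u N + v N n + 2 * b * measure mu ?bad" using bi irregular_sets prob_space by (simp add: mu_space)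
     also have "2 * b * measure mu ?bad <= 2 * b * (e / (4 * (b + 1)))" using K(2)[OF elim(2)] b by (intro mult_left_mono) auto
     also have "... <= e / 2" using b e by (simp add: field_simps)
     finally have "(LINT x|mu. abs (h (X n x) - h (PX N n x))) <= e" using N0[of N] N elim(1) by simp
     moreover have "abs (I n - I' N n) <= (LINT x|mu. abs (h (X n x) - h (PX N n x)))"
      unfolding I_def I'_def Bochner_Integration.integral_diff[symmetric, OF int_mu[OF Xm] int_mu[OF PXm]] by (rule integral_abs_bound)
     ultimately show ?case by linarith
    qed
   qed
   then show ?thesis by (intro exI[of _ "max N0 1"]) simp
  qed
  have grid: "I' N ----> J' N" if N: "N > 0" for N
  proof -
   define D where "D n j x = (S (grid_time N n (Suc j)) x - S (grid_time N n j) x) / sqrt (real n)" for n j x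
   define D' where "D' j om = (if j < N then sgm * (W (real (Suc j) / real N) om - W (real j / real N) om) else 0)" for j om
   define G where "G v = h (polygon N (%j. SUM i<j. v i))" for v :: "nat => real"
   have Gc: "coord_lipschitz N (L * c N) b G"
    unfolding coord_lipschitz_def
   proof (intro conjI allI)
    fix v w :: "nat => real"
    show "abs (G v) <= b" unfolding G_def by (rule hb[OF poly])
    have "abs ((SUM i<k. v i) - (SUM i<k. w i)) <= (SUM j<N. abs (v j - w j))" if "k <= N" for k
     unfolding sum_subtractf[symmetric] by (rule order.trans[OF sum_abs sum_mono2]) (use that in auto)
    from hL'[OF poly poly dp[OF this]]
    show "abs (G v - G w) <= L * c N * (SUM j<N. abs (v j - w j))" unfolding G_def by (simp only: mult.assoc)
   qed
   have D'm: "D' i : borel_measurable M" for i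
   proof (cases "i < N")
    case True
    then have "real (Suc i) / real N : {0..1}" "real i / real N : {0..1}" by auto
    from Wm[OF this(1)] Wm[OF this(2)] show ?thesis using True unfolding D'_def[abs_def] by simp
   qed (simp add: D'_def[abs_def])
   have "(%n. \<integral>x. G (%i. D n i x) \<partial>mu) ----> (LINT om|M. G (%i. D' i om))"
   proof (rule lipschitz_convergence[OF prob_space_axioms M.prob_space_axioms _ D'm _ _ Gc])
    show "D n i : borel_measurable mu" for n i unfolding D_def[abs_def]
     by (intro mu_meas borel_measurable_diff borel_measurable_divide borel_measurable_const S_meas)
    show "EX A. ALL n. measure mu {x : space mu. EX j<N. A < abs (D n j x)} <= e" if e: "e > 0" for e
     using bad[OF e] grid_increments_tight[OF N less_trans[OF eta(1) th(1)] _ _ e] unfolding D_def by blast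
    fix t
    have "(SUM j<N. t j * D' j om) = (SUM j<N. t j * (sgm * (W (real (Suc j) / real N) om - W (real j / real N) om)))" for om
     by (intro sum.cong refl) (simp add: D'_def)
    then show "(%n. \<integral>x. iexp (SUM j<N. t j * D n j x) \<partial>mu) ----> (LINT om|M. iexp (SUM j<N. t j * D' j om))"
     unfolding D_def using grid_increments_characteristic[OF W N sgm, of t] by simp
   qed
   moreover have "(LINT om|M. G (%i. D' i om)) = J' N"
    unfolding J'_def
   proof (rule integral_cong_AE[OF coord_lipschitz_measurable[OF Gc D'm] meas_h[OF PYm]])
    show "AE om in M. G (%i. D' i om) = h (PY N om)"
     using W0
    proof eventually_elim
     case (elim om)
     have "(SUM i<j. D' i om) = sgm * W (real j / real N) om" if "j <= N" for j
      using that by (induction j) (simp_all add: elim D'_def right_diff_distrib)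
     then show ?case unfolding G_def PY_def by (intro arg_cong[of _ _ h] polygon_cong) (simp add: Y_def N)
    qed
   qed
   moreover have "(SUM i<j. D n i x) = S (grid_time N n j) x / sqrt (real n)" for n j x
    by (induction j) (simp_all add: grid_time_0 S_0 D_def diff_divide_distrib)
   then have "G (%i. D n i x) = h (PX N n x)" for n x unfolding G_def PX_def by simp
   ultimately show ?thesis unfolding I'_def[abs_def] by simp
  qed
  have lim_grid: "J' ----> J"
   unfolding J'_def J_def
  proof (rule integral_dominated_convergence[where w = "%_. b"])
   show "(%om. h (Y om)) : borel_measurable M" "!!N. (%om. h (PY N om)) : borel_measurable M" by (rule meas_h[OF Ym], rule meas_h[OF PYm])
   show "AE om in M. (%N. h (PY N om)) ----> h (Y om)"
   proof (rule AE_I2)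
    fix om assume om: "om : space M"
    have "(%N. h (PY N om) - h (Y om)) ----> 0"
    proof (rule Lim_null_comparison)
     show "\<forall>\<^sub>F N in sequentially. norm (h (PY N om) - h (Y om)) <= L * hoelder_dist eta (PY N om) (Y om)"
      unfolding real_norm_def PY_eq by (intro always_eventually allI hL' poly YM[OF om] order.refl)
     show "(%N. L * hoelder_dist eta (PY N om) (Y om)) ----> 0"
      using tendsto_mult[OF tendsto_const[of L] PY_lim[OF om]] by simp
    qed
    then show "(%N. h (PY N om)) ----> h (Y om)" by (simp add: LIM_zero_iff)
   qed
  qed (use hb poly in "auto simp: PY_def")
  have "I ----> J"
  proof (rule double_limit[of I "%N. I' (Suc N)"])
   fix e :: real assume e: "e > 0"
   obtain N0 where N0: "!!N. N >= N0 ==> \<forall>\<^sub>F n in sequentially. abs (I n - I' N n) <= e / 2" using close[of "e / 2"] e by auto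
   have "\<forall>\<^sub>F n in sequentially. dist (I n) (I' (Suc N) n) < e" if "N >= N0" for N
    using N0[OF le_SucI[OF that]] by eventually_elim (use e in "simp add: dist_real_def")
   then show "EX N0. ALL N>=N0. \<forall>\<^sub>F n in sequentially. dist (I n) (I' (Suc N) n) < e" by blast
  qed (rule grid zero_less_Suc LIMSEQ_Suc[OF lim_grid])+
  then show "(%n. \<integral>om. h (X n om) \<partial>mu) ----> (LINT om|M. h (Y om))" unfolding I_def J_def .
 qed
 then show ?thesis by (simp add: hoelder_mtopology X_def Y_def[abs_def])
qed

end

section \<open>From nonuniformly expanding maps to towers\<close>

lemma emeasure_distr_restrict:
 assumes g: "g : M ->M N" and Om: "Om : sets M" and A: "A : sets N"
 shows "emeasure (distr (restrict_space M Om) N g) A = emeasure M (g -` A \<inter> Om)"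
proof -
 have sp: "Om \<subseteq> space M" using sets.sets_into_space[OF Om] .
 have "emeasure (distr (restrict_space M Om) N g) A = emeasure (restrict_space M Om) (g -` A \<inter> space (restrict_space M Om))"
  using A g by (intro emeasure_distr measurable_restrict_space1)
 also have "space (restrict_space M Om) = Om" using sp by (auto simp: space_restrict_space)
 also have "emeasure (restrict_space M Om) (g -` A \<inter> Om) = emeasure M (g -` A \<inter> Om)"
  by (rule emeasure_restrict_space) (use sp Om in "auto simp: Int_absorb2")
 finally show ?thesis .
qed

context nonuniformly_expanding
begin

abbreviation "G \<equiv> induced_map f R"

lemma space_m: "space m = Y" using sets_eq_imp_space_eq[OF sets_m] by (simp add: space_restrict_space)

lemma Y_borel: "Y : sets borel" using closed_basis by (rule borel_closed)

lemma sets_m_iff: "A : sets m \<longleftrightarrow> A \<subseteq> Y & A : sets borel"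
 unfolding sets_m using Y_borel by (subst sets_restrict_space_iff) auto

lemma measurable_m: "g : borel ->M M ==> g : m ->M M"
 using measurable_restrict_space1[of g borel M Y] measurable_cong_sets[OF sets_m refl] by blast

lemma funpow_meas: "f ^^ n : borel ->M borel"
 by (induction n) (auto simp: comp_def intro: measurable_compose[OF _ measurable_map])

lemma branch_borel: "a : \<Gamma> ==> a : sets borel" "a : \<Gamma> ==> a : sets m" "a : \<Gamma> ==> a \<subseteq> Y"
 using partition(3) sets_m_iff by blast+

lemma branch_nonempty: "a : \<Gamma> ==> a ~= {}"
 using partition_pos[of a] by auto

lemma finite_m: "emeasure m Y < \<infinity>"
proof -
 have "(nn_integral m (%y. 1)) <= (nn_integral m (%y. ennreal (real (R y))))"
 proof (rule nn_integral_mono)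
  fix y assume "y : space m"
  then have "1 <= real (R y)" using return_time_pos[of y] by (simp add: space_m)
  then show "1 <= ennreal (real (R y))" by (metis ennreal_1 ennreal_leI)
 qed
 also have "... < \<infinity>" using return_time_integrable unfolding real_integrable_def by (auto simp: less_top[symmetric])
 finally show ?thesis using space_m by simp
qed

sublocale m: finite_measure m
 by standard (use finite_m space_m in auto)

lemma mass_pos: "measure m Y > 0"
proof -
 obtain a where a: "a : \<Gamma>" using partition(2) by (metis ex_in_conv finite.emptyI)
 have "0 < measure m a" using partition_pos[OF a] m.emeasure_eq_measure[of a] by simp
 also have "... <= measure m Y" using branch_borel[OF a] space_m sets.top[of m] by (intro m.finite_measure_mono) auto
 finally show ?thesis .
qed

lemma branch_measurable:
 assumes a: "a : \<Gamma>"
 shows "G : restrict_space m a ->M m"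
proof -
 obtain y where y: "y : a" using branch_nonempty[OF a] by auto
 have sp: "space (restrict_space m a) = a" using branch_borel[OF a] by (auto simp: space_restrict_space space_m)
 have eq: "G x = (f ^^ R y) x" if "x : a" for x using return_time_const[OF a that y] by (simp add: induced_map_def)
 have "f ^^ R y : restrict_space m a ->M restrict_space borel Y"
 proof (rule measurable_restrict_space2)
  show "f ^^ R y : space (restrict_space m a) \<rightarrow> Y"
  proof
   fix x assume "x : space (restrict_space m a)"
   then have x: "x : a" by (simp add: sp)
   then show "(f ^^ R y) x : Y" using eq[OF x] returns[of x] branch_borel(3)[OF a] by (auto simp: induced_map_def)
  qed
  show "f ^^ R y : restrict_space m a ->M borel" by (intro measurable_restrict_space1 measurable_m funpow_meas)
 qed
 then have "f ^^ R y : restrict_space m a ->M m" using measurable_cong_sets[OF refl sets_m] by blast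
 then show ?thesis by (subst measurable_cong[where g = "f ^^ R y"]) (auto simp: sp eq)
qed

text \<open>The branch is a bijection only up to null sets of \<open>m\<close>. The positive density makes the exceptional part of the
branch null for the pulled back measure as well.\<close>

lemma pullback_branch:
 assumes a: "a : \<Gamma>" and bij: "bij_betw_mod_null m G a Y" and jac: "inverse_jacobian m a G zet"
 shows "sets (pullback_measure m a G) = sets (restrict_space m a)" (is "?sets")
  and "distr (pullback_measure m a G) m G = m"
proof -
 let ?Q = "pullback_measure m a G" and ?r = "restrict_space m a"
 have sp: "space ?r = a" using branch_borel[OF a] by (auto simp: space_restrict_space space_m)
 have sig: "sigma_sets a (sets ?r) = sets ?r" using sets.sigma_sets_eq[of ?r] sp by simp
 have pow: "sets ?r \<subseteq> Pow a" using sets.space_closed[of ?r] sp by simp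
 have sQ: "sets ?Q = sets ?r" unfolding pullback_measure_def sets_measure_of_conv using pow sig by simp
 then show ?sets .
 have spQ: "space ?Q = a" using sets_eq_imp_space_eq[OF sQ] sp by simp
 have aQ: "a : sets ?Q" using sets.top[of ?Q] spQ by simp
 have zetm: "zet : borel_measurable ?Q" and zet0: "!!x. x : a ==> 0 < zet x" and dens: "?r = density ?Q (%x. ennreal (zet x))"
  using jac measurable_cong_sets[OF sQ refl] unfolding inverse_jacobian_def by auto
 have er: "emeasure ?r A = emeasure m A" if "A \<subseteq> a" for A
  by (rule emeasure_restrict_space) (use that branch_borel[OF a] in "auto simp: space_m Int_absorb2")
 have dQ: "emeasure m A = (nn_integral ?Q (%x. ennreal (zet x) * indicator A x))" if "A : sets ?Q" for A
 proof -
  have "A \<subseteq> a" using sets.sets_into_space[OF that] spQ by simp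
  then have "emeasure m A = emeasure (density ?Q (%x. ennreal (zet x))) A" using er dens by metis
  then show ?thesis using zetm that by (simp add: emeasure_density)
 qed
 \<comment> \<open>were the set function not a measure, \<open>?Q\<close> would vanish, contradicting \<open>emeasure m a > 0\<close>\<close>
 have ms: "measure_space a (sigma_sets a (sets ?r)) (%B. emeasure m (G ` B))"
 proof (rule ccontr)
  assume "~ ?thesis"
  then have "emeasure ?Q a = 0" unfolding pullback_measure_def by (simp add: emeasure_measure_of_conv)
  then have "a : null_sets ?Q" using aQ by auto
  then have "emeasure m a = 0" using dQ[OF aQ] by (simp add: nn_integral_null_set)
  then show False using partition_pos[OF a] by simp
 qed
 have eQ: "emeasure ?Q B = emeasure m (G ` B)" if "B : sets ?Q" for B
  unfolding pullback_measure_def using ms that sQ sig by (simp add: emeasure_measure_of_conv)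
 have GQ: "G : ?Q ->M m" using branch_measurable[OF a] measurable_cong_sets[OF sQ refl] by blast
 obtain N N' where N: "N : null_sets m" and N': "N' : null_sets m" and b: "bij_betw G (a - N) (Y - N')"
  using bij unfolding bij_betw_mod_null_def by blast
 have NQ: "N \<inter> a : null_sets ?Q"
 proof -
  have s: "N \<inter> a : sets ?Q"
   unfolding sQ using N branch_borel[OF a] by (subst sets_restrict_space_iff) (auto simp: space_m Int_absorb2)
  have "emeasure m (N \<inter> a) = 0" using N branch_borel[OF a] by (meson null_setsD1 null_set_Int2)
  then have "(nn_integral ?Q (%x. ennreal (zet x) * indicator (N \<inter> a) x)) = 0" using dQ[OF s] by simp
  then have "emeasure ?Q {x : space ?Q. ennreal (zet x) * indicator (N \<inter> a) x ~= 0} = 0"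
   using zetm s by (subst (asm) nn_integral_0_iff) auto
  also have "{x : space ?Q. ennreal (zet x) * indicator (N \<inter> a) x ~= 0} = N \<inter> a"
   using zet0 by (force simp: spQ indicator_def)
  finally show ?thesis using s by auto
 qed
 show "distr ?Q m G = m"
 proof (rule measure_eqI)
  show "sets (distr ?Q m G) = sets m" by simp
  fix C assume "C : sets (distr ?Q m G)"
  then have C: "C : sets m" by simp
  have CY: "C \<subseteq> Y" using C sets_m_iff by blast
  have pre: "G -` C \<inter> a : sets ?Q" using measurable_sets[OF GQ C] by (simp add: spQ)
  have "emeasure (distr ?Q m G) C = emeasure ?Q (G -` C \<inter> a)" using GQ C by (simp add: emeasure_distr spQ)
  also have "... = emeasure ?Q (G -` C \<inter> a - N \<inter> a)" by (rule emeasure_Diff_null_set[OF NQ pre, symmetric])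
  also have "... = emeasure m (G ` (G -` C \<inter> a - N \<inter> a))" by (rule eQ) (use pre NQ in auto)
  also have "G ` (G -` C \<inter> a - N \<inter> a) = C - N'"
  proof -
   have "G ` (a - N) = Y - N'" using b by (simp add: bij_betw_def)
   moreover have "G ` (G -` C \<inter> a - N \<inter> a) = C \<inter> G ` (a - N)" by auto
   ultimately show ?thesis using CY by auto
  qed
  also have "emeasure m (C - N') = emeasure m C" by (rule emeasure_Diff_null_set[OF N' C])
  finally show "emeasure (distr ?Q m G) C = emeasure m C" .
 qed
qed

text \<open>Both sides become integrals for the pulled back measure, where \<open>w \<circ> G\<close> and \<open>v \<circ> G\<close> are compared pointwise.\<close>

lemma branch_distortion:
 fixes w v :: "'a => ennreal"
 assumes a: "a : \<Gamma>" and bij: "bij_betw_mod_null m G a Y" and jac: "inverse_jacobian m a G zet"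
  and w: "w : borel_measurable m" and v: "v : borel_measurable m"
  and c: "!!x y. x : a ==> y : a ==> w (G x) ~= 0 ==> v (G y) ~= 0 ==> zet x <= c * zet y" and c0: "0 <= c"
 shows "(nn_integral m (%x. w (G x) * indicator a x)) * (nn_integral m (%x. v x))
  <= ennreal c * (nn_integral m (%x. w x)) * (nn_integral m (%x. v (G x) * indicator a x))"
proof -
 let ?Q = "pullback_measure m a G" and ?r = "restrict_space m a"
 have sp: "space ?r = a" using branch_borel[OF a] by (auto simp: space_restrict_space space_m)
 have sQ: "sets ?Q = sets ?r" by (rule pullback_branch(1)[OF a bij jac])
 have spQ: "space ?Q = a" using sets_eq_imp_space_eq[OF sQ] sp by simp
 have GQ: "G : ?Q ->M m" using branch_measurable[OF a] measurable_cong_sets[OF sQ refl] by blast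
 have zetm: "zet : borel_measurable ?Q" and zet0: "!!x. x : a ==> 0 < zet x" and dens: "?r = density ?Q (%x. ennreal (zet x))"
  using jac measurable_cong_sets[OF sQ refl] unfolding inverse_jacobian_def by auto
 have push: "(nn_integral ?Q (%x. g (G x))) = (nn_integral m (%x. g x))" if g: "g : borel_measurable m" for g
 proof -
  have "(\<integral>\<^sup>+x. g x \<partial>distr ?Q m G) = (nn_integral ?Q (%x. g (G x)))" by (rule nn_integral_distr[OF GQ]) (use g in simp)
  then show ?thesis using pullback_branch(2)[OF a bij jac] by simp
 qed
 have weight: "(nn_integral m (%x. g (G x) * indicator a x)) = (nn_integral ?Q (%x. ennreal (zet x) * g (G x)))" if g: "g : borel_measurable m" for g
 proof -
  have gG: "(%x. g (G x)) : borel_measurable ?Q" by (rule measurable_compose[OF GQ g])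
  have "(nn_integral m (%x. g (G x) * indicator a x)) = (nn_integral ?r (%x. g (G x)))"
   using branch_borel[OF a] by (intro nn_integral_restrict_space[symmetric]) (auto simp: space_m Int_absorb2)
  also have "... = (nn_integral ?Q (%x. ennreal (zet x) * g (G x)))"
   unfolding dens using zetm gG by (intro nn_integral_density) auto
  finally show ?thesis .
 qed
 have m1: "(%x. ennreal (zet x) * g (G x)) : borel_measurable ?Q" if g: "g : borel_measurable m" for g
  using zetm measurable_compose[OF GQ g] by auto
 define A where "A = (nn_integral ?Q (%x. ennreal (zet x) * w (G x)))"
 have pt: "A * v (G y) <= ennreal c * (nn_integral m (%x. w x)) * (ennreal (zet y) * v (G y))" if y: "y : a" for y
 proof (cases "v (G y) = 0")
  case False
  have "A <= (nn_integral ?Q (%x. ennreal (c * zet y) * w (G x)))"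
   unfolding A_def
  proof (rule nn_integral_mono)
   fix x assume "x : space ?Q"
   then have x: "x : a" by (simp add: spQ)
   show "ennreal (zet x) * w (G x) <= ennreal (c * zet y) * w (G x)"
    using c[OF x y _ False] by (cases "w (G x) = 0") (auto intro!: mult_right_mono ennreal_leI)
  qed
  also have "... = ennreal (c * zet y) * (nn_integral m (%x. w x))"
   using measurable_compose[OF GQ w] by (simp add: nn_integral_cmult push[OF w])
  finally have "A * v (G y) <= (ennreal (c * zet y) * (nn_integral m (%x. w x))) * v (G y)" by (rule mult_right_mono) simp
  also have "... = ennreal c * (nn_integral m (%x. w x)) * (ennreal (zet y) * v (G y))"
   using c0 zet0[OF y] by (simp add: ennreal_mult mult_ac)
  finally show ?thesis .
 qed simp
 have "(nn_integral m (%x. w (G x) * indicator a x)) * (nn_integral m (%x. v x)) = A * (nn_integral ?Q (%y. v (G y)))"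
  unfolding A_def weight[OF w] push[OF v] ..
 also have "... = (nn_integral ?Q (%y. A * v (G y)))" using measurable_compose[OF GQ v] by (simp add: nn_integral_cmult)
 also have "... <= (nn_integral ?Q (%y. ennreal c * (nn_integral m (%x. w x)) * (ennreal (zet y) * v (G y))))"
  by (rule nn_integral_mono) (use pt spQ in auto)
 also have "... = ennreal c * (nn_integral m (%x. w x)) * (nn_integral m (%x. v (G x) * indicator a x))"
  unfolding weight[OF v] by (rule nn_integral_cmult[OF m1[OF v]])
 finally show ?thesis .
qed

text \<open>Moved to the whole space, where the tower is built from Borel functions on one type.\<close>

definition ref :: "'a measure" where
 "ref = distr (scale_measure (ennreal (1 / measure m Y)) m) borel (%x. x)"

definition ret :: "'a => nat" where "ret y = (if y : Y then R y else 0)"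

lemma id_m: "(%x. x) : scale_measure r m ->M borel"
 using measurable_m[OF measurable_ident] by (simp add: measurable_def space_scale_measure)

lemma sets_ref: "sets ref = sets borel" by (simp add: ref_def)

lemma nn_integral_ref:
 assumes g: "g : borel_measurable borel"
 shows "(nn_integral ref (%x. g x)) = ennreal (1 / measure m Y) * (nn_integral m (%x. g x))"
proof -
 have "(nn_integral ref (%x. g x)) = (\<integral>\<^sup>+x. g x \<partial>scale_measure (ennreal (1 / measure m Y)) m)"
  unfolding ref_def using id_m g by (intro nn_integral_distr) auto
 also have "... = ennreal (1 / measure m Y) * (nn_integral m (%x. g x))" by (rule nn_integral_scale_measure[OF measurable_m[OF g]])
 finally show ?thesis .
qed

lemma emeasure_ref: "A : sets borel ==> emeasure ref A = ennreal (1 / measure m Y) * emeasure m (A \<inter> Y)"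
 using id_m[of "ennreal (1 / measure m Y)"] by (simp add: ref_def emeasure_distr space_scale_measure space_m)

lemma prob_ref: "prob_space ref"
proof (rule prob_spaceI)
 have "emeasure ref UNIV = ennreal (1 / measure m Y) * ennreal (measure m Y)"
  using emeasure_ref[of UNIV] m.emeasure_eq_measure[of Y] by simp
 also have "... = 1" using mass_pos by (simp add: ennreal_mult[symmetric])
 finally show "emeasure ref (space ref) = 1" by (simp add: ref_def)
qed

lemma measure_ref:
 assumes "A : sets borel" shows "measure ref A = measure m (A \<inter> Y) / measure m Y"
 unfolding measure_def[of ref A] emeasure_ref[OF assms] enn2real_mult measure_def[of m "A \<inter> Y"]
 using mass_pos by simp

lemma F_ret: "x : Y ==> (f ^^ ret x) x = G x" by (simp add: ret_def induced_map_def)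

end

context nonuniformly_expanding
begin

text \<open>Distances enter through \<open>dist x y powr al\<close>, for which expansion by \<open>c\<close> becomes contraction by \<open>th = c powr (- al)\<close>; boundedness of the space
turns the Lipschitz distortion bound into one in this metric, and the factor \<open>2 powr p\<close> in \<open>A0\<close> passes from \<open>n\<close> to \<open>Suc n\<close>.\<close>

lemma tower_instance:
 fixes nu :: "'a measure"
 assumes nu: "ac_invariant_prob m G nu" and al: "0 < al" "al <= 1" and p: "p > 2"
  and tail: "!!n. n >= 1 ==> measure m {y:Y. n < R y} <= S * real n powr (- p)"
 obtains th K D A0 K2 D1 where "tower ref f \<Gamma> ret al th K D p A0 (distr nu borel (%x. x)) K2 D1"
proof -
 let ?n = "distr nu borel (%x. x)"
 obtain Del' where Del': "!!x y :: 'a. dist x y <= Del'" using bounded_space by (auto simp: bounded_two_points)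
 define Del where "Del = max 1 Del'"
 have Del: "Del >= 1" "!!x y :: 'a. dist x y <= Del" using Del' by (auto simp: Del_def le_max_iff_disj)
 define D1 where "D1 = Del powr (1 - al)"
 have D1: "D1 > 0" using Del(1) by (simp add: D1_def)
 have lip: "dist x y <= D1 * dist x y powr al" for x y :: 'a
 proof (cases "dist x y = 0")
  case False
  have "dist x y = dist x y powr (1 - al) * dist x y powr al" using False by (simp add: powr_add[symmetric])
  also have "... <= D1 * dist x y powr al" unfolding D1_def using al Del(2) by (intro mult_right_mono powr_mono2) auto
  finally show ?thesis .
 qed simp
 define Q where "Q c Kd a \<longleftrightarrow> bij_betw_mod_null m G a Y &
    (ALL x:a. ALL y:a. dist (G x) (G y) >= c * dist x y & (ALL k<=R x. dist ((f ^^ k) x) ((f ^^ k) y) <= Kd * dist (G x) (G y))) &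
    (EX zet. inverse_jacobian m a G zet & (ALL x:a. ALL y:a. abs (ln (zet x) - ln (zet y)) <= Kd * dist (G x) (G y)))" for c Kd :: real and a
 have "EX c>1. EX Kd>0. ALL a:\<Gamma>. Q c Kd a" unfolding Q_def by (rule expansion_distortion)
 then obtain c Kd where c: "c > 1" and Kd: "Kd > 0" and Q: "!!a. a : \<Gamma> ==> Q c Kd a" by blast
 note branch = Q[unfolded Q_def]
 have aY: "x : Y" if "a : \<Gamma>" "x : a" for a x using branch_borel(3) that by blast
 have retR: "ret x = R x" if "x : Y" for x using that by (simp add: ret_def)
 interpret ref: prob_space ref by (rule prob_ref)
 interpret nu: prob_space nu using nu by (simp add: ac_invariant_prob_def)
 have nu_sets: "sets nu = sets m" and nu_ac: "absolutely_continuous m nu" and nu_inv: "distr nu nu G = nu"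
  using nu by (auto simp: ac_invariant_prob_def)
 have nu_space: "space nu = Y" using sets_eq_imp_space_eq[OF nu_sets] by (simp add: space_m)
 have nu_meas: "g : nu ->M M" if "g : borel ->M M" for g and M :: "'z measure"
  using measurable_m[OF that] measurable_cong_sets[OF nu_sets refl] by blast
 have id_nu: "(%x. x) : nu ->M borel" by (rule nu_meas[OF measurable_ident_sets[OF refl]])
 define th where "th = c powr (- al)"
 define K where "K = Kd * D1"
 define A0 where "A0 = 1 + 2 powr p * abs S / measure m Y"
 have fb: "full_branch_map ref f \<Gamma> ret al th K (Del powr al)"
 proof
  show "sets ref = sets borel" by (rule sets_ref)
  show "f : borel ->M borel" by (rule measurable_map)
  show "countable \<Gamma>" "disjoint \<Gamma>" by (fact partition)+
  show "\<Gamma> \<subseteq> sets borel" using branch_borel by auto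
  have "emeasure ref (UNIV - Y) = 0" using emeasure_ref[of "UNIV - Y"] Y_borel by (simp add: Diff_Int_distrib2 sets.compl_sets)
  then have "AE x in ref. x : Y" by (intro AE_I[of _ _ "UNIV - Y"]) (use Y_borel in "auto simp: ref_def")
  then show "AE x in ref. x : \<Union>\<Gamma>" by (simp add: partition(5))
  show "measure ref a > 0" if "a : \<Gamma>" for a
  proof -
   have "a \<inter> Y = a" using branch_borel(3)[OF that] by auto
   moreover have "measure m a > 0" using partition_pos[OF that] by (simp add: m.emeasure_eq_measure)
   ultimately show ?thesis using measure_ref[OF branch_borel(1)[OF that]] mass_pos by simp
  qed
  show "ret x = ret y" if "a : \<Gamma>" "x : a" "y : a" for a x y
   using return_time_const[OF that] aY[OF that(1)] that by (simp add: ret_def)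
  show "ret x >= 1" if "x : \<Union>\<Gamma>" for x using that return_time_pos[of x] by (simp add: partition(5) ret_def)
  show "ret x = 0" if "x \<notin> \<Union>\<Gamma>" for x using that by (simp add: partition(5) ret_def)
  show "dist x y powr al <= Del powr al" for x y :: 'a using Del(2) al by (intro powr_mono2) auto
  show "0 < al" by fact
  show "0 < th" using c by (simp add: th_def)
  show "th < 1" using c al powr_less_mono[of "- al" 0 c] by (simp add: th_def)
  show "K > 0" using Kd D1 by (simp add: K_def)
  show "dist x y powr al <= th * dist ((f ^^ ret x) x) ((f ^^ ret y) y) powr al" if a: "a : \<Gamma>" "x : a" "y : a" for a x y
  proof -
   have "c * dist x y <= dist (G x) (G y)" using branch[OF a(1)] a by blast
   then have "dist x y <= dist (G x) (G y) / c" using c by (simp add: pos_le_divide_eq mult.commute)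
   then have "dist x y powr al <= (dist (G x) (G y) / c) powr al" using al by (intro powr_mono2) auto
   also have "... = th * dist (G x) (G y) powr al" using c by (simp add: powr_divide th_def powr_minus_divide)
   finally show ?thesis using F_ret aY a by simp
  qed
  show "(\<integral>x. indicator a x * u ((f ^^ ret x) x) \<partial>ref) * (\<integral>x. v x \<partial>ref)
      <= exp (K * t) * (\<integral>x. u x \<partial>ref) * (\<integral>x. indicator a x * v ((f ^^ ret x) x) \<partial>ref)"
   if a: "a : \<Gamma>" and bu: "bdd_borel u" and bv: "bdd_borel v" and u0: "!!x. 0 <= u x" and v0: "!!x. 0 <= v x"
    and t: "t >= 0" and close: "!!x y. u x ~= 0 ==> v y ~= 0 ==> dist x y powr al <= t" for a u v t
  proof -
   obtain zet where jac: "inverse_jacobian m a G zet" and dis: "!!x y. x : a ==> y : a ==> abs (ln (zet x) - ln (zet y)) <= Kd * dist (G x) (G y)"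
    using branch[OF a] by blast
   have bij: "bij_betw_mod_null m G a Y" using branch[OF a] by blast
   have zet0: "zet x > 0" if "x : a" for x using jac that by (simp add: inverse_jacobian_def)
   have um: "u : borel_measurable borel" and vm: "v : borel_measurable borel" using bu bv by (auto simp: bdd_borel_def)
   obtain y0 where y0: "y0 : a" using branch_nonempty[OF a] by auto
   define r where "r = R y0"
   have Gr: "G x = (f ^^ r) x" "(f ^^ ret x) x = (f ^^ r) x" if "x : a" for x
    using return_time_const[OF a that y0] aY[OF a that] by (simp_all add: induced_map_def r_def ret_def)
   have ain: "a : sets borel" by (rule branch_borel(1)[OF a])
   have comp: "integrable ref (%x. indicator a x * w ((f ^^ r) x))" "(%x. indicator a x * w ((f ^^ r) x)) : borel_measurable borel"
    if bw: "bdd_borel w" for w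
   proof -
    have bw': "bdd_borel (%x. indicator a x * w ((f ^^ r) x))"
     by (intro bdd_borel_mult bdd_borel_indicator ain bdd_borel_comp[OF bw funpow_meas])
    show "integrable ref (%x. indicator a x * w ((f ^^ r) x))"
     by (rule bdd_borel_integrable[OF bw' ref.finite_measure_axioms sets_ref])
    show "(%x. indicator a x * w ((f ^^ r) x)) : borel_measurable borel"
     using bw' unfolding bdd_borel_def by (rule conjunct1)
   qed
   have cv: "ennreal (\<integral>x. indicator a x * w ((f ^^ ret x) x) \<partial>ref) = ennreal (1 / measure m Y) * (nn_integral m (%x. ennreal (w (G x)) * indicator a x))"
    if bw: "bdd_borel w" and w0: "!!x. 0 <= w x" for w
   proof -
    have "(\<integral>x. indicator a x * w ((f ^^ ret x) x) \<partial>ref) = (\<integral>x. indicator a x * w ((f ^^ r) x) \<partial>ref)"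
     by (intro Bochner_Integration.integral_cong refl) (auto simp: indicator_def Gr)
    then have "ennreal (\<integral>x. indicator a x * w ((f ^^ ret x) x) \<partial>ref) = (nn_integral ref (%x. ennreal (indicator a x * w ((f ^^ r) x))))"
     using nn_integral_eq_integral[OF comp(1)[OF bw]] w0 by simp
    also have "... = ennreal (1 / measure m Y) * (nn_integral m (%x. ennreal (indicator a x * w ((f ^^ r) x))))"
     using comp(2)[OF bw] by (intro nn_integral_ref) auto
    also have "(nn_integral m (%x. ennreal (indicator a x * w ((f ^^ r) x)))) = (nn_integral m (%x. ennreal (w (G x)) * indicator a x))"
     by (intro nn_integral_cong) (auto simp: indicator_def Gr)
    finally show ?thesis .
   qed
   have cu: "ennreal (\<integral>x. w x \<partial>ref) = ennreal (1 / measure m Y) * (nn_integral m (%x. ennreal (w x)))"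
    if bw: "bdd_borel w" and w0: "!!x. 0 <= w x" for w
   proof -
    have "ennreal (\<integral>x. w x \<partial>ref) = (nn_integral ref (%x. ennreal (w x)))"
     using nn_integral_eq_integral[OF bdd_borel_integrable[OF bw ref.finite_measure_axioms sets_ref]] w0 by simp
    also have "... = ennreal (1 / measure m Y) * (nn_integral m (%x. ennreal (w x)))"
     using bw by (intro nn_integral_ref) (auto simp: bdd_borel_def)
    finally show ?thesis .
   qed
   have key: "(nn_integral m (%x. ennreal (u (G x)) * indicator a x)) * (nn_integral m (%x. ennreal (v x)))
    <= ennreal (exp (K * t)) * (nn_integral m (%x. ennreal (u x))) * (nn_integral m (%x. ennreal (v (G x)) * indicator a x))"
   proof (rule branch_distortion[OF a bij jac])
    show "(%x. ennreal (u x)) : borel_measurable m" "(%x. ennreal (v x)) : borel_measurable m"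
     using measurable_m[OF um] measurable_m[OF vm] by auto
    fix x y assume xy: "x : a" "y : a" "ennreal (u (G x)) ~= 0" "ennreal (v (G y)) ~= 0"
    have "dist (G x) (G y) powr al <= t" using xy by (intro close) auto
    then have "D1 * dist (G x) (G y) powr al <= D1 * t" using D1 by simp
    with lip[of "G x" "G y"] have "dist (G x) (G y) <= D1 * t" by linarith
    then have "Kd * dist (G x) (G y) <= Kd * (D1 * t)" using Kd by simp
    with dis[OF xy(1,2)] have "ln (zet x) <= K * t + ln (zet y)" by (simp add: K_def mult.assoc)
    then have "exp (ln (zet x)) <= exp (K * t + ln (zet y))" by simp
    then show "zet x <= exp (K * t) * zet y" using zet0 xy by (simp add: exp_add)
   qed simp
   let ?k = "ennreal (1 / measure m Y)"
   have "ennreal ((\<integral>x. indicator a x * u ((f ^^ ret x) x) \<partial>ref) * (\<integral>x. v x \<partial>ref))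
     = ?k * ?k * ((nn_integral m (%x. ennreal (u (G x)) * indicator a x)) * (nn_integral m (%x. ennreal (v x))))"
    using u0 v0 by (simp add: ennreal_mult integral_nonneg_AE cv[OF bu u0] cu[OF bv v0] mult_ac)
   also have "... <= ?k * ?k * (ennreal (exp (K * t)) * (nn_integral m (%x. ennreal (u x))) * (nn_integral m (%x. ennreal (v (G x)) * indicator a x)))"
    by (rule mult_left_mono[OF key]) simp
   also have "... = ennreal (exp (K * t) * (\<integral>x. u x \<partial>ref) * (\<integral>x. indicator a x * v ((f ^^ ret x) x) \<partial>ref))"
    using u0 v0 by (simp add: ennreal_mult integral_nonneg_AE cv[OF bv v0] cu[OF bu u0] mult_ac)
   finally show ?thesis using u0 v0 by (subst (asm) ennreal_le_iff) (auto intro!: mult_nonneg_nonneg integral_nonneg_AE)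
  qed
 qed
 interpret fb: full_branch_map ref f \<Gamma> ret al th K "Del powr al" by (rule fb)
 have FG: "fb.F x = G x" if "x : Y" for x using F_ret[OF that] by (simp add: fb.F_def)
 have "tower ref f \<Gamma> ret al th K (Del powr al) p A0 ?n (Kd powr al) D1"
 proof (intro tower.intro mixing_full_branch_map.intro fb mixing_full_branch_map_axioms.intro tower_axioms.intro)
  show "p > 2" by fact
  show "measure ref {x. n < ret x} <= A0 * decay p n" for n
  proof (cases "n = 0")
   case True
   have "measure ref {x. n < ret x} <= 1" by (rule ref.prob_le_1)
   also have "1 <= A0" using mass_pos by (simp add: A0_def)
   also have "A0 = A0 * decay p n" using True by simp
   finally show ?thesis .
  next
   case False
   then have n: "n >= 1" by simp
   have "{x. n < ret x} \<inter> Y = {y:Y. n < R y}" by (auto simp: ret_def)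
   then have "measure ref {x. n < ret x} = measure m {y:Y. n < R y} / measure m Y"
    using measure_ref[OF fb.R_sets[of "%r. n < r"]] by simp
   also have "... <= S * real n powr (- p) / measure m Y" using tail[OF n] mass_pos by (intro divide_right_mono) auto
   also have "... <= abs S * (2 powr p * decay p n) / measure m Y"
   proof (intro divide_right_mono mult_mono)
    have "real n powr (- p) <= (real (Suc n) / 2) powr (- p)" using n p by (intro powr_mono2') auto
    also have "... = 2 powr p * decay p n" by (simp add: powr_divide powr_minus_divide)
    finally show "real n powr (- p) <= 2 powr p * decay p n" .
   qed (use mass_pos in auto)
   also have "... = (2 powr p * abs S / measure m Y) * decay p n" by simp
   also have "... <= A0 * decay p n" unfolding A0_def by (intro mult_right_mono) auto
   finally show ?thesis .
  qed
  show "Gcd {r. 0 < measure ref {x. ret x = r}} = 1"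
  proof -
   have "R ` Y \<subseteq> {r. 0 < measure ref {x. ret x = r}}"
   proof
    fix r assume "r : R ` Y"
    then obtain y where y: "y : Y" "r = R y" by auto
    then obtain a where a: "a : \<Gamma>" "y : a" using partition(5) by auto
    have "a \<subseteq> {x. ret x = r}" using return_time_const[OF a(1) _ a(2)] aY[OF a(1)] y by (auto simp: ret_def)
    then have "measure ref a <= measure ref {x. ret x = r}"
     using fb.R_sets[of "%s. s = r"] by (intro ref.finite_measure_mono) (auto simp: sets_ref)
    then show "r : {r. 0 < measure ref {x. ret x = r}}" using fb.part_pos[OF a(1)] by simp
   qed
   then have "Gcd {r. 0 < measure ref {x. ret x = r}} dvd Gcd (R ` Y)" by (meson Gcd_dvd Gcd_greatest subsetD)
   then show ?thesis by (simp add: return_time_gcd)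
  qed
  show "prob_space ?n" by (rule nu.prob_space_distr[OF id_nu])
  show "sets ?n = sets borel" by simp
  show "absolutely_continuous ref ?n"
   unfolding absolutely_continuous_def
  proof
   fix A assume "A : null_sets ref"
   then have A: "A : sets borel" "emeasure ref A = 0" by (auto simp: sets_ref)
   then have "emeasure m (A \<inter> Y) = 0" using emeasure_ref[OF A(1)] mass_pos by simp
   then have "A \<inter> Y : null_sets m" using A(1) Y_borel sets_m_iff by auto
   then have "A \<inter> Y : null_sets nu" using nu_ac by (auto simp: absolutely_continuous_def)
   then have "emeasure ?n A = 0" using A(1) id_nu by (simp add: emeasure_distr nu_space null_setsD1)
   then show "A : null_sets ?n" using A(1) by (intro null_setsI) auto
  qed
  show "distr ?n borel fb.F = ?n"
  proof (rule measure_eqI)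
   fix A assume "A : sets (distr ?n borel fb.F)"
   then have A: "A : sets borel" by simp
   have AY: "A \<inter> Y : sets nu" using A Y_borel sets_m_iff nu_sets by auto
   have GY: "G y : Y" if "y : Y" for y using returns[OF that] by (simp add: induced_map_def)
   have Gm: "G : nu ->M nu"
   proof (rule measurableI)
    show "G x : space nu" if "x : space nu" for x using GY that by (simp add: nu_space)
    fix C assume "C : sets nu"
    then have C: "C \<subseteq> Y" "C : sets borel" using sets_m_iff nu_sets by auto
    have "G -` C \<inter> space nu = fb.F -` C \<inter> Y" using FG by (auto simp: nu_space)
    moreover have "fb.F -` C : sets borel" using measurable_sets[OF fb.F_borel C(2)] by simp
    ultimately show "G -` C \<inter> space nu : sets nu" using Y_borel sets_m_iff nu_sets by auto
   qed
   have "emeasure (distr ?n borel fb.F) A = emeasure (distr nu borel fb.F) A"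
    using id_nu fb.F_borel by (simp add: distr_distr comp_def)
   also have "... = emeasure nu (fb.F -` A \<inter> Y)" using A nu_meas[OF fb.F_borel] by (simp add: emeasure_distr nu_space)
   also have "fb.F -` A \<inter> Y = G -` (A \<inter> Y) \<inter> space nu" using FG GY by (auto simp: nu_space)
   also have "emeasure nu (G -` (A \<inter> Y) \<inter> space nu) = emeasure (distr nu nu G) (A \<inter> Y)" using Gm AY by (simp add: emeasure_distr)
   also have "... = emeasure nu (A \<inter> Y)" by (simp add: nu_inv)
   also have "... = emeasure ?n A" using A id_nu by (simp add: emeasure_distr nu_space)
   finally show "emeasure (distr ?n borel fb.F) A = emeasure ?n A" .
  qed simp
  show "dist x y <= D1 * dist x y powr al" for x y :: 'a by (rule lip)
  show "D1 >= 0" "Kd powr al >= 0" using D1 by auto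
  show "dist ((f ^^ k) x) ((f ^^ k) y) powr al <= Kd powr al * dist (fb.F x) (fb.F y) powr al"
   if a: "a : \<Gamma>" "x : a" "y : a" and k: "k <= ret x" for a x y k
  proof -
   have "dist ((f ^^ k) x) ((f ^^ k) y) <= Kd * dist (G x) (G y)" using branch[OF a(1)] a k retR aY by auto
   then have "dist ((f ^^ k) x) ((f ^^ k) y) powr al <= (Kd * dist (G x) (G y)) powr al" using al by (intro powr_mono2) auto
   then show ?thesis using Kd FG aY a by (simp add: powr_mult)
  qed
 qed
 then show thesis by (rule that)
qed

text \<open>The measures \<open>m\<close> and \<open>nu\<close> live on the basis only; points outside it carry no mass and get return time zero.\<close>

lemma tower_measure_extend:
 fixes nu :: "'a measure"
 assumes nu_sets: "sets nu = sets m" and Rm: "!!n. {y. n < ret y} : sets borel"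
 shows "tower_measure f R nu = tower_measure f ret (distr nu borel (%x. x))"
proof -
 have nu_space: "space nu = Y" using sets_eq_imp_space_eq[OF nu_sets] by (simp add: space_m)
 have nu_meas: "g : nu ->M M" if "g : borel ->M M" for g and M :: "'z measure"
  using measurable_m[OF that] measurable_cong_sets[OF nu_sets refl] by blast
 have id_nu: "(%x. x) : nu ->M borel" by (rule nu_meas[OF measurable_ident_sets[OF refl]])
 let ?n = "distr nu borel (%x. x)"
 have ret_m: "ret : borel ->M count_space UNIV"
 proof -
  have "{y. ret y = k} : sets borel" for k
  proof (cases k)
   case 0
   have "{y. ret y = k} = UNIV - {y. 0 < ret y}" using 0 by auto
   then show ?thesis using Rm[of 0] by (metis sets.compl_sets space_borel)
  next
   case (Suc j)
   have "{y. ret y = k} = {y. j < ret y} - {y. k < ret y}" using Suc by auto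
   then show ?thesis using Rm by (metis sets.Diff)
  qed
  then show ?thesis by (intro measurable_count_space_eq2_countable[THEN iffD2]) (auto simp: vimage_def)
 qed
 have "(nn_integral ?n (%y. of_nat (ret y))) = (nn_integral nu (%y. of_nat (ret y)))"
  by (rule nn_integral_distr[OF id_nu]) (use ret_m in "auto intro: measurable_compose")
 also have "... = (nn_integral nu (%y. of_nat (R y)))" by (intro nn_integral_cong) (simp add: nu_space ret_def)
 finally have int: "(nn_integral nu (%y. of_nat (R y))) = (nn_integral ?n (%y. of_nat (ret y)))" by simp
 show ?thesis
  unfolding tower_measure_def
 proof (rule measure_of_eq)
  fix A assume "A : sigma_sets (UNIV :: 'a set) (sets borel)"
  then have A: "A : sets borel" using sets.sigma_sets_eq[of "borel :: 'a measure"] by simp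
  have "emeasure (distr (restrict_space nu {y:space nu. n < R y}) borel (f ^^ n)) A
    = emeasure (distr (restrict_space ?n {y:space ?n. n < ret y}) borel (f ^^ n)) A" for n
  proof -
   have eq: "{y:space nu. n < R y} = {y. n < ret y} \<inter> Y" by (auto simp: nu_space ret_def)
   have S: "{y:space nu. n < R y} : sets nu" unfolding eq using Rm[of n] Y_borel sets_m_iff nu_sets by auto
   have S': "{y:space ?n. n < ret y} : sets ?n" using Rm[of n] by simp
   have pre: "(f ^^ n) -` A \<inter> {y. n < ret y} : sets borel" using measurable_sets[OF funpow_meas A] Rm[of n] by auto
   have "emeasure (distr (restrict_space nu {y:space nu. n < R y}) borel (f ^^ n)) A = emeasure nu ((f ^^ n) -` A \<inter> {y:space nu. n < R y})"
    by (rule emeasure_distr_restrict[OF nu_meas[OF funpow_meas] S A])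
   also have "(f ^^ n) -` A \<inter> {y:space nu. n < R y} = ((f ^^ n) -` A \<inter> {y. n < ret y}) \<inter> Y" unfolding eq by auto
   also have "emeasure nu (((f ^^ n) -` A \<inter> {y. n < ret y}) \<inter> Y) = emeasure ?n ((f ^^ n) -` A \<inter> {y. n < ret y})"
    using pre id_nu by (simp add: emeasure_distr nu_space)
   also have "(f ^^ n) -` A \<inter> {y. n < ret y} = (f ^^ n) -` A \<inter> {y:space ?n. n < ret y}" by simp
   also have "emeasure ?n ... = emeasure (distr (restrict_space ?n {y:space ?n. n < ret y}) borel (f ^^ n)) A"
    by (rule emeasure_distr_restrict[symmetric, OF _ S' A]) (simp add: funpow_meas)
   finally show ?thesis .
  qed
  then show "(\<Sum>n. emeasure (distr (restrict_space nu {y:space nu. n < R y}) borel (f ^^ n)) A) / (nn_integral nu (%y. of_nat (R y)))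
   = (\<Sum>n. emeasure (distr (restrict_space ?n {y:space ?n. n < ret y}) borel (f ^^ n)) A) / (nn_integral ?n (%y. of_nat (ret y)))"
   using int by simp
 qed simp
qed

end

lemma eventually_small_tail_bounded:
 fixes s :: "real => real"
 assumes "(s ---> 0) at_top"
 shows "EX S. ALL n::nat. s (real n) <= S"
proof -
 have "(%n. s (real n)) ----> 0" by (rule filterlim_compose[OF assms filterlim_real_sequentially])
 then have "Bseq (%n. s (real n))" by (rule convergent_imp_Bseq[OF convergentI])
 then obtain S where "!!n. norm (s (real n)) <= S" by (auto simp: Bseq_def)
 then show ?thesis by (metis abs_le_D1 real_norm_def)
qed

theorem theorem1p1:
  fixes f :: "'a::polish_space \<Rightarrow> 'a"
    and Y :: "'a set" and m \<nu> \<mu> :: "'a measure" and \<Gamma> :: "'a set set" and R :: "'a \<Rightarrow> nat"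
    and p \<sigma> :: real and s :: "real \<Rightarrow> real" and u :: "nat \<Rightarrow> real"
    and \<phi> :: "'a \<Rightarrow> real"
  assumes "nonuniformly_expanding f Y m \<Gamma> R"
    and "ac_invariant_prob m (induced_map f R) \<nu>"
    and "\<mu> = tower_measure f R \<nu>"
    and "p > 2"
    and "slowly_varying s" and "(s \<longlongrightarrow> 0) at_top"
    and "\<forall>n\<ge>1. u n > 0" and "u \<longlonglongrightarrow> 0"
    and "\<forall>n\<ge>1. exp (- (real n * u n)) \<le> measure m {y\<in>Y. R y > n} \<and>
               measure m {y\<in>Y. R y > n} \<le> real n powr (- p) * s (real n)"
    and "hoelder_continuous \<phi>"
    and "(\<integral>x. \<phi> x \<partial>\<mu>) = 0"
    and "\<sigma> = sqrt (asymptotic_variance \<mu> f \<phi>)"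
  shows "summable (\<lambda>k. \<bar>covariance \<mu> \<phi> (\<phi> \<circ> f ^^ Suc k)\<bar>) \<and>
    0 \<le> asymptotic_variance \<mu> f \<phi> \<and>
    (\<forall>(M :: 'w measure) W.
       brownian_motion M W \<and>
       (\<forall>\<omega>\<in>space M. (\<lambda>t\<in>{0..1}. W t \<omega>) \<in> hoelder_space0 (1 / 2 - 1 / p)) \<longrightarrow>
       converges_in_distribution (hoelder_topology0 (1 / 2 - 1 / p))
         \<mu> (birkhoff_process f \<phi>) M (\<lambda>\<omega>. \<lambda>t\<in>{0..1}. \<sigma> * W t \<omega>))"
proof -
 interpret nonuniformly_expanding f Y m \<Gamma> R by fact
 obtain al H where al: "0 < al" "al <= 1" and H: "!!x y. abs (\<phi> x - \<phi> y) <= H * dist x y powr al"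
  using assms(10) by (auto simp: hoelder_continuous_def)
 obtain S where S: "!!n::nat. s (real n) <= S" using eventually_small_tail_bounded[OF assms(6)] by auto
 have tail: "measure m {y:Y. n < R y} <= S * real n powr (- p)" if "n >= 1" for n
 proof -
  have "measure m {y:Y. n < R y} <= real n powr (- p) * s (real n)" using assms(9) that by blast
  also have "... <= real n powr (- p) * S" using S by (intro mult_left_mono) auto
  finally show ?thesis by (simp add: mult.commute)
 qed
 obtain th K D A0 K2 D1 where tow: "tower ref f \<Gamma> ret al th K D p A0 (distr \<nu> borel (%x. x)) K2 D1"
  using tower_instance[OF assms(2) al assms(4) tail] .
 interpret tw: tower ref f \<Gamma> ret al th K D p A0 "distr \<nu> borel (%x. x)" K2 D1 by (rule tow)
 have \<mu>: "\<mu> = tower_measure f ret (distr \<nu> borel (%x. x))"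
  unfolding assms(3) using assms(2) tw.R_sets by (intro tower_measure_extend) (auto simp: ac_invariant_prob_def)
 \<comment> \<open>\<open>kap < p - 1\<close> for decorrelation, \<open>kap > p / 2\<close> for the exponent \<open>1 / 2 - 1 / p\<close>\<close>
 define kap where "kap = (p / 2 + (p - 1)) / 2"
 have kap: "p / 2 < kap" "kap < p - 1" "1 < kap" using assms(4) by (auto simp: kap_def field_simps)
 have Dd: "dist x y powr al <= D" for x y :: 'a by (rule tw.diam)
 have \<phi>m: "\<phi> : borel_measurable borel"
 proof (rule borel_measurable_continuous_onI)
  show "continuous_on UNIV \<phi>"
   unfolding continuous_on_def
  proof
   fix x :: 'a
   have "((%y. dist y x) ---> dist x x) (at x)" by (intro tendsto_intros)
   then have d: "((%y. dist y x) ---> 0) (at x)" by simp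
   have "((%y. H * dist y x powr al) ---> H * 0 powr al) (at x)"
    by (intro tendsto_mult tendsto_const tendsto_powr'[OF d tendsto_const]) (use al in auto)
   then have d': "((%y. H * dist y x powr al) ---> 0) (at x)" by simp
   have "((%y. \<phi> y - \<phi> x) ---> 0) (at x)"
    by (rule Lim_null_comparison[OF _ d']) (use H in simp)
   then show "(\<phi> ---> \<phi> x) (at x within UNIV)" by (simp add: LIM_zero_iff)
  qed
 qed
 define B where "B = abs (\<phi> undefined) + abs H * D + 1"
 have D0: "0 <= D" by (rule tw.D_nonneg)
 have B: "B > 0" using D0 by (simp add: B_def add_nonneg_pos)
 have \<phi>B: "abs (\<phi> x) <= B" for x
 proof -
  have "abs (\<phi> x - \<phi> undefined) <= H * dist x undefined powr al" by (rule H)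
  also have "... <= abs H * D" using Dd by (intro mult_mono) auto
  finally show ?thesis unfolding B_def by linarith
 qed
 have \<phi>b: "bdd_borel \<phi>" using \<phi>m \<phi>B by (auto simp: bdd_borel_def)
 obtain A where A: "A > 0" "!!psi n. bdd_borel psi ==> (!!x. abs (psi x) <= 1) ==>
  abs (\<integral>x. \<phi> x * psi ((f ^^ n) x) \<partial>\<mu>) <= A * decay kap n"
  using tw.mu_decorrelation[of kap \<phi> H] kap \<phi>b H assms(11) unfolding \<mu> by auto
 interpret mu: prob_space \<mu> unfolding \<mu> by (rule tw.mu_prob)
 interpret dec: decorrelated_exact \<mu> f \<phi> B A kap
 proof
  show "sets \<mu> = sets borel" "distr \<mu> borel f = \<mu>" unfolding \<mu> by (rule tw.mu_sets, rule tw.mu_invariant)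
  show "EX N. ALL n>=N. ALL psi. bdd_borel psi --> (ALL x. abs (psi x) <= 1) -->
   abs (\<integral>x. (u x - (LINT z|\<mu>. u z)) * psi ((f ^^ n) x) \<partial>\<mu>) <= eps" if "bdd_borel u" "eps > 0" for u eps
   unfolding \<mu> by (rule tw.mu_exact[OF that])
 qed (fact measurable_map \<phi>m \<phi>B B A kap(3) assms(11))+
 have mean_pow: "(LINT x|\<mu>. \<phi> ((f ^^ k) x)) = 0" for k using dec.invariant[OF \<phi>m, of k] assms(11) by simp
 have cov: "covariance \<mu> \<phi> (\<phi> \<circ> f ^^ k) = dec.c k" for k
  unfolding covariance_def dec.c_def comp_def by (simp only: assms(11) mean_pow diff_zero)
 have var: "mu.variance \<phi> = dec.c 0" by (simp add: dec.c_def assms(11) power2_eq_square)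
 have av: "asymptotic_variance \<mu> f \<phi> = 2 * dec.half_variance"
  unfolding asymptotic_variance_def cov var dec.half_variance_def by simp
 have sum: "summable (%k. abs (covariance \<mu> \<phi> (\<phi> \<circ> f ^^ Suc k)))"
  unfolding cov using dec.c_summable by (subst summable_Suc_iff)
 have nn: "0 <= asymptotic_variance \<mu> f \<phi>" unfolding av using dec.half_variance_nonneg by simp
 have \<sigma>2: "\<sigma>^2 = 2 * dec.half_variance" unfolding assms(12) using nn by (simp add: av)
 have eta: "0 < 1 / 2 - 1 / p" "1 / 2 - 1 / p < 1 / 2 - 1 / (2 * kap)"
  using assms(4) kap by (simp_all add: field_simps)
 show ?thesis
  using sum nn dec.functional_clt[OF eta] \<sigma>2 by blast
qed

end
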